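(* Let $n\ge 1$, let $Y$ be a compact real manifold of (real) dimension $2n$, let $X$ be a complex manifold of complex dimension $n+1$, and let $i\colon Y\hookrightarrow X$ be a smooth embedding. Then there is a smooth isotopy of embeddings $i_t\colon Y\hookrightarrow X$, $t\in[0,1]$, $i_0=i$, which can be chosen $\mathcal{C}^0$ close to the original embedding (i.e. with all $i_t$ in any prescribed $\mathcal{C}^0$ neighborhood of $i$), such that all complex points of the submanifold $i_1(Y)\subset X$ are of one of the following two types: \begin{itemize} \item[i)] $w=|z_1|^2+|z_2|^2+\cdots+|z_n|^2$, \item[ii)] $w=\overline{z_1}^2+|z_2|^2+\cdots+|z_n|^2$. \end{itemize}
   Context: For a real $2n$-dimensional submanifold $Y$ of an $(n+1)$-dimensional complex manifold $(X,J)$, a point $p\in Y$ is called a complex point if $T_pY$ is a complex subspace of $T_pX$, i.e. $T_pY=T_pY\cap JT_pY$ (equivalently $\dim_{\mathbb{C}}(T_pY\cap JT_pY)=n$). A complex point $p$ is said to be of type given by one of the equations i), ii) if there are local holomorphic coordinates $(z_1,\ldots,z_n,w)$ on $X$ centered at $p$ in which $Y$ is given, in a neighborhood of $p$, by that equation. *)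

theory Defs
  imports "HOL-Analysis.Analysis"
begin

section \<open>Smooth and holomorphic maps on model spaces\<close>

fun Ck_on :: "nat \<Rightarrow> ('a::euclidean_space \<Rightarrow> 'b::euclidean_space) \<Rightarrow> 'a set \<Rightarrow> bool" where
  "Ck_on 0 f S \<longleftrightarrow> continuous_on S f"
| "Ck_on (Suc k) f S \<longleftrightarrow>
     (\<forall>x\<in>S. f differentiable (at x)) \<and>
     (\<forall>v. Ck_on k (\<lambda>x. frechet_derivative f (at x) v) S)"

text \<open>
  On an arbitrary set, smoothness means local extendability to a smooth function on an open set.
  This covers the set \<open>V \<times> [0,1]\<close>, on which isotopies are smooth up to the endpoints.
\<close>

definition smooth_on :: "'a::euclidean_space set \<Rightarrow> ('a \<Rightarrow> 'b::euclidean_space) \<Rightarrow> bool" where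
  "smooth_on S f \<longleftrightarrow>
     (\<forall>x\<in>S. \<exists>U g. open U \<and> x \<in> U \<and> (\<forall>k. Ck_on k g U) \<and> (\<forall>y\<in>S \<inter> U. g y = f y))"

text \<open>
  The complex model space of dimension \<open>CARD('n) + 1\<close>, with coordinates
  \<open>(z, w) = ((z_j)_j, w)\<close>, and its multiplication by the imaginary unit.
\<close>

type_synonym 'n cmodel = "(complex ^ 'n) \<times> complex"

definition mult_i :: "'n::finite cmodel \<Rightarrow> 'n cmodel" where
  "mult_i v = (\<i> *s fst v, \<i> * snd v)"

text \<open>The derivative is real linear by definition, so commuting with \<open>mult_i\<close> makes it complex
  linear.  Only used for open \<open>S\<close>.\<close>

definition holomorphic_map_on :: "'n::finite cmodel set \<Rightarrow> ('n cmodel \<Rightarrow> 'n cmodel) \<Rightarrow> bool" where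
  "holomorphic_map_on S f \<longleftrightarrow>
     (\<forall>x\<in>S. \<exists>D. (f has_derivative D) (at x) \<and> (\<forall>v. D (mult_i v) = mult_i (D v)))"


section \<open>Manifolds\<close>

type_synonym ('a, 'e) chart = "'a set \<times> ('a \<Rightarrow> 'e)"

definition is_chart :: "'a topology \<Rightarrow> ('a, 'e::euclidean_space) chart \<Rightarrow> bool" where
  "is_chart X = (\<lambda>(U, \<phi>). openin X U \<and> open (\<phi> ` U) \<and>
     homeomorphic_map (subtopology X U) (top_of_set (\<phi> ` U)) \<phi>)"

definition compatible ::
  "('e::euclidean_space set \<Rightarrow> ('e \<Rightarrow> 'e) \<Rightarrow> bool) \<Rightarrow> ('a, 'e) chart \<Rightarrow> ('a, 'e) chart \<Rightarrow> bool" where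
  "compatible P = (\<lambda>(U, \<phi>) (V, \<psi>).
     P (\<phi> ` (U \<inter> V)) (\<psi> \<circ> inv_into U \<phi>) \<and> P (\<psi> ` (U \<inter> V)) (\<phi> \<circ> inv_into V \<psi>))"

definition is_atlas ::
  "('e::euclidean_space set \<Rightarrow> ('e \<Rightarrow> 'e) \<Rightarrow> bool) \<Rightarrow> 'a topology \<Rightarrow> ('a, 'e) chart set \<Rightarrow> bool" where
  "is_atlas P X A \<longleftrightarrow>
     (\<forall>c\<in>A. is_chart X c) \<and> (\<Union>c\<in>A. fst c) = topspace X \<and> (\<forall>c\<in>A. \<forall>d\<in>A. compatible P c d)"

definition smooth_manifold :: "'a topology \<Rightarrow> ('a, 'e::euclidean_space) chart set \<Rightarrow> bool" where
  "smooth_manifold X A \<longleftrightarrow>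
     Hausdorff_space X \<and> second_countable X \<and> is_atlas smooth_on X A"

definition complex_manifold :: "'a topology \<Rightarrow> ('a, 'n::finite cmodel) chart set \<Rightarrow> bool" where
  "complex_manifold X A \<longleftrightarrow>
     Hausdorff_space X \<and> second_countable X \<and> is_atlas holomorphic_map_on X A"

definition holomorphic_chart ::
  "'a topology \<Rightarrow> ('a, 'n::finite cmodel) chart set \<Rightarrow> ('a, 'n cmodel) chart \<Rightarrow> bool" where
  "holomorphic_chart X A c \<longleftrightarrow> is_chart X c \<and> (\<forall>d\<in>A. compatible holomorphic_map_on c d)"


section \<open>Smooth embeddings and isotopies\<close>

text \<open>The map \<open>f\<close> read in a chart of the source and a chart of the target.\<close>

definition local_rep ::
  "('a, 'e) chart \<Rightarrow> ('b, 'f) chart \<Rightarrow> ('a \<Rightarrow> 'b) \<Rightarrow> 'e \<Rightarrow> 'f" where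
  "local_rep c d f = snd d \<circ> f \<circ> inv_into (fst c) (snd c)"

definition smooth_map ::
  "'a topology \<Rightarrow> ('a, 'e::euclidean_space) chart set \<Rightarrow>
   'b topology \<Rightarrow> ('b, 'f::euclidean_space) chart set \<Rightarrow> ('a \<Rightarrow> 'b) \<Rightarrow> bool" where
  "smooth_map Y B X A f \<longleftrightarrow>
     continuous_map Y X f \<and>
     (\<forall>c\<in>B. \<forall>d\<in>A. smooth_on (snd c ` {y \<in> fst c. f y \<in> fst d}) (local_rep c d f))"

definition smooth_embedding ::
  "'a topology \<Rightarrow> ('a, 'e::euclidean_space) chart set \<Rightarrow>
   'b topology \<Rightarrow> ('b, 'f::euclidean_space) chart set \<Rightarrow> ('a \<Rightarrow> 'b) \<Rightarrow> bool" where
  "smooth_embedding Y B X A f \<longleftrightarrow>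
     smooth_map Y B X A f \<and> embedding_map Y X f \<and>
     (\<forall>c\<in>B. \<forall>d\<in>A. \<forall>y\<in>fst c. f y \<in> fst d \<longrightarrow>
        inj (frechet_derivative (local_rep c d f) (at (snd c y))))"

definition smooth_isotopy ::
  "'a topology \<Rightarrow> ('a, 'e::euclidean_space) chart set \<Rightarrow>
   'b topology \<Rightarrow> ('b, 'f::euclidean_space) chart set \<Rightarrow> (real \<Rightarrow> 'a \<Rightarrow> 'b) \<Rightarrow> bool" where
  "smooth_isotopy Y B X A F \<longleftrightarrow>
     continuous_map (prod_topology (top_of_set {0..1}) Y) X (\<lambda>(t, y). F t y) \<and>
     (\<forall>c\<in>B. \<forall>d\<in>A.
        smooth_on {(t, snd c y) | t y. t \<in> {0..1} \<and> y \<in> fst c \<and> F t y \<in> fst d}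
          (\<lambda>(t, x). local_rep c d (F t) x)) \<and>
     (\<forall>t\<in>{0..1}. smooth_embedding Y B X A (F t))"

text \<open>
  The compact-open topology on the continuous maps from \<open>Y\<close> to \<open>X\<close>; for compact \<open>Y\<close> this is the
  topology of uniform (\<open>C^0\<close>) convergence.
\<close>

definition C0_topology :: "'a topology \<Rightarrow> 'b topology \<Rightarrow> ('a \<Rightarrow> 'b) topology" where
  "C0_topology Y X = topology_generated_by
     {{f. continuous_map Y X f \<and> f ` K \<subseteq> U} | K U. compactin Y K \<and> openin X U}"


section \<open>Complex points\<close>

text \<open>
  \<open>range (frechet_derivative (local_rep c d f) (at (snd c y)))\<close> is the tangent space of the embedded
  submanifold \<open>f ` topspace Y\<close> at \<open>f y\<close>, with the tangent space of the ambient manifold identified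
  with the model space via \<open>d\<close>.  Under this identification the complex structure \<open>J\<close> is
  \<open>mult_i\<close>; transition maps being holomorphic, the condition does not depend on the charts.
\<close>

definition complex_point ::
  "('a, 'e::euclidean_space) chart set \<Rightarrow> ('b, 'n::finite cmodel) chart set \<Rightarrow>
   ('a \<Rightarrow> 'b) \<Rightarrow> 'b \<Rightarrow> bool" where
  "complex_point B A f p \<longleftrightarrow>
     (\<exists>c\<in>B. \<exists>d\<in>A. \<exists>y\<in>fst c. f y = p \<and> p \<in> fst d \<and>
        (let T = range (frechet_derivative (local_rep c d f) (at (snd c y)))
         in T = T \<inter> mult_i ` T))"

text \<open>
  In some holomorphic coordinates centred at \<open>p\<close>, the set \<open>S\<close> is given near \<open>p\<close> by the equation
  \<open>eq\<close>.  Coordinate domains may be shrunk, so the equation can be required on a whole domain.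
\<close>

definition locally_given_by ::
  "'b topology \<Rightarrow> ('b, 'n::finite cmodel) chart set \<Rightarrow> 'b set \<Rightarrow> 'b \<Rightarrow>
   (complex ^ 'n \<Rightarrow> complex \<Rightarrow> bool) \<Rightarrow> bool" where
  "locally_given_by X A S p eq \<longleftrightarrow>
     (\<exists>V \<psi>. holomorphic_chart X A (V, \<psi>) \<and> p \<in> V \<and> \<psi> p = 0 \<and>
        (\<forall>q\<in>V. q \<in> S \<longleftrightarrow> eq (fst (\<psi> q)) (snd (\<psi> q))))"

definition type_i_eq :: "complex ^ 'n::finite \<Rightarrow> complex \<Rightarrow> bool" where
  "type_i_eq z w \<longleftrightarrow> w = (\<Sum>j\<in>UNIV. complex_of_real ((cmod (z $ j))\<^sup>2))"

text \<open>The index \<open>k\<close> plays the role of the first coordinate.\<close>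

definition type_ii_eq :: "'n::finite \<Rightarrow> complex ^ 'n \<Rightarrow> complex \<Rightarrow> bool" where
  "type_ii_eq k z w \<longleftrightarrow>
     w = (cnj (z $ k))\<^sup>2 + (\<Sum>j\<in>UNIV - {k}. complex_of_real ((cmod (z $ j))\<^sup>2))"

end

theory Submission
  imports Defs "HOL-Complex_Analysis.Complex_Analysis"
begin

text \<open>
  Locally the submanifold is a graph \<open>w = f z\<close> in holomorphic coordinates \<open>(z, w)\<close>, and its complex points
  are the zeros of the antiholomorphic gradient of \<open>f\<close>. Small perturbations of \<open>f\<close> make all these zeros
  nondegenerate (Sard), so by compactness there are finitely many of them. A shear turns the second order part
  of \<open>f\<close> at such a zero into \<open>cdot (cnjv z) (P z + R (cnjv z) / 2)\<close> with \<open>R\<close> symmetric and the real linear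
  map \<open>z \<mapsto> P z + R (cnjv z)\<close> invertible. A cutoff replaces \<open>f\<close> near the point by the quadratic form of
  any sufficiently close pair \<open>(P, R)\<close> without changing the set of complex points. The space of
  nondegenerate pairs has at most two components, and they are represented by the equations i) and ii); so
  finitely many such replacements along a path of pairs lead to one of the two normal forms.
\<close>

section \<open>Smooth maps\<close>

text \<open>Every deformation moves the embedding only in the \<open>w\<close>-direction of one
  chart, over one ball, and leaves the \<open>z\<close>-coordinate alone. Immersivity and
  injectivity over the ball are then automatic, and only distant parts of the submanifold have to be
  avoided. Genericity comes from the term \<open>cdot a (cnjv z)\<close>, which shifts the
  antiholomorphic gradient by the constant \<open>a\<close>, with \<open>- a\<close> a regular
  value. The obstacle is that a large change of the jet under a cutoff could create complex points,
  because the cutoff has a gradient of its own. The change is harmless if the jets differ by less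
  than a fixed fraction of the lower bound of \<open>rop m\<close>, a fraction that depends on the
  cutoff profile but not on its scale; hence only the component of the jet matters. The sign of the
  real determinant of \<open>rop m\<close> separates the two normal forms. In one coordinate it
  decides between \<open>|a|\<close> and \<open>|b|\<close> in \<open>a z + b cnj z\<close>; in
  several, Schur complements split off the coordinates, and an explicit jet coupling two of them
  changes the type of both.\<close>

definition Cinf :: "('a::euclidean_space \<Rightarrow> 'b::euclidean_space) \<Rightarrow> 'a set \<Rightarrow> bool" where
  "Cinf f S \<longleftrightarrow> open S \<and> (\<forall>k. Ck_on k f S)"

lemma Ck_on_cong:
  assumes "open S" and "\<And>x. x \<in> S \<Longrightarrow> f x = g x"
  shows "Ck_on k f S \<longleftrightarrow> Ck_on k g S"
  using assms(2)
proof (induction k arbitrary: f g)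
  case 0
  then show ?case by (auto cong: continuous_on_cong)
next
  case (Suc k)
  have d: "(f has_derivative D) (at x) \<longleftrightarrow> (g has_derivative D) (at x)" if "x \<in> S" for x D
    using has_derivative_transform_within_open[OF _ assms(1) that, of f D UNIV g]
      has_derivative_transform_within_open[OF _ assms(1) that, of g D UNIV f] Suc.prems by auto
  then have "f differentiable (at x) \<longleftrightarrow> g differentiable (at x)" if "x \<in> S" for x
    using that by (auto simp: differentiable_def)
  moreover have "frechet_derivative f (at x) = frechet_derivative g (at x)" if "x \<in> S" for x
    unfolding frechet_derivative_def using d[OF that] by simp
  ultimately show ?case using Suc.IH[of "\<lambda>x. frechet_derivative f (at x) v" "\<lambda>x. frechet_derivative g (at x) v" for v]
    by auto
qed

lemma Ck_on_subset: "Ck_on k f S \<Longrightarrow> T \<subseteq> S \<Longrightarrow> Ck_on k f T"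
  by (induction k arbitrary: f) (auto intro: continuous_on_subset)

text \<open>\<open>frechet_derivative\<close> is a choice operator; uniqueness of derivatives lets
  smoothness on an open set be checked with any explicit formula \<open>f'\<close>.\<close>

lemma Ck_on_SucI:
  assumes "open S" and "\<And>x. x \<in> S \<Longrightarrow> (f has_derivative f' x) (at x)"
    and "\<And>v. Ck_on k (\<lambda>x. f' x v) S"
  shows "Ck_on (Suc k) f S"
proof -
  have "frechet_derivative f (at x) = f' x" if "x \<in> S" for x
    using frechet_derivative_at[OF assms(2)[OF that]] by simp
  then have "Ck_on k (\<lambda>x. frechet_derivative f (at x) v) S" for v
    using Ck_on_cong[OF assms(1), of "\<lambda>x. frechet_derivative f (at x) v" "\<lambda>x. f' x v" k] assms(3)[of v]
    by simp
  then show ?thesis using assms(2) by (auto simp: differentiable_def)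
qed

lemma Ck_on_SucD:
  assumes "Ck_on (Suc k) f S"
  shows "\<And>x. x \<in> S \<Longrightarrow> (f has_derivative frechet_derivative f (at x)) (at x)"
    and "\<And>v. Ck_on k (\<lambda>x. frechet_derivative f (at x) v) S"
  using assms frechet_derivative_works by auto

lemma Ck_on_continuous: "Ck_on k f S \<Longrightarrow> continuous_on S f"
  by (cases k) (auto intro!: continuous_at_imp_continuous_on differentiable_imp_continuous_within)

lemma Ck_on_Suc_imp: "Ck_on (Suc k) f S \<Longrightarrow> Ck_on k f S"
proof (induction k arbitrary: f)
  case 0
  then show ?case by (metis Ck_on_continuous Ck_on.simps(1))
next
  case (Suc k)
  then show ?case by (metis Ck_on.simps(2))
qed

lemma Ck_on_UN:
  assumes "\<And>i. i \<in> I \<Longrightarrow> open (S i)" "\<And>i. i \<in> I \<Longrightarrow> Ck_on k f (S i)"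
  shows "Ck_on k f (\<Union>i\<in>I. S i)"
  using assms(2) by (induction k arbitrary: f) (auto intro: continuous_on_open_UN assms)

lemma Ck_on_const [simp]: "Ck_on k (\<lambda>x. c) S"
proof (induction k arbitrary: c)
  case (Suc k)
  have "frechet_derivative (\<lambda>x. c) (at x) = (\<lambda>v. 0)" for x :: 'a
    using frechet_derivative_at[OF has_derivative_const] by simp
  then show ?case using Suc.IH[of 0] by simp
qed simp

lemma Ck_on_bounded_linear:
  assumes "bounded_linear L" "open S" shows "Ck_on k L S"
proof (cases k)
  case 0
  then show ?thesis by (simp add: assms(1) linear_continuous_on)
next
  case (Suc m)
  show ?thesis unfolding Suc
    by (rule Ck_on_SucI[OF assms(2), where f'="\<lambda>x. L"])
      (auto intro!: bounded_linear_imp_has_derivative assms)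
qed

lemma Ck_on_add:
  assumes "open S" "Ck_on k f S" "Ck_on k g S"
  shows "Ck_on k (\<lambda>x. f x + g x) S"
  using assms(2,3)
proof (induction k arbitrary: f g)
  case 0
  then show ?case by (auto intro: continuous_intros)
next
  case (Suc k)
  note f = Ck_on_SucD[OF Suc.prems(1)] and g = Ck_on_SucD[OF Suc.prems(2)]
  show ?case
    by (rule Ck_on_SucI[OF assms(1), OF has_derivative_add[OF f(1) g(1)]]) (auto intro!: Suc.IH f(2) g(2))
qed

lemma Ck_on_sum:
  assumes "open S" "\<And>i. i \<in> I \<Longrightarrow> Ck_on k (f i) S"
  shows "Ck_on k (\<lambda>x. \<Sum>i\<in>I. f i x) S"
  using assms(2) by (induction I rule: infinite_finite_induct) (auto intro!: Ck_on_add assms(1))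

lemma Ck_on_bilinear:
  assumes "bounded_bilinear P" "open S" "Ck_on k f S" "Ck_on k g S"
  shows "Ck_on k (\<lambda>x. P (f x) (g x)) S"
  using assms(3,4)
proof (induction k arbitrary: f g)
  case 0
  then show ?case by (auto intro: bounded_bilinear.continuous_on[OF assms(1)])
next
  case (Suc k)
  note f = Ck_on_SucD[OF Suc.prems(1)] and g = Ck_on_SucD[OF Suc.prems(2)]
  have 1: "Ck_on k (\<lambda>x. P (f x) (frechet_derivative g (at x) v)) S" for v
    using Suc.IH[OF Ck_on_Suc_imp[OF Suc.prems(1)] g(2)[of v]] .
  have 2: "Ck_on k (\<lambda>x. P (frechet_derivative f (at x) v) (g x)) S" for v
    using Suc.IH[OF f(2)[of v] Ck_on_Suc_imp[OF Suc.prems(2)]] .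
  show ?case
  proof (rule Ck_on_SucI[OF assms(2)])
    show "((\<lambda>x. P (f x) (g x)) has_derivative
        (\<lambda>v. P (f x) (frechet_derivative g (at x) v) + P (frechet_derivative f (at x) v) (g x))) (at x)"
      if "x \<in> S" for x
      by (rule bounded_bilinear.FDERIV[OF assms(1) f(1)[OF that] g(1)[OF that]])
    show "Ck_on k (\<lambda>x. P (f x) (frechet_derivative g (at x) v) + P (frechet_derivative f (at x) v) (g x)) S" for v
      using Ck_on_add[OF assms(2) 1 2] .
  qed
qed

lemma linear_eq_sum_Basis:
  fixes L :: "'a::euclidean_space \<Rightarrow> 'b::real_vector"
  assumes "linear L" shows "L v = (\<Sum>b\<in>Basis. (v \<bullet> b) *\<^sub>R L b)"
proof -
  have "L v = L (\<Sum>b\<in>Basis. (v \<bullet> b) *\<^sub>R b)" by (simp add: euclidean_representation)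
  also have "\<dots> = (\<Sum>b\<in>Basis. (v \<bullet> b) *\<^sub>R L b)"
    by (simp add: linear_sum[OF assms] linear_scale[OF assms])
  finally show ?thesis .
qed

text \<open>Induction on \<open>k\<close> through the chain rule. \<open>Ck_on\<close> controls the
  derivative in one fixed direction at a time, whereas the chain rule applies the outer derivative
  in a moving direction; expanding that direction in \<open>Basis\<close> leaves sums of products to
  which the induction hypothesis applies.\<close>

lemma Ck_on_compose:
  assumes "open S" "open T" "f ` S \<subseteq> T" "Ck_on k f S" "Ck_on k g T"
  shows "Ck_on k (\<lambda>x. g (f x)) S"
  using assms(4,5)
proof (induction k arbitrary: g)
  case 0
  then show ?case using assms(3) continuous_on_compose2 by auto
next
  case (Suc k)
  note f = Ck_on_SucD[OF Suc.prems(1)] and g = Ck_on_SucD[OF Suc.prems(2)]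
  have fk: "Ck_on k f S" using Suc.prems(1) Ck_on_Suc_imp by blast
  have gd: "(g has_derivative frechet_derivative g (at (f x))) (at (f x))" if "x \<in> S" for x
    using g(1) assms(3) that by auto
  have der: "((\<lambda>x. g (f x)) has_derivative
      (\<lambda>v. \<Sum>b\<in>Basis. (frechet_derivative f (at x) v \<bullet> b) *\<^sub>R frechet_derivative g (at (f x)) b)) (at x)"
    if "x \<in> S" for x
  proof -
    let ?g = "frechet_derivative g (at (f x))" and ?f = "frechet_derivative f (at x)"
    have "linear ?g" using gd[OF that] has_derivative_linear by blast
    then have "?g (?f v) = (\<Sum>b\<in>Basis. (?f v \<bullet> b) *\<^sub>R ?g b)" for v
      by (rule linear_eq_sum_Basis)
    then show ?thesis using has_derivative_compose[OF f(1)[OF that] gd[OF that]] by simp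
  qed
  have 1: "Ck_on k (\<lambda>x. frechet_derivative g (at (f x)) b) S" for b
    using Suc.IH[OF fk g(2)[of b]] .
  have 2: "Ck_on k (\<lambda>x. frechet_derivative f (at x) v \<bullet> b) S" for v b
    using Ck_on_bilinear[OF bounded_bilinear_inner assms(1) f(2)[of v] Ck_on_const[of k b]] .
  have 3: "Ck_on k (\<lambda>x. (frechet_derivative f (at x) v \<bullet> b) *\<^sub>R frechet_derivative g (at (f x)) b) S" for v b
    using Ck_on_bilinear[OF bounded_bilinear_scaleR assms(1) 2 1] .
  show ?case
    by (rule Ck_on_SucI[OF assms(1) der]) (assumption, rule Ck_on_sum[OF assms(1) 3])
qed

lemma CinfD:
  assumes "Cinf f S"
  shows "open S" "Ck_on k f S" "continuous_on S f"
  using assms Ck_on_continuous unfolding Cinf_def by auto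

lemma Cinf_has_derivative:
  "Cinf f S \<Longrightarrow> x \<in> S \<Longrightarrow> (f has_derivative frechet_derivative f (at x)) (at x)"
  using Ck_on_SucD(1)[of 0 f S] unfolding Cinf_def by blast

lemma Cinf_deriv: "Cinf f S \<Longrightarrow> Cinf (\<lambda>x. frechet_derivative f (at x) v) S"
  using Ck_on_SucD(2) unfolding Cinf_def by blast

lemma Cinf_cong:
  assumes "\<And>x. x \<in> S \<Longrightarrow> f x = g x"
  shows "Cinf f S \<longleftrightarrow> Cinf g S"
  using Ck_on_cong[where f=f and g=g and S=S] assms by (auto simp: Cinf_def)

lemma Cinf_subset: "Cinf f S \<Longrightarrow> open T \<Longrightarrow> T \<subseteq> S \<Longrightarrow> Cinf f T"
  using Ck_on_subset unfolding Cinf_def by blast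

lemma Cinf_local:
  assumes "\<And>x. x \<in> S \<Longrightarrow> \<exists>U. x \<in> U \<and> U \<subseteq> S \<and> Cinf f U"
  shows "Cinf f S"
proof -
  obtain U where U: "\<And>x. x \<in> S \<Longrightarrow> x \<in> U x \<and> U x \<subseteq> S \<and> Cinf f (U x)"
    using assms by metis
  then have "S = (\<Union>x\<in>S. U x)" by auto
  moreover have "Cinf f (\<Union>x\<in>S. U x)"
    using U Ck_on_UN[of S U _ f] unfolding Cinf_def by blast
  ultimately show ?thesis by simp
qed

lemma Cinf_const [simp]: "open S \<Longrightarrow> Cinf (\<lambda>x. c) S"
  unfolding Cinf_def by simp

lemma Cinf_linear: "bounded_linear L \<Longrightarrow> open S \<Longrightarrow> Cinf L S"
  unfolding Cinf_def by (simp add: Ck_on_bounded_linear)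

lemma Cinf_compose:
  "Cinf f S \<Longrightarrow> Cinf g T \<Longrightarrow> f ` S \<subseteq> T \<Longrightarrow> Cinf (\<lambda>x. g (f x)) S"
  unfolding Cinf_def using Ck_on_compose by blast

lemma Cinf_linear_compose: "bounded_linear L \<Longrightarrow> Cinf f S \<Longrightarrow> Cinf (\<lambda>x. L (f x)) S"
  by (rule Cinf_compose[where T=UNIV]) (auto intro: Cinf_linear)

lemma Cinf_bilinear:
  "bounded_bilinear P \<Longrightarrow> Cinf f S \<Longrightarrow> Cinf g S \<Longrightarrow> Cinf (\<lambda>x. P (f x) (g x)) S"
  unfolding Cinf_def using Ck_on_bilinear by blast

lemma Cinf_add: "Cinf f S \<Longrightarrow> Cinf g S \<Longrightarrow> Cinf (\<lambda>x. f x + g x) S"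
  unfolding Cinf_def using Ck_on_add by blast

lemma Cinf_sum: "open S \<Longrightarrow> (\<And>i. i \<in> I \<Longrightarrow> Cinf (f i) S) \<Longrightarrow> Cinf (\<lambda>x. \<Sum>i\<in>I. f i x) S"
  unfolding Cinf_def using Ck_on_sum[of S I _ f] by blast

lemma Cinf_minus: "Cinf f S \<Longrightarrow> Cinf (\<lambda>x. - f x) S"
  by (rule Cinf_linear_compose[of uminus]) (auto intro: bounded_linear_minus bounded_linear_ident)

lemma Cinf_diff: "Cinf f S \<Longrightarrow> Cinf g S \<Longrightarrow> Cinf (\<lambda>x. f x - g x) S"
  using Cinf_add[OF _ Cinf_minus] by fastforce

lemma Cinf_mult:
  fixes f g :: "'a::euclidean_space \<Rightarrow> 'b::{euclidean_space,real_normed_algebra}"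
  shows "Cinf f S \<Longrightarrow> Cinf g S \<Longrightarrow> Cinf (\<lambda>x. f x * g x) S"
  by (rule Cinf_bilinear[OF bounded_bilinear_mult])

lemma Cinf_scaleR: "Cinf f S \<Longrightarrow> Cinf g S \<Longrightarrow> Cinf (\<lambda>x. f x *\<^sub>R g x) S"
  by (rule Cinf_bilinear[OF bounded_bilinear_scaleR])

lemma Cinf_id: "open S \<Longrightarrow> Cinf (\<lambda>x. x) S"
  by (rule Cinf_linear[OF bounded_linear_ident])

lemma Cinf_fst: "Cinf f S \<Longrightarrow> Cinf (\<lambda>x. fst (f x)) S"
  by (rule Cinf_linear_compose[OF bounded_linear_fst])

lemma Cinf_snd: "Cinf f S \<Longrightarrow> Cinf (\<lambda>x. snd (f x)) S"
  by (rule Cinf_linear_compose[OF bounded_linear_snd])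

lemma Cinf_Pair:
  assumes "Cinf f S" "Cinf g S" shows "Cinf (\<lambda>x. (f x, g x)) S"
proof -
  have a: "bounded_linear (\<lambda>x. (x, 0))" "bounded_linear (\<lambda>x. (0, x))"
    by (auto intro!: bounded_linear_Pair bounded_linear_ident bounded_linear_zero)
  have "Cinf (\<lambda>x. (f x, 0) + (0, g x)) S"
    by (intro Cinf_add Cinf_linear_compose[OF a(1)] Cinf_linear_compose[OF a(2)] assms)
  then show ?thesis by simp
qed

lemma bounded_linear_axis: "bounded_linear (axis i :: 'b::euclidean_space \<Rightarrow> 'b ^ 'n)"
  by (auto intro!: linear_conv_bounded_linear[THEN iffD1] linearI simp: vec_eq_iff axis_def)

lemma Cinf_vec:
  fixes f :: "'n::finite \<Rightarrow> 'a::euclidean_space \<Rightarrow> 'b::euclidean_space"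
  assumes "open S" "\<And>i. Cinf (f i) S" shows "Cinf (\<lambda>x. \<chi> i. f i x) S"
proof -
  have "(\<chi> i. f i x) = (\<Sum>i\<in>UNIV. axis i (f i x))" for x
    by (auto simp: vec_eq_iff axis_def)
  then show ?thesis
    by (auto intro!: Cinf_sum Cinf_linear_compose[OF bounded_linear_axis] assms)
qed

lemma Cinf_inverse:
  assumes "Cinf f S" "\<And>x. x \<in> S \<Longrightarrow> f x \<noteq> (0::real)" shows "Cinf (\<lambda>x. inverse (f x)) S"
proof -
  have op: "open (- {0::real})" by auto
  have "Ck_on k inverse (- {0::real})" for k
  proof (induction k)
    case 0
    show ?case by (auto intro!: continuous_intros)
  next
    case (Suc k)
    have 1: "Ck_on k (\<lambda>x. inverse x * v * inverse x) (- {0::real})" for v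
      by (intro Ck_on_bilinear[OF bounded_bilinear_mult] op Suc Ck_on_const)
    have 2: "Ck_on k (\<lambda>x. - (inverse x * v * inverse x)) (- {0::real})" for v
      using Ck_on_bilinear[OF bounded_bilinear_mult op Ck_on_const[of k "-1"] 1[of v]] by simp
    show ?case
      by (rule Ck_on_SucI[OF op has_derivative_inverse' 2]) auto
  qed
  then have "Cinf inverse (- {0::real})" using op by (simp add: Cinf_def)
  then show ?thesis by (rule Cinf_compose[OF assms(1)]) (use assms(2) in auto)
qed

text \<open>Smoothness is local, and on an open set the local extensions in \<open>smooth_on\<close>
  coincide with \<open>f\<close> on small open sets.\<close>

lemma smooth_on_iff_Cinf:
  assumes "open S" shows "smooth_on S f \<longleftrightarrow> Cinf f S"
proof
  assume L: "smooth_on S f"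
  show "Cinf f S"
  proof (rule Cinf_local)
    fix x assume "x \<in> S"
    then obtain U g where U: "open U" "x \<in> U" "\<forall>k. Ck_on k g U" "\<forall>y\<in>S \<inter> U. g y = f y"
      using L unfolding smooth_on_def by blast
    have "Cinf g (S \<inter> U)" using U assms Ck_on_subset[of _ g U "S \<inter> U"] by (auto simp: Cinf_def)
    then have "Cinf f (S \<inter> U)" using Cinf_cong[of "S \<inter> U" f g] U(4) by auto
    then show "\<exists>U. x \<in> U \<and> U \<subseteq> S \<and> Cinf f U" using U(2) \<open>x \<in> S\<close> by blast
  qed
next
  assume "Cinf f S"
  then show "smooth_on S f" unfolding smooth_on_def Cinf_def by blast
qed

section \<open>Cutoff functions, and smoothness of holomorphic maps\<close>

text \<open>The flat function \<open>exp (- 1/x)\<close> extended by zero, with a power of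
  \<open>1/x\<close> in front because the resulting family is closed under differentiation;
  smoothness is then an induction over all \<open>n\<close> at once.\<close>

definition flat_exp :: "nat \<Rightarrow> real \<Rightarrow> real" where
  "flat_exp n x = (if x > 0 then inverse x ^ n * exp (- inverse x) else 0)"

lemma flat_exp_tendsto_0: "(flat_exp n \<longlongrightarrow> 0) (at 0)"
proof (rule filterlim_split_at)
  have "((\<lambda>x. inverse x ^ n / exp (inverse x)) \<longlongrightarrow> (0::real)) (at_right 0)"
    by (rule filterlim_compose[OF tendsto_power_div_exp_0 filterlim_inverse_at_top_right])
  then have "((\<lambda>x. inverse x ^ n * exp (- inverse x)) \<longlongrightarrow> (0::real)) (at_right 0)"
    by (simp add: exp_minus divide_inverse)
  then show "(flat_exp n \<longlongrightarrow> 0) (at_right 0)"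
    by (rule Lim_transform_eventually) (auto simp: flat_exp_def eventually_at_right_less eventually_at_filter)
  show "(flat_exp n \<longlongrightarrow> 0) (at_left 0)"
    by (rule tendsto_eventually) (auto simp: flat_exp_def eventually_at_filter)
qed

lemma flat_exp_deriv:
  "(flat_exp n has_field_derivative flat_exp (n + 2) x - real n * flat_exp (n + 1) x) (at x)"
proof -
  consider "x > 0" | "x < 0" | "x = 0" by linarith
  then show ?thesis
  proof cases
    case 1
    have "((\<lambda>x. inverse x) has_field_derivative - (inverse x * inverse x)) (at x)"
      using DERIV_inverse'[OF DERIV_ident, of x] 1 by simp
    note D = DERIV_mult[OF DERIV_power[OF this, of n] DERIV_fun_exp[OF DERIV_minus[OF this]]]
    have "((\<lambda>x. inverse x ^ n * exp (- inverse x)) has_field_derivative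
        flat_exp (n + 2) x - real n * flat_exp (n + 1) x) (at x)"
      by (rule DERIV_cong[OF D], cases n) (use 1 in \<open>simp_all add: flat_exp_def algebra_simps\<close>)
    then show ?thesis
      by (rule has_field_derivative_transform_within_open[where S="{0<..}"]) (use 1 in \<open>auto simp: flat_exp_def\<close>)
  next
    case 2
    have "((\<lambda>x. 0) has_field_derivative 0) (at x)" by simp
    then have "(flat_exp n has_field_derivative 0) (at x)"
      by (rule has_field_derivative_transform_within_open[where S="{..<0}"]) (use 2 in \<open>auto simp: flat_exp_def\<close>)
    then show ?thesis using 2 by (simp add: flat_exp_def)
  next
    case 3
    \<comment> \<open>The difference quotient at 0 raises the power by one, so the limit already
      computed gives derivative 0.\<close>
    have "(\<lambda>h. (flat_exp n (0 + h) - flat_exp n 0) / h) = flat_exp (Suc n)"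
      by (auto simp: flat_exp_def fun_eq_iff field_simps)
    then have "(flat_exp n has_field_derivative 0) (at 0)"
      unfolding DERIV_def using flat_exp_tendsto_0[of "Suc n"] by simp
    then show ?thesis using 3 by (simp add: flat_exp_def)
  qed
qed

lemma Cinf_flat_exp: "Cinf (flat_exp n) UNIV"
proof -
  have "Ck_on k (flat_exp n) UNIV" for k
  proof (induction k arbitrary: n)
    case 0
    show ?case using DERIV_isCont[OF flat_exp_deriv] by (simp add: continuous_at_imp_continuous_on)
  next
    case (Suc k)
    have c: "Ck_on k (\<lambda>x. c * flat_exp m x) UNIV" for c m
      by (intro Ck_on_bilinear[OF bounded_bilinear_mult] Suc open_UNIV Ck_on_const)
    have "Ck_on k (\<lambda>x. v * flat_exp (n + 2) x + (- v * real n) * flat_exp (n + 1) x) UNIV" for v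
      by (rule Ck_on_add[OF open_UNIV c c])
    then have "Ck_on k (\<lambda>x. (flat_exp (n + 2) x - real n * flat_exp (n + 1) x) * v) UNIV" for v
      by (simp add: algebra_simps)
    then show ?case
      using Ck_on_SucI[OF open_UNIV flat_exp_deriv[unfolded has_field_derivative_def]] by blast
  qed
  then show ?thesis by (simp add: Cinf_def)
qed

definition smooth_step :: "real \<Rightarrow> real" where
  "smooth_step x = flat_exp 0 x * inverse (flat_exp 0 x + flat_exp 0 (1 - x))"

lemma flat_exp_0_nonneg: "flat_exp 0 x \<ge> 0"
  by (simp add: flat_exp_def)

lemma flat_exp_sum_pos: "flat_exp 0 x + flat_exp 0 (1 - x) > 0"
  by (cases "x > 0") (auto simp: flat_exp_def add_pos_nonneg)

lemma Cinf_smooth_step: "Cinf smooth_step UNIV"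
  unfolding smooth_step_def
  by (intro Cinf_mult Cinf_inverse Cinf_add Cinf_flat_exp
      Cinf_compose[OF _ Cinf_flat_exp] Cinf_diff Cinf_const Cinf_id)
    (use flat_exp_sum_pos in \<open>auto simp: less_imp_neq[THEN not_sym]\<close>)

lemma smooth_step_0: "x \<le> 0 \<Longrightarrow> smooth_step x = 0"
  by (simp add: smooth_step_def flat_exp_def)

lemma smooth_step_1: "x \<ge> 1 \<Longrightarrow> smooth_step x = 1"
  by (simp add: smooth_step_def flat_exp_def)

lemma smooth_step_bounds: "0 \<le> smooth_step x" "smooth_step x \<le> 1"
proof -
  have "smooth_step x = flat_exp 0 x / (flat_exp 0 x + flat_exp 0 (1 - x))"
    by (simp add: smooth_step_def divide_inverse)
  then show "0 \<le> smooth_step x" "smooth_step x \<le> 1"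
    using flat_exp_0_nonneg[of x] flat_exp_0_nonneg[of "1 - x"] flat_exp_sum_pos[of x]
    by (simp_all add: divide_le_eq_1)
qed

text \<open>The bound \<open>S\<close> measures how much gradient a cutoff adds. It belongs to the
  profile alone and enters the admissible distance between two jets.\<close>

lemma smooth_step_deriv:
  obtains s' S where "\<And>x. (smooth_step has_field_derivative s' x) (at x)"
    "\<And>x. \<bar>s' x\<bar> \<le> S" "S \<ge> 0" "\<And>x. x \<le> 0 \<Longrightarrow> s' x = 0" "\<And>x. x \<ge> 1 \<Longrightarrow> s' x = 0"
proof -
  define s' where "s' x = frechet_derivative smooth_step (at x) 1" for x
  have d: "(smooth_step has_field_derivative s' x) (at x)" for x
  proof -
    have h: "(smooth_step has_derivative frechet_derivative smooth_step (at x)) (at x)"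
      using Cinf_has_derivative[OF Cinf_smooth_step] by simp
    have "frechet_derivative smooth_step (at x) v = s' x * v" for v
      using linear_scale[OF has_derivative_linear[OF h], of v 1] by (simp add: s'_def mult.commute)
    then have "frechet_derivative smooth_step (at x) = (*) (s' x)"
      by (rule ext)
    then show ?thesis using h by (simp add: has_field_derivative_def)
  qed
  have cont: "continuous_on UNIV s'"
    unfolding s'_def using CinfD(3)[OF Cinf_deriv[OF Cinf_smooth_step]] .
  have neg: "s' x = 0" if "x < 0" for x
  proof -
    have "((\<lambda>x. 0) has_field_derivative 0) (at x)" by simp
    then have "(smooth_step has_field_derivative 0) (at x)"
      by (rule has_field_derivative_transform_within_open[where S="{..<0}"]) (use that smooth_step_0 in auto)
    then show ?thesis using DERIV_unique d by blast
  qed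
  have pos: "s' x = 0" if "x > 1" for x
  proof -
    have "((\<lambda>x. 1) has_field_derivative 0) (at x)" by simp
    then have "(smooth_step has_field_derivative 0) (at x)"
      by (rule has_field_derivative_transform_within_open[where S="{1<..}"]) (use that smooth_step_1 in auto)
    then show ?thesis using DERIV_unique d by blast
  qed
  have cl: "closed {x. s' x = 0}"
    using cont by (intro closed_Collect_eq) auto
  \<comment> \<open>Continuity of \<open>s'\<close> carries the vanishing from the open half-lines
    to their endpoints.\<close>
  have z: "s' 0 = 0" "s' 1 = 0"
  proof -
    have "closure {..<0} \<subseteq> {x. s' x = 0}" "closure {1<..} \<subseteq> {x. s' x = 0}"
      by (rule closure_minimal[OF _ cl], use neg pos in blast)+
    moreover have "(0::real) \<in> closure {..<0}" "(1::real) \<in> closure {1<..}" by simp_all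
    ultimately show "s' 0 = 0" "s' 1 = 0" by blast+
  qed
  have "bounded (s' ` {0..1})"
    by (intro compact_imp_bounded compact_continuous_image continuous_on_subset[OF cont]) auto
  then obtain S where "\<forall>y \<in> s' ` {0..1}. norm y \<le> S"
    unfolding bounded_iff by blast
  then have S: "\<And>x. x \<in> {0..1} \<Longrightarrow> \<bar>s' x\<bar> \<le> S" by auto
  have "S \<ge> 0" using S[of 0] by simp
  moreover have "\<bar>s' x\<bar> \<le> S" for x
  proof (cases "x \<in> {0..1}")
    case False
    then have "s' x = 0" using neg pos by force
    then show ?thesis using \<open>S \<ge> 0\<close> by simp
  qed (rule S)
  ultimately show ?thesis
    using that[of s' S] d neg pos z by (metis order_le_less)
qed

section \<open>Complex differentiable maps are smooth\<close>

text \<open>With complex scalars acting diagonally, a directional derivative of a holomorphic map is the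
  derivative along a complex line, hence a Cauchy integral of the map.\<close>

definition cscale :: "complex \<Rightarrow> 'n::finite cmodel \<Rightarrow> 'n cmodel" where
  "cscale c v = (c *s fst v, c * snd v)"

definition holo_fun :: "('n::finite cmodel \<Rightarrow> complex) \<Rightarrow> 'n cmodel set \<Rightarrow> bool" where
  "holo_fun f S \<longleftrightarrow> open S \<and>
     (\<forall>x\<in>S. \<exists>D. (f has_derivative D) (at x) \<and> (\<forall>v. D (mult_i v) = \<i> * D v))"

lemma cscale_eq: "cscale c v = Re c *\<^sub>R v + Im c *\<^sub>R mult_i v"
  by (auto simp: cscale_def mult_i_def prod_eq_iff vec_eq_iff complex_eq_iff)

lemma bounded_bilinear_cscale: "bounded_bilinear cscale"
proof -
  have "bilinear cscale"
    unfolding bilinear_def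
    by (auto intro!: linearI simp: cscale_def prod_eq_iff vec_eq_iff algebra_simps)
  then show ?thesis by (simp add: bilinear_conv_bounded_bilinear)
qed

lemma D_cscale:
  assumes "linear D" "\<And>v. D (mult_i v) = \<i> * D v" shows "D (cscale c v) = c * (D v :: complex)"
proof -
  have "D (cscale c v) = complex_of_real (Re c) * D v + complex_of_real (Im c) * (\<i> * D v)"
    unfolding cscale_eq linear_add[OF assms(1)] linear_scale[OF assms(1)] assms(2)
    by (simp add: scaleR_conv_of_real)
  also have "\<dots> = (complex_of_real (Re c) + \<i> * complex_of_real (Im c)) * D v"
    by (simp only: algebra_simps)
  also have "complex_of_real (Re c) + \<i> * complex_of_real (Im c) = c"
    by (simp add: complex_eq_iff)
  finally show ?thesis .
qed

lemma holo_fun_deriv: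
  assumes "holo_fun f S" "x \<in> S"
  shows "(f has_derivative frechet_derivative f (at x)) (at x)"
    "frechet_derivative f (at x) (mult_i v) = \<i> * frechet_derivative f (at x) v"
proof -
  obtain D where D: "(f has_derivative D) (at x)" "\<forall>v. D (mult_i v) = \<i> * D v"
    using assms unfolding holo_fun_def by blast
  then show "(f has_derivative frechet_derivative f (at x)) (at x)"
    "frechet_derivative f (at x) (mult_i v) = \<i> * frechet_derivative f (at x) v"
    using frechet_derivative_at[OF D(1)] by metis+
qed

lemma holo_fun_Cauchy:
  assumes f: "holo_fun f S" and r: "r > 0" and sub: "\<And>c. cmod c \<le> r \<Longrightarrow> x + cscale c v \<in> S"
  defines "e \<equiv> \<lambda>t. complex_of_real r * exp (2 * of_real pi * \<i> * of_real t)"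
  shows "frechet_derivative f (at x) v = integral {0..1} (\<lambda>t. f (x + cscale (e t) v) * inverse (e t))"
proof -
  define g where "g = (\<lambda>c. f (x + cscale c v))"
  have g: "(g has_field_derivative frechet_derivative f (at (x + cscale c v)) v) (at c)" if "cmod c \<le> r" for c
  proof -
    note fd = holo_fun_deriv[OF f sub[OF that]]
    have "((\<lambda>c. x + cscale c v) has_derivative (\<lambda>h. cscale h v)) (at c)"
    proof -
      have "((\<lambda>c. cscale c v) has_derivative (\<lambda>h. cscale h v)) (at c)"
        by (rule bounded_linear_imp_has_derivative, rule bounded_bilinear.bounded_linear_left[OF bounded_bilinear_cscale])
      from has_derivative_add[OF has_derivative_const this] show ?thesis by simp
    qed
    from has_derivative_compose[OF this fd(1)]
    have "(g has_derivative (\<lambda>h. frechet_derivative f (at (x + cscale c v)) (cscale h v))) (at c)"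
      by (simp add: g_def)
    moreover have "frechet_derivative f (at (x + cscale c v)) (cscale h v)
        = frechet_derivative f (at (x + cscale c v)) v * h" for h
      using D_cscale[OF has_derivative_linear[OF fd(1)] fd(2)] by (simp add: mult.commute)
    ultimately show ?thesis by (simp add: has_field_derivative_def)
  qed
  have "g holomorphic_on cball 0 r"
    unfolding holomorphic_on_def field_differentiable_def
    using g by (meson DERIV_subset mem_cball_0 subset_UNIV)
  then have "continuous_on (cball 0 r) g" "g holomorphic_on ball 0 r"
    using holomorphic_on_imp_continuous_on holomorphic_on_subset ball_subset_cball by blast+
  from Cauchy_derivative_integral_circlepath(2)[OF this, of 0] r
  have "(g has_field_derivative 1 / (2 * of_real pi * \<i>) * contour_integral (circlepath 0 r) (\<lambda>u. g u / u\<^sup>2)) (at 0)"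
    by simp
  then have "frechet_derivative f (at x) v
      = 1 / (2 * of_real pi * \<i>) * contour_integral (circlepath 0 r) (\<lambda>u. g u / u\<^sup>2)"
    using DERIV_unique[OF g[of 0]] r by (simp add: cscale_def zero_prod_def[symmetric])
  also have "\<dots> = 1 / (2 * of_real pi * \<i>) * integral {0..1} (\<lambda>t. g (e t) / (e t)\<^sup>2 * (2 * of_real pi * \<i> * e t))"
    unfolding contour_integral_integral vector_derivative_circlepath by (simp add: e_def circlepath mult_ac)
  also have "\<dots> = integral {0..1} (\<lambda>t. 1 / (2 * of_real pi * \<i>) * (g (e t) / (e t)\<^sup>2 * (2 * of_real pi * \<i> * e t)))"
    by (rule integral_mult_right[symmetric])
  also have "\<dots> = integral {0..1} (\<lambda>t. f (x + cscale (e t) v) * inverse (e t))"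
    using r by (intro integral_cong) (simp add: g_def e_def field_simps power2_eq_square)
  finally show ?thesis .
qed

text \<open>Differentiation of the Cauchy integral under the integral sign. The Leibniz rule needs a
  continuous derivative, which is first obtained from the same integral formula
  (\<open>D_cont\<close>); complex linearity then passes through the integral.\<close>

lemma holo_fun_frechet_derivative:
  assumes f: "holo_fun f S"
  shows "holo_fun (\<lambda>x. frechet_derivative f (at x) v) S"
proof -
  have opS: "open S" using f by (simp add: holo_fun_def)
  have fc: "continuous_on S f"
    using holo_fun_deriv(1)[OF f] by (auto intro!: continuous_at_imp_continuous_on has_derivative_continuous)
  have *: "\<exists>U r. open U \<and> convex U \<and> x0 \<in> U \<and> U \<subseteq> S \<and> r > 0 \<and> (\<forall>x\<in>U. \<forall>c. cmod c \<le> r \<longrightarrow> x + cscale c v \<in> S)"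
    if "x0 \<in> S" for x0 v
  proof -
    from openE[OF opS that] obtain e where e: "e > 0" "ball x0 e \<subseteq> S" .
    obtain K where K: "K > 0" "\<And>c w. norm (cscale c (w :: 'a cmodel)) \<le> cmod c * norm w * K"
      using bounded_bilinear.pos_bounded[OF bounded_bilinear_cscale] by metis
    \<comment> \<open>Discs of radius \<open>r\<close> in the direction \<open>v\<close> around
      points of the half ball stay in \<open>S\<close>; the summand 1 covers
      \<open>v = 0\<close>.\<close>
    define r where "r = e / 2 / (norm v * K + 1)"
    have pos: "norm v * K + 1 > 0" using K(1) by (simp add: add_nonneg_pos)
    have r: "r > 0" "r * (norm v * K) < e / 2"
    proof -
      show "r > 0" using e pos by (simp add: r_def)
      then have "r * (norm v * K) < r * (norm v * K + 1)" by simp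
      also have "\<dots> = e / 2"
        by (rule nonzero_eq_divide_eq[THEN iffD1, OF _ r_def]) (use pos in simp)
      finally show "r * (norm v * K) < e / 2" .
    qed
    have "x + cscale c v \<in> S" if "x \<in> ball x0 (e/2)" "cmod c \<le> r" for x c
    proof -
      have "norm (cscale c v) \<le> cmod c * (norm v * K)" using K(2)[of c v] by (simp add: mult_ac)
      also have "\<dots> \<le> r * (norm v * K)" using that(2) K(1) by (intro mult_right_mono) auto
      finally have "norm (cscale c v) < e / 2" using r(2) by simp
      then have "dist x0 (x + cscale c v) < e"
        using that(1) dist_triangle[of x0 "x + cscale c v" x] by (simp add: dist_norm)
      then show ?thesis using e(2) by auto
    qed
    then show ?thesis using e r by (intro exI[of _ "ball x0 (e/2)"] exI[of _ r]) auto
  qed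
  define E where "E r t = complex_of_real r * exp (2 * of_real pi * \<i> * of_real t)" for r t
  have nE: "cmod (E r t) = r" if "r > 0" for r t using that by (simp add: E_def norm_mult)
  have E0: "E r t \<noteq> 0" if "r > 0" for r t using that by (simp add: E_def)
  have Ec: "continuous_on X (\<lambda>x. E r (t x))" if "continuous_on X t" for X :: "'x::topological_space set" and r t
    unfolding E_def by (intro continuous_intros that)
  have comp: "continuous_on (U \<times> {0..1}) (\<lambda>(x, t). g (x + cscale (E r t) v) * inverse (E r t))"
    if "continuous_on S g" "r > 0" "\<forall>x\<in>U. \<forall>c. cmod c \<le> r \<longrightarrow> x + cscale c v \<in> S" for g :: "_ \<Rightarrow> complex" and U r v
    unfolding case_prod_unfold
    by (intro continuous_intros continuous_on_compose2[OF that(1)]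
        bounded_bilinear.continuous_on[OF bounded_bilinear_cscale] Ec) (use that nE E0 in auto)
  have D_cont: "continuous_on S (\<lambda>x. frechet_derivative f (at x) v)" for v
  proof (rule continuous_at_imp_continuous_on, rule ballI)
    fix x0 assume "x0 \<in> S"
    from *[OF this, of v] obtain U r where U: "open U" "x0 \<in> U" "r > 0"
      "\<forall>x\<in>U. \<forall>c. cmod c \<le> r \<longrightarrow> x + cscale c v \<in> S" by blast
    have "continuous_on U (\<lambda>x. integral (cbox 0 1) (\<lambda>t. f (x + cscale (E r t) v) * inverse (E r t)))"
      by (rule integral_continuous_on_param) (use comp[OF fc U(3,4)] in simp)
    then have "continuous_on U (\<lambda>x. frechet_derivative f (at x) v)"
      by (rule continuous_on_cong[THEN iffD1, rotated -1])
        (use holo_fun_Cauchy[OF f U(3)] U(4) in \<open>auto simp: E_def\<close>)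
    then show "isCont (\<lambda>x. frechet_derivative f (at x) v) x0"
      using U by (simp add: continuous_on_eq_continuous_at)
  qed
  have "\<exists>D. ((\<lambda>x. frechet_derivative f (at x) v) has_derivative D) (at x0) \<and> (\<forall>w. D (mult_i w) = \<i> * D w)"
    if "x0 \<in> S" for x0
  proof -
    from *[OF that, of v] obtain U r where U: "open U" "x0 \<in> U" "r > 0" "convex U"
      "\<forall>x\<in>U. \<forall>c. cmod c \<le> r \<longrightarrow> x + cscale c v \<in> S" by blast
    define F where "F x t u = frechet_derivative f (at (x + cscale (E r t) v)) u * inverse (E r t)" for x t u
    have inS: "x + cscale (E r t) v \<in> S" if "x \<in> U" for x t using U(3,5) nE that by auto
    have bl: "bounded_linear (F x t)" if "x \<in> U" for x t
      unfolding F_def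
      by (intro bounded_linear_mult_const has_derivative_bounded_linear[OF holo_fun_deriv(1)[OF f inS[OF that]]])
    have Fd: "((\<lambda>x. f (x + cscale (E r t) v) * inverse (E r t)) has_derivative F x t) (at x)" if "x \<in> U" for x t
      unfolding F_def
    proof (rule has_derivative_mult_left)
      have "((\<lambda>x. x + cscale (E r t) v) has_derivative (\<lambda>u. u)) (at x)"
        using has_derivative_add[OF has_derivative_ident has_derivative_const] by simp
      from has_derivative_compose[OF this holo_fun_deriv(1)[OF f inS[OF that, of t]]]
      show "((\<lambda>x. f (x + cscale (E r t) v)) has_derivative frechet_derivative f (at (x + cscale (E r t) v))) (at x)" .
    qed
    have bF: "blinfun_apply (Blinfun (F x t)) = F x t" if "x \<in> U" for x t
      using bl[OF that] by (rule bounded_linear_Blinfun_apply)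
    \<comment> \<open>The Leibniz rule takes the derivative as a continuous family of bounded
      operators; continuity is checked on basis vectors, where it comes down to
      \<open>D_cont\<close>.\<close>
    have "continuous_on (U \<times> cbox 0 1) (\<lambda>(x, t). Blinfun (F x t))"
    proof (rule continuous_on_blinfun_componentwise)
      fix i :: "'a cmodel" assume "i \<in> Basis"
      have "continuous_on (U \<times> cbox 0 1) (\<lambda>(x, t). F x t i)"
        using comp[OF D_cont U(3,5), of i] by (simp add: F_def)
      then show "continuous_on (U \<times> cbox 0 1) (\<lambda>x. blinfun_apply (case x of (x, t) \<Rightarrow> Blinfun (F x t)) i)"
        by (rule continuous_on_cong[THEN iffD1, rotated -1]) (use bF in auto)
    qed
    note c = this
    have int: "(\<lambda>t. f (x + cscale (E r t) v) * inverse (E r t)) integrable_on cbox 0 1" if "x \<in> U" for x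
    proof (rule integrable_continuous)
      show "continuous_on (cbox 0 1) (\<lambda>t. f (x + cscale (E r t) v) * inverse (E r t))"
      proof -
        have "continuous_on (cbox (0::real) 1) (Pair x)" "Pair x ` cbox (0::real) 1 \<subseteq> U \<times> {0..1}"
          using that by (auto intro!: continuous_intros simp: mem_box_real)
        from continuous_on_compose2[OF comp[OF fc U(3,5)] this] show ?thesis by simp
      qed
    qed
    have "((\<lambda>x. integral (cbox 0 1) (\<lambda>t. f (x + cscale (E r t) v) * inverse (E r t)))
        has_derivative integral (cbox 0 1) (\<lambda>t. Blinfun (F x0 t))) (at x0 within U)"
    proof (rule leibniz_rule[OF _ int c U(2,4)])
      show "((\<lambda>x. f (x + cscale (E r t) v) * inverse (E r t)) has_derivative blinfun_apply (Blinfun (F x t)))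
          (at x within U)" if "x \<in> U" for x t
        unfolding bF[OF that] by (rule has_derivative_at_withinI[OF Fd[OF that]])
    qed
    then have d1: "((\<lambda>x. integral (cbox 0 1) (\<lambda>t. f (x + cscale (E r t) v) * inverse (E r t)))
        has_derivative integral (cbox 0 1) (\<lambda>t. Blinfun (F x0 t))) (at x0)"
      unfolding at_within_open[OF U(2,1)] .
    have d2: "((\<lambda>x. frechet_derivative f (at x) v) has_derivative integral (cbox 0 1) (\<lambda>t. Blinfun (F x0 t))) (at x0)"
      by (rule has_derivative_transform_within_open[OF d1 U(1,2)])
        (use holo_fun_Cauchy[OF f U(3)] U(5) in \<open>auto simp: E_def\<close>)
    have intF: "(\<lambda>t. Blinfun (F x0 t)) integrable_on cbox 0 1"
    proof (rule integrable_continuous)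
      have "continuous_on (cbox (0::real) 1) (Pair x0)" "Pair x0 ` cbox (0::real) 1 \<subseteq> U \<times> cbox 0 1"
        using U(2) by (auto intro!: continuous_intros)
      from continuous_on_compose2[OF c this]
      show "continuous_on (cbox 0 1) (\<lambda>t. Blinfun (F x0 t))" by simp
    qed
    have val: "blinfun_apply (integral (cbox 0 1) (\<lambda>t. Blinfun (F x0 t))) w = integral (cbox 0 1) (\<lambda>t. F x0 t w)" for w
      using blinfun_apply_integral[OF intF, of w] bF[OF U(2)] by simp
    have "F x0 t (mult_i w) = \<i> * F x0 t w" for t w
      unfolding F_def using holo_fun_deriv(2)[OF f inS[OF U(2)]] by simp
    then have "blinfun_apply (integral (cbox 0 1) (\<lambda>t. Blinfun (F x0 t))) (mult_i w)
        = \<i> * blinfun_apply (integral (cbox 0 1) (\<lambda>t. Blinfun (F x0 t))) w" for w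
      unfolding val by simp
    then show ?thesis using d2 by blast
  qed
  then show ?thesis using opS by (simp add: holo_fun_def)
qed

lemma holo_fun_Cinf:
  assumes "holo_fun f S" shows "Cinf f S"
proof -
  have op: "open S" using assms by (simp add: holo_fun_def)
  have "Ck_on k f S" for k
    using assms
  proof (induction k arbitrary: f)
    case 0
    then show ?case using holo_fun_deriv(1)[OF 0]
      by (auto intro!: continuous_at_imp_continuous_on has_derivative_continuous)
  next
    case (Suc k)
    show ?case
      by (rule Ck_on_SucI[OF op holo_fun_deriv(1)[OF Suc.prems] Suc.IH[OF holo_fun_frechet_derivative[OF Suc.prems]]])
  qed
  then show ?thesis using op by (simp add: Cinf_def)
qed

lemma holomorphic_map_on_Cinf:
  assumes "holomorphic_map_on S f" "open S" shows "Cinf f S"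
proof -
  have k: "holo_fun (\<lambda>x. fst (f x) $ k) S" for k
    unfolding holo_fun_def
  proof (intro conjI ballI assms(2))
    fix x assume "x \<in> S"
    then obtain D where D: "(f has_derivative D) (at x)" "\<forall>v. D (mult_i v) = mult_i (D v)"
      using assms(1) unfolding holomorphic_map_on_def by blast
    have "((\<lambda>x. fst (f x) $ k) has_derivative (\<lambda>v. fst (D v) $ k)) (at x)"
      by (intro bounded_linear.has_derivative[OF bounded_linear_vec_nth] has_derivative_fst D)
    then show "\<exists>D. ((\<lambda>x. fst (f x) $ k) has_derivative D) (at x) \<and> (\<forall>v. D (mult_i v) = \<i> * D v)"
      using D(2) by (intro exI[of _ "\<lambda>v. fst (D v) $ k"]) (simp add: mult_i_def)
  qed
  have l: "holo_fun (\<lambda>x. snd (f x)) S"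
    unfolding holo_fun_def
  proof (intro conjI ballI assms(2))
    fix x assume "x \<in> S"
    then obtain D where D: "(f has_derivative D) (at x)" "\<forall>v. D (mult_i v) = mult_i (D v)"
      using assms(1) unfolding holomorphic_map_on_def by blast
    have "((\<lambda>x. snd (f x)) has_derivative (\<lambda>v. snd (D v))) (at x)"
      by (intro has_derivative_snd D)
    then show "\<exists>D. ((\<lambda>x. snd (f x)) has_derivative D) (at x) \<and> (\<forall>v. D (mult_i v) = \<i> * D v)"
      using D(2) by (intro exI[of _ "\<lambda>v. snd (D v)"]) (simp add: mult_i_def)
  qed
  have "Cinf (\<lambda>x. (\<chi> k. fst (f x) $ k, snd (f x))) S"
    by (intro Cinf_Pair Cinf_vec holo_fun_Cinf[OF k] holo_fun_Cinf[OF l] assms(2))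
  then show ?thesis by simp
qed

section \<open>Graphs over the z-space\<close>

lemma Cinf_eqI: "Cinf f S \<Longrightarrow> (\<And>x. x \<in> S \<Longrightarrow> f x = g x) \<Longrightarrow> Cinf g S"
  using Cinf_cong[of S f g] by simp

section \<open>Perturbing and inverting real linear maps; symmetry of second derivatives\<close>

lemma norm_linear_le_sum_Basis:
  fixes L :: "'a::euclidean_space \<Rightarrow> 'b::real_normed_vector"
  assumes "linear L" shows "norm (L v) \<le> (\<Sum>b\<in>Basis. norm (L b)) * norm v"
proof -
  have "norm (L v) = norm (\<Sum>b\<in>Basis. (v \<bullet> b) *\<^sub>R L b)"
    using linear_eq_sum_Basis[OF assms, of v] by simp
  also have "\<dots> \<le> (\<Sum>b\<in>Basis. norm ((v \<bullet> b) *\<^sub>R L b))" by (rule norm_sum)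
  also have "\<dots> \<le> (\<Sum>b\<in>Basis. norm (L b) * norm v)"
    by (intro sum_mono) (simp add: mult.commute[of _ "norm v"] mult_right_mono Basis_le_norm)
  finally show ?thesis by (simp add: sum_distrib_right)
qed

text \<open>A lower bound drops by at most the size of the perturbation. That size is measured on
  basis vectors because these are the quantities that depend continuously on parameters.\<close>

lemma linear_perturb_bound:
  fixes L L' :: "'a::euclidean_space \<Rightarrow> 'b::real_normed_vector"
  assumes "linear L" "linear L'" "\<And>v. m * norm v \<le> norm (L v)"
    and "(\<Sum>b\<in>Basis. norm (L' b - L b)) \<le> m'"
  shows "(m - m') * norm v \<le> norm (L' v)"
proof -
  have "linear (\<lambda>v. L' v - L v)" using assms linear_compose_sub by blast
  from norm_linear_le_sum_Basis[OF this]
  have "norm (L' v - L v) \<le> (\<Sum>b\<in>Basis. norm (L' b - L b)) * norm v" .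
  also have "\<dots> \<le> m' * norm v" by (intro mult_right_mono assms) auto
  finally have "norm (L' v - L v) \<le> m' * norm v" .
  moreover have "norm (L v) \<le> norm (L' v) + norm (L' v - L v)"
    by (metis add.commute diff_add_cancel norm_minus_commute norm_triangle_ineq)
  ultimately show ?thesis using assms(3)[of v] by (simp add: algebra_simps)
qed

lemma inj_linear_of_bound:
  assumes "linear L" "\<And>v. m * norm v \<le> norm (L v)" "m > 0" shows "inj L"
  unfolding linear_injective_0[OF assms(1)]
proof (intro allI impI)
  fix v assume "L v = 0"
  then have "m * norm v \<le> 0" using assms(2)[of v] by simp
  then show "v = 0" using assms(3) by (simp add: mult_le_0_iff)
qed

lemma linear_inj_imp_bij:
  fixes L :: "'a::euclidean_space \<Rightarrow> 'b::euclidean_space"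
  assumes "linear L" "inj L" "DIM('a) = DIM('b)" shows "bij L"
proof -
  have "dim (range L) = dim (UNIV :: 'a set)"
    by (rule dim_image_eq[OF assms(1)]) (use assms(2) in \<open>auto intro: inj_on_subset\<close>)
  then have "dim (range L) = DIM('b)" using assms(3) by (simp add: dim_UNIV)
  then have "range L = UNIV"
    using dim_eq_full linear_subspace_image[OF assms(1) subspace_UNIV] span_eq_iff by metis
  then show ?thesis using assms(2) by (simp add: bij_def)
qed

lemma linear_inv_bij:
  assumes "linear L" "bij L" shows "linear (inv L)"
proof (rule linearI)
  have s: "L (inv L y) = y" for y using assms(2) by (simp add: bij_is_surj surj_f_inv_f)
  have i: "inv L (L x) = x" for x using assms(2) by (simp add: bij_is_inj)
  show "inv L (a + b) = inv L a + inv L b" for a b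
    using i[of "inv L a + inv L b"] by (simp add: linear_add[OF assms(1)] s)
  show "inv L (c *\<^sub>R a) = c *\<^sub>R inv L a" for c a
    using i[of "c *\<^sub>R inv L a"] by (simp add: linear_scale[OF assms(1)] s)
qed

text \<open>Near \<open>x\<close> all \<open>A y\<close> share the lower bound \<open>m / 2\<close>,
  so the two preimages of \<open>w\<close> differ by at most \<open>2 / m\<close> times
  \<open>norm (A y (inv (A x) w) - w)\<close>. This tends to 0 by continuity of \<open>A\<close> at
  one fixed vector.\<close>

lemma inv_linear_isCont:
  fixes A :: "'a::t2_space \<Rightarrow> 'e::euclidean_space \<Rightarrow> 'f::euclidean_space"
  assumes S: "open S" "x \<in> S" and lin: "\<And>y. y \<in> S \<Longrightarrow> linear (A y)" "\<And>y. y \<in> S \<Longrightarrow> bij (A y)"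
    and cont: "\<And>v. continuous_on S (\<lambda>y. A y v)"
  shows "isCont (\<lambda>y. inv (A y) w) x"
proof -
  have c: "((\<lambda>y. A y v) \<longlongrightarrow> A x v) (at x)" for v
    using cont[of v] S by (simp add: continuous_on_eq_continuous_at isCont_def)
  obtain m where m: "m > 0" "\<And>v. m * norm v \<le> norm (A x v)"
    using linear_inj_bounded_below_pos[OF lin(1)[OF S(2)] bij_is_inj[OF lin(2)[OF S(2)]]] by metis
  have "((\<lambda>y. \<Sum>b\<in>Basis. norm (A y b - A x b)) \<longlongrightarrow> (\<Sum>b\<in>Basis. norm (A x b - A x b))) (at x)"
    by (intro tendsto_intros c)
  then have ev: "\<forall>\<^sub>F y in at x. (\<Sum>b\<in>Basis. norm (A y b - A x b)) < m / 2"
    using m(1) by (intro order_tendstoD(2)[where y=0]) auto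
  have evS: "\<forall>\<^sub>F y in at x. y \<in> S" using S eventually_at_topological by blast
  have lim: "((\<lambda>y. 2 / m * norm (A y (inv (A x) w) - w)) \<longlongrightarrow> 2 / m * norm (A x (inv (A x) w) - w)) (at x)"
    by (intro tendsto_intros c)
  have eq: "A y (inv (A y) w) = w" if "y \<in> S" for y w
    using bij_is_surj[OF lin(2)[OF that]] by (simp add: surj_f_inv_f)
  have "\<forall>\<^sub>F y in at x. norm (inv (A y) w - inv (A x) w) \<le> 2 / m * norm (A y (inv (A x) w) - w)"
    using ev evS
  proof eventually_elim
    case (elim y)
    have "(m - m / 2) * norm (inv (A y) w - inv (A x) w) \<le> norm (A y (inv (A y) w - inv (A x) w))"
      by (rule linear_perturb_bound[OF lin(1)[OF S(2)] lin(1)[OF elim(2)] m(2)]) (use elim(1) in simp)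
    also have "A y (inv (A y) w - inv (A x) w) = w - A y (inv (A x) w)"
      using linear_diff[OF lin(1)[OF elim(2)]] eq[OF elim(2)] by simp
    finally show ?case using m(1) by (simp add: field_simps norm_minus_commute)
  qed
  then have "((\<lambda>y. inv (A y) w - inv (A x) w) \<longlongrightarrow> 0) (at x)"
    by (rule Lim_null_comparison) (use lim eq[OF S(2)] in simp)
  then show ?thesis by (simp add: isCont_def LIM_zero_iff)
qed

text \<open>At a zero of \<open>f\<close> the product rule has no term with the derivative of
  \<open>c\<close>, so continuity of \<open>c\<close> is enough. It is applied to the inverse of a
  family of linear maps, which is only known to be continuous when it is to be
  differentiated.\<close>

lemma has_derivative_zero_scaleR:
  fixes f :: "'a::real_normed_vector \<Rightarrow> real" and c :: "'a \<Rightarrow> 'b::real_normed_vector"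
  assumes f: "(f has_derivative f') (at x)" "f x = 0" and c: "isCont c x"
  shows "((\<lambda>y. f y *\<^sub>R c y) has_derivative (\<lambda>h. f' h *\<^sub>R c x)) (at x)"
proof -
  obtain B where B: "\<And>h. \<bar>f' h\<bar> \<le> norm h * B"
    using bounded_linear.bounded[OF has_derivative_bounded_linear[OF f(1)]] by (auto simp: real_norm_def)
  have q: "((\<lambda>y. norm (f y - f x - f' (y - x)) / norm (y - x)) \<longlongrightarrow> 0) (at x)"
    using f(1) unfolding has_derivative_iff_norm by blast
  have "((\<lambda>y. (norm (f y - f x - f' (y - x)) / norm (y - x) + B) * norm (c y - c x)) \<longlongrightarrow> (0 + B) * norm (c x - c x)) (at x)"
    using c by (intro tendsto_intros q) (simp add: isCont_def)
  then have lim: "((\<lambda>y. (norm (f y - f x - f' (y - x)) / norm (y - x) + B) * norm (c y - c x)) \<longlongrightarrow> 0) (at x)"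
    by simp
  have "((\<lambda>y. f y *\<^sub>R (c y - c x)) has_derivative (\<lambda>h. 0)) (at x)"
  proof (rule has_derivativeI_sandwich[where e=1, OF _ _ _ lim])
    fix y assume "y \<noteq> x"
    have "\<bar>f y\<bar> \<le> norm (f y - f x - f' (y - x)) + norm (y - x) * B"
      using B[of "y - x"] f(2) by (simp add: real_norm_def)
    then have "\<bar>f y\<bar> / norm (y - x) \<le> (norm (f y - f x - f' (y - x)) + norm (y - x) * B) / norm (y - x)"
      by (rule divide_right_mono) simp
    also have "\<dots> = norm (f y - f x - f' (y - x)) / norm (y - x) + B"
      using \<open>y \<noteq> x\<close> by (simp add: add_divide_distrib)
    finally have "\<bar>f y\<bar> / norm (y - x) * norm (c y - c x)
        \<le> (norm (f y - f x - f' (y - x)) / norm (y - x) + B) * norm (c y - c x)"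
      by (rule mult_right_mono) simp
    then show "norm (f y *\<^sub>R (c y - c x) - f x *\<^sub>R (c x - c x) - 0) / norm (y - x)
        \<le> (norm (f y - f x - f' (y - x)) / norm (y - x) + B) * norm (c y - c x)"
      by simp
  qed auto
  from has_derivative_add[OF has_derivative_scaleR_left[OF f(1), of "c x"] this]
  show ?thesis by (simp add: algebra_simps)
qed

text \<open>Derivatives of the inverse come from \<open>B y w = B x w - B y (A y (B x w) - w)\<close> for
  \<open>B y = inv (A y)\<close>, where the last argument vanishes at \<open>y = x\<close>.\<close>

lemma Ck_on_inv_linear:
  fixes A :: "'a::euclidean_space \<Rightarrow> 'e::euclidean_space \<Rightarrow> 'f::euclidean_space"
  assumes S: "open S" and lin: "\<And>y. y \<in> S \<Longrightarrow> linear (A y)" "\<And>y. y \<in> S \<Longrightarrow> bij (A y)"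
    and A: "\<And>v. Ck_on k (\<lambda>y. A y v) S"
  shows "Ck_on k (\<lambda>y. inv (A y) w) S"
  using A
proof (induction k arbitrary: w)
  case 0
  then have c: "\<And>v. continuous_on S (\<lambda>y. A y v)" by simp
  have "isCont (\<lambda>y. inv (A y) w) x" if "x \<in> S" for x
    by (rule inv_linear_isCont[OF S that lin c])
  then show ?case by (simp add: continuous_at_imp_continuous_on)
next
  case (Suc k)
  let ?B = "\<lambda>y. inv (A y)"
  have IH: "Ck_on k (\<lambda>y. ?B y w) S" for w
    using Suc.IH[of w] Suc.prems Ck_on_Suc_imp by blast
  have linB: "linear (?B y)" if "y \<in> S" for y
    using lin[OF that] linear_inv_bij by blast
  have eq: "A y (?B y w) = w" "?B y (A y v) = v" if "y \<in> S" for y w v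
    using lin(2)[OF that] by (auto simp: bij_is_inj bij_is_surj surj_f_inv_f inv_f_f)
  define A' where "A' v x = frechet_derivative (\<lambda>y. A y v) (at x)" for v x
  have A': "((\<lambda>y. A y v) has_derivative A' v x) (at x)" if "x \<in> S" for x v
    using Ck_on_SucD(1)[OF Suc.prems that] by (simp add: A'_def)
  have A'k: "Ck_on k (\<lambda>x. A' v x u) S" for u v
    using Ck_on_SucD(2)[OF Suc.prems] by (simp add: A'_def)
  have linA': "A' v x u = (\<Sum>b\<in>Basis. (v \<bullet> b) *\<^sub>R A' b x u)" if "x \<in> S" for v x u
  proof -
    have "((\<lambda>y. \<Sum>b\<in>Basis. (v \<bullet> b) *\<^sub>R A y b) has_derivative (\<lambda>u. \<Sum>b\<in>Basis. (v \<bullet> b) *\<^sub>R A' b x u)) (at x)"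
      by (intro has_derivative_sum has_derivative_scaleR_right A' that)
    then have "((\<lambda>y. A y v) has_derivative (\<lambda>u. \<Sum>b\<in>Basis. (v \<bullet> b) *\<^sub>R A' b x u)) (at x)"
      by (rule has_derivative_transform_within_open[OF _ S that]) (metis linear_eq_sum_Basis lin(1))
    from has_derivative_unique[OF A'[OF that] this] show ?thesis by metis
  qed
  \<comment> \<open>The expected derivative: minus \<open>inv (A x)\<close> after the derivative of
    \<open>A\<close> in direction \<open>u\<close> after \<open>inv (A x)\<close>, applied to
    \<open>w\<close>. It is expanded in bases so that only fixed vectors are plugged into
    \<open>A'\<close> and \<open>inv (A x)\<close>.\<close>
  define D where "D x u = - (\<Sum>c\<in>Basis. ((\<Sum>b\<in>Basis. (?B x w \<bullet> b) *\<^sub>R A' b x u) \<bullet> c) *\<^sub>R ?B x c)" for x u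
  show ?case
  proof (rule Ck_on_SucI[OF S])
    fix x assume x: "x \<in> S"
    define r where "r y = A y (?B x w) - w" for y
    have r: "(r has_derivative (\<lambda>u. \<Sum>b\<in>Basis. (?B x w \<bullet> b) *\<^sub>R A' b x u)) (at x)"
    proof -
      have "A' (?B x w) x = (\<lambda>u. \<Sum>b\<in>Basis. (?B x w \<bullet> b) *\<^sub>R A' b x u)"
        using linA'[OF x] by (intro ext)
      then show ?thesis
        using has_derivative_diff[OF A'[OF x, of "?B x w"] has_derivative_const[of w]] unfolding r_def by simp
    qed
    have c: "isCont (\<lambda>y. ?B y c) x" for c
      using Ck_on_continuous[OF IH] x S by (simp add: continuous_on_eq_continuous_at)
    have "((\<lambda>y. ?B x w - (\<Sum>c\<in>Basis. (r y \<bullet> c) *\<^sub>R ?B y c)) has_derivative (\<lambda>u. 0 -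
        (\<Sum>c\<in>Basis. ((\<Sum>b\<in>Basis. (?B x w \<bullet> b) *\<^sub>R A' b x u) \<bullet> c) *\<^sub>R ?B x c))) (at x)"
      by (intro has_derivative_diff has_derivative_const has_derivative_sum has_derivative_zero_scaleR[OF _ _ c]
          has_derivative_inner_left r) (use eq(1)[OF x] in \<open>simp add: r_def\<close>)
    then have "((\<lambda>y. ?B x w - (\<Sum>c\<in>Basis. (r y \<bullet> c) *\<^sub>R ?B y c)) has_derivative D x) (at x)"
      by (simp add: D_def[abs_def])
    then show "((\<lambda>y. ?B y w) has_derivative D x) (at x)"
    proof (rule has_derivative_transform_within_open[OF _ S x])
      fix y assume y: "y \<in> S"
      have "(\<Sum>c\<in>Basis. (r y \<bullet> c) *\<^sub>R ?B y c) = ?B y (r y)"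
        using linear_eq_sum_Basis[OF linB[OF y]] by metis
      also have "\<dots> = ?B x w - ?B y w"
        using linear_diff[OF linB[OF y]] eq(2)[OF y] by (simp add: r_def)
      finally show "?B x w - (\<Sum>c\<in>Basis. (r y \<bullet> c) *\<^sub>R ?B y c) = ?B y w" by simp
    qed
  next
    fix u
    have 1: "Ck_on k (\<lambda>x. (?B x w \<bullet> b) *\<^sub>R A' b x u) S" for b
      by (intro Ck_on_bilinear[OF bounded_bilinear_scaleR S] Ck_on_bilinear[OF bounded_bilinear_inner S]
          IH A'k Ck_on_const)
    have 2: "Ck_on k (\<lambda>x. ((\<Sum>b\<in>Basis. (?B x w \<bullet> b) *\<^sub>R A' b x u) \<bullet> c) *\<^sub>R ?B x c) S" for c
      by (intro Ck_on_bilinear[OF bounded_bilinear_scaleR S] Ck_on_bilinear[OF bounded_bilinear_inner S]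
          IH Ck_on_sum[OF S 1] Ck_on_const)
    have 3: "Ck_on k (\<lambda>x. (-1) *\<^sub>R (\<Sum>c\<in>Basis. ((\<Sum>b\<in>Basis. (?B x w \<bullet> b) *\<^sub>R A' b x u) \<bullet> c) *\<^sub>R ?B x c)) S"
      by (rule Ck_on_bilinear[OF bounded_bilinear_scaleR S Ck_on_const Ck_on_sum[OF S 2]])
    then show "Ck_on k (\<lambda>x. D x u) S" unfolding D_def by simp
  qed
qed

text \<open>The second difference of \<open>f\<close> over the parallelogram with sides
  \<open>t u\<close> and \<open>t v\<close> is symmetric in \<open>u\<close> and \<open>v\<close>.
  The mean value inequality along \<open>u\<close> shows that it equals \<open>t^2 U v\<close> up to
  \<open>o(t^2)\<close>, and by symmetry also \<open>t^2 V u\<close>.\<close>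

lemma second_derivative_symmetric:
  fixes f :: "'a::real_normed_vector \<Rightarrow> 'b::real_normed_vector"
  assumes S: "open S" "x \<in> S" and f: "\<And>y. y \<in> S \<Longrightarrow> (f has_derivative f' y) (at y)"
    and U: "((\<lambda>y. f' y u) has_derivative U) (at x)" and V: "((\<lambda>y. f' y v) has_derivative V) (at x)"
  shows "U v = V u"
proof -
  have key: "\<exists>d>0. \<forall>t. 0 < t \<and> t < d \<longrightarrow>
      norm (f (x + t *\<^sub>R u + t *\<^sub>R v) - f (x + t *\<^sub>R u) - f (x + t *\<^sub>R v) + f x - (t * t) *\<^sub>R U v)
        \<le> t * t * (e * (2 * norm u + norm v))"
    if U: "((\<lambda>y. f' y u) has_derivative U) (at x)" and e: "e > 0" for u v U e
  proof -
    have linU: "linear U" using U has_derivative_linear by blast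
    obtain d1 where d1: "d1 > 0" "ball x d1 \<subseteq> S" using openE[OF S] by blast
    obtain d2 where d2: "d2 > 0" "\<And>y. norm (y - x) < d2 \<Longrightarrow> norm (f' y u - f' x u - U (y - x)) \<le> e * norm (y - x)"
      using U e unfolding has_derivative_at_alt by blast
    define d where "d = min d1 d2 / (norm u + norm v + 1)"
    have nn: "norm u + norm v + 1 > 0" by (simp add: add_nonneg_pos)
    have "d > 0" using d1 d2 nn by (simp add: d_def)
    moreover have "norm (f (x + t *\<^sub>R u + t *\<^sub>R v) - f (x + t *\<^sub>R u) - f (x + t *\<^sub>R v) + f x - (t * t) *\<^sub>R U v)
        \<le> t * t * (e * (2 * norm u + norm v))" if t: "0 < t" "t < d" for t
    proof -
      have td: "t * (norm u + norm v + 1) < min d1 d2"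
        using t(2) nn by (simp add: d_def pos_less_divide_eq)
      have small: "norm (s *\<^sub>R u + q *\<^sub>R v) < min d1 d2" if "0 \<le> s" "s \<le> t" "0 \<le> q" "q \<le> t" for s q
      proof -
        have "norm (s *\<^sub>R u + q *\<^sub>R v) \<le> s * norm u + q * norm v"
          using norm_triangle_ineq[of "s *\<^sub>R u" "q *\<^sub>R v"] that by simp
        also have "\<dots> \<le> t * norm u + t * norm v"
          using that by (intro add_mono mult_right_mono) auto
        also have "\<dots> \<le> t * (norm u + norm v + 1)" using t by (simp add: algebra_simps)
        finally show ?thesis using td by linarith
      qed
      \<comment> \<open>Difference of \<open>f\<close> along two parallel segments minus its
        predicted linear growth; its derivative in \<open>s\<close> is \<open>t\<close> times an
        arbitrarily small factor.\<close>
      define H where "H s = f (x + s *\<^sub>R u + t *\<^sub>R v) - f (x + s *\<^sub>R u) - (s * t) *\<^sub>R U v" for s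
      define H' where "H' s h = h *\<^sub>R (f' (x + s *\<^sub>R u + t *\<^sub>R v) u - f' (x + s *\<^sub>R u) u - t *\<^sub>R U v)" for s h :: real
      have dH: "(H has_derivative H' s) (at s within {0..t})" if s: "s \<in> {0..t}" for s
      proof -
        have "x + s *\<^sub>R u + t *\<^sub>R v \<in> S" "x + s *\<^sub>R u \<in> S"
        proof -
          have "x + (s *\<^sub>R u + t *\<^sub>R v) \<in> ball x d1" "x + s *\<^sub>R u \<in> ball x d1"
            using small[of s t] small[of s 0] s t unfolding mem_ball dist_commute[of x] by (simp_all add: dist_norm)
          then show "x + s *\<^sub>R u + t *\<^sub>R v \<in> S" "x + s *\<^sub>R u \<in> S"
            using d1(2) by (auto simp: add.assoc)
        qed
        note fs = f[OF this(1)] f[OF this(2)]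
        have a: "((\<lambda>s. x + s *\<^sub>R u + t *\<^sub>R v) has_derivative (\<lambda>h. h *\<^sub>R u)) (at s)"
          and b: "((\<lambda>s. x + s *\<^sub>R u) has_derivative (\<lambda>h. h *\<^sub>R u)) (at s)"
          by (auto intro!: derivative_eq_intros)
        have "(H has_derivative (\<lambda>h. f' (x + s *\<^sub>R u + t *\<^sub>R v) (h *\<^sub>R u) - f' (x + s *\<^sub>R u) (h *\<^sub>R u)
            - (h * t) *\<^sub>R U v)) (at s)"
          unfolding H_def
          by (intro has_derivative_diff has_derivative_compose[OF a fs(1)] has_derivative_compose[OF b fs(2)])
            (auto intro!: derivative_eq_intros)
        moreover have "f' y (h *\<^sub>R u) = h *\<^sub>R f' y u" if "(f has_derivative f' y) (at y)" for y h
          using linear_scale[OF has_derivative_linear[OF that]] .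
        ultimately have "(H has_derivative H' s) (at s)"
          using fs by (simp add: H'_def[abs_def] algebra_simps)
        then show ?thesis by (rule has_derivative_at_withinI)
      qed
      have bH: "onorm (H' s) \<le> t * (e * (2 * norm u + norm v))" if s: "s \<in> {0..t}" for s
      proof (rule onorm_le)
        fix h
        let ?a = "s *\<^sub>R u + t *\<^sub>R v" and ?b = "s *\<^sub>R u"
        have 1: "norm (f' (x + ?a) u - f' x u - U ?a) \<le> e * norm ?a"
          using d2(2)[of "x + ?a"] small[of s t] s t by simp
        have 2: "norm (f' (x + ?b) u - f' x u - U ?b) \<le> e * norm ?b"
          using d2(2)[of "x + ?b"] small[of s 0] s t by simp
        have "U ?a - U ?b = t *\<^sub>R U v" using linear_add[OF linU] linear_scale[OF linU] by simp
        then have eq: "f' (x + s *\<^sub>R u + t *\<^sub>R v) u - f' (x + s *\<^sub>R u) u - t *\<^sub>R U v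
            = (f' (x + ?a) u - f' x u - U ?a) - (f' (x + ?b) u - f' x u - U ?b)"
          by (simp add: algebra_simps)
        have "norm (f' (x + s *\<^sub>R u + t *\<^sub>R v) u - f' (x + s *\<^sub>R u) u - t *\<^sub>R U v) \<le> e * norm ?a + e * norm ?b"
          unfolding eq using norm_triangle_ineq4 1 2 by (meson add_mono order_trans)
        also have "\<dots> \<le> e * (t * norm u + t * norm v) + e * (t * norm u)"
          using e s t norm_triangle_ineq[of ?b "t *\<^sub>R v"]
          by (intro add_mono mult_left_mono order_trans[OF norm_triangle_ineq]) (auto intro!: mult_right_mono)
        also have "\<dots> = t * (e * (2 * norm u + norm v))" by (simp add: algebra_simps)
        finally show "norm (H' s h) \<le> t * (e * (2 * norm u + norm v)) * norm h"
          unfolding H'_def by (simp add: mult.commute mult_left_mono)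
      qed
      have "norm (H t - H 0) \<le> t * (e * (2 * norm u + norm v)) * norm (t - 0)"
        by (rule differentiable_bound[OF _ dH bH]) (use t in auto)
      moreover have "H t - H 0 = f (x + t *\<^sub>R u + t *\<^sub>R v) - f (x + t *\<^sub>R u) - f (x + t *\<^sub>R v) + f x - (t * t) *\<^sub>R U v"
        by (simp add: H_def)
      ultimately show ?thesis using t by (simp add: mult_ac)
    qed
    ultimately show ?thesis by blast
  qed
  have small: "norm (U v - V u) \<le> e * (3 * norm u + 3 * norm v)" if e: "e > 0" for e
  proof -
    from key[OF assms(4) e, of v] obtain d1 where d1: "d1 > 0" "\<And>t. 0 < t \<and> t < d1 \<Longrightarrow>
      norm (f (x + t *\<^sub>R u + t *\<^sub>R v) - f (x + t *\<^sub>R u) - f (x + t *\<^sub>R v) + f x - (t * t) *\<^sub>R U v)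
        \<le> t * t * (e * (2 * norm u + norm v))" by blast
    from key[OF assms(5) e, of u] obtain d2 where d2: "d2 > 0" "\<And>t. 0 < t \<and> t < d2 \<Longrightarrow>
      norm (f (x + t *\<^sub>R v + t *\<^sub>R u) - f (x + t *\<^sub>R v) - f (x + t *\<^sub>R u) + f x - (t * t) *\<^sub>R V u)
        \<le> t * t * (e * (2 * norm v + norm u))" by blast
    define t where "t = min d1 d2 / 2"
    have t: "0 < t" "t < d1" "t < d2" using d1 d2 by (auto simp: t_def)
    let ?G = "f (x + t *\<^sub>R u + t *\<^sub>R v) - f (x + t *\<^sub>R u) - f (x + t *\<^sub>R v) + f x"
    have 1: "norm (?G - (t * t) *\<^sub>R U v) \<le> t * t * (e * (2 * norm u + norm v))" using d1(2) t by blast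
    have eqG: "f (x + t *\<^sub>R v + t *\<^sub>R u) - f (x + t *\<^sub>R v) - f (x + t *\<^sub>R u) + f x = ?G"
      by (simp add: algebra_simps)
    have 2: "norm (?G - (t * t) *\<^sub>R V u) \<le> t * t * (e * (2 * norm v + norm u))"
      using d2(2)[of t] t unfolding eqG by blast
    have "t * t * norm (U v - V u) = norm ((?G - (t * t) *\<^sub>R V u) - (?G - (t * t) *\<^sub>R U v))"
      by (simp flip: scaleR_diff_right)
    also have "\<dots> \<le> t * t * (e * (2 * norm v + norm u)) + t * t * (e * (2 * norm u + norm v))"
      using norm_triangle_ineq4 1 2 by (meson add_mono order_trans)
    also have "\<dots> = t * t * (e * (3 * norm u + 3 * norm v))" by (simp add: algebra_simps)
    finally show ?thesis using t by simp
  qed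
  have "norm (U v - V u) \<le> 0 + e" if "e > 0" for e
  proof -
    have pos: "3 * norm u + 3 * norm v + 1 > 0" by (simp add: add_nonneg_pos)
    have "norm (U v - V u) \<le> e / (3 * norm u + 3 * norm v + 1) * (3 * norm u + 3 * norm v)"
      using that pos by (intro small divide_pos_pos)
    also have "\<dots> \<le> e / (3 * norm u + 3 * norm v + 1) * (3 * norm u + 3 * norm v + 1)"
      using that pos by (intro mult_left_mono) auto
    finally show ?thesis using pos by simp
  qed
  then have "norm (U v - V u) \<le> 0" by (rule field_le_epsilon)
  then show ?thesis by simp
qed

section \<open>Wirtinger parts of real linear maps, and tangent spaces that are graphs\<close>

definition lin_part :: "(complex ^ 'n \<Rightarrow> complex) \<Rightarrow> complex ^ 'n" where
  "lin_part l = (\<chi> k. (l (axis k 1) - \<i> * l (axis k \<i>)) / 2)"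

text \<open>Half of \<open>d_x + i d_y\<close> in the coordinate \<open>z $ k = x + i y\<close>,
  that is, the Wirtinger derivative with respect to \<open>cnj (z $ k)\<close>;
  \<open>lin_part\<close> is the one with respect to \<open>z $ k\<close>.\<close>

definition antilin_part :: "(complex ^ 'n \<Rightarrow> complex) \<Rightarrow> complex ^ 'n" where
  "antilin_part l = (\<chi> k. (l (axis k 1) + \<i> * l (axis k \<i>)) / 2)"

text \<open>Bilinear, not Hermitian: every conjugation is written out by \<open>cnjv\<close>, so
  that linear and antilinear terms stay apart.\<close>

definition cdot :: "complex ^ 'n \<Rightarrow> complex ^ 'n \<Rightarrow> complex" where
  "cdot p z = (\<Sum>k\<in>UNIV. p $ k * z $ k)"

definition cnjv :: "complex ^ 'n \<Rightarrow> complex ^ 'n" where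
  "cnjv z = (\<chi> k. cnj (z $ k))"

lemma bounded_bilinear_cdot: "bounded_bilinear (cdot :: complex ^ 'n::finite \<Rightarrow> _)"
proof -
  have "bilinear (cdot :: complex ^ 'n::finite \<Rightarrow> _)"
    unfolding bilinear_def
    by (auto intro!: linearI simp: cdot_def algebra_simps sum.distrib scaleR_sum_right)
  then show ?thesis by (simp add: bilinear_conv_bounded_bilinear)
qed

lemma bounded_linear_cnjv: "bounded_linear (cnjv :: complex ^ 'n::finite \<Rightarrow> _)"
  by (auto intro!: linear_conv_bounded_linear[THEN iffD1] linearI simp: cnjv_def vec_eq_iff)

lemma norm_cnjv [simp]: "norm (cnjv z) = norm z"
  by (simp add: cnjv_def norm_vec_def)

lemma norm_cdot_le: "cmod (cdot p z) \<le> norm p * norm z"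
proof -
  have "cmod (cdot p z) \<le> (\<Sum>k\<in>UNIV. \<bar>norm (p $ k)\<bar> * \<bar>norm (z $ k)\<bar>)"
    unfolding cdot_def by (rule order_trans[OF norm_sum]) (simp add: norm_mult)
  also have "\<dots> \<le> norm p * norm z"
    unfolding norm_vec_def by (rule L2_set_mult_ineq)
  finally show ?thesis .
qed

lemma cdot_axis [simp]: "cdot p (axis k c) = p $ k * c"
  by (simp add: cdot_def axis_def if_distrib cong: if_cong)

lemma cnjv_axis [simp]: "cnjv (axis k c) = axis k (cnj c)"
  by (simp add: cnjv_def axis_def vec_eq_iff)

lemma vec_decompose:
  "(z :: complex ^ 'n::finite) = (\<Sum>k\<in>UNIV. Re (z $ k) *\<^sub>R axis k 1 + Im (z $ k) *\<^sub>R axis k \<i>)"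
  by (simp add: vec_eq_iff axis_def sum.distrib if_distrib complex_eq_iff cong: if_cong)

lemma linear_lin_antilin:
  fixes l :: "complex ^ 'n::finite \<Rightarrow> complex"
  assumes "linear l" shows "l z = cdot (lin_part l) z + cdot (antilin_part l) (cnjv z)"
proof -
  have "l z = (\<Sum>k\<in>UNIV. Re (z $ k) *\<^sub>R l (axis k 1) + Im (z $ k) *\<^sub>R l (axis k \<i>))"
    by (subst vec_decompose[of z])
      (simp only: linear_sum[OF assms] linear_add[OF assms] linear_scale[OF assms])
  also have "\<dots> = (\<Sum>k\<in>UNIV. lin_part l $ k * z $ k + antilin_part l $ k * cnj (z $ k))"
  proof (rule sum.cong[OF refl])
    fix k
    obtain a b where "z $ k = Complex a b" by (cases "z $ k")
    then show "Re (z $ k) *\<^sub>R l (axis k 1) + Im (z $ k) *\<^sub>R l (axis k \<i>)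
        = lin_part l $ k * z $ k + antilin_part l $ k * cnj (z $ k)"
      by (simp add: lin_part_def antilin_part_def scaleR_conv_of_real Complex_eq field_simps)
  qed
  finally show ?thesis by (simp add: cdot_def cnjv_def sum.distrib)
qed

lemma lin_part_eqI: "(\<And>z. l z = cdot p z + cdot g (cnjv z)) \<Longrightarrow> lin_part l = p"
  and antilin_part_eqI: "(\<And>z. l z = cdot p z + cdot g (cnjv z)) \<Longrightarrow> antilin_part l = g"
  by (simp_all add: lin_part_def antilin_part_def vec_eq_iff algebra_simps)

text \<open>A tangent space \<open>range D\<close> that projects isomorphically to the \<open>z\<close>-space is the graph of
  \<open>graph_op D\<close>; it is complex iff the antilinear part of this real linear map vanishes.\<close>

definition graph_op :: "('e \<Rightarrow> 'n cmodel) \<Rightarrow> complex ^ 'n \<Rightarrow> complex" where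
  "graph_op D \<zeta> = snd (D (inv (\<lambda>v. fst (D v)) \<zeta>))"

definition graphical :: "('e::real_vector \<Rightarrow> 'n::finite cmodel) \<Rightarrow> bool" where
  "graphical D \<longleftrightarrow> linear D \<and> bij (\<lambda>v. fst (D v))"

definition dz_part :: "('e \<Rightarrow> 'n cmodel) \<Rightarrow> complex ^ 'n" where
  "dz_part D = lin_part (graph_op D)"

definition dbar_part :: "('e \<Rightarrow> 'n cmodel) \<Rightarrow> complex ^ 'n" where
  "dbar_part D = antilin_part (graph_op D)"

lemma linear_fst_comp: "linear D \<Longrightarrow> linear (\<lambda>v. fst (D v))"
  by (intro linearI) (simp_all add: linear_add linear_scale)

lemma linear_snd_comp: "linear D \<Longrightarrow> linear (\<lambda>v. snd (D v))"
  by (intro linearI) (simp_all add: linear_add linear_scale)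

lemma graphicalD:
  assumes "graphical D"
  shows "linear D" "bij (\<lambda>v. fst (D v))" "linear (graph_op D)"
    "graph_op D (fst (D v)) = snd (D v)" "fst (D (inv (\<lambda>v. fst (D v)) \<zeta>)) = \<zeta>"
proof -
  show D: "linear D" and b: "bij (\<lambda>v. fst (D v))" using assms by (auto simp: graphical_def)
  have li: "linear (inv (\<lambda>v. fst (D v)))"
    by (rule linear_inv_bij[OF linear_fst_comp[OF D] b])
  have "linear ((\<lambda>v. snd (D v)) \<circ> inv (\<lambda>v. fst (D v)))"
    by (rule linear_compose[OF li linear_snd_comp[OF D]])
  then show "linear (graph_op D)" by (simp add: graph_op_def[abs_def] o_def)
  show "graph_op D (fst (D v)) = snd (D v)"
    using inv_f_f[OF bij_is_inj[OF b], of v] by (simp add: graph_op_def)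
  show "fst (D (inv (\<lambda>v. fst (D v)) \<zeta>)) = \<zeta>"
    using surj_f_inv_f[OF bij_is_surj[OF b], of \<zeta>] by simp
qed

lemma graphical_repr:
  assumes "graphical D"
  shows "snd (D v) = cdot (dz_part D) (fst (D v)) + cdot (dbar_part D) (cnjv (fst (D v)))"
  using linear_lin_antilin[OF graphicalD(3)[OF assms], of "fst (D v)"] graphicalD(4)[OF assms]
  by (simp add: dz_part_def dbar_part_def)

text \<open>The decomposition into a linear and an antilinear part is unique, so any explicit
  formula for \<open>snd (D v)\<close> identifies both gradients.\<close>

lemma graphical_eqI:
  assumes "graphical D" and "\<And>v. snd (D v) = cdot p (fst (D v)) + cdot g (cnjv (fst (D v)))"
  shows "dz_part D = p" "dbar_part D = g"
proof -
  have "graph_op D \<zeta> = cdot p \<zeta> + cdot g (cnjv \<zeta>)" for \<zeta>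
    using assms(2)[of "inv (\<lambda>v. fst (D v)) \<zeta>"] graphicalD(5)[OF assms(1)] by (simp add: graph_op_def)
  then show "dz_part D = p" "dbar_part D = g"
    unfolding dz_part_def dbar_part_def by (metis lin_part_eqI, metis antilin_part_eqI)
qed

lemma complex_range_iff:
  "range D = range D \<inter> mult_i ` range D \<longleftrightarrow> (\<forall>v. \<exists>u. D v = mult_i (D u))"
  by blast

text \<open>The graph is stable under multiplication by \<open>\<i>\<close> iff its operator
  commutes with \<open>\<i>\<close>. The linear part does so, while the antilinear part turns
  \<open>\<i>\<close> into \<open>- \<i>\<close>, hence it has to vanish.\<close>

lemma graphical_complex_iff:
  assumes "graphical D"
  shows "range D = range D \<inter> mult_i ` range D \<longleftrightarrow> dbar_part D = 0"
proof -
  let ?p = "dz_part D" and ?g = "dbar_part D"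
  note r = graphical_repr[OF assms]
  have iz: "cdot p (\<i> *s z) = \<i> * cdot p z" "cnjv (\<i> *s z) = (-\<i>) *s cnjv z" "cdot p ((-\<i>) *s z) = - \<i> * cdot p z"
    for p z :: "complex ^ 'b"
    by (simp_all add: cdot_def cnjv_def vec_eq_iff sum_distrib_left mult_ac sum_negf)
  show ?thesis unfolding complex_range_iff
  proof
    assume L: "\<forall>v. \<exists>u. D v = mult_i (D u)"
    have "cdot ?g (cnjv \<zeta>) = 0" for \<zeta>
    proof -
      define v where "v = inv (\<lambda>v. fst (D v)) (\<i> *s \<zeta>)"
      have v: "fst (D v) = \<i> *s \<zeta>" using graphicalD(5)[OF assms] by (simp add: v_def)
      obtain u where u: "D v = mult_i (D u)" using L by blast
      then have "fst (D u) = \<zeta>" using v by (simp add: mult_i_def vec_eq_iff)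
      moreover have "snd (D v) = \<i> * snd (D u)" using u by (simp add: mult_i_def)
      ultimately have "cdot ?p (\<i> *s \<zeta>) + cdot ?g (cnjv (\<i> *s \<zeta>)) = \<i> * (cdot ?p \<zeta> + cdot ?g (cnjv \<zeta>))"
        using r[of v] r[of u] v by simp
      then show ?thesis by (simp only: iz) (simp add: algebra_simps)
    qed
    from this[of "axis k 1" for k] show "?g = 0" by (simp add: vec_eq_iff)
  next
    assume g: "?g = 0"
    have g0: "cdot ?g z = 0" for z by (simp add: g cdot_def)
    show "\<forall>v. \<exists>u. D v = mult_i (D u)"
    proof
      fix v
      define u where "u = inv (\<lambda>v. fst (D v)) ((-\<i>) *s fst (D v))"
      have u: "fst (D u) = (-\<i>) *s fst (D v)" using graphicalD(5)[OF assms] by (simp add: u_def)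
      have "snd (D v) = \<i> * snd (D u)"
        unfolding r[of v] r[of u] g0 u iz by simp
      moreover have "fst (D v) = \<i> *s fst (D u)" unfolding u by (simp add: vec_eq_iff)
      ultimately show "\<exists>u. D v = mult_i (D u)" by (auto simp: mult_i_def prod_eq_iff)
    qed
  qed
qed

text \<open>The inverse of the \<open>z\<close>-projection depends smoothly on the base point. This
  makes the antiholomorphic gradient a smooth function, to which Sard's theorem can be
  applied.\<close>

lemma Cinf_graph_op:
  fixes D :: "'a::euclidean_space \<Rightarrow> 'e::euclidean_space \<Rightarrow> 'n::finite cmodel"
  assumes D: "\<And>v. Cinf (\<lambda>x. D x v) S" and g: "\<And>x. x \<in> S \<Longrightarrow> graphical (D x)" and S: "open S"
  shows "Cinf (\<lambda>x. graph_op (D x) \<zeta>) S"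
proof -
  have "Ck_on k (\<lambda>x. inv (\<lambda>v. fst (D x v)) \<zeta>) S" for k
    by (rule Ck_on_inv_linear[OF S linear_fst_comp[OF graphicalD(1)[OF g]] graphicalD(2)[OF g]
          CinfD(2)[OF Cinf_fst[OF D]]])
  then have B: "Cinf (\<lambda>x. inv (\<lambda>v. fst (D x v)) \<zeta>) S"
    using S by (simp add: Cinf_def)
  have "Cinf (\<lambda>x. \<Sum>b\<in>Basis. (inv (\<lambda>v. fst (D x v)) \<zeta> \<bullet> b) *\<^sub>R snd (D x b)) S"
    by (intro Cinf_sum S Cinf_scaleR Cinf_bilinear[OF bounded_bilinear_inner B] Cinf_const Cinf_snd D)
  moreover have "(\<Sum>b\<in>Basis. (inv (\<lambda>v. fst (D x v)) \<zeta> \<bullet> b) *\<^sub>R snd (D x b)) = graph_op (D x) \<zeta>" if "x \<in> S" for x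
    unfolding graph_op_def
    by (rule linear_eq_sum_Basis[OF linear_snd_comp[OF graphicalD(1)[OF g[OF that]]], symmetric])
  ultimately show ?thesis by (rule Cinf_eqI)
qed

lemma Cinf_dz_part:
  fixes D :: "'a::euclidean_space \<Rightarrow> 'e::euclidean_space \<Rightarrow> 'n::finite cmodel"
  assumes D: "\<And>v. Cinf (\<lambda>x. D x v) S" and g: "\<And>x. x \<in> S \<Longrightarrow> graphical (D x)" and S: "open S"
  shows "Cinf (\<lambda>x. dz_part (D x)) S" "Cinf (\<lambda>x. dbar_part (D x)) S"
  unfolding dz_part_def dbar_part_def lin_part_def antilin_part_def divide_inverse
  by (intro Cinf_vec S Cinf_mult Cinf_diff Cinf_add Cinf_const Cinf_graph_op[OF assms], assumption+)+

section \<open>Charts and complex points\<close>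

abbreviation cinv :: "('a, 'e) chart \<Rightarrow> 'e \<Rightarrow> 'a" where
  "cinv c \<equiv> inv_into (fst c) (snd c)"

lemma is_chartD:
  assumes "is_chart X c"
  shows "openin X (fst c)" "open (snd c ` fst c)" "inj_on (snd c) (fst c)"
    and is_chart_homeo: "homeomorphic_map (subtopology X (fst c)) (top_of_set (snd c ` fst c)) (snd c)"
    and is_chart_topspace: "topspace (subtopology X (fst c)) = fst c"
proof -
  show o: "openin X (fst c)" and "open (snd c ` fst c)"
    and h: "homeomorphic_map (subtopology X (fst c)) (top_of_set (snd c ` fst c)) (snd c)"
    using assms by (auto simp: is_chart_def split: prod.splits)
  show t: "topspace (subtopology X (fst c)) = fst c"
    using openin_subset[OF o] by auto
  show "inj_on (snd c) (fst c)" using h t by (simp add: homeomorphic_map_def)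
qed

lemma chart_cinv:
  assumes "is_chart X c"
  shows "y \<in> fst c \<Longrightarrow> cinv c (snd c y) = y" "x \<in> snd c ` fst c \<Longrightarrow> cinv c x \<in> fst c"
    "x \<in> snd c ` fst c \<Longrightarrow> snd c (cinv c x) = x"
  using is_chartD(3)[OF assms] by (auto simp: inv_into_into f_inv_into_f)

lemma chart_open_image:
  assumes "is_chart X c" "openin X W" "W \<subseteq> fst c" shows "open (snd c ` W)"
proof -
  have "openin (subtopology X (fst c)) W"
    using assms openin_subset_topspace_eq by (metis openin_open_subtopology is_chartD(1))
  then have "openin (top_of_set (snd c ` fst c)) (snd c ` W)"
    using homeomorphic_imp_open_map[OF is_chart_homeo[OF assms(1)]] by (simp add: open_map_def)
  then show ?thesis using is_chartD(2)[OF assms(1)] openin_open_eq by blast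
qed

lemma chart_open_preimage:
  assumes "is_chart X c" "open W" shows "openin X {q \<in> fst c. snd c q \<in> W}"
proof -
  have "continuous_map (subtopology X (fst c)) (top_of_set (snd c ` fst c)) (snd c)"
    by (rule homeomorphic_imp_continuous_map[OF is_chart_homeo[OF assms(1)]])
  then have "continuous_map (subtopology X (fst c)) euclidean (snd c)"
    by (simp add: continuous_map_in_subtopology)
  then have "openin (subtopology X (fst c)) {q \<in> topspace (subtopology X (fst c)). snd c q \<in> W}"
    using assms(2) openin_continuous_map_preimage open_openin by blast
  then show ?thesis
    unfolding is_chart_topspace[OF assms(1)] using is_chartD(1)[OF assms(1)] openin_trans_full by blast
qed

lemma chart_continuous_map:
  assumes "is_chart X c" shows "continuous_map (subtopology X (fst c)) euclidean (snd c)"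
  using homeomorphic_imp_continuous_map[OF is_chart_homeo[OF assms]]
  by (simp add: continuous_map_in_subtopology)

lemma chart_cinv_continuous_map:
  assumes c: "is_chart X c" shows "continuous_map (top_of_set (snd c ` fst c)) X (cinv c)"
  unfolding continuous_map
proof (intro conjI allI impI)
  show "cinv c ` topspace (top_of_set (snd c ` fst c)) \<subseteq> topspace X"
    using chart_cinv(2)[OF c] openin_subset[OF is_chartD(1)[OF c]] by auto
  fix U assume U: "openin X U"
  have "{x \<in> topspace (top_of_set (snd c ` fst c)). cinv c x \<in> U} = snd c ` (U \<inter> fst c)"
    using chart_cinv[OF c] by force
  moreover have "open (snd c ` (U \<inter> fst c))"
    using U is_chartD(1)[OF c] by (intro chart_open_image[OF c]) auto
  ultimately show "openin (top_of_set (snd c ` fst c)) {x \<in> topspace (top_of_set (snd c ` fst c)). cinv c x \<in> U}"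
    unfolding openin_open by (metis (no_types) Int_absorb1 image_mono inf_le2)
qed

lemma chart_open_cinv_image:
  assumes "is_chart X c" "open W" "W \<subseteq> snd c ` fst c" shows "openin X (cinv c ` W)"
proof -
  have "cinv c ` W = {q \<in> fst c. snd c q \<in> W}"
    using chart_cinv[OF assms(1)] assms(3) by force
  then show ?thesis using chart_open_preimage[OF assms(1,2)] by simp
qed

lemma chart_compact_cinv_image:
  assumes "is_chart X c" "compact K" "K \<subseteq> snd c ` fst c" shows "compactin X (cinv c ` K)"
  by (rule image_compactin[OF _ chart_cinv_continuous_map[OF assms(1)]])
    (use assms in \<open>simp add: compactin_subtopology\<close>)

lemma compatible_iff:
  "compatible P c d \<longleftrightarrow> P (snd c ` (fst c \<inter> fst d)) (snd d \<circ> cinv c) \<and> P (snd d ` (fst c \<inter> fst d)) (snd c \<circ> cinv d)"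
  by (cases c; cases d) (simp add: compatible_def)

lemma chart_overlap_open:
  assumes "is_chart X c" "is_chart X d"
  shows "open (snd c ` (fst c \<inter> fst d))" "open (snd d ` (fst c \<inter> fst d))"
  using assms by (auto intro!: chart_open_image[where X=X] is_chartD(1))

lemma holomorphic_map_on_compose:
  assumes "holomorphic_map_on S f" "holomorphic_map_on T g" "f ` S \<subseteq> T"
  shows "holomorphic_map_on S (\<lambda>x. g (f x))"
  unfolding holomorphic_map_on_def
proof
  fix x assume x: "x \<in> S"
  then obtain D where D: "(f has_derivative D) (at x)" "\<forall>v. D (mult_i v) = mult_i (D v)"
    using assms(1) by (auto simp: holomorphic_map_on_def)
  have "f x \<in> T" using assms(3) x by blast
  then obtain E where E: "(g has_derivative E) (at (f x))" "\<forall>v. E (mult_i v) = mult_i (E v)"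
    using assms(2) unfolding holomorphic_map_on_def by blast
  show "\<exists>D. ((\<lambda>x. g (f x)) has_derivative D) (at x) \<and> (\<forall>v. D (mult_i v) = mult_i (D v))"
    using has_derivative_compose[OF D(1) E(1)] D(2) E(2) by (intro exI[of _ "\<lambda>v. E (D v)"]) (simp del: split_paired_All)
qed

lemma holomorphic_map_on_eqI:
  assumes "holomorphic_map_on S f" "open S" "\<And>x. x \<in> S \<Longrightarrow> f x = g x"
  shows "holomorphic_map_on S g"
  unfolding holomorphic_map_on_def
proof
  fix x assume x: "x \<in> S"
  then obtain D where D: "(f has_derivative D) (at x)" "\<forall>v. D (mult_i v) = mult_i (D v)"
    using assms(1) by (auto simp: holomorphic_map_on_def)
  then show "\<exists>D. (g has_derivative D) (at x) \<and> (\<forall>v. D (mult_i v) = mult_i (D v))"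
    using has_derivative_transform_within_open[OF D(1) assms(2) x assms(3)] by blast
qed

lemma holomorphic_map_on_local:
  assumes "\<And>x. x \<in> S \<Longrightarrow> \<exists>U. x \<in> U \<and> holomorphic_map_on U f"
  shows "holomorphic_map_on S f"
  using assms unfolding holomorphic_map_on_def by blast

lemma holomorphic_map_on_subset: "holomorphic_map_on S f \<Longrightarrow> T \<subseteq> S \<Longrightarrow> holomorphic_map_on T f"
  unfolding holomorphic_map_on_def by blast

locale cr_setting =
  fixes Y :: "'y topology" and B :: "('y, 'e::euclidean_space) chart set"
    and X :: "'x topology" and A :: "('x, 'n::finite cmodel) chart set"
  assumes Y: "smooth_manifold Y B" and compact_Y: "compact_space Y"
    and dim: "DIM('e) = 2 * CARD('n)" and X: "complex_manifold X A"
begin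

section \<open>Maps and tangent spaces read in arbitrary holomorphic charts\<close>

abbreviation hc :: "('x, 'n cmodel) chart \<Rightarrow> bool" where "hc \<equiv> holomorphic_chart X A"

lemma B_chart: "c \<in> B \<Longrightarrow> is_chart Y c"
  and B_compatible: "c \<in> B \<Longrightarrow> c' \<in> B \<Longrightarrow> compatible smooth_on c c'"
  and B_cover: "y \<in> topspace Y \<Longrightarrow> \<exists>c\<in>B. y \<in> fst c"
  and Hausdorff_Y: "Hausdorff_space Y"
  using Y unfolding smooth_manifold_def is_atlas_def by blast+

lemma A_chart: "d \<in> A \<Longrightarrow> is_chart X d"
  and A_cover: "p \<in> topspace X \<Longrightarrow> \<exists>d\<in>A. p \<in> fst d"
  and Hausdorff_X: "Hausdorff_space X"
  and A_hc: "d \<in> A \<Longrightarrow> hc d"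
  using X unfolding complex_manifold_def is_atlas_def holomorphic_chart_def by blast+

lemma hc_chart: "hc d \<Longrightarrow> is_chart X d"
  by (simp add: holomorphic_chart_def)

text \<open>Compatibility is given only with charts of the atlas; near each point the transition
  factors through an atlas chart around it.\<close>

lemma hc_transition:
  assumes c: "hc c" and d: "hc d"
  shows "holomorphic_map_on (snd c ` (fst c \<inter> fst d)) (\<lambda>x. snd d (cinv c x))"
proof (rule holomorphic_map_on_local)
  note ic = hc_chart[OF c] and id = hc_chart[OF d]
  fix x assume "x \<in> snd c ` (fst c \<inter> fst d)"
  then obtain p where p: "p \<in> fst c" "p \<in> fst d" "x = snd c p" by blast
  have "p \<in> topspace X" using p(1) openin_subset[OF is_chartD(1)[OF ic]] by blast
  then obtain a where a: "a \<in> A" "p \<in> fst a" using A_cover by blast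
  note ia = A_chart[OF a(1)]
  let ?W = "snd c ` (fst c \<inter> fst d \<inter> fst a)"
  have W: "open ?W"
    by (intro chart_open_image[OF ic] openin_Int is_chartD(1)[OF ic] is_chartD(1)[OF id] is_chartD(1)[OF ia]) auto
  have 1: "holomorphic_map_on ?W (snd a \<circ> cinv c)"
  proof -
    have "holomorphic_map_on (snd c ` (fst c \<inter> fst a)) (snd a \<circ> cinv c)"
      using c a(1) unfolding holomorphic_chart_def compatible_iff by simp
    then show ?thesis by (rule holomorphic_map_on_subset) auto
  qed
  have 2: "holomorphic_map_on (snd a ` (fst d \<inter> fst a)) (snd d \<circ> cinv a)"
    using d a(1) unfolding holomorphic_chart_def compatible_iff by simp
  have "holomorphic_map_on ?W (\<lambda>x. (snd d \<circ> cinv a) ((snd a \<circ> cinv c) x))"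
    by (rule holomorphic_map_on_compose[OF 1 2]) (auto simp: chart_cinv(1)[OF ic])
  then have "holomorphic_map_on ?W (\<lambda>x. snd d (cinv c x))"
    by (rule holomorphic_map_on_eqI[OF _ W]) (auto simp: chart_cinv(1)[OF ic] chart_cinv(1)[OF ia])
  then show "\<exists>U. x \<in> U \<and> holomorphic_map_on U (\<lambda>x. snd d (cinv c x))"
    using p a(2) by (intro exI[of _ ?W]) simp
qed

lemma hc_transition_Cinf:
  assumes "hc c" "hc d" shows "Cinf (\<lambda>x. snd d (cinv c x)) (snd c ` (fst c \<inter> fst d))"
  by (rule holomorphic_map_on_Cinf[OF hc_transition[OF assms]])
    (rule chart_overlap_open(1)[OF hc_chart[OF assms(1)] hc_chart[OF assms(2)]])

lemma B_transition_Cinf: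
  assumes "c \<in> B" "c' \<in> B" shows "Cinf (\<lambda>x. snd c' (cinv c x)) (snd c ` (fst c \<inter> fst c'))"
proof -
  have "smooth_on (snd c ` (fst c \<inter> fst c')) (snd c' \<circ> cinv c)"
    using B_compatible[OF assms] by (simp add: compatible_iff)
  then have "Cinf (snd c' \<circ> cinv c) (snd c ` (fst c \<inter> fst c'))"
    by (rule iffD1[OF smooth_on_iff_Cinf[OF chart_overlap_open(1)[OF B_chart[OF assms(1)] B_chart[OF assms(2)]]]])
  then show ?thesis by (simp add: o_def)
qed

lemma transition_derivative_bij:
  assumes c: "is_chart Z c" and d: "is_chart Z d" and p: "p \<in> fst c" "p \<in> fst d"
    and D: "((\<lambda>x. snd d (cinv c x)) has_derivative D) (at (snd c p))"
    and E: "((\<lambda>x. snd c (cinv d x)) has_derivative E) (at (snd d p))"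
  shows "E (D v) = v" "D (E v) = v"
proof -
  have *: "E (D v) = v" if c: "is_chart Z c" and d: "is_chart Z d" and p: "p \<in> fst c" "p \<in> fst d"
    and D: "((\<lambda>x. snd d (cinv c x)) has_derivative D) (at (snd c p))"
    and E: "((\<lambda>x. snd c (cinv d x)) has_derivative E) (at (snd d p))" for c d :: "('q, 'r::euclidean_space) chart" and D E p v Z
  proof -
    have E': "((\<lambda>x. snd c (cinv d x)) has_derivative E) (at (snd d (cinv c (snd c p))))"
      using E chart_cinv(1)[OF c p(1)] by simp
    have "((\<lambda>x. snd c (cinv d (snd d (cinv c x)))) has_derivative (\<lambda>v. E (D v))) (at (snd c p))"
      using has_derivative_compose[OF D E'] .
    then have "((\<lambda>x. x) has_derivative (\<lambda>v. E (D v))) (at (snd c p))"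
      by (rule has_derivative_transform_within_open[OF _ chart_overlap_open(1)[OF c d]])
        (use p in \<open>auto simp: chart_cinv(1)[OF c] chart_cinv(1)[OF d]\<close>)
    from has_derivative_unique[OF this has_derivative_ident] show ?thesis by metis
  qed
  show "E (D v) = v" by (rule *[OF assms])
  show "D (E v) = v" by (rule *[OF d c p(2,1) E D])
qed

text \<open>All holomorphic charts are allowed on the target, not only those of \<open>A\<close>,
  because the proof works in coordinates adapted to single points.\<close>

definition smf :: "('y \<Rightarrow> 'x) \<Rightarrow> bool" where
  "smf f \<longleftrightarrow> continuous_map Y X f \<and>
     (\<forall>c\<in>B. \<forall>d. hc d \<longrightarrow> Cinf (local_rep c d f) (snd c ` {y \<in> fst c. f y \<in> fst d}))"

lemma smfD:
  assumes "smf f"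
  shows "continuous_map Y X f"
    and "c \<in> B \<Longrightarrow> hc d \<Longrightarrow> Cinf (local_rep c d f) (snd c ` {y \<in> fst c. f y \<in> fst d})"
  using assms unfolding smf_def by blast+

lemma open_rep_domain:
  assumes "continuous_map Y X f" "c \<in> B" "openin X W"
  shows "open (snd c ` {y \<in> fst c. f y \<in> W})"
proof -
  have "openin Y {y \<in> topspace Y. f y \<in> W}"
    by (rule openin_continuous_map_preimage[OF assms(1,3)])
  then have "openin Y (fst c \<inter> {y \<in> topspace Y. f y \<in> W})"
    using is_chartD(1)[OF B_chart[OF assms(2)]] by blast
  moreover have "fst c \<inter> {y \<in> topspace Y. f y \<in> W} = {y \<in> fst c. f y \<in> W}"
    using openin_subset[OF is_chartD(1)[OF B_chart[OF assms(2)]]] by auto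
  ultimately show ?thesis using chart_open_image[OF B_chart[OF assms(2)]] by auto
qed

lemma smooth_map_iff_smf: "smooth_map Y B X A f \<longleftrightarrow> smf f"
proof
  assume L: "smooth_map Y B X A f"
  then have cf: "continuous_map Y X f" by (simp add: smooth_map_def)
  have "Cinf (local_rep c d f) (snd c ` {y \<in> fst c. f y \<in> fst d})" if c: "c \<in> B" and d: "hc d" for c d
  proof (rule Cinf_local)
    note ic = B_chart[OF c] and id = hc_chart[OF d]
    fix x assume "x \<in> snd c ` {y \<in> fst c. f y \<in> fst d}"
    then obtain y where y: "y \<in> fst c" "f y \<in> fst d" "x = snd c y" by blast
    have "f y \<in> topspace X" using y(2) openin_subset[OF is_chartD(1)[OF id]] by blast
    then obtain a where a: "a \<in> A" "f y \<in> fst a" using A_cover by blast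
    note ia = A_chart[OF a(1)]
    let ?W = "snd c ` {y \<in> fst c. f y \<in> fst d \<inter> fst a}"
    have W: "open ?W"
      by (intro open_rep_domain[OF cf c] openin_Int is_chartD(1)[OF id] is_chartD(1)[OF ia])
    have Wa: "open (snd c ` {y \<in> fst c. f y \<in> fst a})"
      by (intro open_rep_domain[OF cf c] is_chartD(1)[OF ia])
    have "Cinf (local_rep c a f) (snd c ` {y \<in> fst c. f y \<in> fst a})"
      by (rule iffD1[OF smooth_on_iff_Cinf[OF Wa]]) (use L c a(1) in \<open>simp add: smooth_map_def\<close>)
    then have 1: "Cinf (local_rep c a f) ?W" by (rule Cinf_subset[OF _ W]) auto
    have "Cinf (\<lambda>x. snd d (cinv a (local_rep c a f x))) ?W"
      by (rule Cinf_compose[OF 1 hc_transition_Cinf[OF A_hc[OF a(1)] d]])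
        (auto simp: local_rep_def chart_cinv(1)[OF ic])
    then have "Cinf (local_rep c d f) ?W"
      by (rule Cinf_eqI) (auto simp: local_rep_def chart_cinv(1)[OF ic] chart_cinv(1)[OF ia])
    then show "\<exists>U. x \<in> U \<and> U \<subseteq> snd c ` {y \<in> fst c. f y \<in> fst d} \<and> Cinf (local_rep c d f) U"
      using y a by (intro exI[of _ ?W]) auto
  qed
  then show "smf f" using cf by (simp add: smf_def)
next
  assume R: "smf f"
  then have cf: "continuous_map Y X f" by (simp add: smf_def)
  have "smooth_on (snd c ` {y \<in> fst c. f y \<in> fst d}) (local_rep c d f)" if "c \<in> B" "d \<in> A" for c d
    by (rule iffD2[OF smooth_on_iff_Cinf[OF open_rep_domain[OF cf that(1) is_chartD(1)[OF A_chart[OF that(2)]]]]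
          smfD(2)[OF R that(1) A_hc[OF that(2)]]])
  then show "smooth_map Y B X A f" using cf by (simp add: smooth_map_def)
qed

abbreviation drep :: "('y, 'e) chart \<Rightarrow> ('x, 'n cmodel) chart \<Rightarrow> ('y \<Rightarrow> 'x) \<Rightarrow> 'y \<Rightarrow> 'e \<Rightarrow> 'n cmodel" where
  "drep c d f y \<equiv> frechet_derivative (local_rep c d f) (at (snd c y))"

lemma smf_has_derivative:
  assumes "smf f" "c \<in> B" "hc d" "y \<in> fst c" "f y \<in> fst d"
  shows "(local_rep c d f has_derivative drep c d f y) (at (snd c y))"
  by (rule Cinf_has_derivative[where S="snd c ` {y \<in> fst c. f y \<in> fst d}"])
    (rule smfD(2)[OF assms(1-3)], use assms(4,5) in blast)

text \<open>The source of chart independence: two coordinate expressions of the differential differ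
  by linear bijections, and the one on the target commutes with \<open>mult_i\<close>, so
  injectivity and complex tangency carry over.\<close>

lemma change_of_charts:
  assumes f: "smf f" and c: "c \<in> B" "c' \<in> B" and d: "hc d" "hc d'"
    and y: "y \<in> fst c" "y \<in> fst c'" "f y \<in> fst d" "f y \<in> fst d'"
  obtains P Q where "bij P" "bij Q" "linear P" "linear Q" "\<And>v. Q (mult_i v) = mult_i (Q v)"
    "\<And>v. drep c' d' f y v = Q (drep c d f y (P v))"
proof -
  note ic = B_chart[OF c(1)] and ic' = B_chart[OF c(2)] and id = hc_chart[OF d(1)] and id' = hc_chart[OF d(2)]
  have cf: "continuous_map Y X f" using f by (simp add: smf_def)
  obtain P where P: "((\<lambda>x. snd c (cinv c' x)) has_derivative P) (at (snd c' y))"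
    using Cinf_has_derivative[OF B_transition_Cinf[OF c(2,1)], of "snd c' y"] y by blast
  obtain P' where P': "((\<lambda>x. snd c' (cinv c x)) has_derivative P') (at (snd c y))"
    using Cinf_has_derivative[OF B_transition_Cinf[OF c], of "snd c y"] y by blast
  have fy: "snd d (f y) \<in> snd d ` (fst d \<inter> fst d')" "snd d' (f y) \<in> snd d' ` (fst d' \<inter> fst d)"
    using y by auto
  obtain Q where Q: "((\<lambda>x. snd d' (cinv d x)) has_derivative Q) (at (snd d (f y)))"
    "\<forall>v. Q (mult_i v) = mult_i (Q v)"
    using hc_transition[OF d] fy(1) unfolding holomorphic_map_on_def by blast
  obtain Q' where Q': "((\<lambda>x. snd d (cinv d' x)) has_derivative Q') (at (snd d' (f y)))"
    using hc_transition[OF d(2,1)] fy(2) unfolding holomorphic_map_on_def by blast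
  have bP: "bij P"
    by (rule o_bij[of P'])
      (use transition_derivative_bij[OF ic' ic y(2,1) P P'] in \<open>auto simp: fun_eq_iff\<close>)
  have bQ: "bij Q"
    by (rule o_bij[of Q'])
      (use transition_derivative_bij[OF id id' y(3,4) Q(1) Q'] in \<open>auto simp: fun_eq_iff\<close>)
  let ?W = "snd c' ` {y \<in> fst c'. y \<in> fst c \<and> f y \<in> fst d \<inter> fst d'}"
  have W: "open ?W"
  proof -
    have "?W = snd c' ` (fst c' \<inter> fst c) \<inter> snd c' ` {y \<in> fst c'. f y \<in> fst d \<inter> fst d'}"
      using is_chartD(3)[OF ic'] by (auto simp: inj_on_def)
    then show ?thesis
      using chart_overlap_open(1)[OF ic' ic] open_rep_domain[OF cf c(2) openin_Int[OF is_chartD(1)[OF id] is_chartD(1)[OF id']]]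
      by auto
  qed
  have L: "(local_rep c d f has_derivative drep c d f y) (at (snd c (cinv c' (snd c' y))))"
    using smf_has_derivative[OF f c(1) d(1) y(1,3)] chart_cinv(1)[OF ic' y(2)] by simp
  have Q1: "((\<lambda>x. snd d' (cinv d x)) has_derivative Q) (at (local_rep c d f (snd c (cinv c' (snd c' y)))))"
    using Q(1) chart_cinv(1)[OF ic' y(2)] chart_cinv(1)[OF ic y(1)] by (simp add: local_rep_def)
  have "((\<lambda>x. snd d' (cinv d (local_rep c d f (snd c (cinv c' x))))) has_derivative
      (\<lambda>v. Q (drep c d f y (P v)))) (at (snd c' y))"
    using has_derivative_compose[OF has_derivative_compose[OF P L] Q1] .
  then have "(local_rep c' d' f has_derivative (\<lambda>v. Q (drep c d f y (P v)))) (at (snd c' y))"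
    by (rule has_derivative_transform_within_open[OF _ W])
      (use y in \<open>auto simp: local_rep_def chart_cinv(1)[OF ic] chart_cinv(1)[OF ic'] chart_cinv(1)[OF id]\<close>)
  then have "drep c' d' f y = (\<lambda>v. Q (drep c d f y (P v)))"
    using frechet_derivative_at by metis
  then show ?thesis
    using that[OF bP bQ has_derivative_linear[OF P] has_derivative_linear[OF Q(1)]] Q(2) by metis
qed

lemma immersion_chart_indep:
  assumes f: "smf f" and c: "c \<in> B" "c' \<in> B" and d: "hc d" "hc d'"
    and y: "y \<in> fst c" "y \<in> fst c'" "f y \<in> fst d" "f y \<in> fst d'"
    and i: "inj (drep c d f y)"
  shows "inj (drep c' d' f y)"
proof -
  obtain P Q where "bij P" "bij Q" "\<And>v. drep c' d' f y v = Q (drep c d f y (P v))"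
    by (rule change_of_charts[OF f c d y]) blast
  moreover from this have "drep c' d' f y = Q \<circ> drep c d f y \<circ> P" by (intro ext) (simp only: o_apply)
  ultimately show ?thesis using i by (simp add: inj_compose bij_is_inj)
qed

text \<open>Complex tangency recorded at points of the source, so that the same point can be
  followed while the embedding is deformed.\<close>

definition cpt :: "('y \<Rightarrow> 'x) \<Rightarrow> 'y \<Rightarrow> bool" where
  "cpt f y \<longleftrightarrow> (\<exists>c\<in>B. \<exists>d\<in>A. y \<in> fst c \<and> f y \<in> fst d \<and>
     range (drep c d f y) = range (drep c d f y) \<inter> mult_i ` range (drep c d f y))"

lemma complex_tangent_chart_indep:
  assumes f: "smf f" and c: "c \<in> B" "c' \<in> B" and d: "hc d" "hc d'"
    and y: "y \<in> fst c" "y \<in> fst c'" "f y \<in> fst d" "f y \<in> fst d'"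
    and i: "range (drep c d f y) = range (drep c d f y) \<inter> mult_i ` range (drep c d f y)"
  shows "range (drep c' d' f y) = range (drep c' d' f y) \<inter> mult_i ` range (drep c' d' f y)"
proof -
  obtain P Q where PQ: "bij P" "\<And>v. Q (mult_i v) = mult_i (Q v)" "\<And>v. drep c' d' f y v = Q (drep c d f y (P v))"
    by (rule change_of_charts[OF f c d y]) blast
  show ?thesis unfolding complex_range_iff
  proof
    fix v
    obtain u where u: "drep c d f y (P v) = mult_i (drep c d f y u)" using i unfolding complex_range_iff by blast
    obtain u' where "u = P u'" using PQ(1) by (metis bij_is_surj surjD)
    then have "drep c' d' f y v = mult_i (drep c' d' f y u')" using u PQ(2,3) by simp
    then show "\<exists>u. drep c' d' f y v = mult_i (drep c' d' f y u)" by blast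
  qed
qed

lemma smf_topspace: "smf f \<Longrightarrow> y \<in> topspace Y \<Longrightarrow> f y \<in> topspace X"
  using continuous_map_image_subset_topspace[OF smfD(1)] by blast

lemma cpt_iff:
  assumes f: "smf f" and c: "c \<in> B" and d: "hc d" and y: "y \<in> fst c" "f y \<in> fst d"
  shows "cpt f y \<longleftrightarrow> range (drep c d f y) = range (drep c d f y) \<inter> mult_i ` range (drep c d f y)"
proof
  assume "cpt f y"
  then show "range (drep c d f y) = range (drep c d f y) \<inter> mult_i ` range (drep c d f y)"
    unfolding cpt_def using complex_tangent_chart_indep[OF f _ c A_hc d _ y(1) _ y(2)] by blast
next
  assume R: "range (drep c d f y) = range (drep c d f y) \<inter> mult_i ` range (drep c d f y)"
  obtain a where a: "a \<in> A" "f y \<in> fst a"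
    using A_cover y(2) openin_subset[OF is_chartD(1)[OF hc_chart[OF d]]] by blast
  then show "cpt f y"
    unfolding cpt_def using c y complex_tangent_chart_indep[OF f c c d A_hc[OF a(1)] y(1,1,2) a(2) R] by blast
qed

text \<open>One pair of charts per point suffices by chart independence, and an injective continuous
  map from the compact \<open>Y\<close> to the Hausdorff \<open>X\<close> is a topological
  embedding. So these three properties are all that a deformation has to preserve.\<close>

definition embd :: "('y \<Rightarrow> 'x) \<Rightarrow> bool" where
  "embd f \<longleftrightarrow> smf f \<and> inj_on f (topspace Y) \<and>
     (\<forall>y\<in>topspace Y. \<exists>c\<in>B. \<exists>d. hc d \<and> y \<in> fst c \<and> f y \<in> fst d \<and> inj (drep c d f y))"

lemma smooth_embedding_iff_embd: "smooth_embedding Y B X A f \<longleftrightarrow> embd f"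
proof
  assume L: "smooth_embedding Y B X A f"
  then have f: "smf f" by (simp add: smooth_embedding_def smooth_map_iff_smf)
  have "inj_on f (topspace Y)"
    using L by (simp add: smooth_embedding_def embedding_map_def homeomorphic_map_def)
  moreover have "\<exists>c\<in>B. \<exists>d. hc d \<and> y \<in> fst c \<and> f y \<in> fst d \<and> inj (drep c d f y)" if "y \<in> topspace Y" for y
  proof -
    obtain c where c: "c \<in> B" "y \<in> fst c" using B_cover \<open>y \<in> topspace Y\<close> by blast
    have "f y \<in> topspace X" by (rule smf_topspace[OF f that])
    then obtain d where d: "d \<in> A" "f y \<in> fst d" using A_cover by blast
    have "inj (drep c d f y)" using L c d unfolding smooth_embedding_def by blast
    then show ?thesis using c d A_hc by blast
  qed
  ultimately show "embd f" using f by (simp add: embd_def)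
next
  assume R: "embd f"
  then have f: "smf f" and i: "inj_on f (topspace Y)" by (auto simp: embd_def)
  have cf: "continuous_map Y X f" using f by (simp add: smf_def)
  have "embedding_map Y X f"
    by (rule continuous_imp_embedding_map[OF cf compact_Y Hausdorff_X i])
  moreover have "inj (drep c d f y)" if c: "c \<in> B" and d: "d \<in> A" and y: "y \<in> fst c" "f y \<in> fst d" for c d y
  proof -
    have "y \<in> topspace Y" using openin_subset[OF is_chartD(1)[OF B_chart[OF c]]] y by blast
    then obtain c' d' where "c' \<in> B" "hc d'" "y \<in> fst c'" "f y \<in> fst d'" "inj (drep c' d' f y)"
      using R unfolding embd_def by blast
    then show ?thesis
      using immersion_chart_indep[OF f _ c _ A_hc[OF d] _ y(1) _ y(2)] by blast
  qed
  ultimately show "smooth_embedding Y B X A f"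
    using f by (simp add: smooth_embedding_def smooth_map_iff_smf)
qed

lemma embd_immersion:
  assumes "embd f" "c \<in> B" "hc d" "y \<in> fst c" "f y \<in> fst d" shows "inj (drep c d f y)"
proof -
  have "y \<in> topspace Y" using openin_subset[OF is_chartD(1)[OF B_chart[OF assms(2)]]] assms(4) by blast
  then obtain c' d' where "c' \<in> B" "hc d'" "y \<in> fst c'" "f y \<in> fst d'" "inj (drep c' d' f y)"
    using assms(1) unfolding embd_def by blast
  moreover have "smf f" using assms(1) by (simp add: embd_def)
  ultimately show ?thesis
    using immersion_chart_indep[of f c' c d' d y] assms by blast
qed

lemma complex_point_iff: "embd f \<Longrightarrow> complex_point B A f p \<longleftrightarrow> (\<exists>y\<in>topspace Y. f y = p \<and> cpt f y)"
proof -
  have "y \<in> topspace Y" if "c \<in> B" "y \<in> fst c" for c y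
    using openin_subset[OF is_chartD(1)[OF B_chart[OF that(1)]]] that(2) by blast
  then show ?thesis unfolding complex_point_def cpt_def Let_def by blast
qed

lemma drep_local:
  assumes "openin Y W" "y \<in> W" "c \<in> B" "y \<in> fst c" "\<And>y. y \<in> W \<Longrightarrow> f y = g y"
    and f: "smf f" "f y \<in> fst d" "hc d"
  shows "drep c d f y = drep c d g y" "(local_rep c d g has_derivative drep c d g y) (at (snd c y))"
proof -
  note ic = B_chart[OF assms(3)]
  have o: "open (snd c ` (W \<inter> fst c))"
    using assms is_chartD(1)[OF ic] by (intro chart_open_image[OF ic]) auto
  have "(local_rep c d g has_derivative drep c d f y) (at (snd c y))"
    by (rule has_derivative_transform_within_open[OF smf_has_derivative[OF f(1) assms(3) f(3) assms(4) f(2)] o])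
      (use assms(2,4,5) in \<open>auto simp: local_rep_def chart_cinv(1)[OF ic]\<close>)
  then show "drep c d f y = drep c d g y" using frechet_derivative_at by blast
  with \<open>(local_rep c d g has_derivative drep c d f y) _\<close>
  show "(local_rep c d g has_derivative drep c d g y) (at (snd c y))" by simp
qed

lemma cpt_local:
  assumes W: "openin Y W" "y \<in> W" "\<And>y. y \<in> W \<Longrightarrow> f y = g y" and f: "smf f" "smf g"
  shows "cpt f y \<longleftrightarrow> cpt g y"
proof -
  have "y \<in> topspace Y" using W openin_subset by blast
  then obtain c d where c: "c \<in> B" "y \<in> fst c" and d: "d \<in> A" "f y \<in> fst d"
    using B_cover A_cover smf_topspace[OF f(1)] by meson
  have "g y \<in> fst d" using W(2,3) d(2) by simp
  then show ?thesis
    using cpt_iff[OF f(1) c(1) A_hc[OF d(1)] c(2) d(2)] cpt_iff[OF f(2) c(1) A_hc[OF d(1)] c(2)]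
      drep_local(1)[OF W(1,2) c W(3) f(1) d(2) A_hc[OF d(1)]] by simp
qed

end

section \<open>Families of embeddings\<close>

text \<open>A displacement by \<open>\<eta>\<close> in the \<open>w\<close>-direction over one
  coordinate ball. The two branches fit together when \<open>\<eta>\<close> vanishes near the
  boundary of the ball.\<close>

definition push ::
  "('y, 'e::euclidean_space) chart \<Rightarrow> ('x, 'n::finite cmodel) chart \<Rightarrow> 'e \<Rightarrow> real \<Rightarrow> ('y \<Rightarrow> 'x) \<Rightarrow>
   ('e \<Rightarrow> complex) \<Rightarrow> 'y \<Rightarrow> 'x" where
  "push c d x0 r f \<eta> y = (if y \<in> cinv c ` ball x0 r
     then cinv d (local_rep c d f (snd c y) + (0, \<eta> (snd c y))) else f y)"

context cr_setting
begin

text \<open>Joint smoothness over an open parameter set, so that no one-sided derivatives occur. The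
  parameter is time for isotopies and a vector of \<open>complex ^ 'n\<close> in the transversality
  argument.\<close>

definition fam :: "'p::euclidean_space set \<Rightarrow> ('p \<Rightarrow> 'y \<Rightarrow> 'x) \<Rightarrow> bool" where
  "fam P F \<longleftrightarrow> open P \<and> continuous_map (prod_topology (top_of_set P) Y) X (\<lambda>(a, y). F a y) \<and>
     (\<forall>c\<in>B. \<forall>d. hc d \<longrightarrow>
        Cinf (\<lambda>(a, x). local_rep c d (F a) x) {(a, snd c y) | a y. a \<in> P \<and> y \<in> fst c \<and> F a y \<in> fst d})"

lemma fam_domain_eq:
  assumes "c \<in> B"
  shows "{(a, snd c y) | a y. a \<in> P \<and> y \<in> fst c \<and> F a y \<in> W}
    = {(a, x). a \<in> P \<and> x \<in> snd c ` fst c \<and> F a (cinv c x) \<in> W}"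
  using chart_cinv[OF B_chart[OF assms]] by force

lemma fam_domain_open:
  assumes c: "c \<in> B" and P: "open P"
    and F: "continuous_map (prod_topology (top_of_set P) Y) X (\<lambda>(a, y). F a y)" and W: "openin X W"
  shows "open {(a, x). a \<in> P \<and> x \<in> snd c ` fst c \<and> F a (cinv c x) \<in> W}"
proof -
  note ic = B_chart[OF c]
  have "continuous_map (prod_topology (top_of_set P) (top_of_set (snd c ` fst c))) (prod_topology (top_of_set P) Y)
      (\<lambda>(a, x). (a, cinv c x))"
    unfolding case_prod_unfold
    by (intro continuous_map_pairedI continuous_map_fst
        continuous_map_compose[OF continuous_map_snd chart_cinv_continuous_map[OF ic], unfolded o_def])
  from continuous_map_compose[OF this F]
  have "continuous_map (top_of_set (P \<times> (snd c ` fst c))) X (\<lambda>(a, x). F a (cinv c x))"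
    by (simp add: o_def case_prod_unfold)
  from openin_continuous_map_preimage[OF this W]
  have "openin (top_of_set (P \<times> (snd c ` fst c))) {q \<in> P \<times> (snd c ` fst c). (\<lambda>(a, x). F a (cinv c x)) q \<in> W}"
    by simp
  moreover have "open (P \<times> (snd c ` fst c))" by (intro open_Times P is_chartD(2)[OF ic])
  ultimately have "open {q \<in> P \<times> (snd c ` fst c). (\<lambda>(a, x). F a (cinv c x)) q \<in> W}"
    using openin_open_eq by blast
  moreover have "{q \<in> P \<times> (snd c ` fst c). (\<lambda>(a, x). F a (cinv c x)) q \<in> W}
      = {(a, x). a \<in> P \<and> x \<in> snd c ` fst c \<and> F a (cinv c x) \<in> W}" by auto
  ultimately show ?thesis by simp
qed

lemma famD:
  assumes "fam P F"
  shows "open P" "continuous_map (prod_topology (top_of_set P) Y) X (\<lambda>(a, y). F a y)"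
    "c \<in> B \<Longrightarrow> hc d \<Longrightarrow>
      Cinf (\<lambda>(a, x). local_rep c d (F a) x) {(a, x). a \<in> P \<and> x \<in> snd c ` fst c \<and> F a (cinv c x) \<in> fst d}"
  using assms unfolding fam_def by (blast, blast, simp add: fam_domain_eq del: split_paired_All)

lemma famI:
  assumes P: "open P" and F: "continuous_map (prod_topology (top_of_set P) Y) X (\<lambda>(a, y). F a y)"
    and l: "\<And>c d a y. c \<in> B \<Longrightarrow> hc d \<Longrightarrow> a \<in> P \<Longrightarrow> y \<in> fst c \<Longrightarrow> F a y \<in> fst d \<Longrightarrow>
      \<exists>U. open U \<and> (a, snd c y) \<in> U \<and> Cinf (\<lambda>(a, x). local_rep c d (F a) x)
        (U \<inter> {(a, x). a \<in> P \<and> x \<in> snd c ` fst c \<and> F a (cinv c x) \<in> fst d})"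
  shows "fam P F"
  unfolding fam_def
proof (intro conjI ballI allI impI P F)
  fix c d assume c: "c \<in> B" and d: "hc d"
  show "Cinf (\<lambda>(a, x). local_rep c d (F a) x) {(a, snd c y) | a y. a \<in> P \<and> y \<in> fst c \<and> F a y \<in> fst d}"
    (is "Cinf ?f ?S")
  proof (rule Cinf_local)
    fix q assume "q \<in> ?S"
    then obtain a y where q: "q = (a, snd c y)" "a \<in> P" "y \<in> fst c" "F a y \<in> fst d" by blast
    from l[OF c d q(2-4)] obtain U where "(a, snd c y) \<in> U"
      "Cinf ?f (U \<inter> {(a, x). a \<in> P \<and> x \<in> snd c ` fst c \<and> F a (cinv c x) \<in> fst d})" by blast
    then show "\<exists>U. q \<in> U \<and> U \<subseteq> ?S \<and> Cinf ?f U"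
      unfolding fam_domain_eq[OF c] using q chart_cinv(1)[OF B_chart[OF c]]
      by (intro exI[of _ "U \<inter> {(a, x). a \<in> P \<and> x \<in> snd c ` fst c \<and> F a (cinv c x) \<in> fst d}"]) auto
  qed
qed

lemma fam_slice:
  assumes F: "fam P F" and a: "a \<in> P" shows "smf (F a)"
  unfolding smf_def
proof (intro conjI ballI allI impI)
  have "continuous_map Y (prod_topology (top_of_set P) Y) (\<lambda>y. (a, y))"
    using a by (intro continuous_map_pairedI continuous_map_id[unfolded id_def]) (auto simp: continuous_map_const)
  from continuous_map_compose[OF this famD(2)[OF F]]
  show "continuous_map Y X (F a)" by (simp add: o_def)
  then have cF: "continuous_map Y X (F a)" .
  fix c d assume c: "c \<in> B" and d: "hc d"
  let ?S = "{(a, x). a \<in> P \<and> x \<in> snd c ` fst c \<and> F a (cinv c x) \<in> fst d}"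
  have o: "open (snd c ` {y \<in> fst c. F a y \<in> fst d})"
    by (rule open_rep_domain[OF cF c is_chartD(1)[OF hc_chart[OF d]]])
  have "Cinf (\<lambda>x. (\<lambda>(a, x). local_rep c d (F a) x) (a, x)) (snd c ` {y \<in> fst c. F a y \<in> fst d})"
    by (rule Cinf_compose[OF Cinf_Pair[OF Cinf_const[OF o] Cinf_id[OF o]] famD(3)[OF F c d]])
      (use a chart_cinv[OF B_chart[OF c]] in auto)
  then show "Cinf (local_rep c d (F a)) (snd c ` {y \<in> fst c. F a y \<in> fst d})" by simp
qed

lemma fam_const:
  assumes f: "smf f" and P: "open P" shows "fam P (\<lambda>a. f)"
proof (rule famI[OF P])
  have "continuous_map (prod_topology (top_of_set P) Y) X (f \<circ> snd)"
    by (rule continuous_map_compose[OF continuous_map_snd smfD(1)[OF f]])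
  then show "continuous_map (prod_topology (top_of_set P) Y) X (\<lambda>(a, y). f y)"
    by (simp add: o_def case_prod_unfold)
  then have F: "continuous_map (prod_topology (top_of_set P) Y) X (\<lambda>(a, y). (\<lambda>a. f) a y)" .
  fix c d a y assume c: "c \<in> B" and d: "hc d" and "a \<in> P"
  let ?S = "{(a, x). a \<in> P \<and> x \<in> snd c ` fst c \<and> f (cinv c x) \<in> fst d}"
  have o: "open ?S" using fam_domain_open[OF c P F is_chartD(1)[OF hc_chart[OF d]]] .
  have "Cinf (\<lambda>q. local_rep c d f (snd q)) ?S"
    by (rule Cinf_compose[OF Cinf_snd[OF Cinf_id[OF o]] smfD(2)[OF f c d]])
      (use chart_cinv[OF B_chart[OF c]] in force)
  then have "Cinf (\<lambda>(a, x). local_rep c d f x) (UNIV \<inter> ?S)"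
    by (simp add: case_prod_unfold)
  then show "\<exists>U. open U \<and> (a, snd c y) \<in> U \<and> Cinf (\<lambda>(a, x). local_rep c d f x) (U \<inter> ?S)"
    by blast
qed

end

section \<open>Vertical pushes over one coordinate ball\<close>

locale patch = cr_setting Y B X A
  for Y :: "'y topology" and B :: "('y, 'e::euclidean_space) chart set"
    and X :: "'x topology" and A :: "('x, 'n::finite cmodel) chart set" +
  fixes f c d x0 r s
  assumes c: "c \<in> B" and d: "hc d" and s: "0 < s" "s < r" and ball: "cball x0 r \<subseteq> snd c ` fst c"
    and f: "smf f" and fd: "\<And>x. x \<in> cball x0 r \<Longrightarrow> f (cinv c x) \<in> fst d"
begin

lemmas ic = B_chart[OF c] and id = hc_chart[OF d]

abbreviation "u \<equiv> local_rep c d f"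
abbreviation "Bc \<equiv> cinv c ` ball x0 r"
abbreviation "Sc \<equiv> cinv c ` cball x0 s"

lemma ballc: "ball x0 r \<subseteq> snd c ` fst c" "cball x0 s \<subseteq> ball x0 r" "cball x0 s \<subseteq> snd c ` fst c"
proof -
  show 1: "ball x0 r \<subseteq> snd c ` fst c" using ball ball_subset_cball by blast
  show 2: "cball x0 s \<subseteq> ball x0 r" using s by (auto simp: subset_iff)
  show "cball x0 s \<subseteq> snd c ` fst c" using 1 2 by blast
qed

lemma in_Bc: "y \<in> Bc \<longleftrightarrow> y \<in> fst c \<and> snd c y \<in> ball x0 r"
  using ballc(1) chart_cinv[OF ic] by force

lemma in_Sc: "y \<in> Sc \<longleftrightarrow> y \<in> fst c \<and> snd c y \<in> cball x0 s"
  using ballc(3) chart_cinv[OF ic] by force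

lemma open_Bc: "openin Y Bc"
  by (rule chart_open_cinv_image[OF ic open_ball ballc(1)])

lemma open_compl_Sc: "openin Y (topspace Y - Sc)"
  using compactin_imp_closedin[OF Hausdorff_Y chart_compact_cinv_image[OF ic compact_cball ballc(3)]]
  by (simp add: closedin_def)

lemma u_eq: "x \<in> cball x0 r \<Longrightarrow> u x = snd d (f (cinv c x))"
  by (simp add: local_rep_def)

lemma u_Cinf: "Cinf u (ball x0 r)"
  by (rule Cinf_subset[OF smfD(2)[OF f c d] open_ball])
    (use fd ballc(1) chart_cinv[OF ic] in \<open>force simp: image_iff\<close>)

lemma u_cont: "continuous_on (cball x0 r) u"
  by (rule continuous_on_subset[OF CinfD(3)[OF smfD(2)[OF f c d]]])
    (use fd ball chart_cinv[OF ic] in \<open>force simp: image_iff\<close>)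

text \<open>On the collar between the radii \<open>s\<close> and \<open>r\<close> the pushed map
  equals \<open>f\<close>; this is what makes the gluing smooth.\<close>

definition adm :: "('e \<Rightarrow> complex) \<Rightarrow> bool" where
  "adm \<eta> \<longleftrightarrow> Cinf \<eta> (ball x0 r) \<and> (\<forall>x\<in>ball x0 r - cball x0 s. \<eta> x = 0) \<and>
     (\<forall>x\<in>ball x0 r. u x + (0, \<eta> x) \<in> snd d ` fst d)"

lemma push_in: "y \<in> Bc \<Longrightarrow> push c d x0 r f \<eta> y = cinv d (u (snd c y) + (0, \<eta> (snd c y)))"
  by (simp add: push_def)

lemma push_out:
  assumes "\<And>x. x \<in> ball x0 r - cball x0 s \<Longrightarrow> \<eta> x = 0" "y \<notin> Sc"
  shows "push c d x0 r f \<eta> y = f y"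
proof (cases "y \<in> Bc")
  case True
  then have y: "y \<in> fst c" "snd c y \<in> ball x0 r" "snd c y \<notin> cball x0 s"
    using in_Bc assms(2) in_Sc by auto
  have "f y \<in> fst d" using fd[of "snd c y"] y chart_cinv(1)[OF ic y(1)] by auto
  then show ?thesis
    using y assms(1) chart_cinv(1)[OF id] chart_cinv(1)[OF ic y(1)] ball_subset_cball
    by (simp add: push_in[OF True] local_rep_def flip: zero_prod_def)
next
  case False
  then show ?thesis unfolding push_def by simp
qed

lemma push_0: "push c d x0 r f (\<lambda>x. 0) y = f y"
proof (cases "y \<in> Bc")
  case True
  then have y: "y \<in> fst c" "snd c y \<in> ball x0 r"
    using in_Bc by auto
  have "f y \<in> fst d" using fd[of "snd c y"] y chart_cinv(1)[OF ic y(1)] by auto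
  then show ?thesis
    using y chart_cinv(1)[OF id] chart_cinv(1)[OF ic y(1)]
    by (simp add: push_in[OF True] local_rep_def flip: zero_prod_def)
qed (simp add: push_def)

text \<open>Two open sets cover the source: the ball of radius \<open>r\<close> and the complement
  of the closed ball of radius \<open>s\<close>. On each the map has a smooth formula, and on the
  overlap both formulas give \<open>f\<close> because \<open>h\<close> vanishes there.\<close>

lemma fam_push:
  fixes h :: "'p::euclidean_space \<Rightarrow> 'e \<Rightarrow> complex"
  assumes P: "open P" and h: "Cinf (\<lambda>(a, x). h a x) (P \<times> ball x0 r)"
    and supp: "\<And>a x. a \<in> P \<Longrightarrow> x \<in> ball x0 r - cball x0 s \<Longrightarrow> h a x = 0"
    and dom: "\<And>a x. a \<in> P \<Longrightarrow> x \<in> ball x0 r \<Longrightarrow> u x + (0, h a x) \<in> snd d ` fst d"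
  shows "fam P (\<lambda>a. push c d x0 r f (h a))"
proof (rule famI[OF P])
  let ?F = "\<lambda>a. push c d x0 r f (h a)"
  define g where "g = (\<lambda>q. u (snd q) + (0, h (fst q) (snd q)))"
  have gC: "Cinf g (P \<times> ball x0 r)"
  proof -
    have o: "open (P \<times> ball x0 r)" by (intro open_Times P open_ball)
    have "Cinf (\<lambda>q. u (snd q)) (P \<times> ball x0 r)"
      by (rule Cinf_compose[OF Cinf_snd[OF Cinf_id[OF o]] u_Cinf]) auto
    moreover have "Cinf (\<lambda>q. h (fst q) (snd q)) (P \<times> ball x0 r)"
      using h by (simp add: case_prod_unfold)
    ultimately show ?thesis unfolding g_def by (intro Cinf_add Cinf_Pair Cinf_const o)
  qed
  have gd: "g q \<in> snd d ` fst d" if "q \<in> P \<times> ball x0 r" for q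
    using dom that by (auto simp: g_def)
  show cont: "continuous_map (prod_topology (top_of_set P) Y) X (\<lambda>(a, y). ?F a y)"
  proof (rule pasting_lemma[where I="UNIV :: bool set"
        and T="\<lambda>b. if b then P \<times> Bc else P \<times> (topspace Y - Sc)"
        and f="\<lambda>b. if b then (\<lambda>(a, y). cinv d (g (a, snd c y))) else (\<lambda>(a, y). f y)"])
    show "openin (prod_topology (top_of_set P) Y) (if b then P \<times> Bc else P \<times> (topspace Y - Sc))" for b
      using open_Bc open_compl_Sc P by (auto simp: openin_prod_Times_iff)
    show "continuous_map (subtopology (prod_topology (top_of_set P) Y) (if b then P \<times> Bc else P \<times> (topspace Y - Sc))) X
        (if b then (\<lambda>(a, y). cinv d (g (a, snd c y))) else (\<lambda>(a, y). f y))" for b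
    proof (cases b)
      case True
      have c1: "continuous_map (subtopology Y Bc) (top_of_set (ball x0 r)) (snd c)"
      proof -
        have "continuous_map (subtopology Y Bc) euclidean (snd c)"
          by (rule continuous_map_from_subtopology_mono[OF chart_continuous_map[OF ic]]) (use in_Bc in auto)
        then show ?thesis using in_Bc by (auto simp: continuous_map_in_subtopology)
      qed
      have c2: "continuous_map (prod_topology (top_of_set P) (subtopology Y Bc))
          (top_of_set (P \<times> ball x0 r)) (\<lambda>(a, y). (a, snd c y))"
        using c1 continuous_map_id[of "top_of_set P"]
        by (auto simp: continuous_map_prod_top id_def simp flip: prod_topology_subtopology_eu)
      have c3: "continuous_map (top_of_set (P \<times> ball x0 r)) (top_of_set (snd d ` fst d)) g"
        using CinfD(3)[OF gC] gd by (auto simp: continuous_map_in_subtopology)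
      have "continuous_map (prod_topology (top_of_set P) (subtopology Y Bc)) X (cinv d \<circ> (g \<circ> (\<lambda>(a, y). (a, snd c y))))"
        by (rule continuous_map_compose[OF continuous_map_compose[OF c2 c3] chart_cinv_continuous_map[OF id]])
      moreover have "subtopology (prod_topology (top_of_set P) Y) (P \<times> Bc) = prod_topology (top_of_set P) (subtopology Y Bc)"
        by (simp add: subtopology_Times subtopology_subtopology)
      ultimately show ?thesis using True by (simp add: o_def case_prod_unfold)
    next
      case False
      have "continuous_map (prod_topology (top_of_set P) Y) X (f \<circ> snd)"
        by (rule continuous_map_compose[OF continuous_map_snd smfD(1)[OF f]])
      then show ?thesis using False
        by (simp add: o_def case_prod_unfold continuous_map_from_subtopology)
    qed
    show "(if i then (\<lambda>(a, y). cinv d (g (a, snd c y))) else (\<lambda>(a, y). f y)) q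
        = (if j then (\<lambda>(a, y). cinv d (g (a, snd c y))) else (\<lambda>(a, y). f y)) q"
      if "q \<in> topspace (prod_topology (top_of_set P) Y) \<inter> (if i then P \<times> Bc else P \<times> (topspace Y - Sc))
        \<inter> (if j then P \<times> Bc else P \<times> (topspace Y - Sc))" for i j q
    proof -
      have "cinv d (g (a, snd c y)) = f y" if "a \<in> P" "y \<in> Bc" "y \<notin> Sc" for a y
        using push_out[OF supp[OF that(1)] that(3)] push_in[OF that(2), of "h a"] by (simp add: g_def)
      then show ?thesis using that by (cases i; cases j; cases q) auto
    qed
    show "\<exists>j. j \<in> UNIV \<and> q \<in> (if j then P \<times> Bc else P \<times> (topspace Y - Sc)) \<and>
        (\<lambda>(a, y). ?F a y) q = (if j then (\<lambda>(a, y). cinv d (g (a, snd c y))) else (\<lambda>(a, y). f y)) q"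
      if q: "q \<in> topspace (prod_topology (top_of_set P) Y)" for q
    proof -
      obtain a y where ay: "q = (a, y)" "a \<in> P" "y \<in> topspace Y" using q by (cases q) auto
      show ?thesis
      proof (cases "y \<in> Bc")
        case True
        then show ?thesis using ay by (intro exI[of _ True]) (simp add: push_in g_def)
      next
        case False
        then have "y \<notin> Sc" using ballc(2) by blast
        then show ?thesis using ay push_out[OF supp[OF ay(2)]] by (intro exI[of _ False]) simp
      qed
    qed
  qed
  fix c' d' a y assume c': "c' \<in> B" and d': "hc d'" and a: "a \<in> P" and y: "y \<in> fst c'" "?F a y \<in> fst d'"
  note ic' = B_chart[OF c'] and id' = hc_chart[OF d']
  let ?S = "{(a, x). a \<in> P \<and> x \<in> snd c' ` fst c' \<and> ?F a (cinv c' x) \<in> fst d'}"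
  have oS: "open ?S" by (rule fam_domain_open[OF c' P cont is_chartD(1)[OF id']])
  show "\<exists>U. open U \<and> (a, snd c' y) \<in> U \<and> Cinf (\<lambda>(a, x). local_rep c' d' (?F a) x) (U \<inter> ?S)"
  proof (cases "y \<in> Bc")
    case True
    let ?U = "UNIV \<times> snd c' ` (fst c' \<inter> Bc) :: ('p \<times> 'e) set"
    have oU: "open ?U"
      using open_Bc is_chartD(1)[OF ic'] by (intro open_Times open_UNIV chart_open_image[OF ic']) auto
    have oUS: "open (?U \<inter> ?S)" using oU oS by blast
    have cx: "cinv c' (snd q) \<in> Bc" "cinv c' (snd q) \<in> fst c'" "fst q \<in> P"
      "snd q \<in> snd c' ` (fst c' \<inter> fst c)" if "q \<in> ?U \<inter> ?S" for q
    proof -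
      have "snd q \<in> snd c' ` (fst c' \<inter> Bc)" using that by (simp add: mem_Times_iff)
      then obtain y where "y \<in> fst c'" "y \<in> Bc" "snd q = snd c' y" by blast
      then show "cinv c' (snd q) \<in> Bc" "cinv c' (snd q) \<in> fst c'"
        "snd q \<in> snd c' ` (fst c' \<inter> fst c)" using chart_cinv(1)[OF ic'] in_Bc by auto
      show "fst q \<in> P" using that by (simp add: case_prod_unfold)
    qed
    have "Cinf (\<lambda>q. snd c (cinv c' (snd q))) (?U \<inter> ?S)"
      by (rule Cinf_compose[OF Cinf_snd[OF Cinf_id[OF oUS]] B_transition_Cinf[OF c' c]]) (use cx(4) in blast)
    then have 1: "Cinf (\<lambda>q. (fst q, snd c (cinv c' (snd q)))) (?U \<inter> ?S)"
      by (intro Cinf_Pair Cinf_fst Cinf_id oUS)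
    have 2: "Cinf (\<lambda>q. g (fst q, snd c (cinv c' (snd q)))) (?U \<inter> ?S)"
    proof (rule Cinf_compose[OF 1 gC], rule image_subsetI)
      show "(fst q, snd c (cinv c' (snd q))) \<in> P \<times> ball x0 r" if "q \<in> ?U \<inter> ?S" for q
        by (intro SigmaI cx(3)[OF that]) (use cx(1)[OF that] in_Bc in blast)
    qed
    have gF: "g (fst q, snd c (cinv c' (snd q))) = snd d (?F (fst q) (cinv c' (snd q)))"
      "?F (fst q) (cinv c' (snd q)) \<in> fst d" if "q \<in> ?U \<inter> ?S" for q
    proof -
      have "g (fst q, snd c (cinv c' (snd q))) \<in> snd d ` fst d"
        using cx[OF that] in_Bc by (intro gd) auto
      then show "g (fst q, snd c (cinv c' (snd q))) = snd d (?F (fst q) (cinv c' (snd q)))"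
        "?F (fst q) (cinv c' (snd q)) \<in> fst d"
        using chart_cinv(2,3)[OF id] by (simp_all add: push_in[OF cx(1)[OF that]] g_def)
    qed
    have "Cinf (\<lambda>q. snd d' (cinv d (g (fst q, snd c (cinv c' (snd q)))))) (?U \<inter> ?S)"
    proof (rule Cinf_compose[OF 2 hc_transition_Cinf[OF d d']], rule image_subsetI)
      fix q assume q: "q \<in> ?U \<inter> ?S"
      then have "?F (fst q) (cinv c' (snd q)) \<in> fst d'" by (simp add: case_prod_unfold)
      then show "g (fst q, snd c (cinv c' (snd q))) \<in> snd d ` (fst d \<inter> fst d')"
        unfolding gF(1)[OF q] using gF(2)[OF q] by blast
    qed
    then have "Cinf (\<lambda>(a, x). local_rep c' d' (?F a) x) (?U \<inter> ?S)"
      by (rule Cinf_eqI) (use gF chart_cinv(1)[OF id] in \<open>auto simp: local_rep_def\<close>)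
    then show ?thesis using oU True y by (intro exI[of _ ?U]) auto
  next
    case False
    then have ySc: "y \<notin> Sc" using ballc(2) by blast
    let ?U = "UNIV \<times> snd c' ` (fst c' \<inter> (topspace Y - Sc)) :: ('p \<times> 'e) set"
    have oU: "open ?U"
      using open_compl_Sc is_chartD(1)[OF ic'] by (intro open_Times open_UNIV chart_open_image[OF ic']) auto
    have oUS: "open (?U \<inter> ?S)" using oU oS by blast
    have F: "?F (fst q) (cinv c' (snd q)) = f (cinv c' (snd q))" "cinv c' (snd q) \<in> fst c'"
      if "q \<in> ?U \<inter> ?S" for q
    proof -
      have "snd q \<in> snd c' ` (fst c' \<inter> (topspace Y - Sc))" using that by (simp add: mem_Times_iff)
      then obtain y where "y \<in> fst c'" "y \<notin> Sc" "snd q = snd c' y" by blast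
      then have "cinv c' (snd q) \<notin> Sc" "cinv c' (snd q) \<in> fst c'" using chart_cinv(1)[OF ic'] by simp_all
      moreover have "fst q \<in> P" using that by (simp add: case_prod_unfold)
      ultimately show "?F (fst q) (cinv c' (snd q)) = f (cinv c' (snd q))" "cinv c' (snd q) \<in> fst c'"
        using push_out[OF supp] by auto
    qed
    have sub: "snd ` (?U \<inter> ?S) \<subseteq> snd c' ` {y \<in> fst c'. f y \<in> fst d'}"
    proof
      fix x assume "x \<in> snd ` (?U \<inter> ?S)"
      then obtain q where q: "q \<in> ?U \<inter> ?S" "x = snd q" by blast
      have "f (cinv c' x) \<in> fst d'" using F(1)[OF q(1)] q by auto
      moreover have "x = snd c' (cinv c' x)" using q chart_cinv(3)[OF ic'] by auto
      ultimately show "x \<in> snd c' ` {y \<in> fst c'. f y \<in> fst d'}" using F(2)[OF q(1)] q(2) by blast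
    qed
    have "Cinf (\<lambda>q. local_rep c' d' f (snd q)) (?U \<inter> ?S)"
      by (rule Cinf_compose[OF Cinf_snd[OF Cinf_id[OF oUS]] smfD(2)[OF f c' d'] sub])
    then have "Cinf (\<lambda>(a, x). local_rep c' d' (?F a) x) (?U \<inter> ?S)"
    proof (rule Cinf_eqI)
      show "local_rep c' d' f (snd q) = (\<lambda>(a, x). local_rep c' d' (?F a) x) q" if "q \<in> ?U \<inter> ?S" for q
        using F(1)[OF that] by (simp only: local_rep_def case_prod_unfold o_apply)
    qed
    moreover have "y \<in> topspace Y" using y openin_subset[OF is_chartD(1)[OF ic']] by blast
    ultimately show ?thesis using oU ySc y by (intro exI[of _ ?U]) auto
  qed
qed

lemma push_smf:
  assumes "adm \<eta>" shows "smf (push c d x0 r f \<eta>)"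
proof -
  have o: "open (UNIV \<times> ball x0 r :: (real \<times> 'e) set)" by (intro open_Times) auto
  have C: "Cinf \<eta> (ball x0 r)" using assms by (simp add: adm_def)
  have "Cinf (\<lambda>q. \<eta> (snd q)) (UNIV \<times> ball x0 r :: (real \<times> 'e) set)"
    by (rule Cinf_compose[OF Cinf_snd[OF Cinf_id[OF o]] C]) auto
  then have "fam (UNIV :: real set) (\<lambda>a. push c d x0 r f \<eta>)"
    by (intro fam_push) (use assms in \<open>auto simp: adm_def case_prod_unfold\<close>)
  then show ?thesis by (rule fam_slice) simp
qed

text \<open>The compact image of \<open>K\<close> under \<open>u\<close> has a positive distance
  from the complement of the open set.\<close>

lemma displacement:
  assumes K: "compact K" "K \<subseteq> cball x0 r" and W: "openin X W" and fK: "\<And>x. x \<in> K \<Longrightarrow> f (cinv c x) \<in> W"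
  shows "\<exists>\<delta>>0. \<forall>x\<in>K. \<forall>w. cmod w < \<delta> \<longrightarrow> u x + (0, w) \<in> snd d ` (W \<inter> fst d)"
proof -
  have "compact (u ` K)"
    by (rule compact_continuous_image[OF continuous_on_subset[OF u_cont K(2)] K(1)])
  moreover have "open (snd d ` (W \<inter> fst d))"
    using W is_chartD(1)[OF id] by (intro chart_open_image[OF id]) auto
  moreover have "u ` K \<subseteq> snd d ` (W \<inter> fst d)"
    using fK fd K(2) u_eq by auto
  ultimately obtain \<delta> where \<delta>: "\<delta> > 0" "(\<Union>p\<in>u ` K. ball p \<delta>) \<subseteq> snd d ` (W \<inter> fst d)"
    by (rule compact_subset_open_imp_ball_epsilon_subset)
  have "u x + (0, w) \<in> snd d ` (W \<inter> fst d)" if "x \<in> K" "cmod w < \<delta>" for x w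
  proof -
    have "u x + (0, w) \<in> ball (u x) \<delta>" using that by (simp add: dist_norm norm_Pair)
    then show ?thesis using \<delta>(2) that(1) by blast
  qed
  then show ?thesis using \<delta>(1) by blast
qed

lemma rep_push:
  assumes "adm \<eta>" "x \<in> ball x0 r" shows "local_rep c d (push c d x0 r f \<eta>) x = u x + (0, \<eta> x)"
    "push c d x0 r f \<eta> (cinv c x) \<in> fst d"
proof -
  have x: "cinv c x \<in> Bc" "snd c (cinv c x) = x" using assms(2) chart_cinv(3)[OF ic] ballc(1) by auto
  have "u x + (0, \<eta> x) \<in> snd d ` fst d" using assms by (simp add: adm_def)
  then show "local_rep c d (push c d x0 r f \<eta>) x = u x + (0, \<eta> x)" "push c d x0 r f \<eta> (cinv c x) \<in> fst d"
    using x chart_cinv(2,3)[OF id] by (simp_all add: local_rep_def push_in)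
qed

lemma u_deriv: "x \<in> ball x0 r \<Longrightarrow> (u has_derivative frechet_derivative u (at x)) (at x)"
  by (rule Cinf_has_derivative[OF u_Cinf])

lemma rep_push_deriv:
  assumes "adm \<eta>" "x \<in> ball x0 r"
  shows "frechet_derivative (local_rep c d (push c d x0 r f \<eta>)) (at x)
    = (\<lambda>v. frechet_derivative u (at x) v + (0, frechet_derivative \<eta> (at x) v))"
    "(local_rep c d (push c d x0 r f \<eta>) has_derivative
      (\<lambda>v. frechet_derivative u (at x) v + (0, frechet_derivative \<eta> (at x) v))) (at x)"
proof -
  have "(\<eta> has_derivative frechet_derivative \<eta> (at x)) (at x)"
    by (rule Cinf_has_derivative[OF _ assms(2)]) (use assms(1) in \<open>simp add: adm_def\<close>)
  then have "((\<lambda>x. u x + (0, \<eta> x)) has_derivative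
      (\<lambda>v. frechet_derivative u (at x) v + (0, frechet_derivative \<eta> (at x) v))) (at x)"
    by (intro has_derivative_add u_deriv assms has_derivative_Pair has_derivative_const)
  then show "(local_rep c d (push c d x0 r f \<eta>) has_derivative
      (\<lambda>v. frechet_derivative u (at x) v + (0, frechet_derivative \<eta> (at x) v))) (at x)"
    by (rule has_derivative_transform_within_open[OF _ open_ball assms(2)]) (simp add: rep_push[OF assms(1)])
  then show "frechet_derivative (local_rep c d (push c d x0 r f \<eta>)) (at x)
    = (\<lambda>v. frechet_derivative u (at x) v + (0, frechet_derivative \<eta> (at x) v))"
    by (rule frechet_derivative_at[symmetric])
qed

end

text \<open>Since the \<open>z\<close>-coordinate is injective and immersive over the ball and a
  push does not touch it, pushed maps stay injective and immersive over the ball.\<close>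

locale graph_patch = patch Y B X A f c d x0 r s
  for Y :: "'y topology" and B :: "('y, 'e::euclidean_space) chart set"
    and X :: "'x topology" and A :: "('x, 'n::finite cmodel) chart set" and f c d x0 r s +
  assumes emb: "embd f" and gr: "\<And>x. x \<in> ball x0 r \<Longrightarrow> graphical (frechet_derivative u (at x))"
    and inj_z: "inj_on (\<lambda>x. fst (u x)) (ball x0 r)"
begin

text \<open>Collisions are possible only between the displaced part and the image of the complement
  of the ball. That image is compact and misses the image of the inner closed ball, so small
  displacements avoid it.\<close>

lemma push_embd:
  "\<exists>\<delta>>0. \<forall>\<eta>. adm \<eta> \<and> (\<forall>x\<in>ball x0 r. cmod (\<eta> x) < \<delta>) \<longrightarrow> embd (push c d x0 r f \<eta>)"
proof -
  have injf: "inj_on f (topspace Y)" using emb by (simp add: embd_def)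
  have fst_c: "fst c \<subseteq> topspace Y" using openin_subset[OF is_chartD(1)[OF ic]] .
  let ?C = "topspace Y - Bc"
  have "compactin Y ?C"
    using open_Bc compact_Y by (simp add: closedin_compact_space closedin_diff)
  then have "compactin X (f ` ?C)" by (rule image_compactin[OF _ smfD(1)[OF f]])
  then have oW: "openin X (topspace X - f ` ?C)"
    using compactin_imp_closedin[OF Hausdorff_X] by (simp add: openin_diff)
  have K: "f (cinv c x) \<in> topspace X - f ` ?C" if "x \<in> cball x0 s" for x
  proof -
    have x: "cinv c x \<in> Bc" "cinv c x \<in> topspace Y"
      using that ballc chart_cinv(2)[OF ic] fst_c by blast+
    then have "f (cinv c x) \<notin> f ` ?C" using injf by (auto simp: inj_on_def)
    then show ?thesis using smf_topspace[OF f x(2)] by blast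
  qed
  have sub: "cball x0 s \<subseteq> cball x0 r" using ballc(2) ball_subset_cball by blast
  obtain \<delta> where \<delta>: "\<delta> > 0"
    "\<forall>x\<in>cball x0 s. \<forall>w. cmod w < \<delta> \<longrightarrow> u x + (0, w) \<in> snd d ` ((topspace X - f ` ?C) \<inter> fst d)"
    using displacement[OF compact_cball sub oW K] by blast
  have "embd (push c d x0 r f \<eta>)" if \<eta>: "adm \<eta>" "\<And>x. x \<in> ball x0 r \<Longrightarrow> cmod (\<eta> x) < \<delta>" for \<eta>
  proof -
    let ?g = "push c d x0 r f \<eta>"
    have supp: "\<And>x. x \<in> ball x0 r - cball x0 s \<Longrightarrow> \<eta> x = 0" using \<eta>(1) by (simp add: adm_def)
    have rep: "snd d (?g y) = u (snd c y) + (0, \<eta> (snd c y))" if "y \<in> Bc" for y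
      using rep_push(1)[OF \<eta>(1), of "snd c y"] that in_Bc chart_cinv(1)[OF ic] by (simp add: local_rep_def)
    have sep: "?g y \<noteq> f y'" if y: "y \<in> Sc" "y' \<in> ?C" for y y'
    proof -
      have yb: "y \<in> Bc" "snd c y \<in> cball x0 s" "snd c y \<in> ball x0 r" using y(1) in_Sc in_Bc ballc(2) by blast+
      have "u (snd c y) + (0, \<eta> (snd c y)) \<in> snd d ` ((topspace X - f ` ?C) \<inter> fst d)"
        using \<delta>(2) yb(2) \<eta>(2)[OF yb(3)] by blast
      then obtain q where q: "q \<in> topspace X - f ` ?C" "q \<in> fst d" "u (snd c y) + (0, \<eta> (snd c y)) = snd d q" by blast
      have "?g y = q" unfolding push_in[OF yb(1)] q(3) by (rule chart_cinv(1)[OF id q(2)])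
      then show ?thesis using q(1) y(2) by blast
    qed
    have inj: "inj_on ?g (topspace Y)"
    proof (rule inj_onI)
      fix y y' assume yy: "y \<in> topspace Y" "y' \<in> topspace Y" "?g y = ?g y'"
      have one: "y = y'" if "y \<in> Bc" "y' \<notin> Bc" "y \<in> topspace Y" "y' \<in> topspace Y" "?g y = ?g y'" for y y'
      proof -
        have y'S: "y' \<notin> Sc" using that(2) ballc(2) by blast
        have gy': "?g y' = f y'" by (rule push_out[OF supp y'S])
        show ?thesis
        proof (cases "y \<in> Sc")
          case True
          then show ?thesis using sep[OF True, of y'] that gy' by simp
        next
          case False
          have "?g y = f y" by (rule push_out[OF supp False])
          then show ?thesis using gy' that injf by (simp add: inj_on_def)
        qed
      qed
      consider "y \<in> Bc" "y' \<in> Bc" | "y \<in> Bc" "y' \<notin> Bc" | "y \<notin> Bc" "y' \<in> Bc" | "y \<notin> Bc" "y' \<notin> Bc" by blast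
      then show "y = y'"
      proof cases
        case 1
        have "fst (u (snd c y)) = fst (u (snd c y'))" using rep[OF 1(1)] rep[OF 1(2)] yy(3)
          by (metis add_0_right fst_add fst_conv)
        then have "snd c y = snd c y'" using inj_z 1 in_Bc by (auto simp: inj_on_def)
        then show ?thesis using 1 in_Bc chart_cinv(1)[OF ic] by metis
      next
        case 2
        then show ?thesis using one yy by blast
      next
        case 3
        then show ?thesis using one[of y' y] yy by metis
      next
        case 4
        then have "?g y = f y" "?g y' = f y'" unfolding push_def by auto
        then show ?thesis using yy injf by (simp add: inj_on_def)
      qed
    qed
    have gsm: "smf ?g" by (rule push_smf[OF \<eta>(1)])
    have "\<exists>c\<in>B. \<exists>d. hc d \<and> y \<in> fst c \<and> ?g y \<in> fst d \<and> inj (drep c d ?g y)" if y: "y \<in> topspace Y" for y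
    proof (cases "y \<in> Bc")
      case True
      then have yc: "y \<in> fst c" "snd c y \<in> ball x0 r" using in_Bc by auto
      have lin: "linear (drep c d ?g y)"
        unfolding rep_push_deriv(1)[OF \<eta>(1) yc(2)] by (rule has_derivative_linear[OF rep_push_deriv(2)[OF \<eta>(1) yc(2)]])
      have "inj (drep c d ?g y)" unfolding linear_injective_0[OF lin]
      proof (intro allI impI)
        fix v assume "drep c d ?g y v = 0"
        then have "fst (frechet_derivative u (at (snd c y)) v) = 0"
          unfolding rep_push_deriv(1)[OF \<eta>(1) yc(2)] by (metis add_0_right fst_add fst_conv fst_zero)
        moreover have "linear (\<lambda>v. fst (frechet_derivative u (at (snd c y)) v))" "inj (\<lambda>v. fst (frechet_derivative u (at (snd c y)) v))"
          using gr[OF yc(2)] linear_fst_comp bij_is_inj by (auto simp: graphical_def)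
        ultimately show "v = 0" using linear_injective_0 by blast
      qed
      moreover have "?g y \<in> fst d"
        using rep_push(2)[OF \<eta>(1) yc(2)] chart_cinv(1)[OF ic yc(1)] by simp
      ultimately show ?thesis using c d yc by blast
    next
      case False
      then have yS: "y \<in> topspace Y - Sc" using y ballc(2) by blast
      obtain c' d' where cd: "c' \<in> B" "hc d'" "y \<in> fst c'" "f y \<in> fst d'" "inj (drep c' d' f y)"
        using emb y unfolding embd_def by blast
      have out: "?g y' = f y'" if "y' \<in> topspace Y - Sc" for y'
        by (rule push_out[where \<eta>=\<eta>, OF supp]) (use that in auto)
      have "drep c' d' f y = drep c' d' ?g y"
        by (rule drep_local(1)[OF open_compl_Sc yS cd(1,3) _ f cd(4,2)]) (use out in simp)
      then show ?thesis using cd out[OF yS] by metis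
    qed
    then show ?thesis using inj gsm by (simp add: embd_def)
  qed
  then show ?thesis using \<delta>(1) by blast
qed

text \<open>Induction over the generation of the compact-open topology by its subbasic sets.\<close>

lemma push_nbhd:
  assumes N: "openin (C0_topology Y X) N" "f \<in> N"
  shows "\<exists>\<delta>>0. \<forall>\<eta>. adm \<eta> \<and> (\<forall>x\<in>ball x0 r. cmod (\<eta> x) < \<delta>) \<longrightarrow> push c d x0 r f \<eta> \<in> N"
proof -
  have "generate_topology_on {{f. continuous_map Y X f \<and> f ` K \<subseteq> U} | K U. compactin Y K \<and> openin X U} N"
    using N(1) unfolding C0_topology_def by (rule openin_topology_generated_by)
  then have "f \<in> N \<longrightarrow> (\<exists>\<delta>>0. \<forall>\<eta>. adm \<eta> \<and> (\<forall>x\<in>ball x0 r. cmod (\<eta> x) < \<delta>) \<longrightarrow> push c d x0 r f \<eta> \<in> N)"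
  proof (induction rule: generate_topology_on.induct)
    case Empty
    then show ?case by simp
  next
    case (Int a b)
    show ?case
    proof
      assume "f \<in> a \<inter> b"
      then obtain \<delta>1 \<delta>2 where "\<delta>1 > 0" "\<forall>\<eta>. adm \<eta> \<and> (\<forall>x\<in>ball x0 r. cmod (\<eta> x) < \<delta>1) \<longrightarrow> push c d x0 r f \<eta> \<in> a"
        "\<delta>2 > 0" "\<forall>\<eta>. adm \<eta> \<and> (\<forall>x\<in>ball x0 r. cmod (\<eta> x) < \<delta>2) \<longrightarrow> push c d x0 r f \<eta> \<in> b"
        using Int.IH by blast
      then show "\<exists>\<delta>>0. \<forall>\<eta>. adm \<eta> \<and> (\<forall>x\<in>ball x0 r. cmod (\<eta> x) < \<delta>) \<longrightarrow> push c d x0 r f \<eta> \<in> a \<inter> b"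
        by (intro exI[of _ "min \<delta>1 \<delta>2"]) auto
    qed
  next
    case (UN K)
    show ?case
    proof
      assume "f \<in> \<Union>K"
      then obtain k where k: "k \<in> K" "f \<in> k" by blast
      then obtain \<delta> where "\<delta> > 0" "\<forall>\<eta>. adm \<eta> \<and> (\<forall>x\<in>ball x0 r. cmod (\<eta> x) < \<delta>) \<longrightarrow> push c d x0 r f \<eta> \<in> k"
        using UN.IH by blast
      then show "\<exists>\<delta>>0. \<forall>\<eta>. adm \<eta> \<and> (\<forall>x\<in>ball x0 r. cmod (\<eta> x) < \<delta>) \<longrightarrow> push c d x0 r f \<eta> \<in> \<Union>K"
        using k(1) by (intro exI[of _ \<delta>]) blast
    qed
  next
    case (Basis M)
    then obtain K U where KU: "M = {f. continuous_map Y X f \<and> f ` K \<subseteq> U}" "compactin Y K" "openin X U" by blast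
    show ?case
    proof
      assume fM: "f \<in> M"
      \<comment> \<open>Only points of \<open>K\<close> over the inner ball move; they form a
        compact set that \<open>f\<close> maps into \<open>U\<close>.\<close>
      let ?K = "{x \<in> cball x0 s. cinv c x \<in> K}"
      have "continuous_map (top_of_set (cball x0 s)) Y (cinv c)"
        by (rule continuous_map_from_subtopology_mono[OF chart_cinv_continuous_map[OF ic] ballc(3)])
      then have "closedin (top_of_set (cball x0 s)) ?K"
        using closedin_continuous_map_preimage[OF _ compactin_imp_closedin[OF Hausdorff_Y KU(2)]] by fastforce
      then have cK: "compact ?K" using closedin_compact compact_cball by blast
      have sub: "?K \<subseteq> cball x0 r" using ballc(2) ball_subset_cball by blast
      have fK: "f (cinv c x) \<in> U" if "x \<in> ?K" for x using that fM KU(1) by blast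
      obtain \<delta> where \<delta>: "\<delta> > 0" "\<forall>x\<in>?K. \<forall>w. cmod w < \<delta> \<longrightarrow> u x + (0, w) \<in> snd d ` (U \<inter> fst d)"
        using displacement[OF cK sub KU(3) fK] by blast
      have "push c d x0 r f \<eta> \<in> M" if \<eta>: "adm \<eta>" "\<forall>x\<in>ball x0 r. cmod (\<eta> x) < \<delta>" for \<eta>
      proof -
        have "push c d x0 r f \<eta> y \<in> U" if "y \<in> K" for y
        proof (cases "y \<in> Sc")
          case True
          then have y: "y \<in> fst c" "snd c y \<in> cball x0 s" "snd c y \<in> ball x0 r" "y \<in> Bc" using in_Sc ballc(2) by blast+
          then have "snd c y \<in> ?K" using that chart_cinv(1)[OF ic y(1)] by simp
          then have "u (snd c y) + (0, \<eta> (snd c y)) \<in> snd d ` (U \<inter> fst d)"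
            using \<delta>(2) \<eta>(2) y(3) by blast
          then show ?thesis using chart_cinv(1)[OF id] by (auto simp: push_in[OF y(4)])
        next
          case False
          then have "push c d x0 r f \<eta> y = f y" by (intro push_out) (use \<eta>(1) in \<open>simp add: adm_def\<close>)
          then show ?thesis using that fM KU(1) by auto
        qed
        then show ?thesis using smfD(1)[OF push_smf[OF \<eta>(1)]] KU(1) by blast
      qed
      then show "\<exists>\<delta>>0. \<forall>\<eta>. adm \<eta> \<and> (\<forall>x\<in>ball x0 r. cmod (\<eta> x) < \<delta>) \<longrightarrow> push c d x0 r f \<eta> \<in> M"
        using \<delta>(1) by blast
    qed
  qed
  then show ?thesis using N(2) by blast
qed

lemma small_adm:
  "\<exists>\<delta>>0. \<forall>\<eta>. Cinf \<eta> (ball x0 r) \<and> (\<forall>x\<in>ball x0 r - cball x0 s. \<eta> x = 0) \<and>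
    (\<forall>x\<in>ball x0 r. cmod (\<eta> x) < \<delta>) \<longrightarrow> adm \<eta>"
proof -
  have sub: "cball x0 s \<subseteq> cball x0 r" using ballc(2) ball_subset_cball by blast
  have K: "f (cinv c x) \<in> fst d" if "x \<in> cball x0 s" for x
    using fd that sub by blast
  obtain \<delta> where \<delta>: "\<delta> > 0" "\<forall>x\<in>cball x0 s. \<forall>w. cmod w < \<delta> \<longrightarrow> u x + (0, w) \<in> snd d ` (fst d \<inter> fst d)"
    using displacement[OF compact_cball sub is_chartD(1)[OF id] K] by blast
  have "adm \<eta>" if \<eta>: "Cinf \<eta> (ball x0 r)" "\<And>x. x \<in> ball x0 r - cball x0 s \<Longrightarrow> \<eta> x = 0"
    "\<And>x. x \<in> ball x0 r \<Longrightarrow> cmod (\<eta> x) < \<delta>" for \<eta>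
  proof -
    have "u x + (0, \<eta> x) \<in> snd d ` fst d" if x: "x \<in> ball x0 r" for x
    proof (cases "x \<in> cball x0 s")
      case True
      then show ?thesis using \<delta>(2) \<eta>(3)[OF x] by auto
    next
      case False
      then show ?thesis using \<eta>(2)[of x] x u_eq[of x] fd[of x] by (auto simp flip: zero_prod_def)
    qed
    then show ?thesis using \<eta> by (simp add: adm_def)
  qed
  then show ?thesis using \<delta>(1) by blast
qed

end

section \<open>Isotopies inside a neighbourhood and their concatenation\<close>

context cr_setting
begin

text \<open>Time runs over the whole line and the family rests before 0 and after \<open>T\<close>.
  This makes concatenation smooth, and the closed time interval appears only at the very
  end.\<close>

definition reach :: "('y \<Rightarrow> 'x) set \<Rightarrow> ('y \<Rightarrow> 'x) \<Rightarrow> ('y \<Rightarrow> 'x) \<Rightarrow> bool" where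
  "reach N f g \<longleftrightarrow> (\<exists>F T. 0 < T \<and> fam (UNIV :: real set) F \<and> (\<forall>t. embd (F t) \<and> F t \<in> N) \<and>
     (\<forall>t\<le>0. \<forall>y\<in>topspace Y. F t y = f y) \<and> (\<forall>t\<ge>T. \<forall>y\<in>topspace Y. F t y = g y))"

lemma reach_refl: "embd f \<Longrightarrow> f \<in> N \<Longrightarrow> reach N f f"
  unfolding reach_def
  by (intro exI[of _ "\<lambda>t. f"] exI[of _ 1]) (auto intro: fam_const simp: embd_def)

lemma fam_reparam:
  assumes F: "fam (UNIV :: real set) F" shows "fam (UNIV :: real set) (\<lambda>t. F (a * t + b))"
proof (rule famI[OF open_UNIV])
  have "continuous_map (prod_topology (top_of_set UNIV) Y) (prod_topology (top_of_set UNIV) Y) (\<lambda>q. (a * fst q + b, snd q))"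
  proof (intro continuous_map_pairedI continuous_map_snd)
    have "continuous_map (top_of_set UNIV) (top_of_set UNIV) (\<lambda>t. a * t + b)"
      by (auto intro!: continuous_intros)
    from continuous_map_compose[OF continuous_map_fst this]
    show "continuous_map (prod_topology (top_of_set UNIV) Y) (top_of_set UNIV) (\<lambda>q. a * fst q + b)"
      by (simp add: o_def)
  qed
  from continuous_map_compose[OF this famD(2)[OF F]]
  show c1: "continuous_map (prod_topology (top_of_set UNIV) Y) X (\<lambda>(t, y). F (a * t + b) y)"
    by (simp add: o_def case_prod_unfold)
  fix c d t y assume c: "c \<in> B" and d: "hc d"
  let ?S = "{(t, x). t \<in> (UNIV :: real set) \<and> x \<in> snd c ` fst c \<and> F (a * t + b) (cinv c x) \<in> fst d}"
  have o: "open ?S" by (rule fam_domain_open[OF c open_UNIV c1 is_chartD(1)[OF hc_chart[OF d]]])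
  have "Cinf (\<lambda>q. (\<lambda>(t, x). local_rep c d (F t) x) (a * fst q + b, snd q)) ?S"
  proof (rule Cinf_compose[OF _ famD(3)[OF F c d]])
    show "Cinf (\<lambda>q. (a * fst q + b, snd q)) ?S"
      by (intro Cinf_Pair Cinf_add Cinf_mult Cinf_const Cinf_fst Cinf_snd Cinf_id o)
  qed auto
  then have "Cinf (\<lambda>(t, x). local_rep c d (F (a * t + b)) x) (UNIV \<inter> ?S)" by (simp add: case_prod_unfold)
  then show "\<exists>U. open U \<and> (t, snd c y) \<in> U \<and> Cinf (\<lambda>(t, x). local_rep c d (F (a * t + b)) x) (U \<inter> ?S)"
    by blast
qed

text \<open>Near the junction both families are constant in time, so the concatenation is smooth.\<close>

lemma reach_trans:
  assumes "reach N f g" "reach N g h" shows "reach N f h"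
proof -
  obtain F T where T: "0 < T" and F: "fam (UNIV :: real set) F" "\<forall>t. embd (F t) \<and> F t \<in> N"
    "\<forall>t\<le>0. \<forall>y\<in>topspace Y. F t y = f y" "\<forall>t\<ge>T. \<forall>y\<in>topspace Y. F t y = g y"
    using assms(1) unfolding reach_def by blast
  obtain G' T' where T': "0 < T'" and G': "fam (UNIV :: real set) G'" "\<forall>t. embd (G' t) \<and> G' t \<in> N"
    "\<forall>t\<le>0. \<forall>y\<in>topspace Y. G' t y = g y" "\<forall>t\<ge>T'. \<forall>y\<in>topspace Y. G' t y = h y"
    using assms(2) unfolding reach_def by blast
  \<comment> \<open>The second family is delayed so as to start at \<open>T + 2\<close>; between the
    times \<open>T\<close> and \<open>T + 2\<close> both families rest at \<open>g\<close>.\<close>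
  define G where "G = (\<lambda>t. G' (1 * t + - (T + 2)))"
  have G: "fam (UNIV :: real set) G" unfolding G_def by (rule fam_reparam[OF G'(1)])
  have Gg: "G t y = g y" if "t \<le> T + 2" "y \<in> topspace Y" for t y using G'(3) that by (simp add: G_def)
  define H where "H t = (if t \<le> T + 1 then F t else G t)" for t
  have HF: "H t y = F t y" if "t < T + 2" "y \<in> topspace Y" for t y
    using that F(4) Gg T by (auto simp: H_def)
  have HG: "H t y = G t y" if "t > T" "y \<in> topspace Y" for t y
    using that F(4) Gg by (auto simp: H_def)
  have "fam (UNIV :: real set) H"
  proof (rule famI[OF open_UNIV])
    show cH: "continuous_map (prod_topology (top_of_set UNIV) Y) X (\<lambda>(t, y). H t y)"
    proof (rule pasting_lemma[where I="UNIV :: bool set"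
        and T="\<lambda>b. if b then {..<T + 2} \<times> topspace Y else {T<..} \<times> topspace Y"
        and f="\<lambda>b. if b then (\<lambda>(t, y). F t y) else (\<lambda>(t, y). G t y)"])
      show "openin (prod_topology (top_of_set UNIV) Y) (if b then {..<T + 2} \<times> topspace Y else {T<..} \<times> topspace Y)" for b
        by (auto simp: openin_prod_Times_iff)
      show "continuous_map (subtopology (prod_topology (top_of_set UNIV) Y) (if b then {..<T + 2} \<times> topspace Y else {T<..} \<times> topspace Y)) X
         (if b then (\<lambda>(t, y). F t y) else (\<lambda>(t, y). G t y))" for b
        using famD(2)[OF F(1)] famD(2)[OF G] by (simp add: continuous_map_from_subtopology)
      show "(if i then (\<lambda>(t, y). F t y) else (\<lambda>(t, y). G t y)) q = (if j then (\<lambda>(t, y). F t y) else (\<lambda>(t, y). G t y)) q"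
        if "q \<in> topspace (prod_topology (top_of_set UNIV) Y) \<inter> (if i then {..<T + 2} \<times> topspace Y else {T<..} \<times> topspace Y)
          \<inter> (if j then {..<T + 2} \<times> topspace Y else {T<..} \<times> topspace Y)" for i j q
        using that HF HG by (cases i; cases j; cases q) (auto, (metis (full_types))+)
      show "\<exists>j. j \<in> UNIV \<and> q \<in> (if j then {..<T + 2} \<times> topspace Y else {T<..} \<times> topspace Y) \<and>
          (\<lambda>(t, y). H t y) q = (if j then (\<lambda>(t, y). F t y) else (\<lambda>(t, y). G t y)) q"
        if q: "q \<in> topspace (prod_topology (top_of_set UNIV) Y)" for q
      proof -
        obtain t y where ty: "q = (t, y)" "y \<in> topspace Y" using q by (cases q) auto
        show ?thesis
        proof (cases "t < T + 2")
          case True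
          then show ?thesis using ty HF by (intro exI[of _ True]) simp
        next
          case False
          then show ?thesis using ty HG by (intro exI[of _ False]) simp
        qed
      qed
    qed
    fix c d t y assume c: "c \<in> B" and d: "hc d" and y: "y \<in> fst c" "H t y \<in> fst d"
    note ic = B_chart[OF c]
    have inY: "cinv c x \<in> topspace Y" if "x \<in> snd c ` fst c" for x
      using chart_cinv(2)[OF ic that] openin_subset[OF is_chartD(1)[OF ic]] by blast
    let ?S = "\<lambda>H. {(t, x). t \<in> (UNIV :: real set) \<and> x \<in> snd c ` fst c \<and> H t (cinv c x) \<in> fst d}"
    have oH: "open (?S H)" by (rule fam_domain_open[OF c open_UNIV cH is_chartD(1)[OF hc_chart[OF d]]])
    have piece: "\<exists>U. open U \<and> (t, snd c y) \<in> U \<and> Cinf (\<lambda>(t, x). local_rep c d (H t) x) (U \<inter> ?S H)"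
      if K: "fam (UNIV :: real set) K" and I: "open I" "t \<in> I" and HK: "\<And>t y. t \<in> I \<Longrightarrow> y \<in> topspace Y \<Longrightarrow> H t y = K t y" for K I
    proof -
      have o: "open ((I \<times> UNIV) \<inter> ?S H)" using oH I(1) by (intro open_Int open_Times) auto
      have "(I \<times> UNIV) \<inter> ?S H \<subseteq> ?S K" using HK inY by auto
      then have "Cinf (\<lambda>(t, x). local_rep c d (K t) x) ((I \<times> UNIV) \<inter> ?S H)"
        by (rule Cinf_subset[OF famD(3)[OF K c d] o])
      then have "Cinf (\<lambda>(t, x). local_rep c d (H t) x) ((I \<times> UNIV) \<inter> ?S H)"
        by (rule Cinf_eqI) (use HK inY in \<open>auto simp: local_rep_def\<close>)
      then show ?thesis using I by (intro exI[of _ "I \<times> UNIV"]) (auto intro: open_Times)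
    qed
    show "\<exists>U. open U \<and> (t, snd c y) \<in> U \<and> Cinf (\<lambda>(t, x). local_rep c d (H t) x) (U \<inter> ?S H)"
    proof (cases "t < T + 2")
      case True
      then show ?thesis by (intro piece[OF F(1), of "{..<T + 2}"]) (use HF in auto)
    next
      case False
      then show ?thesis by (intro piece[OF G, of "{T<..}"]) (use HG in auto)
    qed
  qed
  moreover have "\<forall>t. embd (H t) \<and> H t \<in> N" using F(2) G'(2) by (simp add: H_def G_def)
  moreover have "\<forall>t\<le>0. \<forall>y\<in>topspace Y. H t y = f y" using F(3) T by (simp add: H_def)
  moreover have "\<forall>t\<ge>T + 2 + T'. \<forall>y\<in>topspace Y. H t y = h y" using G'(4) T T' by (simp add: H_def G_def)
  ultimately show ?thesis
    unfolding reach_def using T T' by (intro exI[of _ H] exI[of _ "T + 2 + T'"]) simp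
qed

end

context graph_patch
begin

text \<open>The displacement is switched on by the factor \<open>smooth_step t\<close>. Being
  between 0 and 1, this factor keeps it below the bounds that guarantee embeddedness, membership in
  \<open>N\<close> and staying in the chart.\<close>

lemma push_reach:
  assumes N: "openin (C0_topology Y X) N" "f \<in> N"
  shows "\<exists>\<delta>>0. \<forall>\<eta>. Cinf \<eta> (ball x0 r) \<and> (\<forall>x\<in>ball x0 r - cball x0 s. \<eta> x = 0) \<and>
    (\<forall>x\<in>ball x0 r. cmod (\<eta> x) < \<delta>) \<longrightarrow>
    adm \<eta> \<and> embd (push c d x0 r f \<eta>) \<and> push c d x0 r f \<eta> \<in> N \<and> reach N f (push c d x0 r f \<eta>)"
proof -
  obtain \<delta>1 where \<delta>1: "\<delta>1 > 0" "\<forall>\<eta>. adm \<eta> \<and> (\<forall>x\<in>ball x0 r. cmod (\<eta> x) < \<delta>1) \<longrightarrow> embd (push c d x0 r f \<eta>)"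
    using push_embd by blast
  obtain \<delta>2 where \<delta>2: "\<delta>2 > 0" "\<forall>\<eta>. adm \<eta> \<and> (\<forall>x\<in>ball x0 r. cmod (\<eta> x) < \<delta>2) \<longrightarrow> push c d x0 r f \<eta> \<in> N"
    using push_nbhd[OF N] by blast
  obtain \<delta>3 where \<delta>3: "\<delta>3 > 0" "\<forall>\<eta>. Cinf \<eta> (ball x0 r) \<and> (\<forall>x\<in>ball x0 r - cball x0 s. \<eta> x = 0) \<and>
    (\<forall>x\<in>ball x0 r. cmod (\<eta> x) < \<delta>3) \<longrightarrow> adm \<eta>"
    using small_adm by blast
  define \<delta> where "\<delta> = min \<delta>1 (min \<delta>2 \<delta>3)"
  have "adm \<eta> \<and> embd (push c d x0 r f \<eta>) \<and> push c d x0 r f \<eta> \<in> N \<and> reach N f (push c d x0 r f \<eta>)"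
    if \<eta>: "Cinf \<eta> (ball x0 r)" "\<And>x. x \<in> ball x0 r - cball x0 s \<Longrightarrow> \<eta> x = 0"
      "\<And>x. x \<in> ball x0 r \<Longrightarrow> cmod (\<eta> x) < \<delta>" for \<eta>
  proof -
    define h where "h t x = smooth_step t *\<^sub>R \<eta> x" for t x
    have hs: "h t x = 0" if "x \<in> ball x0 r - cball x0 s" for t x using \<eta>(2)[OF that] by (simp add: h_def)
    have hb: "cmod (h t x) < \<delta>" if "x \<in> ball x0 r" for t x
    proof -
      have "cmod (h t x) = smooth_step t * cmod (\<eta> x)" using smooth_step_bounds[of t] by (simp add: h_def)
      also have "\<dots> \<le> 1 * cmod (\<eta> x)" by (intro mult_right_mono smooth_step_bounds) simp
      finally show ?thesis using \<eta>(3)[OF that] by simp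
    qed
    have hC: "Cinf (\<lambda>(t, x). h t x) (UNIV \<times> ball x0 r)"
    proof -
      have o: "open (UNIV \<times> ball x0 r :: (real \<times> _) set)" by (intro open_Times) auto
      have "Cinf (\<lambda>q. smooth_step (fst q)) (UNIV \<times> ball x0 r :: (real \<times> _) set)"
        by (rule Cinf_compose[OF Cinf_fst[OF Cinf_id[OF o]] Cinf_smooth_step]) auto
      moreover have "Cinf (\<lambda>q. \<eta> (snd q)) (UNIV \<times> ball x0 r :: (real \<times> _) set)"
        by (rule Cinf_compose[OF Cinf_snd[OF Cinf_id[OF o]] \<eta>(1)]) auto
      ultimately show ?thesis by (simp add: h_def case_prod_unfold Cinf_scaleR)
    qed
    have hCt: "Cinf (h t) (ball x0 r)" for t
      unfolding h_def by (intro Cinf_scaleR Cinf_const open_ball \<eta>(1))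
    have ha: "adm (h t)" for t
      using \<delta>3(2) hCt hs hb by (simp add: \<delta>_def)
    let ?F = "\<lambda>t. push c d x0 r f (h t)"
    have he: "embd (?F t)" "?F t \<in> N" for t
      using \<delta>1(2) \<delta>2(2) ha[of t] hb[of _ t] by (simp_all add: \<delta>_def)
    have h1: "h t = \<eta>" if "t \<ge> 1" for t using that smooth_step_1 by (auto simp: h_def)
    have "fam UNIV ?F" by (rule fam_push[OF open_UNIV hC hs]) (use ha in \<open>auto simp: adm_def\<close>)
    moreover have "?F t y = f y" if "t \<le> 0" for t y
    proof -
      have "h t = (\<lambda>x. 0)" using smooth_step_0[OF that] by (simp add: h_def fun_eq_iff)
      then show ?thesis using push_0[of y] by simp
    qed
    moreover have "?F t = push c d x0 r f \<eta>" if "t \<ge> 1" for t using h1[OF that] by simp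
    ultimately have "reach N f (push c d x0 r f \<eta>)"
      unfolding reach_def using he by (intro exI[of _ ?F] exI[of _ 1]) auto
    then show ?thesis using ha[of 1] he[of 1] h1[of 1] by simp
  qed
  moreover have "\<delta> > 0" using \<delta>1 \<delta>2 \<delta>3 by (simp add: \<delta>_def)
  ultimately show ?thesis by blast
qed

end

section \<open>Transversality\<close>

text \<open>\<open>baby_Sard\<close> transported along linear isomorphisms; \<open>'n bit0\<close>
  is an index type with twice as many elements as \<open>'n\<close>.\<close>

lemma Sard_euclidean:
  fixes G :: "'e::euclidean_space \<Rightarrow> complex ^ 'n::finite"
  assumes dim: "DIM('e) = 2 * CARD('n)"
    and G: "\<And>x. x \<in> S \<Longrightarrow> (G has_derivative G' x) (at x)" and sing: "\<And>x. x \<in> S \<Longrightarrow> \<not> inj (G' x)"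
  shows "negligible (G ` S)"
proof -
  have d1: "DIM(real ^ 'n bit0) = DIM('e)" and d2: "DIM(complex ^ 'n) = DIM(real ^ 'n bit0)"
    using dim by simp_all
  obtain p :: "real ^ 'n bit0 \<Rightarrow> 'e" and p' where p: "linear p" "linear p'" "\<And>x. p' (p x) = x" "\<And>y. p (p' y) = y"
    using isomorphisms_UNIV_UNIV[OF d1] by metis
  obtain q :: "complex ^ 'n \<Rightarrow> real ^ 'n bit0" and q' where q: "linear q" "linear q'" "\<And>x. q' (q x) = x" "\<And>y. q (q' y) = y"
    using isomorphisms_UNIV_UNIV[OF d2] by metis
  define h where "h x = q (G (p x))" for x
  define h' where "h' x v = q (G' (p x) (p v))" for x v
  have h: "(h has_derivative h' x) (at x within p' ` S)" if x: "x \<in> p' ` S" for x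
  proof -
    have "p x \<in> S" using x p by auto
    from has_derivative_compose[OF has_derivative_compose[OF linear_imp_has_derivative[OF p(1)] G[OF this]]
        linear_imp_has_derivative[OF q(1)]]
    show ?thesis unfolding h_def[abs_def] h'_def[abs_def] by (rule has_derivative_at_withinI)
  qed
  have rk: "rank (matrix (h' x)) < CARD('n bit0)" if x: "x \<in> p' ` S" for x
  proof -
    have pS: "p x \<in> S" using x p by auto
    have lin: "linear (h' x)" using h[OF x] has_derivative_linear by blast
    have "\<not> inj (h' x)"
    proof
      assume i: "inj (h' x)"
      have "inj (G' (p x))"
      proof (rule injI)
        fix a b assume "G' (p x) a = G' (p x) b"
        then have "h' x (p' a) = h' x (p' b)" by (simp add: h'_def p)
        then have "p' a = p' b" using i by (simp add: inj_def)
        then show "a = b" using p(4) by metis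
      qed
      then show False using sing[OF pS] by simp
    qed
    moreover have "(*v) (matrix (h' x)) = h' x" by (rule matrix_vector_mul(2)[OF lin])
    ultimately show ?thesis unfolding less_rank_noninjective by simp
  qed
  have "negligible (h ` (p' ` S))"
    by (rule baby_Sard[OF _ h rk]) auto
  then have "negligible (q' ` (h ` (p' ` S)))"
    by (intro negligible_differentiable_image_negligible[OF _ _ linear_imp_differentiable_on[OF q(2)]])
      (use d2 in auto)
  moreover have "q' ` (h ` (p' ` S)) = G ` S"
    by (simp add: image_image h_def p q)
  ultimately show ?thesis by simp
qed

text \<open>Injectivity fails iff the range of \<open>D\<close> meets the complex line through
  \<open>(v, 1)\<close> outside 0, that is, iff \<open>v\<close> is a slope \<open>\<phi> x\<close>.
  Slopes are invariant under real scaling, so all of them are taken on the null sets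
  \<open>H b\<close>. Differentiable images of null sets in equal dimension are null, hence some
  \<open>v\<close> is left over.\<close>

lemma exists_transverse_line:
  fixes D :: "'e::euclidean_space \<Rightarrow> 'n::finite cmodel"
  assumes dim: "DIM('e) = 2 * CARD('n)" and D: "linear D" "inj D"
  obtains v where "inj (\<lambda>x. fst (D x) - snd (D x) *s v)"
proof -
  define \<phi> where "\<phi> x = inverse (snd (D x)) *s fst (D x)" for x
  define H where "H b = {x. b \<bullet> x = 1 \<and> snd (D x) \<noteq> 0}" for b :: 'e
  have bl: "bounded_linear (\<lambda>x. fst (D x))" "bounded_linear (\<lambda>x. snd (D x))"
    using linear_fst_comp[OF D(1)] linear_snd_comp[OF D(1)] linear_conv_bounded_linear by blast+
  have bb: "bounded_bilinear (\<lambda>(c::complex) (v :: complex ^ 'n). c *s v)"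
  proof -
    have "bilinear (\<lambda>(c::complex) (v :: complex ^ 'n). c *s v)"
      unfolding bilinear_def by (auto intro!: linearI simp: vec_eq_iff algebra_simps)
    then show ?thesis by (simp add: bilinear_conv_bounded_bilinear)
  qed
  have "\<phi> differentiable_on H b" for b
    unfolding differentiable_on_def
  proof
    fix x assume "x \<in> H b"
    then have s0: "snd (D x) \<noteq> 0" by (simp add: H_def)
    from bounded_bilinear.FDERIV[OF bb Deriv.has_derivative_inverse[OF s0 bounded_linear_imp_has_derivative[OF bl(2)]]
        bounded_linear_imp_has_derivative[OF bl(1)], of "H b"]
    show "\<phi> differentiable (at x within H b)" unfolding \<phi>_def differentiable_def by blast
  qed
  moreover have "negligible (H b)" if "b \<in> Basis" for b
    by (rule negligible_subset[OF negligible_hyperplane[of b 1]]) (auto simp: H_def)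
  ultimately have "negligible (\<phi> ` H b)" if "b \<in> Basis" for b
    using that dim by (intro negligible_differentiable_image_negligible) auto
  then have "negligible (\<Union>b\<in>Basis. \<phi> ` H b)" by (intro negligible_Union) auto
  then obtain v where v: "v \<notin> (\<Union>b\<in>Basis. \<phi> ` H b)"
    using non_negligible_UNIV by (metis UNIV_eq_I)
  have lin: "linear (\<lambda>x. fst (D x) - snd (D x) *s v)"
    by (rule linearI) (simp_all add: linear_add[OF D(1)] linear_scale[OF D(1)] vec_eq_iff algebra_simps)
  have "inj (\<lambda>x. fst (D x) - snd (D x) *s v)"
    unfolding linear_injective_0[OF lin]
  proof (intro allI impI, rule ccontr)
    fix x assume x: "fst (D x) - snd (D x) *s v = 0" "x \<noteq> 0"
    have Dx: "D x \<noteq> 0" using D x(2) linear_injective_0 by blast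
    have s: "snd (D x) \<noteq> 0"
      using x(1) Dx by (auto simp: prod_eq_iff)
    obtain b where b: "b \<in> Basis" "b \<bullet> x \<noteq> 0" using x(2) by (metis euclidean_all_zero_iff inner_commute)
    \<comment> \<open>Real rescaling puts the kernel vector on the hyperplane of \<open>H b\<close>
      without changing its slope.\<close>
    define y where "y = inverse (b \<bullet> x) *\<^sub>R x"
    have Dy: "fst (D y) = inverse (b \<bullet> x) *\<^sub>R fst (D x)" "snd (D y) = inverse (b \<bullet> x) *\<^sub>R snd (D x)"
      by (simp_all add: y_def linear_scale[OF D(1)])
    have "y \<in> H b" using b s by (simp add: H_def Dy) (simp add: y_def)
    moreover have "\<phi> y = v"
    proof -
      have f: "fst (D x) = snd (D x) *s v" using x(1) by simp
      show ?thesis using b s by (simp add: \<phi>_def Dy f vec_eq_iff) (simp add: scaleR_conv_of_real)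
    qed
    ultimately show False using v b by blast
  qed
  then show ?thesis using that by blast
qed

lemma inj_linear_open:
  fixes L :: "'a::topological_space \<Rightarrow> 'e::euclidean_space \<Rightarrow> 'f::euclidean_space"
  assumes S: "open S" "q \<in> S" and L: "\<And>q. q \<in> S \<Longrightarrow> linear (L q)" and c: "\<And>v. continuous_on S (\<lambda>q. L q v)"
    and i: "inj (L q)"
  shows "\<exists>U. open U \<and> q \<in> U \<and> U \<subseteq> S \<and> (\<forall>q\<in>U. inj (L q))"
proof -
  obtain m where m: "m > 0" "\<And>v. m * norm v \<le> norm (L q v)"
    using linear_inj_bounded_below_pos[OF L[OF S(2)] i] by metis
  let ?U = "S \<inter> (\<lambda>q'. \<Sum>b\<in>Basis. norm (L q' b - L q b)) -` {..<m/2}"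
  have "open ?U" by (intro continuous_open_preimage continuous_intros c S open_lessThan)
  moreover have "inj (L q')" if "q' \<in> ?U" for q'
  proof (rule inj_linear_of_bound)
    show "(m - m/2) * norm v \<le> norm (L q' v)" for v
      by (rule linear_perturb_bound[OF L[OF S(2)] L m(2)]) (use that in auto)
  qed (use that m L in auto)
  ultimately show ?thesis using S m by (intro exI[of _ ?U]) auto
qed

type_synonym ('y, 'e, 'x, 'n) patch_data =
  "('y, 'e) chart \<times> ('x, 'n cmodel) chart \<times> 'e \<times> real \<times> ('e \<Rightarrow> complex ^ 'n) \<times> real"

section \<open>Patches on which the embedding is a graph, and their stability\<close>

context cr_setting
begin

abbreviation dbar :: "('y, 'e) chart \<Rightarrow> ('x, 'n cmodel) chart \<Rightarrow> ('y \<Rightarrow> 'x) \<Rightarrow> 'e \<Rightarrow> complex ^ 'n" where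
  "dbar c d f x \<equiv> dbar_part (frechet_derivative (local_rep c d f) (at x))"

text \<open>The last condition keeps the \<open>z\<close>-coordinate of \<open>f\<close> so close to the linear map \<open>Z\<close> that it is
  injective on the ball; unlike injectivity itself it is visibly stable under perturbation.\<close>

definition patch_ok :: "('y \<Rightarrow> 'x) \<Rightarrow> ('y, 'e, 'x, 'n) patch_data \<Rightarrow> bool" where
  "patch_ok f = (\<lambda>(c, d, x0, r, Z, m). c \<in> B \<and> hc d \<and> 0 < r \<and> cball x0 r \<subseteq> snd c ` fst c \<and>
     linear Z \<and> 0 < m \<and> (\<forall>v. 2 * m * norm v \<le> norm (Z v)) \<and>
     (\<forall>x\<in>cball x0 r. f (cinv c x) \<in> fst d \<and>
        (\<Sum>b\<in>Basis. norm (fst (frechet_derivative (local_rep c d f) (at x) b) - Z b)) < m))"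

text \<open>Only half the radius is inspected, which leaves room for the cutoff of the perturbation
  in \<open>transversality_step\<close>.\<close>

definition patch_good :: "('y \<Rightarrow> 'x) \<Rightarrow> ('y, 'e, 'x, 'n) patch_data \<Rightarrow> bool" where
  "patch_good f = (\<lambda>(c, d, x0, r, Z, m).
     \<forall>x\<in>cball x0 (r / 2). dbar c d f x = 0 \<longrightarrow> inj (frechet_derivative (dbar c d f) (at x)))"

lemma graphical_of_bound:
  assumes "linear D" "linear Z" "0 < m" "\<And>v. 2 * m * norm v \<le> norm (Z v)"
    and "(\<Sum>b\<in>Basis. norm (fst (D b) - Z b)) < m"
  shows "graphical (D :: 'e \<Rightarrow> 'n cmodel)" "m * norm v \<le> norm (fst (D v))"
proof -
  have b: "(2 * m - m) * norm v \<le> norm (fst (D v))" for v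
    by (rule linear_perturb_bound[OF assms(2) linear_fst_comp[OF assms(1)] assms(4)]) (use assms(5) in simp)
  then show "m * norm v \<le> norm (fst (D v))" by simp
  have "inj (\<lambda>v. fst (D v))"
    by (rule inj_linear_of_bound[OF linear_fst_comp[OF assms(1)] b]) (use assms(3) in simp)
  then have "bij (\<lambda>v. fst (D v))"
    by (rule linear_inj_imp_bij[OF linear_fst_comp[OF assms(1)]]) (use dim in simp)
  then show "graphical D" using assms(1) by (simp add: graphical_def)
qed

lemma rep_has_derivative:
  assumes "smf f" "c \<in> B" "hc d" "x \<in> snd c ` fst c" "f (cinv c x) \<in> fst d"
  shows "(local_rep c d f has_derivative frechet_derivative (local_rep c d f) (at x)) (at x)"
  using smf_has_derivative[OF assms(1-3), of "cinv c x"] assms(4,5) chart_cinv[OF B_chart[OF assms(2)]] by simp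

text \<open>On the convex ball the \<open>z\<close>-coordinate differs from \<open>Z\<close> by an
  \<open>m\<close>-Lipschitz map, and \<open>Z\<close> expands by at least \<open>2 * m\<close>;
  this leaves the lower bound \<open>m\<close> and gives injectivity.\<close>

lemma patch_okD:
  assumes f: "smf f" and ok: "patch_ok f (c, d, x0, r, Z, m)"
  shows "c \<in> B" "hc d" "0 < r" "cball x0 r \<subseteq> snd c ` fst c" "\<And>x. x \<in> cball x0 r \<Longrightarrow> f (cinv c x) \<in> fst d"
    and "\<And>x. x \<in> cball x0 r \<Longrightarrow> graphical (frechet_derivative (local_rep c d f) (at x))"
    and "\<And>x y. x \<in> cball x0 r \<Longrightarrow> y \<in> cball x0 r \<Longrightarrow>
      m * norm (x - y) \<le> norm (fst (local_rep c d f x) - fst (local_rep c d f y))"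
    and "inj_on (\<lambda>x. fst (local_rep c d f x)) (cball x0 r)" "0 < m"
proof -
  let ?u = "local_rep c d f"
  show B: "c \<in> B" "hc d" "0 < r" "cball x0 r \<subseteq> snd c ` fst c" "\<And>x. x \<in> cball x0 r \<Longrightarrow> f (cinv c x) \<in> fst d" "0 < m"
    using ok by (auto simp: patch_ok_def)
  have Z: "linear Z" "0 < m" "\<And>v. 2 * m * norm v \<le> norm (Z v)"
    and sl: "\<And>x. x \<in> cball x0 r \<Longrightarrow> (\<Sum>b\<in>Basis. norm (fst (frechet_derivative ?u (at x) b) - Z b)) < m"
    using ok by (auto simp: patch_ok_def)
  have du: "(?u has_derivative frechet_derivative ?u (at x)) (at x)" if "x \<in> cball x0 r" for x
    using rep_has_derivative[OF f B(1,2)] B(4,5) that by blast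
  show "graphical (frechet_derivative ?u (at x))" if "x \<in> cball x0 r" for x
    by (rule graphical_of_bound(1)[OF has_derivative_linear[OF du[OF that]] Z sl[OF that]])
  have lower: "m * norm (x - y) \<le> norm (fst (?u x) - fst (?u y))" if xy: "x \<in> cball x0 r" "y \<in> cball x0 r" for x y
  proof -
    define D where "D x v = fst (frechet_derivative ?u (at x) v) - Z v" for x v
    have "norm ((fst (?u x) - Z x) - (fst (?u y) - Z y)) \<le> m * norm (x - y)"
    proof (rule differentiable_bound[of "cball x0 r" _ D, OF convex_cball _ _ xy])
      show dD: "((\<lambda>x. fst (?u x) - Z x) has_derivative D x) (at x within cball x0 r)" if "x \<in> cball x0 r" for x
        unfolding D_def
        by (intro has_derivative_diff has_derivative_fst has_derivative_at_withinI[OF du[OF that]]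
            linear_imp_has_derivative Z(1))
      show "onorm (D x) \<le> m" if "x \<in> cball x0 r" for x
      proof (rule onorm_le)
        fix v
        have "norm (D x v) \<le> (\<Sum>b\<in>Basis. norm (D x b)) * norm v"
          by (rule norm_linear_le_sum_Basis[OF has_derivative_linear[OF dD[OF that]]])
        also have "\<dots> \<le> m * norm v"
          using sl[OF that] by (intro mult_right_mono) (auto simp: D_def)
        finally show "norm (D x v) \<le> m * norm v" .
      qed
    qed
    moreover have "2 * m * norm (x - y) \<le> norm (Z x - Z y)"
      using Z(3)[of "x - y"] linear_diff[OF Z(1)] by simp
    moreover have "norm (Z x - Z y) \<le> norm (fst (?u x) - fst (?u y)) + norm ((fst (?u x) - Z x) - (fst (?u y) - Z y))"
      using norm_triangle_ineq4[of "fst (?u x) - fst (?u y)" "(fst (?u x) - Z x) - (fst (?u y) - Z y)"]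
      by (simp add: algebra_simps)
    ultimately show ?thesis by simp
  qed
  then show "\<And>x y. x \<in> cball x0 r \<Longrightarrow> y \<in> cball x0 r \<Longrightarrow> m * norm (x - y) \<le> norm (fst (?u x) - fst (?u y))" .
  show "inj_on (\<lambda>x. fst (?u x)) (cball x0 r)"
  proof (rule inj_onI)
    fix x y assume "x \<in> cball x0 r" "y \<in> cball x0 r" "fst (?u x) = fst (?u y)"
    then have "m * norm (x - y) \<le> 0" using lower[of x y] by simp
    then show "x = y" using Z(2) by (simp add: mult_le_0_iff)
  qed
qed

lemma patch_ok_graph_patch:
  assumes f: "embd f" and ok: "patch_ok f (c, d, x0, r, Z, m)" and s: "0 < s" "s < r"
  shows "graph_patch Y B X A f c d x0 r s"
proof -
  have sf: "smf f" using f by (simp add: embd_def)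
  note p = patch_okD[OF sf ok]
  have b: "x \<in> cball x0 r" if "x \<in> ball x0 r" for x using that by simp
  have i: "inj_on (\<lambda>x. fst (local_rep c d f x)) (ball x0 r)"
    by (rule inj_on_subset[OF p(8) ball_subset_cball])
  show ?thesis
    by unfold_locales (fact p(1) p(2) s sf p(4) p(5) f i | rule p(6) b | assumption)+
qed

text \<open>\<open>Z\<close> is the derivative of the \<open>z\<close>-coordinate at the centre,
  \<open>m\<close> is half of its lower bound, and continuity of the derivative provides the
  radius.\<close>

lemma patch_exists:
  assumes f: "smf f" and c: "c \<in> B" and d: "hc d" and y: "y \<in> fst c" "f y \<in> fst d"
    and g: "graphical (drep c d f y)" and R: "0 < R"
  obtains r Z m where "r \<le> R" "patch_ok f (c, d, snd c y, r, Z, m)"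
proof -
  let ?u = "local_rep c d f" and ?x = "snd c y"
  define Z where "Z v = fst (drep c d f y v)" for v
  have Z: "linear Z" "inj Z" using g linear_fst_comp bij_is_inj by (auto simp: Z_def[abs_def] graphical_def)
  obtain m0 where m0: "m0 > 0" "\<And>v. m0 * norm v \<le> norm (Z v)"
    using linear_inj_bounded_below_pos[OF Z] by metis
  define m where "m = m0 / 2"
  let ?S = "snd c ` {y \<in> fst c. f y \<in> fst d}"
  have u: "Cinf ?u ?S" by (rule smfD(2)[OF f c d])
  have cont: "continuous_on ?S (\<lambda>x. frechet_derivative ?u (at x) v)" for v
    using CinfD(3)[OF Cinf_deriv[OF u]] .
  let ?U = "?S \<inter> (\<lambda>x. \<Sum>b\<in>Basis. norm (fst (frechet_derivative ?u (at x) b) - Z b)) -` {..<m}"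
  have "open ?U" by (intro continuous_open_preimage continuous_intros cont CinfD(1)[OF u] open_lessThan)
  moreover have "?x \<in> ?U" using y m0 by (auto simp: Z_def m_def)
  ultimately obtain e where e: "e > 0" "cball ?x e \<subseteq> ?U" using open_contains_cball by blast
  define r where "r = min e R"
  have r: "cball ?x r \<subseteq> ?U" "0 < r" "r \<le> R" using e R by (auto simp: r_def)
  have "patch_ok f (c, d, ?x, r, Z, m)"
    unfolding patch_ok_def
  proof (clarsimp simp: c d r Z, intro conjI ballI)
    show "0 < m" using m0 by (simp add: m_def)
    show "\<forall>v. 2 * m * norm v \<le> norm (Z v)" using m0 by (simp add: m_def)
    show "cball ?x r \<subseteq> snd c ` fst c" using r(1) by blast
    fix x assume "x \<in> cball ?x r"
    then have x: "x \<in> ?U" using r(1) by blast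
    then show "f (cinv c x) \<in> fst d" using chart_cinv(1)[OF B_chart[OF c]] by auto
    show "(\<Sum>b\<in>Basis. norm (fst (frechet_derivative ?u (at x) b) - Z b)) < m" using x by auto
  qed
  then show ?thesis using that r(3) by blast
qed

text \<open>Both properties are open conditions on pairs of a parameter and a point, and they hold
  over a compact set with parameter 0, hence on a tube around it. For goodness the condition is that
  the gradient is nonzero or has an injective derivative; each alternative is open.\<close>

lemma fam_dbar_stable:
  fixes F :: "'p::euclidean_space \<Rightarrow> 'y \<Rightarrow> 'x"
  assumes F: "fam P F" and P0: "0 \<in> P" and ok: "patch_ok (F 0) p"
  shows "\<exists>\<delta>>0. \<forall>a. norm a < \<delta> \<longrightarrow> a \<in> P \<and> patch_ok (F a) p \<and> (patch_good (F 0) p \<longrightarrow> patch_good (F a) p)"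
proof -
  obtain c d x0 r Z m where p: "p = (c, d, x0, r, Z, m)" by (cases p)
  have okp: "c \<in> B" "hc d" "0 < r" "cball x0 r \<subseteq> snd c ` fst c" "linear Z" "0 < m" "\<And>v. 2 * m * norm v \<le> norm (Z v)"
    "\<And>x. x \<in> cball x0 r \<Longrightarrow> F 0 (cinv c x) \<in> fst d"
    "\<And>x. x \<in> cball x0 r \<Longrightarrow> (\<Sum>b\<in>Basis. norm (fst (frechet_derivative (local_rep c d (F 0)) (at x) b) - Z b)) < m"
    using ok by (auto simp: patch_ok_def p)
  define U where "U = (\<lambda>(a, x). local_rep c d (F a) x)"
  define S where "S = {(a, x). a \<in> P \<and> x \<in> snd c ` fst c \<and> F a (cinv c x) \<in> fst d}"
  have U: "Cinf U S" using famD(3)[OF F okp(1,2)] by (simp add: U_def S_def)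
  note oS = CinfD(1)[OF U]
  define D where "D q v = frechet_derivative U (at q) (0, v)" for q v
  have Dc: "Cinf (\<lambda>q. D q v) S" for v unfolding D_def by (rule Cinf_deriv[OF U])
  have slice: "((\<lambda>x. g (a, x)) has_derivative (\<lambda>v. g' (0, v))) (at x)"
    if "(g has_derivative g') (at (a, x))" for g :: "'p \<times> 'e \<Rightarrow> 'z::real_normed_vector" and g' a x
  proof -
    have "((\<lambda>x. (a, x)) has_derivative (\<lambda>v. (0, v))) (at x)"
      by (intro has_derivative_Pair has_derivative_const has_derivative_ident)
    from has_derivative_compose[OF this that] show ?thesis .
  qed
  have DU: "frechet_derivative (local_rep c d (F a)) (at x) = D (a, x)" "linear (D (a, x))" if "(a, x) \<in> S" for a x
  proof -
    have "(local_rep c d (F a) has_derivative D (a, x)) (at x)"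
      using slice[OF Cinf_has_derivative[OF U that]] by (simp add: U_def D_def[abs_def])
    then show "frechet_derivative (local_rep c d (F a)) (at x) = D (a, x)" "linear (D (a, x))"
      using frechet_derivative_at has_derivative_linear by metis+
  qed
  let ?O1 = "S \<inter> (\<lambda>q. \<Sum>b\<in>Basis. norm (fst (D q b) - Z b)) -` {..<m}"
  have o1: "open ?O1" by (intro continuous_open_preimage continuous_intros CinfD(3)[OF Dc] oS open_lessThan)
  have gr: "graphical (D q)" if "q \<in> ?O1" for q
    by (rule graphical_of_bound(1)[OF _ okp(5-7)]) (use that DU(2)[of "fst q" "snd q"] in auto)
  define G where "G q = dbar_part (D q)" for q
  have G: "Cinf G ?O1"
    unfolding G_def by (rule Cinf_dz_part(2)[OF Cinf_subset[OF Dc o1] gr o1]) auto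
  define G' where "G' q v = frechet_derivative G (at q) (0, v)" for q v
  have G'c: "Cinf (\<lambda>q. G' q v) ?O1" for v unfolding G'_def by (rule Cinf_deriv[OF G])
  have sl1: "open {x. (a, x) \<in> ?O1}" for a
  proof -
    have "open ((\<lambda>x. (a, x)) -` ?O1)" by (rule open_vimage[OF o1]) (auto intro!: continuous_intros)
    then show ?thesis by (simp add: vimage_def)
  qed
  have dbG: "dbar c d (F a) x = G (a, x)" "(dbar c d (F a) has_derivative G' (a, x)) (at x)"
    "frechet_derivative (dbar c d (F a)) (at x) = G' (a, x)" "linear (G' (a, x))" if q: "(a, x) \<in> ?O1" for a x
  proof -
    have eq: "dbar c d (F a) y = G (a, y)" if "(a, y) \<in> ?O1" for y using DU(1)[of a y] that by (simp add: G_def)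
    then show "dbar c d (F a) x = G (a, x)" using q by blast
    have "((\<lambda>x. G (a, x)) has_derivative G' (a, x)) (at x)"
      using slice[OF Cinf_has_derivative[OF G q]] by (simp add: G'_def[abs_def])
    then show dd: "(dbar c d (F a) has_derivative G' (a, x)) (at x)"
      by (rule has_derivative_transform_within_open[OF _ sl1[of a]]) (use q eq in auto)
    show "frechet_derivative (dbar c d (F a)) (at x) = G' (a, x)" by (rule frechet_derivative_at[OF dd, symmetric])
    show "linear (G' (a, x))" by (rule has_derivative_linear[OF dd])
  qed
  let ?O2 = "{q \<in> ?O1. G q \<noteq> 0 \<or> inj (G' q)}"
  have o2: "open ?O2"
  proof -
    have "\<exists>T. open T \<and> q \<in> T \<and> T \<subseteq> ?O2" if q: "q \<in> ?O2" for q
    proof (cases "G q = 0")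
      case False
      have "open (?O1 \<inter> G -` (- {0}))" by (rule continuous_open_preimage[OF CinfD(3)[OF G] o1]) auto
      then show ?thesis using q False by (intro exI[of _ "?O1 \<inter> G -` (- {0})"]) auto
    next
      case True
      have "q \<in> ?O1" "inj (G' q)" using q True by auto
      moreover have "linear (G' q)" if "q \<in> ?O1" for q using dbG(4)[of "fst q" "snd q"] that by simp
      ultimately obtain T where "open T" "q \<in> T" "T \<subseteq> ?O1" "\<forall>q\<in>T. inj (G' q)"
        using inj_linear_open[OF o1, of q G'] CinfD(3)[OF G'c] by blast
      then show ?thesis by (intro exI[of _ T]) blast
    qed
    then show ?thesis using open_subopen by blast
  qed
  have sub1: "{0} \<times> cball x0 r \<subseteq> ?O1"
  proof
    fix q assume "q \<in> {0::'p} \<times> cball x0 r"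
    then obtain x where x: "q = (0, x)" "x \<in> cball x0 r" by blast
    have "(0, x) \<in> S" using x(2) P0 okp(4,8) by (auto simp: S_def)
    then show "q \<in> ?O1" using okp(9)[OF x(2)] x(1) DU(1) by simp
  qed
  have tube: "\<exists>\<delta>>0. \<forall>a. norm a < \<delta> \<longrightarrow> (\<forall>x\<in>cball x0 k. (a, x) \<in> W)"
    if "open W" "{0} \<times> cball x0 k \<subseteq> W" for W :: "('p \<times> 'e) set" and k
  proof -
    have "compact ({0::'p} \<times> cball x0 k)" by (intro compact_Times) auto
    from this that obtain \<delta> where \<delta>: "\<delta> > 0" "(\<Union>q\<in>{0::'p} \<times> cball x0 k. ball q \<delta>) \<subseteq> W"
      by (rule compact_subset_open_imp_ball_epsilon_subset)
    have "(a, x) \<in> W" if "norm a < \<delta>" "x \<in> cball x0 k" for a x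
    proof -
      have "(a, x) \<in> ball (0, x) \<delta>" using that(1) by (simp add: dist_Pair_Pair)
      then show ?thesis using \<delta>(2) that(2) by blast
    qed
    then show ?thesis using \<delta>(1) by blast
  qed
  obtain \<delta>1 where \<delta>1: "\<delta>1 > 0" "\<And>a x. norm a < \<delta>1 \<Longrightarrow> x \<in> cball x0 r \<Longrightarrow> (a, x) \<in> ?O1"
    using tube[OF o1 sub1] by blast
  have okF: "a \<in> P \<and> patch_ok (F a) p" if a: "norm a < \<delta>1" for a
  proof -
    have q: "(a, x) \<in> ?O1" if "x \<in> cball x0 r" for x by (rule \<delta>1(2)[OF a that])
    have "x0 \<in> cball x0 r" using okp(3) by simp
    then have "a \<in> P" using q[of x0] by (auto simp: S_def)
    moreover have "F a (cinv c x) \<in> fst d" if "x \<in> cball x0 r" for x using q[OF that] by (auto simp: S_def)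
    moreover have "(\<Sum>b\<in>Basis. norm (fst (frechet_derivative (local_rep c d (F a)) (at x) b) - Z b)) < m"
      if "x \<in> cball x0 r" for x using q[OF that] DU(1)[of a x] by auto
    ultimately show ?thesis using okp by (simp add: patch_ok_def p)
  qed
  show ?thesis
  proof (cases "patch_good (F 0) p")
    case False
    then show ?thesis using okF \<delta>1(1) by blast
  next
    case True
    have "{0} \<times> cball x0 (r/2) \<subseteq> ?O2"
    proof
      fix q assume "q \<in> {0::'p} \<times> cball x0 (r/2)"
      then obtain x where x: "q = (0, x)" "x \<in> cball x0 (r/2)" by blast
      have "cball x0 (r/2) \<subseteq> cball x0 r" using okp(3) by auto
      then have q1: "(0, x) \<in> ?O1" using sub1 x(2) by blast
      have "dbar c d (F 0) x = 0 \<longrightarrow> inj (frechet_derivative (dbar c d (F 0)) (at x))"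
        using True x(2) by (auto simp: patch_good_def p)
      then show "q \<in> ?O2" using dbG(1,3)[OF q1] q1 x(1) by auto
    qed
    from tube[OF o2 this] obtain \<delta>2 where \<delta>2: "\<delta>2 > 0" "\<And>a x. norm a < \<delta>2 \<Longrightarrow> x \<in> cball x0 (r/2) \<Longrightarrow> (a, x) \<in> ?O2"
      by blast
    have "patch_good (F a) p" if a: "norm a < \<delta>2" for a
    proof -
      have "dbar c d (F a) x = 0 \<longrightarrow> inj (frechet_derivative (dbar c d (F a)) (at x))" if "x \<in> cball x0 (r/2)" for x
        using \<delta>2(2)[OF a that] dbG(1,3)[of a x] by auto
      then show ?thesis by (simp add: patch_good_def p)
    qed
    then show ?thesis using okF \<delta>1(1) \<delta>2(1) by (intro exI[of _ "min \<delta>1 \<delta>2"]) auto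
  qed
qed

section \<open>Holomorphic coordinate changes, and a graph patch around every point\<close>

lemma hc_compose:
  assumes d: "hc d" and H: "holomorphic_map_on UNIV H" and K: "holomorphic_map_on UNIV K"
    and HK: "\<And>q. H (K q) = q" "\<And>q. K (H q) = q"
  shows "hc (fst d, \<lambda>q. H (snd d q))"
proof -
  note id = hc_chart[OF d]
  have cH: "continuous_on UNIV H" "continuous_on UNIV K"
    using H K has_derivative_continuous unfolding holomorphic_map_on_def
    by (metis UNIV_I continuous_at_imp_continuous_on)+
  have KH: "K (H (snd d q)) = snd d q" for q by (rule HK(2))
  have im: "(\<lambda>q. H (snd d q)) ` fst d = K -` (snd d ` fst d)"
  proof (intro set_eqI iffI)
    show "w \<in> K -` (snd d ` fst d)" if w: "w \<in> (\<lambda>q. H (snd d q)) ` fst d" for w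
    proof -
      obtain q where q: "q \<in> fst d" "w = H (snd d q)" using w by blast
      have "K w = snd d q" unfolding q(2) by (rule HK(2))
      then show ?thesis using q(1) by simp
    qed
    show "w \<in> (\<lambda>q. H (snd d q)) ` fst d" if w: "w \<in> K -` (snd d ` fst d)" for w
    proof -
      obtain q where q: "q \<in> fst d" "K w = snd d q" using w by blast
      have "w = H (snd d q)" using HK(1)[of w] q(2) by simp
      then show ?thesis using q(1) by blast
    qed
  qed
  have op: "open ((\<lambda>q. H (snd d q)) ` fst d)"
    unfolding im by (rule open_vimage[OF is_chartD(2)[OF id] cH(2)])
  have hom: "homeomorphic_map (top_of_set (snd d ` fst d)) (top_of_set ((\<lambda>q. H (snd d q)) ` fst d)) H"
    unfolding homeomorphic_map_maps
  proof (intro exI[of _ K], unfold homeomorphic_maps_def, intro conjI ballI)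
    show "continuous_map (top_of_set (snd d ` fst d)) (top_of_set ((\<lambda>q. H (snd d q)) ` fst d)) H"
      using continuous_on_subset[OF cH(1)] by (auto simp: continuous_map_in_subtopology)
    show "continuous_map (top_of_set ((\<lambda>q. H (snd d q)) ` fst d)) (top_of_set (snd d ` fst d)) K"
    proof -
      have "K ` ((\<lambda>q. H (snd d q)) ` fst d) \<subseteq> snd d ` fst d" unfolding im by blast
      then show ?thesis
        using continuous_on_subset[OF cH(2)] by (simp add: continuous_map_in_subtopology image_subset_iff_funcset)
    qed
  qed (use HK in auto)
  have "homeomorphic_map (subtopology X (fst d)) (top_of_set ((\<lambda>q. H (snd d q)) ` fst d)) (H \<circ> snd d)"
    by (rule homeomorphic_map_compose[OF is_chart_homeo[OF id] hom])
  then have ic: "is_chart X (fst d, \<lambda>q. H (snd d q))"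
    using op is_chartD(1)[OF id] by (simp add: is_chart_def o_def)
  have ci: "cinv (fst d, \<lambda>q. H (snd d q)) w = cinv d (K w)" if w: "w \<in> (\<lambda>q. H (snd d q)) ` fst d" for w
  proof -
    obtain q where q: "q \<in> fst d" "w = H (snd d q)" using w by blast
    have "K w = snd d q" unfolding q(2) by (rule HK(2))
    then show ?thesis using chart_cinv(1)[OF ic, of q] chart_cinv(1)[OF id q(1)] q by simp
  qed
  have "compatible holomorphic_map_on (fst d, \<lambda>q. H (snd d q)) a" if a: "a \<in> A" for a
    unfolding compatible_iff
  proof
    note ia = A_chart[OF a]
    have t: "holomorphic_map_on (snd d ` (fst d \<inter> fst a)) (\<lambda>x. snd a (cinv d x))"
      by (rule hc_transition[OF d A_hc[OF a]])
    have t': "holomorphic_map_on (snd a ` (fst a \<inter> fst d)) (\<lambda>x. snd d (cinv a x))"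
      by (rule hc_transition[OF A_hc[OF a] d])
    let ?S = "snd (fst d, \<lambda>q. H (snd d q)) ` (fst (fst d, \<lambda>q. H (snd d q)) \<inter> fst a)"
    have o: "open ?S" by (rule chart_overlap_open(1)[OF ic ia])
    have "holomorphic_map_on ?S (\<lambda>w. snd a (cinv d (K w)))"
      by (rule holomorphic_map_on_compose[OF holomorphic_map_on_subset[OF K] t]) (use KH in auto)
    then show "holomorphic_map_on ?S (snd a \<circ> cinv (fst d, \<lambda>q. H (snd d q)))"
    proof (rule holomorphic_map_on_eqI[OF _ o])
      fix w assume "w \<in> ?S"
      then have "w \<in> (\<lambda>q. H (snd d q)) ` fst d" by (simp only: fst_conv snd_conv) blast
      from ci[OF this] show "snd a (cinv d (K w)) = (snd a \<circ> cinv (fst d, \<lambda>q. H (snd d q))) w"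
        by (simp only: o_apply)
    qed
    have "holomorphic_map_on (snd a ` (fst a \<inter> fst d)) (\<lambda>x. H (snd d (cinv a x)))"
      by (rule holomorphic_map_on_compose[OF t' H]) auto
    then show "holomorphic_map_on (snd a ` (fst (fst d, \<lambda>q. H (snd d q)) \<inter> fst a)) (snd (fst d, \<lambda>q. H (snd d q)) \<circ> cinv a)"
      by (simp add: o_def Int_commute)
  qed
  then show ?thesis using ic by (simp add: holomorphic_chart_def)
qed

text \<open>Shears \<open>(z, w) \<mapsto> (z - z0 - w v, w - P z)\<close> with either \<open>v = 0\<close> or \<open>P = 0\<close> are the only
  coordinate changes that are needed.\<close>

lemma bounded_linear_smult_vec: "bounded_linear (\<lambda>c. c *s (v :: complex ^ 'n))"
  by (auto intro!: linear_conv_bounded_linear[THEN iffD1] linearI simp: vec_eq_iff algebra_simps)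

lemma hc_tilt:
  assumes "hc d" shows "hc (fst d, \<lambda>q. (fst (snd d q) - snd (snd d q) *s v, snd (snd d q)))"
proof -
  have h: "holomorphic_map_on UNIV (\<lambda>p :: 'n cmodel. (fst p + snd p *s v, snd p))" for v
    unfolding holomorphic_map_on_def
  proof
    fix p :: "'n cmodel"
    have "((\<lambda>p. (fst p + snd p *s v, snd p)) has_derivative (\<lambda>p. (fst p + snd p *s v, snd p))) (at p)"
      by (intro has_derivative_Pair has_derivative_add has_derivative_fst has_derivative_snd has_derivative_ident
          bounded_linear.has_derivative[OF bounded_linear_smult_vec])
    then show "\<exists>D. ((\<lambda>p. (fst p + snd p *s v, snd p)) has_derivative D) (at p) \<and> (\<forall>v. D (mult_i v) = mult_i (D v))"
      by (intro exI[of _ "\<lambda>p. (fst p + snd p *s v, snd p)"]) (auto simp: mult_i_def vec_eq_iff algebra_simps)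
  qed
  have "holomorphic_map_on UNIV (\<lambda>p :: 'n cmodel. (fst p - snd p *s v, snd p))"
    using h[of "- v"] by (simp add: vec_eq_iff algebra_simps)
  from hc_compose[OF assms this h[of v]] show ?thesis by (simp add: vec_eq_iff)
qed

text \<open>In an atlas chart the tangent space may project degenerately to the
  \<open>z\<close>-space; tilting the coordinates along a transverse complex line makes it a
  graph.\<close>

lemma transverse_patch:
  assumes f: "embd f" and y: "y \<in> topspace Y"
  obtains c d r Z m where "patch_ok f (c, d, snd c y, r, Z, m)" "y \<in> fst c"
proof -
  have sf: "smf f" using f by (simp add: embd_def)
  obtain c where c: "c \<in> B" "y \<in> fst c" using B_cover y by blast
  have "f y \<in> topspace X" by (rule smf_topspace[OF sf y])
  then obtain d where d: "d \<in> A" "f y \<in> fst d" using A_cover by blast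
  note hd = A_hc[OF d(1)]
  let ?D = "drep c d f y"
  have D: "(local_rep c d f has_derivative ?D) (at (snd c y))"
    by (rule smf_has_derivative[OF sf c(1) hd c(2) d(2)])
  obtain v where v: "inj (\<lambda>x. fst (?D x) - snd (?D x) *s v)"
    using exists_transverse_line[OF dim has_derivative_linear[OF D] embd_immersion[OF f c(1) hd c(2) d(2)]] by blast
  define d' where "d' = (fst d, \<lambda>q. (fst (snd d q) - snd (snd d q) *s v, snd (snd d q)))"
  have d': "hc d'" unfolding d'_def by (rule hc_tilt[OF hd])
  have "local_rep c d' f = (\<lambda>x. (fst (local_rep c d f x) - snd (local_rep c d f x) *s v, snd (local_rep c d f x)))"
    by (simp add: local_rep_def d'_def fun_eq_iff)
  then have D': "(local_rep c d' f has_derivative (\<lambda>x. (fst (?D x) - snd (?D x) *s v, snd (?D x)))) (at (snd c y))"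
    using has_derivative_Pair[OF has_derivative_diff[OF has_derivative_fst[OF D]
        bounded_linear.has_derivative[OF bounded_linear_smult_vec has_derivative_snd[OF D]]] has_derivative_snd[OF D]] by simp
  then have eq: "drep c d' f y = (\<lambda>x. (fst (?D x) - snd (?D x) *s v, snd (?D x)))"
    by (rule frechet_derivative_at[symmetric])
  have lin: "linear (drep c d' f y)" unfolding eq by (rule has_derivative_linear[OF D'])
  have "bij (\<lambda>x. fst (drep c d' f y x))"
    by (rule linear_inj_imp_bij[OF linear_fst_comp[OF lin]]) (use v dim in \<open>simp_all add: eq\<close>)
  then have g: "graphical (drep c d' f y)" using lin by (simp add: graphical_def)
  have "f y \<in> fst d'" using d(2) by (simp add: d'_def)
  from patch_exists[OF sf c(1) d' c(2) this g zero_less_one] show ?thesis using that c(2) by metis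
qed

text \<open>A vertical push adds to the graph operator the differential of \<open>\<eta>\<close>
  read through the \<open>z\<close>-coordinate, and taking the antilinear part is additive.\<close>

lemma dbar_push:
  assumes gp: "graph_patch Y B X A f c d x0 r s" and adm: "patch.adm f c d x0 r s \<eta>"
    and x: "x \<in> ball x0 r"
  shows "dbar c d (push c d x0 r f \<eta>) x = dbar c d f x +
    antilin_part (\<lambda>\<zeta>. frechet_derivative \<eta> (at x) (inv (\<lambda>v. fst (frechet_derivative (local_rep c d f) (at x) v)) \<zeta>))"
    "graphical (frechet_derivative (local_rep c d (push c d x0 r f \<eta>)) (at x))"
proof -
  interpret graph_patch Y B X A f c d x0 r s by (rule gp)
  have D: "frechet_derivative (local_rep c d (push c d x0 r f \<eta>)) (at x)
    = (\<lambda>v. frechet_derivative u (at x) v + (0, frechet_derivative \<eta> (at x) v))"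
    by (rule rep_push_deriv(1)[OF adm x])
  have lin: "linear (frechet_derivative (local_rep c d (push c d x0 r f \<eta>)) (at x))"
    unfolding D by (rule has_derivative_linear[OF rep_push_deriv(2)[OF adm x]])
  have g: "graphical (frechet_derivative u (at x))" by (rule gr[OF x])
  show "graphical (frechet_derivative (local_rep c d (push c d x0 r f \<eta>)) (at x))"
    using lin g by (simp add: graphical_def D)
  show "dbar c d (push c d x0 r f \<eta>) x = dbar c d f x +
    antilin_part (\<lambda>\<zeta>. frechet_derivative \<eta> (at x) (inv (\<lambda>v. fst (frechet_derivative u (at x) v)) \<zeta>))"
    unfolding D dbar_part_def graph_op_def by (simp add: antilin_part_def vec_eq_iff add_divide_distrib algebra_simps)
qed

text \<open>Adding \<open>cdot a (cnjv z)\<close> shifts the antiholomorphic gradient by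
  \<open>a\<close> where the cutoff is 1. Sard's theorem provides arbitrarily small regular values
  \<open>b\<close>; with \<open>a = - b\<close> the new zeros lie at old points with value
  \<open>b\<close>, where the derivative is injective. For small \<open>a\<close> the other patches
  keep what they had.\<close>

lemma transversality_step:
  assumes f: "embd f" and N: "openin (C0_topology Y X) N" "f \<in> N" and fin: "finite Q"
    and ok: "\<And>p. p \<in> Q \<Longrightarrow> patch_ok f p" and p0: "p0 \<in> Q"
  shows "\<exists>g. embd g \<and> g \<in> N \<and> reach N f g \<and> (\<forall>p\<in>Q. patch_ok g p) \<and>
    (\<forall>p\<in>Q. patch_good f p \<longrightarrow> patch_good g p) \<and> patch_good g p0"
proof -
  have sf: "smf f" using f by (simp add: embd_def)
  obtain c d x0 r Z m where p: "p0 = (c, d, x0, r, Z, m)" by (cases p0)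
  have okp: "patch_ok f (c, d, x0, r, Z, m)" using ok[OF p0] p by simp
  have r: "0 < r" using patch_okD(3)[OF sf okp] .
  \<comment> \<open>The cutoff is 1 on the ball of radius \<open>5/8 * r\<close> and 0 outside the
    closed ball of radius \<open>3/4 * r\<close>. So around each point of the closed half ball the
    gradient is shifted by a constant and its derivative does not change.\<close>
  define s where "s = 3/4 * r"
  have gp: "graph_patch Y B X A f c d x0 r s"
    by (rule patch_ok_graph_patch[OF f okp]) (use r in \<open>auto simp: s_def\<close>)
  interpret gp: graph_patch Y B X A f c d x0 r s by (rule gp)
  let ?u = "local_rep c d f"
  define bump where "bump x = smooth_step ((s\<^sup>2 - (x - x0) \<bullet> (x - x0)) / (s\<^sup>2 - (5/8 * r)\<^sup>2))" for x
  have den: "s\<^sup>2 - (5/8 * r)\<^sup>2 > 0" using r by (simp add: s_def power2_eq_square)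
  have chi0: "bump x = 0" if "x \<notin> cball x0 s" for x
  proof -
    have "s < norm (x - x0)" using that by (simp add: dist_norm norm_minus_commute)
    then have "s\<^sup>2 \<le> (norm (x - x0))\<^sup>2" using r by (intro power_mono) (auto simp: s_def)
    then show ?thesis unfolding bump_def using den
      by (intro smooth_step_0) (simp add: divide_le_0_iff power2_norm_eq_inner)
  qed
  have chi1: "bump x = 1" if "x \<in> ball x0 (5/8 * r)" for x
  proof -
    have "norm (x - x0) \<le> 5/8 * r" using that by (simp add: dist_norm norm_minus_commute)
    then have "(norm (x - x0))\<^sup>2 \<le> (5/8 * r)\<^sup>2" by (intro power_mono) auto
    then have "(x - x0) \<bullet> (x - x0) \<le> (5/8 * r)\<^sup>2" by (simp add: power2_norm_eq_inner)
    then show ?thesis unfolding bump_def using den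
      by (intro smooth_step_1) (simp add: le_divide_eq)
  qed
  have chiC: "Cinf bump UNIV"
    unfolding bump_def divide_inverse
    by (intro Cinf_compose[OF _ Cinf_smooth_step] Cinf_mult Cinf_diff Cinf_const Cinf_id open_UNIV
        Cinf_bilinear[OF bounded_bilinear_inner]) auto
  define h where "h a x = of_real (bump x) * cdot a (cnjv (fst (?u x)))" for a x
  have hC: "Cinf (\<lambda>(a, x). h a x) (UNIV \<times> ball x0 r)"
  proof -
    have o: "open (UNIV \<times> ball x0 r :: ((complex ^ 'n) \<times> 'e) set)" by (intro open_Times) auto
    have 1: "Cinf (\<lambda>q. bump (snd q)) (UNIV \<times> ball x0 r :: ((complex ^ 'n) \<times> 'e) set)"
      by (rule Cinf_compose[OF Cinf_snd[OF Cinf_id[OF o]] chiC]) auto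
    have 2: "Cinf (\<lambda>q. ?u (snd q)) (UNIV \<times> ball x0 r :: ((complex ^ 'n) \<times> 'e) set)"
      by (rule Cinf_compose[OF Cinf_snd[OF Cinf_id[OF o]] gp.u_Cinf]) auto
    show ?thesis unfolding h_def case_prod_unfold
      by (intro Cinf_mult Cinf_linear_compose[OF bounded_linear_of_real] 1
          Cinf_bilinear[OF bounded_bilinear_cdot] Cinf_fst[OF Cinf_id[OF o]]
          Cinf_linear_compose[OF bounded_linear_cnjv] Cinf_fst[OF 2])
  qed
  have hCa: "Cinf (h a) (ball x0 r)" for a
    unfolding h_def
    by (intro Cinf_mult Cinf_linear_compose[OF bounded_linear_of_real] Cinf_subset[OF chiC]
          Cinf_bilinear[OF bounded_bilinear_cdot] Cinf_const
          Cinf_linear_compose[OF bounded_linear_cnjv] Cinf_fst gp.u_Cinf) auto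
  have hs: "h a x = 0" if "x \<in> ball x0 r - cball x0 s" for a x using chi0 that by (simp add: h_def)
  have "compact ((\<lambda>x. fst (?u x)) ` cball x0 r)"
    by (intro compact_continuous_image continuous_intros gp.u_cont compact_cball)
  then obtain K where K: "K > 0" "\<And>x. x \<in> cball x0 r \<Longrightarrow> norm (fst (?u x)) \<le> K"
    by (metis bounded_pos compact_imp_bounded imageI)
  have hb: "cmod (h a x) \<le> norm a * K" if "x \<in> ball x0 r" for a x
  proof -
    have "cmod (h a x) = bump x * cmod (cdot a (cnjv (fst (?u x))))"
      using smooth_step_bounds(1) by (simp add: h_def norm_mult bump_def)
    also have "\<dots> \<le> 1 * (norm a * norm (fst (?u x)))"
      using smooth_step_bounds norm_cdot_le[of a "cnjv (fst (?u x))"] by (intro mult_mono) (auto simp: bump_def)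
    also have "\<dots> \<le> norm a * K" using K(2)[of x] that by (simp add: mult_left_mono)
    finally show ?thesis .
  qed
  obtain \<delta>0 where \<delta>0: "\<delta>0 > 0" "\<forall>\<eta>. Cinf \<eta> (ball x0 r) \<and> (\<forall>x\<in>ball x0 r - cball x0 s. \<eta> x = 0) \<and>
    (\<forall>x\<in>ball x0 r. cmod (\<eta> x) < \<delta>0) \<longrightarrow>
    gp.adm \<eta> \<and> embd (push c d x0 r f \<eta>) \<and> push c d x0 r f \<eta> \<in> N \<and> reach N f (push c d x0 r f \<eta>)"
    using gp.push_reach[OF N] by blast
  let ?F = "\<lambda>a. push c d x0 r f (h a)"
  have small: "gp.adm (h a) \<and> embd (?F a) \<and> ?F a \<in> N \<and> reach N f (?F a)" if "norm a < \<delta>0 / K" for a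
  proof -
    have "norm a * K < \<delta>0" using that K(1) by (simp add: pos_less_divide_eq)
    then have "cmod (h a x) < \<delta>0" if "x \<in> ball x0 r" for x using hb[OF that, of a] by linarith
    then show ?thesis using \<delta>0(2) hCa[of a] hs[of _ a] by blast
  qed
  have oP: "open (ball 0 (\<delta>0 / K))" by simp
  have fam: "fam (ball 0 (\<delta>0 / K)) ?F"
  proof (rule gp.fam_push[OF oP _ hs])
    show "Cinf (\<lambda>(a, x). h a x) (ball 0 (\<delta>0 / K) \<times> ball x0 r)"
      by (rule Cinf_subset[OF hC]) (auto intro: open_Times)
    show "?u x + (0, h a x) \<in> snd d ` fst d" if "a \<in> ball 0 (\<delta>0 / K)" "x \<in> ball x0 r" for a x
      using small[of a] that by (auto simp: gp.adm_def)
  qed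
  have F0: "?F 0 = f"
  proof
    have "h 0 = (\<lambda>x. 0)" by (simp add: h_def fun_eq_iff cdot_def)
    then show "?F 0 y = f y" for y using gp.push_0[of y] by simp
  qed
  have P0: "0 \<in> ball (0 :: complex ^ 'n) (\<delta>0 / K)" using \<delta>0(1) K(1) by simp
  have "\<forall>p\<in>Q. \<exists>\<delta>>0. \<forall>a. norm a < \<delta> \<longrightarrow> a \<in> ball 0 (\<delta>0 / K) \<and> patch_ok (?F a) p \<and> (patch_good f p \<longrightarrow> patch_good (?F a) p)"
    using fam_dbar_stable[OF fam P0] F0 ok by simp
  then obtain \<Delta> where \<Delta>: "\<And>p. p \<in> Q \<Longrightarrow> \<Delta> p > 0" "\<And>p a. p \<in> Q \<Longrightarrow> norm a < \<Delta> p \<Longrightarrow>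
      a \<in> ball 0 (\<delta>0 / K) \<and> patch_ok (?F a) p \<and> (patch_good f p \<longrightarrow> patch_good (?F a) p)"
    by metis
  define \<delta> where "\<delta> = Min (\<Delta> ` Q)"
  have \<delta>: "\<delta> > 0" "\<And>p. p \<in> Q \<Longrightarrow> \<delta> \<le> \<Delta> p"
  proof -
    have "\<delta> \<in> \<Delta> ` Q" unfolding \<delta>_def by (rule Min_in) (use fin p0 in auto)
    then show "\<delta> > 0" using \<Delta>(1) by blast
    show "\<delta> \<le> \<Delta> p" if "p \<in> Q" for p unfolding \<delta>_def by (rule Min_le) (use fin that in auto)
  qed
  have G: "Cinf (dbar c d f) (ball x0 r)"
    by (rule Cinf_dz_part(2)[OF Cinf_deriv[OF gp.u_Cinf] gp.gr open_ball])
  \<comment> \<open>The critical points of the gradient. Their values form a null set, which cannot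
    fill the ball of radius \<open>\<delta>\<close>.\<close>
  define bad where "bad = {x \<in> ball x0 r. \<not> inj (frechet_derivative (dbar c d f) (at x))}"
  have "negligible (dbar c d f ` bad)"
    by (rule Sard_euclidean[OF dim Cinf_has_derivative[OF G]]) (auto simp: bad_def)
  moreover have "\<not> negligible (ball (0 :: complex ^ 'n) \<delta>)"
    using \<delta>(1) open_not_negligible[OF open_ball] by (metis ball_eq_empty not_le)
  ultimately have "\<not> ball 0 \<delta> \<subseteq> dbar c d f ` bad" using negligible_subset by blast
  then obtain b where "b \<in> ball 0 \<delta>" "b \<notin> dbar c d f ` bad" by blast
  then have b: "norm b < \<delta>" "b \<notin> dbar c d f ` bad" by auto
  define a where "a = - b"
  have a: "norm a < \<delta>" using b(1) by (simp add: a_def)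
  have aQ: "a \<in> ball 0 (\<delta>0 / K) \<and> patch_ok (?F a) p \<and> (patch_good f p \<longrightarrow> patch_good (?F a) p)" if "p \<in> Q" for p
    using \<Delta>(2)[OF that] \<delta>(2)[OF that] a by simp
  have an: "norm a < \<delta>0 / K" using aQ[OF p0] by simp
  note sm = small[OF an]
  have dbF: "dbar c d (?F a) x = dbar c d f x + a" if x: "x \<in> ball x0 (5/8 * r)" for x
  proof -
    have xr: "x \<in> ball x0 r" using x r by auto
    note gx = gp.gr[OF xr]
    let ?D = "frechet_derivative ?u (at x)"
    have "((\<lambda>x. cdot a (cnjv (fst (?u x)))) has_derivative (\<lambda>v. cdot a (cnjv (fst (?D v))))) (at x)"
      by (intro bounded_linear.has_derivative[OF bounded_bilinear.bounded_linear_right[OF bounded_bilinear_cdot]]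
          bounded_linear.has_derivative[OF bounded_linear_cnjv] has_derivative_fst gp.u_deriv[OF xr])
    then have "(h a has_derivative (\<lambda>v. cdot a (cnjv (fst (?D v))))) (at x)"
      by (rule has_derivative_transform_within_open[OF _ open_ball x]) (simp add: h_def chi1)
    then have hd: "frechet_derivative (h a) (at x) = (\<lambda>v. cdot a (cnjv (fst (?D v))))"
      by (rule frechet_derivative_at[symmetric])
    have "antilin_part (\<lambda>\<zeta>. frechet_derivative (h a) (at x) (inv (\<lambda>v. fst (?D v)) \<zeta>)) = a"
      by (rule antilin_part_eqI[of _ 0]) (simp add: hd graphicalD(5)[OF gx] cdot_def[of 0])
    then show ?thesis using dbar_push(1)[OF gp _ xr, of "h a"] sm by simp
  qed
  have "patch_good (?F a) p0"
    unfolding patch_good_def p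
  proof (clarify)
    fix x assume x: "x \<in> cball x0 (r/2)" and 0: "dbar c d (?F a) x = 0"
    have x5: "x \<in> ball x0 (5/8 * r)" and xr: "x \<in> ball x0 r" using x r by auto
    have "dbar c d f x = b" using 0 dbF[OF x5] by (simp add: a_def)
    then have "x \<notin> bad" using b(2) by blast
    then have i: "inj (frechet_derivative (dbar c d f) (at x))" using xr by (simp add: bad_def)
    have "((\<lambda>x. dbar c d f x + a) has_derivative frechet_derivative (dbar c d f) (at x)) (at x)"
      using has_derivative_add[OF Cinf_has_derivative[OF G xr] has_derivative_const[of a]] by simp
    then have "(dbar c d (?F a) has_derivative frechet_derivative (dbar c d f) (at x)) (at x)"
      by (rule has_derivative_transform_within_open[OF _ open_ball x5]) (simp add: dbF)
    then have "frechet_derivative (dbar c d (?F a)) (at x) = frechet_derivative (dbar c d f) (at x)"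
      by (rule frechet_derivative_at[symmetric])
    then show "inj (frechet_derivative (dbar c d (?F a)) (at x))" using i by simp
  qed
  then show ?thesis using sm aQ by (intro exI[of _ "?F a"]) blast
qed

text \<open>The patch data are forgotten: what remains depends only on the germ of the map at
  \<open>y\<close> and survives changes elsewhere.\<close>

definition regular :: "('y \<Rightarrow> 'x) \<Rightarrow> 'y \<Rightarrow> bool" where
  "regular f y \<longleftrightarrow> (\<exists>c\<in>B. \<exists>d. hc d \<and> y \<in> fst c \<and> f y \<in> fst d \<and> graphical (drep c d f y) \<and>
     (dbar c d f (snd c y) = 0 \<longrightarrow> inj (frechet_derivative (dbar c d f) (at (snd c y)))))"

text \<open>Half balls of finitely many patches cover \<open>Y\<close>. The patches are fixed before
  any perturbation and treated one after the other; each step keeps all of them valid and the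
  earlier ones good.\<close>

lemma generic_embedding:
  assumes f: "embd f" and N: "openin (C0_topology Y X) N" "f \<in> N"
  obtains g where "embd g" "g \<in> N" "reach N f g" "\<And>y. y \<in> topspace Y \<Longrightarrow> regular g y"
proof -
  define W where "W p = (case p of (c, d, x0, r, Z, m) \<Rightarrow> cinv c ` ball x0 (r / 2))"
    for p :: "('y, 'e, 'x, 'n) patch_data"
  have sf: "smf f" using f by (simp add: embd_def)
  have oW: "openin Y (W p)" if "patch_ok f p" for p
  proof -
    obtain c d x0 r Z m where p: "p = (c, d, x0, r, Z, m)" by (cases p)
    note q = patch_okD[OF sf that[unfolded p]]
    have "ball x0 (r/2) \<subseteq> cball x0 r" using q(3) by auto
    then show ?thesis using q(4) chart_open_cinv_image[OF B_chart[OF q(1)] open_ball] by (auto simp: W_def p)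
  qed
  have "topspace Y \<subseteq> \<Union>(W ` {p. patch_ok f p})"
  proof
    fix y assume "y \<in> topspace Y"
    then obtain c d r Z m where p: "patch_ok f (c, d, snd c y, r, Z, m)" "y \<in> fst c"
      using transverse_patch[OF f] by metis
    have "y = cinv c (snd c y)" using chart_cinv(1)[OF B_chart[OF patch_okD(1)[OF sf p(1)]] p(2)] by simp
    moreover have "snd c y \<in> ball (snd c y) (r / 2)" using patch_okD(3)[OF sf p(1)] by simp
    ultimately have "y \<in> W (c, d, snd c y, r, Z, m)" by (auto simp: W_def)
    then show "y \<in> \<Union>(W ` {p. patch_ok f p})" using p(1) by blast
  qed
  note cov = this
  have op: "openin Y U" if "U \<in> W ` {p. patch_ok f p}" for U using that oW by blast
  obtain \<F> where F: "finite \<F>" "\<F> \<subseteq> W ` {p. patch_ok f p}" "topspace Y \<subseteq> \<Union>\<F>"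
    using compactinD[OF compact_Y[unfolded compact_space_def] op cov] by blast
  obtain Q where Q: "Q \<subseteq> {p. patch_ok f p}" "finite Q" "\<F> = W ` Q"
    using finite_subset_image[OF F(1,2)] by blast
  have Q: "finite Q" "Q \<subseteq> {p. patch_ok f p}" "topspace Y \<subseteq> \<Union>(W ` Q)"
    using Q F(3) by auto
  have "\<exists>g. embd g \<and> g \<in> N \<and> reach N f g \<and> (\<forall>p\<in>Q. patch_ok g p) \<and> (\<forall>p\<in>G. patch_good g p)" if "finite G" "G \<subseteq> Q" for G
    using that
  proof (induction G)
    case empty
    then show ?case using f N Q(2) reach_refl by (intro exI[of _ f]) blast
  next
    case (insert p0 G)
    then obtain g where g: "embd g" "g \<in> N" "reach N f g" "\<forall>p\<in>Q. patch_ok g p" "\<forall>p\<in>G. patch_good g p" by blast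
    have ok: "\<And>p. p \<in> Q \<Longrightarrow> patch_ok g p" and p0: "p0 \<in> Q" using g(4) insert.prems by blast+
    obtain g' where g': "embd g'" "g' \<in> N" "reach N g g'" "\<forall>p\<in>Q. patch_ok g' p"
      "\<forall>p\<in>Q. patch_good g p \<longrightarrow> patch_good g' p" "patch_good g' p0"
      using transversality_step[OF g(1) N(1) g(2) Q(1) ok p0] by blast
    then show ?case using g insert.prems reach_trans[OF g(3) g'(3)] by (intro exI[of _ g']) blast
  qed
  from this[OF Q(1) order_refl] obtain g where g: "embd g" "g \<in> N" "reach N f g" "\<forall>p\<in>Q. patch_ok g p" "\<forall>p\<in>Q. patch_good g p"
    by blast
  have sg: "smf g" using g(1) by (simp add: embd_def)
  have "regular g y" if y: "y \<in> topspace Y" for y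
  proof -
    obtain p where p: "p \<in> Q" "y \<in> W p" using Q(3) y by blast
    obtain c d x0 r Z m where pp: "p = (c, d, x0, r, Z, m)" by (cases p)
    note q = patch_okD[OF sg g(4)[rule_format, OF p(1), unfolded pp]]
    obtain x where x: "x \<in> ball x0 (r/2)" "y = cinv c x" using p(2) by (auto simp: W_def pp)
    then have xr: "x \<in> cball x0 r" "x \<in> cball x0 (r/2)" using q(3) by auto
    note cc = chart_cinv[OF B_chart[OF q(1)]]
    have y: "y \<in> fst c" "snd c y = x" using cc(2,3)[of x] q(4) xr(1) x(2) by auto
    have "dbar c d g x = 0 \<longrightarrow> inj (frechet_derivative (dbar c d g) (at x))"
      using g(5) p(1) xr(2) by (auto simp: patch_good_def pp)
    then show ?thesis unfolding regular_def using q(1,2,5,6) xr(1) y x(2) by metis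
  qed
  then show ?thesis using that g by blast
qed

end

section \<open>Jets at complex points\<close>

type_synonym 'n jet = "(complex ^ 'n ^ 'n) \<times> (complex ^ 'n ^ 'n)"

text \<open>\<open>rop m\<close> is the derivative with respect to \<open>cnjv z\<close> of the quadratic form \<open>qform m\<close>.\<close>

definition rop :: "'n::finite jet \<Rightarrow> complex ^ 'n \<Rightarrow> complex ^ 'n" where
  "rop m z = fst m *v z + snd m *v cnjv z"

text \<open>The factor 1/2 is that of a Taylor expansion: differentiation with respect to
  \<open>cnjv z\<close> meets the term of the second matrix twice and the mixed term once.\<close>

definition qform :: "'n::finite jet \<Rightarrow> complex ^ 'n \<Rightarrow> complex" where
  "qform m z = cdot (cnjv z) (rop (fst m, (1/2) *\<^sub>R snd m) z)"

text \<open>Symmetry of the second matrix reflects that of second derivatives. Injectivity as a real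
  linear map says that the complex point is a nondegenerate zero of the antiholomorphic
  gradient.\<close>

definition nondeg :: "'n::finite jet \<Rightarrow> bool" where
  "nondeg m \<longleftrightarrow> transpose (snd m) = snd m \<and> inj (rop m)"

lemma bounded_linear_matrix_vector: "bounded_linear (\<lambda>z. M *v (z :: complex ^ 'n::finite))"
  using linear_conv_bounded_linear matrix_vector_mul_linear by blast

lemma bounded_bilinear_rop: "bounded_bilinear (rop :: 'n::finite jet \<Rightarrow> _)"
proof -
  have "bilinear (rop :: 'n::finite jet \<Rightarrow> _)"
    unfolding bilinear_def rop_def
    by (auto intro!: linearI simp: matrix_vector_mult_def cnjv_def vec_eq_iff sum.distrib algebra_simps scaleR_sum_right)
  then show ?thesis by (simp add: bilinear_conv_bounded_bilinear)
qed

lemma linear_rop: "linear (rop m)"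
  using bounded_bilinear.bounded_linear_right[OF bounded_bilinear_rop] bounded_linear.linear by blast

lemma norm_smult_vec: "norm (c *s (z :: complex ^ 'n)) = cmod c * norm z"
  by (simp add: norm_vec_def norm_mult L2_set_right_distrib)

lemma jet_bounds:
  obtains C where "C > 0" "\<And>(m :: 'n::finite jet) z. norm (rop m z) \<le> C * norm m * norm z"
    "\<And>(m :: 'n::finite jet) z. cmod (qform m z) \<le> C * norm m * (norm z)\<^sup>2"
proof -
  obtain C where C: "C > 0" "\<And>(m :: 'n jet) z. norm (rop m z) \<le> norm m * norm z * C"
    using bounded_bilinear.pos_bounded[OF bounded_bilinear_rop] by metis
  have "cmod (qform m z) \<le> C * norm m * (norm z)\<^sup>2" for m :: "'n jet" and z
  proof -
    have "norm (fst m, (1/2) *\<^sub>R snd m) \<le> norm m"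
      unfolding norm_prod_def by (intro real_sqrt_le_mono) (auto simp: power_mult_distrib field_simps)
    then have "norm (rop (fst m, (1/2) *\<^sub>R snd m) z) \<le> norm m * norm z * C"
      by (intro order_trans[OF C(2)] mult_right_mono) (use C(1) in auto)
    then have "cmod (qform m z) \<le> norm z * (norm m * norm z * C)"
      unfolding qform_def by (intro order_trans[OF norm_cdot_le]) (simp add: mult_left_mono)
    then show ?thesis by (simp add: power2_eq_square mult_ac)
  qed
  then show ?thesis using that[of C] C by (simp add: mult_ac)
qed

lemma cdot_commute: "cdot p z = cdot z p"
  by (simp add: cdot_def mult.commute)

lemma cdot_matrix_transpose: "cdot p (M *v z) = cdot (transpose M *v p) z"
proof -
  have "cdot p (M *v z) = (\<Sum>k\<in>UNIV. \<Sum>j\<in>UNIV. p $ k * (M $ k $ j * z $ j))"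
    by (simp add: cdot_def matrix_vector_mult_def sum_distrib_left)
  also have "\<dots> = (\<Sum>j\<in>UNIV. \<Sum>k\<in>UNIV. p $ k * (M $ k $ j * z $ j))" by (rule sum.swap)
  also have "\<dots> = cdot (transpose M *v p) z"
    by (simp only: cdot_def matrix_vector_mult_def transpose_def vec_lambda_beta sum_distrib_right) (simp add: mult_ac)
  finally show ?thesis .
qed

lemma cdot_add: "cdot (p + q) z = cdot p z + cdot q z" "cdot p (z + w) = cdot p z + cdot p w"
  "cdot (p - q) z = cdot p z - cdot q z" "cdot p (z - w) = cdot p z - cdot p w"
  "cdot (r *\<^sub>R p) z = r *\<^sub>R cdot p z" "cdot p (r *\<^sub>R z) = r *\<^sub>R cdot p z"
  "cdot (c *s p) z = c * cdot p z" "cdot 0 z = 0" "cdot p 0 = 0"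
  by (simp_all add: cdot_def sum.distrib sum_subtractf algebra_simps scaleR_sum_right sum_distrib_left)

text \<open>Symmetry of the second matrix cancels the factor 1/2, so the coefficient of the
  conjugate differential is \<open>rop m\<close>: this is the antiholomorphic gradient of the graph
  of \<open>qform m\<close>.\<close>

lemma qform_deriv:
  assumes "transpose (snd m) = snd m" and z: "(z has_derivative z') (at x)"
  shows "((\<lambda>x. qform m (z x)) has_derivative
    (\<lambda>v. cdot (transpose (fst m) *v cnjv (z x)) (z' v) + cdot (rop m (z x)) (cnjv (z' v)))) (at x)"
proof -
  let ?h = "(fst m, (1/2) *\<^sub>R snd m)"
  have c: "((\<lambda>x. cnjv (z x)) has_derivative (\<lambda>v. cnjv (z' v))) (at x)"
    by (rule bounded_linear.has_derivative[OF bounded_linear_cnjv z])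
  have r: "((\<lambda>x. rop ?h (z x)) has_derivative (\<lambda>v. rop ?h (z' v))) (at x)"
    by (rule bounded_linear.has_derivative[OF bounded_bilinear.bounded_linear_right[OF bounded_bilinear_rop] z])
  have "((\<lambda>x. qform m (z x)) has_derivative
      (\<lambda>v. cdot (cnjv (z x)) (rop ?h (z' v)) + cdot (cnjv (z' v)) (rop ?h (z x)))) (at x)"
    unfolding qform_def by (rule bounded_bilinear.FDERIV[OF bounded_bilinear_cdot c r])
  moreover have "cdot (cnjv (z x)) (rop ?h (z' v)) + cdot (cnjv (z' v)) (rop ?h (z x))
      = cdot (transpose (fst m) *v cnjv (z x)) (z' v) + cdot (rop m (z x)) (cnjv (z' v))" for v
  proof -
    have s: "(r *\<^sub>R M) *v y = r *\<^sub>R (M *v y)" for r and M :: "complex ^ 'a ^ 'a" and y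
      by (simp add: matrix_vector_mult_def vec_eq_iff scaleR_sum_right)
    have "cdot (cnjv (z x)) (snd m *v cnjv (z' v)) = cdot (snd m *v cnjv (z x)) (cnjv (z' v))"
      by (simp add: cdot_matrix_transpose assms(1))
    then show ?thesis
      by (simp add: rop_def cdot_add s cdot_matrix_transpose[of "cnjv (z x)" "fst m"] cdot_commute[of "cnjv (z' v)"]
          scaleR_conv_of_real[where 'a=complex] algebra_simps)
  qed
  ultimately show ?thesis by simp
qed

lemma Cinf_qform: "Cinf z S \<Longrightarrow> Cinf (\<lambda>x. qform m (z x)) S"
  unfolding qform_def
  by (intro Cinf_bilinear[OF bounded_bilinear_cdot] Cinf_linear_compose[OF bounded_linear_cnjv]
      Cinf_linear_compose[OF bounded_bilinear.bounded_linear_right[OF bounded_bilinear_rop]])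

definition lmat :: "(complex ^ 'n \<Rightarrow> complex ^ 'n) \<Rightarrow> complex ^ 'n ^ 'n" where
  "lmat T = (\<chi> k. lin_part (\<lambda>z. T z $ k))"

definition amat :: "(complex ^ 'n \<Rightarrow> complex ^ 'n) \<Rightarrow> complex ^ 'n ^ 'n" where
  "amat T = (\<chi> k. antilin_part (\<lambda>z. T z $ k))"

lemma rop_mats:
  assumes "linear T" shows "rop (lmat T, amat T) z = T z"
proof -
  have "linear (\<lambda>z. T z $ k)" for k
    using linear_compose[OF assms bounded_linear.linear[OF bounded_linear_vec_nth]] by (simp add: o_def)
  from linear_lin_antilin[OF this, where z=z]
  show ?thesis by (simp add: rop_def vec_eq_iff matrix_vector_mult_def cdot_def lmat_def amat_def)
qed

lemma rop_axis: "rop (P, R) (axis j a) $ k = P $ k $ j * a + R $ k $ j * cnj a"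
  unfolding rop_def fst_conv snd_conv cnjv_axis
  by (simp add: matrix_vector_mult_def axis_def if_distrib cong: if_cong)

text \<open>Symmetry of second derivatives: for \<open>w\<close> a function of \<open>z\<close> with \<open>dw = p dz + g d(cnjv z)\<close>,
  the form \<open>(\<zeta>, \<omega>) \<mapsto> dp(\<zeta>) \<omega> + dg(\<zeta>) cnjv \<omega>\<close> is symmetric.\<close>

lemma symmetric_form_mats:
  fixes P G :: "complex ^ 'n::finite \<Rightarrow> complex ^ 'n"
  assumes P: "linear P" and G: "linear G"
    and sym: "\<And>\<zeta> \<omega>. cdot (P \<zeta>) \<omega> + cdot (G \<zeta>) (cnjv \<omega>) = cdot (P \<omega>) \<zeta> + cdot (G \<omega>) (cnjv \<zeta>)"
  shows "transpose (lmat P) = lmat P" "amat P = transpose (lmat G)" "transpose (amat G) = amat G"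
proof -
  have *: "lmat P $ k $ j = lmat P $ j $ k \<and> amat P $ k $ j = lmat G $ j $ k \<and> amat G $ k $ j = amat G $ j $ k" for j k
  proof -
    let ?x = "lmat P $ k $ j - lmat P $ j $ k" and ?y = "amat P $ k $ j - lmat G $ j $ k"
      and ?z = "lmat G $ k $ j - amat P $ j $ k" and ?t = "amat G $ k $ j - amat G $ j $ k"
    \<comment> \<open>The form is tested on multiples \<open>a\<close>, \<open>b\<close> of two
      coordinate vectors. The values 1 and \<open>\<i>\<close> for each of them give four
      independent linear equations for the four unknowns.\<close>
    have E: "a * b * ?x + cnj a * b * ?y + a * cnj b * ?z + cnj a * cnj b * ?t = 0" for a b
    proof -
      have "P (axis j a) $ k = lmat P $ k $ j * a + amat P $ k $ j * cnj a" for j k a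
        using rop_axis[of "lmat P" "amat P" j a k] rop_mats[OF P] by simp
      moreover have "G (axis j a) $ k = lmat G $ k $ j * a + amat G $ k $ j * cnj a" for j k a
        using rop_axis[of "lmat G" "amat G" j a k] rop_mats[OF G] by simp
      ultimately show ?thesis using sym[of "axis j a" "axis k b"] by (simp add: algebra_simps)
    qed
    have 1: "?x + ?y + ?z + ?t = 0" using E[of 1 1] by simp
    have "\<i> * (?x - ?y + ?z - ?t) = 0" using E[of \<i> 1] by (simp add: algebra_simps)
    then have 2: "?x - ?y + ?z - ?t = 0" by (simp only: mult_eq_0_iff) simp
    have "\<i> * (?x + ?y - ?z - ?t) = 0" using E[of 1 \<i>] by (simp add: algebra_simps)
    then have 3: "?x + ?y - ?z - ?t = 0" by (simp only: mult_eq_0_iff) simp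
    have 4: "- ?x + ?y + ?z - ?t = 0"
    proof -
      have c: "\<i> * \<i> = (-1 :: complex)" "cnj \<i> * \<i> = 1" "\<i> * cnj \<i> = 1" "cnj \<i> * cnj \<i> = -1" by simp_all
      show ?thesis using E[of \<i> \<i>] unfolding c by (simp only: mult_minus1 mult_1_left diff_conv_add_uminus)
    qed
    have q: "x = 0 \<and> y = 0 \<and> t = 0" if "x + y + z + t = 0" "x - y + z - t = 0" "x + y - z - t = 0" "- x + y + z - t = 0"
      for x y z t :: complex
    proof -
      have "4 * x = (x + y + z + t) + (x - y + z - t) + (x + y - z - t) - (- x + y + z - t)"
        "4 * y = (x + y + z + t) - (x - y + z - t) + (x + y - z - t) + (- x + y + z - t)"
        "4 * t = (x + y + z + t) - (x - y + z - t) - (x + y - z - t) - (- x + y + z - t)" by simp_all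
      then show ?thesis unfolding that by simp
    qed
    show ?thesis using q[OF 1 2 3 4] by simp
  qed
  then show "transpose (lmat P) = lmat P" "amat P = transpose (lmat G)" "transpose (amat G) = amat G"
    by (simp_all add: transpose_def vec_eq_iff)
qed

section \<open>Osculating jets in adapted coordinates\<close>

context cr_setting
begin

abbreviation zc :: "('y, 'e) chart \<Rightarrow> ('x, 'n cmodel) chart \<Rightarrow> ('y \<Rightarrow> 'x) \<Rightarrow> 'e \<Rightarrow> complex ^ 'n" where
  "zc c d f x \<equiv> fst (local_rep c d f x)"

abbreviation wc :: "('y, 'e) chart \<Rightarrow> ('x, 'n cmodel) chart \<Rightarrow> ('y \<Rightarrow> 'x) \<Rightarrow> 'e \<Rightarrow> complex" where
  "wc c d f x \<equiv> snd (local_rep c d f x)"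

text \<open>Only \<open>z\<close> is centred; \<open>w\<close> vanishes at the point as soon as
  \<open>oscul\<close> or \<open>normal_at\<close> holds in the chart.\<close>

definition graph_chart :: "('y \<Rightarrow> 'x) \<Rightarrow> 'y \<Rightarrow> ('y, 'e) chart \<Rightarrow> ('x, 'n cmodel) chart \<Rightarrow> bool" where
  "graph_chart f y c d \<longleftrightarrow> c \<in> B \<and> hc d \<and> y \<in> fst c \<and> f y \<in> fst d \<and> graphical (drep c d f y) \<and> zc c d f (snd c y) = 0"

text \<open>Closeness of the gradient is demanded separately since it does not follow from closeness
  of the functions; the cutoff argument uses both.\<close>

definition oscul :: "('y \<Rightarrow> 'x) \<Rightarrow> 'y \<Rightarrow> 'n jet \<Rightarrow> bool" where
  "oscul f y m \<longleftrightarrow> (\<exists>c d. graph_chart f y c d \<and> (\<forall>\<kappa>>0. \<exists>\<rho>>0. \<forall>x\<in>ball (snd c y) \<rho>.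
     cmod (wc c d f x - qform m (zc c d f x)) \<le> \<kappa> * (norm (zc c d f x))\<^sup>2 \<and>
     norm (dbar c d f x - rop m (zc c d f x)) \<le> \<kappa> * norm (zc c d f x)))"

definition normal_at :: "('y \<Rightarrow> 'x) \<Rightarrow> 'y \<Rightarrow> 'n jet \<Rightarrow> bool" where
  "normal_at f y m \<longleftrightarrow> (\<exists>c d. graph_chart f y c d \<and> (\<exists>\<rho>>0. \<forall>x\<in>ball (snd c y) \<rho>. wc c d f x = qform m (zc c d f x)))"

lemma hc_shear:
  assumes d: "hc d" and P: "\<And>z. \<exists>P'. (P has_derivative P') (at z) \<and> (\<forall>v. P' (\<i> *s v) = \<i> * P' v)"
  shows "hc (fst d, \<lambda>q. (fst (snd d q) - z0, snd (snd d q) - P (fst (snd d q))))"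
proof -
  have H: "holomorphic_map_on UNIV (\<lambda>q :: 'n cmodel. (fst q - z0, snd q - P (fst q)))"
    unfolding holomorphic_map_on_def
  proof
    fix q :: "'n cmodel"
    obtain P' where P': "(P has_derivative P') (at (fst q))" "\<forall>v. P' (\<i> *s v) = \<i> * P' v" using P by blast
    have "((\<lambda>q. (fst q - z0, snd q - P (fst q))) has_derivative (\<lambda>v. (fst v - 0, snd v - P' (fst v)))) (at q)"
      by (intro has_derivative_Pair has_derivative_diff has_derivative_fst has_derivative_snd has_derivative_ident
          has_derivative_const has_derivative_compose[OF has_derivative_fst[OF has_derivative_ident] P'(1)])
    then show "\<exists>D. ((\<lambda>q. (fst q - z0, snd q - P (fst q))) has_derivative D) (at q) \<and> (\<forall>v. D (mult_i v) = mult_i (D v))"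
      using P'(2) by (intro exI[of _ "\<lambda>v. (fst v - 0, snd v - P' (fst v))"]) (simp add: mult_i_def algebra_simps)
  qed
  have K: "holomorphic_map_on UNIV (\<lambda>q :: 'n cmodel. (fst q + z0, snd q + P (fst q + z0)))"
    unfolding holomorphic_map_on_def
  proof
    fix q :: "'n cmodel"
    obtain P' where P': "(P has_derivative P') (at (fst q + z0))" "\<forall>v. P' (\<i> *s v) = \<i> * P' v" using P by blast
    have "((\<lambda>q. fst q + z0) has_derivative (\<lambda>v. fst v + 0)) (at q)"
      by (intro has_derivative_add has_derivative_fst has_derivative_ident has_derivative_const)
    from has_derivative_compose[OF this P'(1)]
    have "((\<lambda>q. (fst q + z0, snd q + P (fst q + z0))) has_derivative (\<lambda>v. (fst v + 0, snd v + P' (fst v + 0)))) (at q)"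
      by (intro has_derivative_Pair has_derivative_add has_derivative_fst has_derivative_snd has_derivative_ident
          has_derivative_const)
    then show "\<exists>D. ((\<lambda>q. (fst q + z0, snd q + P (fst q + z0))) has_derivative D) (at q) \<and> (\<forall>v. D (mult_i v) = mult_i (D v))"
      using P'(2) by (intro exI[of _ "\<lambda>v. (fst v + 0, snd v + P' (fst v + 0))"]) (simp add: mult_i_def algebra_simps)
  qed
  from hc_compose[OF d H K] show ?thesis by simp
qed

lemma small_patch:
  assumes f: "smf f" and g: "graph_chart f y c d" and W: "openin Y W" "y \<in> W"
  obtains r Z m where "patch_ok f (c, d, snd c y, r, Z, m)" "cinv c ` cball (snd c y) r \<subseteq> W"
proof -
  have g': "c \<in> B" "hc d" "y \<in> fst c" "f y \<in> fst d" "graphical (drep c d f y)" using g by (auto simp: graph_chart_def)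
  note ic = B_chart[OF g'(1)]
  have "open (snd c ` (fst c \<inter> W))"
    using W(1) is_chartD(1)[OF ic] by (intro chart_open_image[OF ic]) auto
  moreover have "snd c y \<in> snd c ` (fst c \<inter> W)" using g' W(2) by blast
  ultimately obtain R where R: "R > 0" "cball (snd c y) R \<subseteq> snd c ` (fst c \<inter> W)"
    using open_contains_cball by blast
  obtain r Z m where r: "r \<le> R" "patch_ok f (c, d, snd c y, r, Z, m)"
    using patch_exists[OF f g' R(1)] by blast
  have "cball (snd c y) r \<subseteq> snd c ` (fst c \<inter> W)" using r(1) R(2) subset_cball[OF r(1)] by blast
  then have "cinv c ` cball (snd c y) r \<subseteq> W"
    using chart_cinv(1)[OF ic] by fastforce
  then show ?thesis using that r(2) by blast
qed

text \<open>Makes the outcome of one replacement a starting point for the next.\<close>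

lemma normal_at_imp_oscul:
  assumes f: "embd f" and n: "normal_at f y m" and m: "transpose (snd m) = snd m"
  shows "oscul f y m"
proof -
  obtain c d \<rho> where g: "graph_chart f y c d" and \<rho>: "\<rho> > 0" "\<forall>x\<in>ball (snd c y) \<rho>. wc c d f x = qform m (zc c d f x)"
    using n unfolding normal_at_def by blast
  have sf: "smf f" using f by (simp add: embd_def)
  have "y \<in> topspace Y" using g openin_subset[OF is_chartD(1)[OF B_chart, of c]] unfolding graph_chart_def by blast
  then obtain r Z m0 where p: "patch_ok f (c, d, snd c y, r, Z, m0)"
    by (rule small_patch[OF sf g openin_topspace]) (rule that, assumption)
  note pk = patch_okD[OF sf p]
  have "dbar c d f x = rop m (zc c d f x)" if x: "x \<in> ball (snd c y) (min \<rho> r)" for x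
  proof -
    have xr: "x \<in> cball (snd c y) r" and x\<rho>: "x \<in> ball (snd c y) \<rho>" using x by auto
    let ?D = "frechet_derivative (local_rep c d f) (at x)"
    have D: "(local_rep c d f has_derivative ?D) (at x)"
      using rep_has_derivative[OF sf pk(1,2) _ pk(5)[OF xr]] pk(4) xr by blast
    have "((\<lambda>x. wc c d f x) has_derivative (\<lambda>v. cdot (transpose (fst m) *v cnjv (zc c d f x)) (fst (?D v))
        + cdot (rop m (zc c d f x)) (cnjv (fst (?D v))))) (at x)"
      by (rule has_derivative_transform_within_open[OF qform_deriv[OF m has_derivative_fst[OF D]] open_ball x\<rho>])
        (use \<rho>(2) in simp)
    from has_derivative_unique[OF has_derivative_snd[OF D] this]
    have "snd (?D v) = cdot (transpose (fst m) *v cnjv (zc c d f x)) (fst (?D v))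
        + cdot (rop m (zc c d f x)) (cnjv (fst (?D v)))" for v by (rule fun_cong)
    then show ?thesis by (rule graphical_eqI(2)[OF pk(6)[OF xr]])
  qed
  then show ?thesis unfolding oscul_def
    using g \<rho> pk(3) by (intro exI[of _ c] exI[of _ d] conjI allI impI exI[of _ "min \<rho> r"]) auto
qed

text \<open>Subtracting from \<open>w\<close> the holomorphic Taylor polynomial \<open>q\<close>,
  with linear part \<open>pp x0\<close> and quadratic part \<open>C\<close>, leaves
  \<open>qform m\<close> up to terms that are small of second order. The matrices in
  \<open>m\<close> are those of the derivative of the antiholomorphic gradient with respect to
  \<open>z\<close>. Symmetry of second derivatives makes \<open>snd m\<close> symmetric and ties the
  mixed term to the derivative of the holomorphic gradient.\<close>

lemma regular_complex_oscul:
  assumes f: "embd f" and reg: "regular f y" and cp: "cpt f y"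
  obtains m where "nondeg m" "oscul f y m"
proof -
  have sf: "smf f" using f by (simp add: embd_def)
  obtain c d where cd: "c \<in> B" "hc d" "y \<in> fst c" "f y \<in> fst d" "graphical (drep c d f y)"
    and ii: "dbar c d f (snd c y) = 0 \<longrightarrow> inj (frechet_derivative (dbar c d f) (at (snd c y)))"
    using reg unfolding regular_def by blast
  define x0 where "x0 = snd c y"
  obtain r Z0 m0 where p: "patch_ok f (c, d, x0, r, Z0, m0)"
    using patch_exists[OF sf cd zero_less_one] unfolding x0_def by blast
  note pk = patch_okD[OF sf p]
  let ?u = "local_rep c d f"
  define D where "D x = frechet_derivative ?u (at x)" for x
  have sub: "ball x0 r \<subseteq> cball x0 r" by (rule ball_subset_cball)
  have x0r: "x0 \<in> ball x0 r" using pk(3) by simp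
  have uC: "Cinf ?u (ball x0 r)"
  proof (rule Cinf_subset[OF smfD(2)[OF sf cd(1,2)] open_ball])
    show "ball x0 r \<subseteq> snd c ` {y \<in> fst c. f y \<in> fst d}"
    proof
      fix x assume "x \<in> ball x0 r"
      then have x: "x \<in> cball x0 r" using sub by blast
      then have "cinv c x \<in> fst c" "snd c (cinv c x) = x" "f (cinv c x) \<in> fst d"
        using chart_cinv(2,3)[OF B_chart[OF cd(1)]] pk(4,5) by blast+
      then show "x \<in> snd c ` {y \<in> fst c. f y \<in> fst d}" by force
    qed
  qed
  have du: "(?u has_derivative D x) (at x)" if "x \<in> ball x0 r" for x
    unfolding D_def by (rule Cinf_has_derivative[OF uC that])
  have DC: "Cinf (\<lambda>x. D x v) (ball x0 r)" for v unfolding D_def by (rule Cinf_deriv[OF uC])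
  have gr: "graphical (D x)" if "x \<in> ball x0 r" for x using pk(6) that sub by (auto simp: D_def)
  define pp where "pp x = dz_part (D x)" for x
  define g where "g x = dbar_part (D x)" for x
  have pC: "Cinf pp (ball x0 r)" and gC: "Cinf g (ball x0 r)"
    unfolding pp_def g_def by (rule Cinf_dz_part[OF DC gr open_ball], assumption)+
  have g0: "g x0 = 0"
    using cp cpt_iff[OF sf cd(1-4)] graphical_complex_iff[OF cd(5)] by (simp add: g_def D_def x0_def)
  have geq: "g = dbar c d f" by (simp add: g_def[abs_def] D_def)
  define g' where "g' = frechet_derivative g (at x0)"
  define p' where "p' = frechet_derivative pp (at x0)"
  have dg: "(g has_derivative g') (at x0)" and dp: "(pp has_derivative p') (at x0)"
    unfolding g'_def p'_def by (rule Cinf_has_derivative[OF gC x0r], rule Cinf_has_derivative[OF pC x0r])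
  have ig: "inj g'" using ii g0 unfolding g'_def geq x0_def by simp
  have repr: "snd (D x v) = cdot (pp x) (fst (D x v)) + cdot (g x) (cnjv (fst (D x v)))" if "x \<in> ball x0 r" for x v
    unfolding pp_def g_def by (rule graphical_repr[OF gr[OF that]])
  define D2 where "D2 v = frechet_derivative (\<lambda>x. D x v) (at x0)" for v
  have dD: "((\<lambda>x. D x v) has_derivative D2 v) (at x0)" for v
    unfolding D2_def by (rule Cinf_has_derivative[OF DC x0r])
  have D2sym: "D2 v v' = D2 v' v" for v v'
    by (rule second_derivative_symmetric[OF open_ball x0r du dD dD])
  define Zi where "Zi = inv (\<lambda>v. fst (D x0 v))"
  have ZZi: "fst (D x0 (Zi \<zeta>)) = \<zeta>" for \<zeta> unfolding Zi_def by (rule graphicalD(5)[OF gr[OF x0r]])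
  have ZiZ: "Zi (fst (D x0 v)) = v" for v
    using inv_f_f[OF bij_is_inj[OF graphicalD(2)[OF gr[OF x0r]]], of v] by (simp add: Zi_def)
  have linZi: "linear Zi"
    unfolding Zi_def using gr[OF x0r] by (intro linear_inv_bij linear_fst_comp) (auto simp: graphical_def)
  \<comment> \<open>The relation \<open>dw = pp dz + g d(cnjv z)\<close> is differentiated at
    \<open>x0\<close>; the term with \<open>g x0\<close> drops out because the point is
    complex.\<close>
  have D2eq: "snd (D2 v v') = cdot (p' v') (fst (D x0 v)) + cdot (pp x0) (fst (D2 v v')) + cdot (g' v') (cnjv (fst (D x0 v)))" for v v'
  proof -
    have a: "((\<lambda>x. fst (D x v)) has_derivative (\<lambda>v'. fst (D2 v v'))) (at x0)"
      by (rule has_derivative_fst[OF dD])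
    have b: "((\<lambda>x. cnjv (fst (D x v))) has_derivative (\<lambda>v'. cnjv (fst (D2 v v')))) (at x0)"
      by (rule bounded_linear.has_derivative[OF bounded_linear_cnjv a])
    have "((\<lambda>x. cdot (pp x) (fst (D x v)) + cdot (g x) (cnjv (fst (D x v)))) has_derivative
        (\<lambda>v'. (cdot (pp x0) (fst (D2 v v')) + cdot (p' v') (fst (D x0 v)))
          + (cdot (g x0) (cnjv (fst (D2 v v'))) + cdot (g' v') (cnjv (fst (D x0 v)))))) (at x0)"
      by (intro has_derivative_add bounded_bilinear.FDERIV[OF bounded_bilinear_cdot] dp dg a b)
    then have "((\<lambda>x. snd (D x v)) has_derivative
        (\<lambda>v'. (cdot (pp x0) (fst (D2 v v')) + cdot (p' v') (fst (D x0 v)))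
          + (cdot (g x0) (cnjv (fst (D2 v v'))) + cdot (g' v') (cnjv (fst (D x0 v)))))) (at x0)"
      by (rule has_derivative_transform_within_open[OF _ open_ball x0r]) (use repr in simp)
    from fun_cong[OF has_derivative_unique[OF has_derivative_snd[OF dD[of v]] this], of v']
    show ?thesis by (simp add: g0 cdot_add)
  qed
  define P where "P \<zeta> = p' (Zi \<zeta>)" for \<zeta>
  define G where "G \<zeta> = g' (Zi \<zeta>)" for \<zeta>
  have linP: "linear P" and linG: "linear G"
    using linear_compose[OF linZi has_derivative_linear[OF dp]] linear_compose[OF linZi has_derivative_linear[OF dg]]
    by (simp_all add: P_def[abs_def] G_def[abs_def] o_def)
  have sym: "cdot (P \<zeta>) \<omega> + cdot (G \<zeta>) (cnjv \<omega>) = cdot (P \<omega>) \<zeta> + cdot (G \<omega>) (cnjv \<zeta>)" for \<zeta> \<omega>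
    using D2eq[of "Zi \<omega>" "Zi \<zeta>"] D2eq[of "Zi \<zeta>" "Zi \<omega>"] D2sym[of "Zi \<zeta>" "Zi \<omega>"]
    by (simp add: ZZi P_def G_def)
  note mats = symmetric_form_mats[OF linP linG sym]
  define C where "C = lmat P"
  define m where "m = (lmat G, amat G)"
  have Geq: "G \<zeta> = rop m \<zeta>" and Peq: "P \<zeta> = C *v \<zeta> + transpose (fst m) *v cnjv \<zeta>" for \<zeta>
    using rop_mats[OF linG, of \<zeta>] rop_mats[OF linP, of \<zeta>] mats(2) by (simp_all add: m_def C_def rop_def)
  have symC: "transpose C = C" and symB: "transpose (snd m) = snd m" using mats by (simp_all add: C_def m_def)
  have gv: "g' v = rop m (fst (D x0 v))" and pv: "p' v = C *v fst (D x0 v) + transpose (fst m) *v cnjv (fst (D x0 v))" for v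
    using Geq[of "fst (D x0 v)"] Peq[of "fst (D x0 v)"] by (simp_all add: G_def P_def ZiZ)
  have "inj (rop m)"
  proof (rule injI)
    fix a b assume "rop m a = rop m b"
    then have "Zi a = Zi b" using Geq ig by (simp add: G_def inj_def flip: Geq)
    then show "a = b" using ZZi by metis
  qed
  then have nd: "nondeg m" using symB by (simp add: nondeg_def)
  define z0 where "z0 = zc c d f x0"
  define q where "q z = wc c d f x0 + cdot (pp x0) (z - z0) + (1/2) *\<^sub>R cdot (z - z0) (C *v (z - z0))" for z
  define q' where "q' z \<zeta> = cdot (pp x0 + C *v (z - z0)) \<zeta>" for z \<zeta>
  have dq: "(q has_derivative q' z) (at z)" for z
  proof -
    have a: "((\<lambda>z. z - z0) has_derivative (\<lambda>\<zeta>. \<zeta>)) (at z)"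
      using has_derivative_diff[OF has_derivative_ident has_derivative_const[of z0]] by simp
    have b: "((\<lambda>z. C *v (z - z0)) has_derivative (\<lambda>\<zeta>. C *v \<zeta>)) (at z)"
      by (rule bounded_linear.has_derivative[OF bounded_linear_matrix_vector a])
    have "(q has_derivative (\<lambda>\<zeta>. 0 + cdot (pp x0) \<zeta> + (1/2) *\<^sub>R (cdot (z - z0) (C *v \<zeta>) + cdot \<zeta> (C *v (z - z0))))) (at z)"
      unfolding q_def
      by (intro has_derivative_add has_derivative_const has_derivative_scaleR_right a
          bounded_bilinear.FDERIV[OF bounded_bilinear_cdot a b]
          bounded_linear.has_derivative[OF bounded_bilinear.bounded_linear_right[OF bounded_bilinear_cdot] a])
    moreover have "0 + cdot (pp x0) \<zeta> + (1/2) *\<^sub>R (cdot (z - z0) (C *v \<zeta>) + cdot \<zeta> (C *v (z - z0))) = q' z \<zeta>" for \<zeta>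
      using cdot_matrix_transpose[of "z - z0" C \<zeta>] cdot_commute[of \<zeta> "C *v (z - z0)"]
      by (simp add: symC q'_def cdot_add scaleR_conv_of_real)
    ultimately show ?thesis by simp
  qed
  have "q' z (\<i> *s v) = \<i> * q' z v" for z v
    by (simp add: q'_def cdot_def sum_distrib_left mult_ac)
  then have hq: "\<exists>q'. (q has_derivative q') (at z) \<and> (\<forall>v. q' (\<i> *s v) = \<i> * q' v)" for z using dq[of z] by blast
  define d' where "d' = (fst d, \<lambda>p. (fst (snd d p) - z0, snd (snd d p) - q (fst (snd d p))))"
  have d': "hc d'" unfolding d'_def by (rule hc_shear[OF cd(2) hq])
  have rep: "local_rep c d' f x = (zc c d f x - z0, wc c d f x - q (zc c d f x))" for x
    by (simp add: local_rep_def d'_def)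
  have Drep: "(local_rep c d' f has_derivative (\<lambda>v. (fst (D x v), snd (D x v) - q' (zc c d f x) (fst (D x v))))) (at x)"
    if x: "x \<in> ball x0 r" for x
  proof -
    have "((\<lambda>x. (zc c d f x - z0, wc c d f x - q (zc c d f x))) has_derivative
        (\<lambda>v. (fst (D x v) - 0, snd (D x v) - q' (zc c d f x) (fst (D x v))))) (at x)"
      by (intro has_derivative_Pair has_derivative_diff has_derivative_const has_derivative_fst has_derivative_snd
          du[OF x] has_derivative_compose[OF has_derivative_fst[OF du[OF x]] dq])
    moreover have "local_rep c d' f = (\<lambda>x. (zc c d f x - z0, wc c d f x - q (zc c d f x)))"
      by (rule ext) (rule rep)
    ultimately show ?thesis by simp
  qed
  have D': "frechet_derivative (local_rep c d' f) (at x) = (\<lambda>v. (fst (D x v), snd (D x v) - q' (zc c d f x) (fst (D x v))))"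
    if "x \<in> ball x0 r" for x by (rule frechet_derivative_at[OF Drep[OF that], symmetric])
  have gr': "graphical (frechet_derivative (local_rep c d' f) (at x))" if x: "x \<in> ball x0 r" for x
    using gr[OF x] has_derivative_linear[OF Drep[OF x]] by (simp add: graphical_def D'[OF x])
  define zh where "zh x = zc c d f x - z0" for x
  \<comment> \<open>The holomorphic gradient in the sheared chart; the antiholomorphic one is
    unchanged (\<open>db'\<close>) because \<open>q\<close> is holomorphic.\<close>
  define ph where "ph x = pp x - pp x0 - C *v zh x" for x
  have db': "dbar c d' f x = g x" if x: "x \<in> ball x0 r" for x
    by (rule graphical_eqI(2)[OF gr'[OF x], of "ph x"])
      (simp add: D'[OF x] repr[OF x] q'_def ph_def zh_def cdot_add algebra_simps)
  have dzh: "(zh has_derivative (\<lambda>v. fst (D x v))) (at x)" if x: "x \<in> ball x0 r" for x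
    using has_derivative_diff[OF has_derivative_fst[OF du[OF x]] has_derivative_const[of z0]]
    by (simp add: zh_def[abs_def])
  have zh0: "zh x0 = 0" by (simp add: zh_def z0_def)
  have lo1: "((\<lambda>x. g x - rop m (zh x)) has_derivative (\<lambda>v. 0)) (at x0)"
    using has_derivative_diff[OF dg bounded_linear.has_derivative[OF
        bounded_bilinear.bounded_linear_right[OF bounded_bilinear_rop, of m] dzh[OF x0r]]] by (simp add: gv)
  have lo2: "((\<lambda>x. ph x - transpose (fst m) *v cnjv (zh x)) has_derivative (\<lambda>v. 0)) (at x0)"
    using has_derivative_diff[OF has_derivative_diff[OF has_derivative_diff[OF dp has_derivative_const[of "pp x0"]]
        bounded_linear.has_derivative[OF bounded_linear_matrix_vector dzh[OF x0r], of C]]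
        bounded_linear.has_derivative[OF bounded_linear_matrix_vector
          bounded_linear.has_derivative[OF bounded_linear_cnjv dzh[OF x0r]], of "transpose (fst m)"]]
    by (simp add: pv ph_def[abs_def])
  define L where "L = m0 + (\<Sum>b\<in>Basis. norm (Z0 b))"
  have m0: "m0 > 0" by (rule pk(9))
  have L: "norm (fst (D x v)) \<le> L * norm v" "L > 0" if x: "x \<in> ball x0 r" for x v
  proof -
    have sl: "(\<Sum>b\<in>Basis. norm (fst (D x b) - Z0 b)) < m0" using p x sub by (auto simp: patch_ok_def D_def)
    have "(\<Sum>b\<in>Basis. norm (fst (D x b))) \<le> (\<Sum>b\<in>Basis. norm (fst (D x b) - Z0 b) + norm (Z0 b))"
      by (intro sum_mono) (metis diff_add_cancel norm_triangle_ineq)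
    also have "\<dots> \<le> L" using sl by (simp add: L_def sum.distrib)
    finally have "(\<Sum>b\<in>Basis. norm (fst (D x b))) \<le> L" .
    then show "norm (fst (D x v)) \<le> L * norm v"
      by (intro order_trans[OF norm_linear_le_sum_Basis[OF linear_fst_comp[OF graphicalD(1)[OF gr[OF x]]]]] mult_right_mono) auto
    show "L > 0" using m0 by (simp add: L_def add_pos_nonneg sum_nonneg)
  qed
  have low: "m0 * norm (x - x0) \<le> norm (zh x)" if "x \<in> ball x0 r" for x
    using pk(7)[of x x0] that sub x0r by (auto simp: zh_def z0_def)
  \<comment> \<open>Both gradients of \<open>k\<close> are small compared with the distance to
    \<open>x0\<close> (\<open>lo1\<close>, \<open>lo2\<close>). So the mean value inequality makes
    \<open>k\<close> small compared with its square, and \<open>low\<close> turns the distance into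
    \<open>norm (zh x)\<close>.\<close>
  define k where "k x = wc c d' f x - qform m (zh x)" for x
  have dk: "(k has_derivative (\<lambda>v. cdot (ph x - transpose (fst m) *v cnjv (zh x)) (fst (D x v))
      + cdot (g x - rop m (zh x)) (cnjv (fst (D x v))))) (at x)" if x: "x \<in> ball x0 r" for x
  proof -
    have "(k has_derivative (\<lambda>v. (snd (D x v) - q' (zc c d f x) (fst (D x v))) -
        (cdot (transpose (fst m) *v cnjv (zh x)) (fst (D x v)) + cdot (rop m (zh x)) (cnjv (fst (D x v)))))) (at x)"
      unfolding k_def using has_derivative_diff[OF has_derivative_snd[OF Drep[OF x]] qform_deriv[OF symB dzh[OF x]]] by simp
    moreover have "(snd (D x v) - q' (zc c d f x) (fst (D x v))) -
        (cdot (transpose (fst m) *v cnjv (zh x)) (fst (D x v)) + cdot (rop m (zh x)) (cnjv (fst (D x v))))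
      = cdot (ph x - transpose (fst m) *v cnjv (zh x)) (fst (D x v)) + cdot (g x - rop m (zh x)) (cnjv (fst (D x v)))" for v
      by (simp add: repr[OF x] q'_def ph_def zh_def cdot_add algebra_simps)
    ultimately show ?thesis by simp
  qed
  have k0: "k x0 = 0" by (simp add: k_def rep zh0 q_def z0_def[symmetric] qform_def cdot_add cnjv_def rop_def cdot_def)
  have gc: "graph_chart f y c d'"
    using cd d' gr'[OF x0r] rep[of x0] by (simp add: graph_chart_def d'_def x0_def[symmetric] z0_def)
  have zc': "zc c d' f x = zh x" for x by (simp add: rep zh_def)
  have "\<exists>\<rho>>0. \<forall>x\<in>ball x0 \<rho>. cmod (wc c d' f x - qform m (zc c d' f x)) \<le> \<kappa> * (norm (zc c d' f x))\<^sup>2 \<and>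
     norm (dbar c d' f x - rop m (zc c d' f x)) \<le> \<kappa> * norm (zc c d' f x)" if \<kappa>: "\<kappa> > 0" for \<kappa>
  proof -
    have Lp: "L > 0" by (rule L(2)[OF x0r])
    \<comment> \<open>The first entry serves the gradient estimate. The second serves the mean value
      estimate, whose constant is \<open>2 * e * L\<close> times the distance, with \<open>L\<close>
      a bound for the derivative of the \<open>z\<close>-coordinate.\<close>
    define e where "e = min (\<kappa> * m0) (\<kappa> * m0\<^sup>2 / (2 * L))"
    have e: "e > 0" "e \<le> \<kappa> * m0" "2 * e * L \<le> \<kappa> * m0\<^sup>2"
    proof -
      show "e > 0" using \<kappa> m0 Lp by (simp add: e_def)
      show "e \<le> \<kappa> * m0" by (simp add: e_def)
      have "e \<le> \<kappa> * m0\<^sup>2 / (2 * L)" by (simp add: e_def)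
      then show "2 * e * L \<le> \<kappa> * m0\<^sup>2" using Lp by (simp add: field_simps)
    qed
    obtain \<rho>1 where \<rho>1: "\<rho>1 > 0" "\<And>x. norm (x - x0) < \<rho>1 \<Longrightarrow> norm (g x - rop m (zh x)) \<le> e * norm (x - x0)"
      using lo1 e(1) unfolding has_derivative_at_alt
      by (auto simp: g0 zh0 linear_0[OF linear_rop])
    obtain \<rho>2 where \<rho>2: "\<rho>2 > 0" "\<And>x. norm (x - x0) < \<rho>2 \<Longrightarrow> norm (ph x - transpose (fst m) *v cnjv (zh x)) \<le> e * norm (x - x0)"
      using lo2 e(1) unfolding has_derivative_at_alt
      by (auto simp: ph_def zh0 linear_0[OF bounded_linear.linear[OF bounded_linear_cnjv]])
    define \<rho> where "\<rho> = min r (min \<rho>1 \<rho>2)"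
    have "cmod (wc c d' f x - qform m (zc c d' f x)) \<le> \<kappa> * (norm (zc c d' f x))\<^sup>2 \<and>
     norm (dbar c d' f x - rop m (zc c d' f x)) \<le> \<kappa> * norm (zc c d' f x)" if x: "x \<in> ball x0 \<rho>" for x
    proof
      have xr: "x \<in> ball x0 r" and xn: "norm (x - x0) < \<rho>1" "norm (x - x0) < \<rho>2"
        using x by (auto simp: \<rho>_def dist_norm norm_minus_commute)
      have "norm (dbar c d' f x - rop m (zc c d' f x)) \<le> e * norm (x - x0)"
        using \<rho>1(2)[OF xn(1)] db'[OF xr] zc' by simp
      also have "\<dots> \<le> \<kappa> * (m0 * norm (x - x0))" using e(2) by (simp add: mult_right_mono flip: mult.assoc)
      also have "\<dots> \<le> \<kappa> * norm (zc c d' f x)" using low[OF xr] \<kappa> zc' by (simp add: mult_left_mono)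
      finally show "norm (dbar c d' f x - rop m (zc c d' f x)) \<le> \<kappa> * norm (zc c d' f x)" .
      let ?R = "norm (x - x0)"
      have sb: "t \<in> ball x0 r" "norm (t - x0) < \<rho>1" "norm (t - x0) < \<rho>2" "norm (t - x0) \<le> ?R" if "t \<in> cball x0 ?R" for t
        using that xr xn by (auto simp: dist_norm norm_minus_commute)
      have "norm (k x - k x0) \<le> 2 * e * ?R * L * norm (x - x0)"
      proof (rule differentiable_bound[OF convex_cball, of x0 ?R])
        show "(k has_derivative (\<lambda>v. cdot (ph t - transpose (fst m) *v cnjv (zh t)) (fst (D t v))
            + cdot (g t - rop m (zh t)) (cnjv (fst (D t v))))) (at t within cball x0 ?R)" if "t \<in> cball x0 ?R" for t
          by (rule has_derivative_at_withinI[OF dk[OF sb(1)[OF that]]])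
        show "onorm (\<lambda>v. cdot (ph t - transpose (fst m) *v cnjv (zh t)) (fst (D t v))
            + cdot (g t - rop m (zh t)) (cnjv (fst (D t v)))) \<le> 2 * e * ?R * L" if t: "t \<in> cball x0 ?R" for t
        proof (rule onorm_le)
          fix v
          note s = sb[OF t]
          have er: "e * norm (t - x0) \<le> e * ?R" using e(1) s(4) by simp
          have n1: "norm (ph t - transpose (fst m) *v cnjv (zh t)) \<le> e * ?R"
            by (rule order_trans[OF \<rho>2(2)[OF s(3)] er])
          have n2: "norm (g t - rop m (zh t)) \<le> e * ?R" by (rule order_trans[OF \<rho>1(2)[OF s(2)] er])
          have "norm (cdot (ph t - transpose (fst m) *v cnjv (zh t)) (fst (D t v))) \<le> e * ?R * (L * norm v)"
            by (intro order_trans[OF norm_cdot_le] mult_mono n1 L(1)[OF s(1)]) (use e(1) in auto)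
          moreover have "norm (cdot (g t - rop m (zh t)) (cnjv (fst (D t v)))) \<le> e * ?R * (L * norm v)"
            by (intro order_trans[OF norm_cdot_le] mult_mono n2) (use e(1) L(1)[OF s(1)] in auto)
          ultimately show "norm (cdot (ph t - transpose (fst m) *v cnjv (zh t)) (fst (D t v))
            + cdot (g t - rop m (zh t)) (cnjv (fst (D t v)))) \<le> 2 * e * ?R * L * norm v"
            using norm_triangle_ineq[of "cdot (ph t - transpose (fst m) *v cnjv (zh t)) (fst (D t v))"
                "cdot (g t - rop m (zh t)) (cnjv (fst (D t v)))"] by (simp add: algebra_simps)
        qed
      qed (auto simp: dist_norm norm_minus_commute)
      then have "cmod (k x) \<le> (2 * e * L) * ?R\<^sup>2" by (simp add: k0 power2_eq_square mult_ac)
      also have "\<dots> \<le> \<kappa> * (m0 * ?R)\<^sup>2" using e(3) by (simp add: power_mult_distrib mult_right_mono flip: mult.assoc)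
      also have "\<dots> \<le> \<kappa> * (norm (zc c d' f x))\<^sup>2"
        using low[OF xr] \<kappa> zc' m0 by (intro mult_left_mono power_mono) auto
      finally show "cmod (wc c d' f x - qform m (zc c d' f x)) \<le> \<kappa> * (norm (zc c d' f x))\<^sup>2"
        by (simp add: k_def zc')
    qed
    then show ?thesis using pk(3) \<rho>1(1) \<rho>2(1) by (intro exI[of _ \<rho>]) (auto simp: \<rho>_def)
  qed
  then have "oscul f y m" unfolding oscul_def using gc unfolding x0_def by blast
  then show ?thesis using that nd by blast
qed

section \<open>Replacing the jet at one complex point by means of a cutoff\<close>

lemma real_inner_cdot: "(of_real (z \<bullet> \<zeta>) :: complex) = (1/2) * (cdot (cnjv z) \<zeta> + cdot z (cnjv \<zeta>))"
proof -
  have e: "(of_real (z $ k \<bullet> \<zeta> $ k) :: complex) = (1/2) * (cnj (z $ k) * \<zeta> $ k + z $ k * cnj (\<zeta> $ k))" for k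
    by (simp add: complex_eq_iff inner_complex_def)
  show ?thesis
    by (simp add: inner_vec_def e cdot_def cnjv_def sum_distrib_left flip: sum.distrib)
qed

text \<open>The cutoff depends on \<open>|z|/\<epsilon>\<close>. Its derivative is of order \<open>1/|z|\<close>, while the function that it
  multiplies is at most a small multiple of \<open>|z|^2\<close>; so the antiholomorphic gradient
  stays within a small multiple of \<open>|z|\<close> of \<open>rop m z\<close>, and no new zeros appear.\<close>

lemma modify_jet:
  fixes \<mu> \<kappa>' S :: real
  assumes f: "embd f" and N: "openin (C0_topology Y X) N" "f \<in> N" and osc: "oscul f y m"
    and W: "openin Y W" "y \<in> W" and m: "transpose (snd m) = snd m" "transpose (snd m') = snd m'"
    and \<mu>: "\<And>z. \<mu> * norm z \<le> norm (rop m z)"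
    and m': "\<And>z. norm (rop m' z - rop m z) \<le> \<kappa>' * norm z" "\<And>z. cmod (qform m' z - qform m z) \<le> \<kappa>' * (norm z)\<^sup>2"
    and S: "\<And>x. (smooth_step has_field_derivative s' x) (at x)" "\<And>x. \<bar>s' x\<bar> \<le> S" "\<And>x. x \<le> 0 \<Longrightarrow> s' x = 0"
    and close: "\<kappa>' * (1 + 2 * S) < \<mu>" and \<kappa>'0: "0 \<le> \<kappa>'" and S0: "0 \<le> S"
  obtains g K where "embd g" "g \<in> N" "reach N f g" "normal_at g y m'"
    "closedin Y K" "K \<subseteq> W" "\<And>y'. y' \<in> topspace Y - K \<Longrightarrow> g y' = f y'"
    "\<And>y'. y' \<in> topspace Y \<Longrightarrow> cpt g y' \<longleftrightarrow> cpt f y'"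
proof -
  have sf: "smf f" using f by (simp add: embd_def)
  obtain c d where gc: "graph_chart f y c d" and osc': "\<forall>\<kappa>>0. \<exists>\<rho>>0. \<forall>x\<in>ball (snd c y) \<rho>.
     cmod (wc c d f x - qform m (zc c d f x)) \<le> \<kappa> * (norm (zc c d f x))\<^sup>2 \<and>
     norm (dbar c d f x - rop m (zc c d f x)) \<le> \<kappa> * norm (zc c d f x)"
    using osc unfolding oscul_def by blast
  have cd: "c \<in> B" "hc d" "y \<in> fst c" "f y \<in> fst d" "graphical (drep c d f y)" "zc c d f (snd c y) = 0"
    using gc by (auto simp: graph_chart_def)
  define x0 where "x0 = snd c y"
  obtain r Z m0 where p: "patch_ok f (c, d, x0, r, Z, m0)" and rW: "cinv c ` cball x0 r \<subseteq> W"
    unfolding x0_def by (rule small_patch[OF sf gc W]) blast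
  note pk = patch_okD[OF sf p]
  define s where "s = r / 2"
  have s: "0 < s" "s < r" using pk(3) by (auto simp: s_def)
  have gp: "graph_patch Y B X A f c d x0 r s" by (rule patch_ok_graph_patch[OF f p s])
  interpret gp: graph_patch Y B X A f c d x0 r s by (rule gp)
  let ?u = "local_rep c d f"
  define z where "z x = zc c d f x" for x
  define w where "w x = wc c d f x" for x
  define g where "g x = dbar c d f x" for x
  have yx0: "cinv c x0 = y" unfolding x0_def by (rule chart_cinv(1)[OF gp.ic cd(3)])
  have x0r: "x0 \<in> ball x0 r" using pk(3) by simp
  have z0: "z x0 = 0" using cd(6) by (simp add: z_def x0_def)
  have m0: "0 < m0" by (rule pk(9))
  have low: "m0 * norm (x - x0) \<le> norm (z x)" if "x \<in> ball x0 r" for x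
    using pk(7)[of x x0] that x0r z0 by (simp add: z_def)
  \<comment> \<open>The slack in \<open>close\<close> is halved: with osculation up to
    \<open>\<kappa>\<close> the total relative error stays below \<open>\<mu>\<close>.\<close>
  define \<kappa> where "\<kappa> = (\<mu> - \<kappa>' * (1 + 2 * S)) / (2 * (1 + 2 * S))"
  have S1: "1 + 2 * S > 0" using S0 by simp
  have \<kappa>: "\<kappa> > 0" "(\<kappa> + \<kappa>') * (1 + 2 * S) < \<mu>"
  proof -
    show "\<kappa> > 0" using close S1 by (simp add: \<kappa>_def)
    have "\<kappa> * (1 + 2 * S) = (\<mu> - \<kappa>' * (1 + 2 * S)) / 2" using S1 by (simp add: \<kappa>_def field_simps)
    then show "(\<kappa> + \<kappa>') * (1 + 2 * S) < \<mu>" using close by (simp add: distrib_right)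
  qed
  obtain \<rho>0 where \<rho>0: "\<rho>0 > 0" "\<forall>x\<in>ball x0 \<rho>0. cmod (w x - qform m (z x)) \<le> \<kappa> * (norm (z x))\<^sup>2 \<and>
     norm (g x - rop m (z x)) \<le> \<kappa> * norm (z x)"
    using osc'[rule_format, OF \<kappa>(1)] unfolding w_def z_def g_def x0_def by blast
  define \<rho> where "\<rho> = min \<rho>0 s"
  have \<rho>: "\<rho> > 0" "\<rho> \<le> s" "\<rho> \<le> \<rho>0" using \<rho>0(1) s by (auto simp: \<rho>_def)
  obtain \<delta> where \<delta>: "\<delta> > 0" "\<forall>\<eta>. Cinf \<eta> (ball x0 r) \<and> (\<forall>x\<in>ball x0 r - cball x0 s. \<eta> x = 0) \<and>
    (\<forall>x\<in>ball x0 r. cmod (\<eta> x) < \<delta>) \<longrightarrow>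
    gp.adm \<eta> \<and> embd (push c d x0 r f \<eta>) \<and> push c d x0 r f \<eta> \<in> N \<and> reach N f (push c d x0 r f \<eta>)"
    using gp.push_reach[OF N] by blast
  \<comment> \<open>Through \<open>low\<close>, the first bound puts the points with
    \<open>norm (z x)^2 \<le> 2 \<epsilon>^2\<close> where the osculation estimates hold; the second
    makes the displacement smaller than \<open>\<delta>\<close>.\<close>
  define \<epsilon> where "\<epsilon> = min (m0 * \<rho> / 2) (sqrt (\<delta> / (4 * (\<kappa> + \<kappa>'))))"
  have kk: "\<kappa> + \<kappa>' > 0" using \<kappa>(1) \<kappa>'0 by simp
  have \<epsilon>: "\<epsilon> > 0" "\<epsilon> \<le> m0 * \<rho> / 2" "(\<kappa> + \<kappa>') * (2 * \<epsilon>\<^sup>2) < \<delta>"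
  proof -
    show "\<epsilon> > 0" using m0 \<rho>(1) \<delta>(1) kk by (simp add: \<epsilon>_def)
    then have "\<epsilon>\<^sup>2 \<le> (sqrt (\<delta> / (4 * (\<kappa> + \<kappa>'))))\<^sup>2" by (intro power_mono) (simp_all add: \<epsilon>_def)
    also have "\<dots> = \<delta> / (4 * (\<kappa> + \<kappa>'))" using \<delta>(1) kk by simp
    finally have "(\<kappa> + \<kappa>') * (2 * \<epsilon>\<^sup>2) \<le> (\<kappa> + \<kappa>') * (2 * (\<delta> / (4 * (\<kappa> + \<kappa>'))))" using kk by (intro mult_left_mono) auto
    also have "\<dots> = \<delta> / 2" using kk by (simp add: field_simps)
    also have "\<dots> < \<delta>" using \<delta>(1) by simp
    finally show "(\<kappa> + \<kappa>') * (2 * \<epsilon>\<^sup>2) < \<delta>" .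
  qed (simp add: \<epsilon>_def)
  have near: "x \<in> ball x0 \<rho>" if x: "x \<in> ball x0 r" "(norm (z x))\<^sup>2 \<le> 2 * \<epsilon>\<^sup>2" for x
  proof -
    have "(m0 * norm (x - x0))\<^sup>2 \<le> (norm (z x))\<^sup>2" using low[OF x(1)] m0 by (intro power_mono) auto
    also have "\<dots> \<le> 2 * (m0 * \<rho> / 2)\<^sup>2" using x(2) \<epsilon>(1,2) power_mono[OF \<epsilon>(2), of 2] by linarith
    also have "\<dots> < (m0 * \<rho>)\<^sup>2" using m0 \<rho>(1) by (simp add: power2_eq_square field_simps)
    finally have "m0 * norm (x - x0) < m0 * \<rho>" using m0 \<rho>(1) by (simp add: power2_less_imp_less)
    then show ?thesis using m0 by (simp add: dist_norm norm_minus_commute)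
  qed
  \<comment> \<open>A function of the squared norm, hence smooth also at \<open>z = 0\<close>. The
    cutoff \<open>smooth_step (a x)\<close> is 1 for \<open>norm (z x) \<le> \<epsilon>\<close> and
    0 from \<open>sqrt 2 * \<epsilon>\<close> on.\<close>
  define a where "a x = 2 - inverse (\<epsilon>\<^sup>2) * (z x \<bullet> z x)" for x
  have a0: "a x \<le> 0 \<longleftrightarrow> 2 * \<epsilon>\<^sup>2 \<le> (norm (z x))\<^sup>2" and a1: "a x \<ge> 1 \<longleftrightarrow> (norm (z x))\<^sup>2 \<le> \<epsilon>\<^sup>2" for x
    using \<epsilon>(1) by (simp_all add: a_def power2_norm_eq_inner field_simps)
  define \<eta> where "\<eta> x = of_real (smooth_step (a x)) * (qform m' (z x) - w x)" for x
  have zC: "Cinf z (ball x0 r)" and wC: "Cinf w (ball x0 r)"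
    unfolding z_def w_def by (rule Cinf_fst[OF gp.u_Cinf], rule Cinf_snd[OF gp.u_Cinf])
  have aC: "Cinf a (ball x0 r)"
    unfolding a_def by (intro Cinf_diff Cinf_const open_ball Cinf_mult Cinf_bilinear[OF bounded_bilinear_inner zC zC])
  have \<eta>C: "Cinf \<eta> (ball x0 r)"
    unfolding \<eta>_def
    by (intro Cinf_mult Cinf_linear_compose[OF bounded_linear_of_real] Cinf_compose[OF aC Cinf_smooth_step]
        Cinf_diff Cinf_qform zC wC) auto
  have \<eta>0: "\<eta> x = 0" if "2 * \<epsilon>\<^sup>2 \<le> (norm (z x))\<^sup>2" for x
    using smooth_step_0 a0 that by (simp add: \<eta>_def)
  have diffb: "cmod (qform m' (z x) - w x) \<le> (\<kappa> + \<kappa>') * (norm (z x))\<^sup>2" if "x \<in> ball x0 \<rho>" for x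
  proof -
    have "cmod (qform m' (z x) - w x) \<le> cmod (qform m' (z x) - qform m (z x)) + cmod (w x - qform m (z x))"
      using norm_triangle_ineq4[of "qform m' (z x) - qform m (z x)" "w x - qform m (z x)"] by simp
    also have "\<dots> \<le> \<kappa>' * (norm (z x))\<^sup>2 + \<kappa> * (norm (z x))\<^sup>2"
      using m'(2)[of "z x"] \<rho>0(2) that \<rho>(3) by (intro add_mono) auto
    finally show ?thesis by (simp add: algebra_simps)
  qed
  have \<eta>s: "\<eta> x = 0" if "x \<in> ball x0 r - cball x0 s" for x
  proof (rule \<eta>0, rule ccontr)
    assume "\<not> 2 * \<epsilon>\<^sup>2 \<le> (norm (z x))\<^sup>2"
    then have "x \<in> ball x0 \<rho>" using near[of x] that by simp
    then show False using that \<rho>(2) by auto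
  qed
  have \<eta>b: "cmod (\<eta> x) < \<delta>" if x: "x \<in> ball x0 r" for x
  proof (cases "2 * \<epsilon>\<^sup>2 \<le> (norm (z x))\<^sup>2")
    case True
    then show ?thesis using \<eta>0[OF True] \<delta>(1) by simp
  next
    case False
    then have xn: "x \<in> ball x0 \<rho>" using near[OF x] by simp
    have "cmod (\<eta> x) = smooth_step (a x) * cmod (qform m' (z x) - w x)"
      using smooth_step_bounds(1)[of "a x"] by (simp add: \<eta>_def norm_mult)
    also have "\<dots> \<le> 1 * ((\<kappa> + \<kappa>') * (norm (z x))\<^sup>2)"
      using smooth_step_bounds diffb[OF xn] by (intro mult_mono) auto
    also have "\<dots> \<le> (\<kappa> + \<kappa>') * (2 * \<epsilon>\<^sup>2)" using False kk by simp
    finally show ?thesis using \<epsilon>(3) by simp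
  qed
  define f' where "f' = push c d x0 r f \<eta>"
  have adm: "gp.adm \<eta>" and f': "embd f'" "f' \<in> N" "reach N f f'"
    using \<delta>(2) \<eta>C \<eta>s \<eta>b by (auto simp: f'_def)
  have sf': "smf f'" using f'(1) by (simp add: embd_def)
  have rep': "local_rep c d f' x = (z x, w x + \<eta> x)" "f' (cinv c x) \<in> fst d" if "x \<in> ball x0 r" for x
    using gp.rep_push[OF adm that] by (auto simp: f'_def z_def w_def prod_eq_iff)
  have gr': "graphical (frechet_derivative (local_rep c d f') (at x))" if "x \<in> ball x0 r" for x
    using dbar_push(2)[OF gp adm that] by (simp add: f'_def)
  \<comment> \<open>Product rule for \<open>\<eta>\<close>. The last term is due to the cutoff: the
    antiholomorphic gradient of the squared norm of \<open>z\<close> is \<open>z\<close>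
    itself.\<close>
  have db: "dbar c d f' x = g x + smooth_step (a x) *\<^sub>R (rop m' (z x) - g x)
      - (of_real (s' (a x) * inverse (\<epsilon>\<^sup>2)) * (qform m' (z x) - w x)) *s z x" if x: "x \<in> ball x0 r" for x
  proof -
    let ?D = "frechet_derivative ?u (at x)"
    note gx = gp.gr[OF x]
    have D: "(?u has_derivative ?D) (at x)" by (rule gp.u_deriv[OF x])
    have dz: "(z has_derivative (\<lambda>v. fst (?D v))) (at x)" and dw: "(w has_derivative (\<lambda>v. snd (?D v))) (at x)"
      unfolding z_def w_def by (rule has_derivative_fst[OF D], rule has_derivative_snd[OF D])
    have da: "(a has_derivative (\<lambda>v. 0 - inverse (\<epsilon>\<^sup>2) * (z x \<bullet> fst (?D v) + fst (?D v) \<bullet> z x))) (at x)"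
      unfolding a_def
      by (intro has_derivative_diff has_derivative_const has_derivative_mult_right
          bounded_bilinear.FDERIV[OF bounded_bilinear_inner dz dz])
    have ds: "((\<lambda>x. smooth_step (a x)) has_derivative
        (\<lambda>v. s' (a x) * (0 - inverse (\<epsilon>\<^sup>2) * (z x \<bullet> fst (?D v) + fst (?D v) \<bullet> z x)))) (at x)"
      by (rule has_derivative_compose[OF da, of smooth_step "(*) (s' (a x))"])
        (use S(1) in \<open>simp add: has_field_derivative_def\<close>)
    have d\<eta>: "(\<eta> has_derivative (\<lambda>v. of_real (smooth_step (a x)) *
          ((cdot (transpose (fst m') *v cnjv (z x)) (fst (?D v)) + cdot (rop m' (z x)) (cnjv (fst (?D v)))) - snd (?D v))
        + of_real (s' (a x) * (0 - inverse (\<epsilon>\<^sup>2) * (z x \<bullet> fst (?D v) + fst (?D v) \<bullet> z x))) * (qform m' (z x) - w x))) (at x)"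
      unfolding \<eta>_def
      by (intro has_derivative_mult has_derivative_of_real ds has_derivative_diff qform_deriv[OF m(2) dz] dw)
    define Zi where "Zi = inv (\<lambda>v. fst (?D v))"
    have Zi: "fst (?D (Zi \<zeta>)) = \<zeta>" for \<zeta> unfolding Zi_def by (rule graphicalD(5)[OF gx])
    let ?c = "of_real (s' (a x) * inverse (\<epsilon>\<^sup>2)) * (qform m' (z x) - w x)"
    let ?G = "smooth_step (a x) *\<^sub>R (rop m' (z x) - g x) - ?c *s z x"
    let ?P = "smooth_step (a x) *\<^sub>R (transpose (fst m') *v cnjv (z x) - dz_part ?D) - ?c *s cnjv (z x)"
    have "frechet_derivative \<eta> (at x) (Zi \<zeta>) = cdot ?P \<zeta> + cdot ?G (cnjv \<zeta>)" for \<zeta>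
    proof -
      have sn: "snd (?D (Zi \<zeta>)) = cdot (dz_part ?D) \<zeta> + cdot (g x) (cnjv \<zeta>)"
        using graphical_repr[OF gx, of "Zi \<zeta>"] Zi by (simp add: g_def)
      have inn: "complex_of_real (s' (a x) * (0 - inverse (\<epsilon>\<^sup>2) * (z x \<bullet> \<zeta> + \<zeta> \<bullet> z x)))
          = - (of_real (s' (a x) * inverse (\<epsilon>\<^sup>2)) * (cdot (cnjv (z x)) \<zeta> + cdot (z x) (cnjv \<zeta>)))"
      proof -
        have "s' (a x) * (0 - inverse (\<epsilon>\<^sup>2) * (z x \<bullet> \<zeta> + \<zeta> \<bullet> z x)) = - (s' (a x) * inverse (\<epsilon>\<^sup>2)) * (2 * (z x \<bullet> \<zeta>))"
          by (simp add: inner_commute)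
        note e1 = this
        have e2: "2 * complex_of_real (z x \<bullet> \<zeta>) = cdot (cnjv (z x)) \<zeta> + cdot (z x) (cnjv \<zeta>)"
          by (simp add: real_inner_cdot)
        show ?thesis unfolding e1 by (simp only: of_real_mult of_real_minus of_real_numeral e2 mult_minus_left)
      qed
      have "frechet_derivative \<eta> (at x) = (\<lambda>v. of_real (smooth_step (a x)) *
          ((cdot (transpose (fst m') *v cnjv (z x)) (fst (?D v)) + cdot (rop m' (z x)) (cnjv (fst (?D v)))) - snd (?D v))
        + of_real (s' (a x) * (0 - inverse (\<epsilon>\<^sup>2) * (z x \<bullet> fst (?D v) + fst (?D v) \<bullet> z x))) * (qform m' (z x) - w x))"
        by (rule frechet_derivative_at[OF d\<eta>, symmetric])
      then have "frechet_derivative \<eta> (at x) (Zi \<zeta>) = of_real (smooth_step (a x)) *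
          ((cdot (transpose (fst m') *v cnjv (z x)) \<zeta> + cdot (rop m' (z x)) (cnjv \<zeta>)) - (cdot (dz_part ?D) \<zeta> + cdot (g x) (cnjv \<zeta>)))
        + (- (of_real (s' (a x) * inverse (\<epsilon>\<^sup>2)) * (cdot (cnjv (z x)) \<zeta> + cdot (z x) (cnjv \<zeta>)))) * (qform m' (z x) - w x)"
        by (simp only: Zi sn inn)
      then show ?thesis
        by (simp only: cdot_add scaleR_conv_of_real[where 'a=complex]) (simp add: algebra_simps)
    qed
    then have "antilin_part (\<lambda>\<zeta>. frechet_derivative \<eta> (at x) (Zi \<zeta>)) = ?G" by (rule antilin_part_eqI)
    then show ?thesis using dbar_push(1)[OF gp adm x] by (simp add: f'_def g_def Zi_def)
  qed
  have out: "dbar c d f' x = g x" if "x \<in> ball x0 r" "2 * \<epsilon>\<^sup>2 \<le> (norm (z x))\<^sup>2" for x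
    using db[OF that(1)] that(2) a0[of x] smooth_step_0 S(3) by simp
  have inn: "dbar c d f' x \<noteq> 0 \<and> g x \<noteq> 0"
    if x: "x \<in> ball x0 r" "(norm (z x))\<^sup>2 < 2 * \<epsilon>\<^sup>2" "z x \<noteq> 0" for x
  proof -
    have xn: "x \<in> ball x0 \<rho>" using near x by simp
    have zp: "norm (z x) > 0" using x(3) by simp
    have g1: "norm (g x - rop m (z x)) \<le> \<kappa> * norm (z x)" using \<rho>0(2) xn \<rho>(3) by auto
    let ?\<sigma> = "smooth_step (a x)"
    let ?c = "of_real (s' (a x) * inverse (\<epsilon>\<^sup>2)) * (qform m' (z x) - w x)"
    \<comment> \<open>The first two terms average errors of at most \<open>\<kappa>\<close> and
      \<open>\<kappa>'\<close> times \<open>norm (z x)\<close>. In the third, the factor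
      \<open>1/\<epsilon>^2\<close> is absorbed by \<open>norm (z x)^2 < 2 \<epsilon>^2\<close>,
      which leaves \<open>2 * S\<close> times the sum of the two.\<close>
    have eq: "dbar c d f' x - rop m (z x) = (1 - ?\<sigma>) *\<^sub>R (g x - rop m (z x)) + ?\<sigma> *\<^sub>R (rop m' (z x) - rop m (z x)) - ?c *s z x"
      unfolding db[OF x(1)] by (simp add: algebra_simps)
    have c: "cmod ?c \<le> 2 * S * (\<kappa> + \<kappa>')"
    proof -
      have "cmod ?c = \<bar>s' (a x)\<bar> * inverse (\<epsilon>\<^sup>2) * cmod (qform m' (z x) - w x)"
        by (simp add: norm_mult abs_mult norm_inverse norm_power)
      also have "\<dots> \<le> S * inverse (\<epsilon>\<^sup>2) * ((\<kappa> + \<kappa>') * (2 * \<epsilon>\<^sup>2))"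
      proof (intro mult_mono)
        show "cmod (qform m' (z x) - w x) \<le> (\<kappa> + \<kappa>') * (2 * \<epsilon>\<^sup>2)"
          using diffb[OF xn] x(2) kk by (meson less_imp_le mult_left_mono order_trans)
      qed (use S(2) S0 in auto)
      also have "\<dots> = 2 * S * (\<kappa> + \<kappa>')" using \<epsilon>(1) by (simp add: field_simps)
      finally show ?thesis .
    qed
    have "norm (dbar c d f' x - rop m (z x)) \<le> norm ((1 - ?\<sigma>) *\<^sub>R (g x - rop m (z x)))
        + norm (?\<sigma> *\<^sub>R (rop m' (z x) - rop m (z x))) + norm (?c *s z x)"
      unfolding eq by (meson add_right_mono norm_triangle_ineq norm_triangle_ineq4 order_trans)
    also have "\<dots> \<le> 1 * (\<kappa> * norm (z x)) + 1 * (\<kappa>' * norm (z x)) + 2 * S * (\<kappa> + \<kappa>') * norm (z x)"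
    proof (intro add_mono)
      show "norm ((1 - ?\<sigma>) *\<^sub>R (g x - rop m (z x))) \<le> 1 * (\<kappa> * norm (z x))"
        unfolding norm_scaleR by (intro mult_mono g1) (use smooth_step_bounds[of "a x"] in auto)
      show "norm (?\<sigma> *\<^sub>R (rop m' (z x) - rop m (z x))) \<le> 1 * (\<kappa>' * norm (z x))"
        unfolding norm_scaleR by (intro mult_mono m'(1)) (use smooth_step_bounds[of "a x"] in auto)
      show "norm (?c *s z x) \<le> 2 * S * (\<kappa> + \<kappa>') * norm (z x)"
        unfolding norm_smult_vec by (intro mult_right_mono c) simp
    qed
    also have "\<dots> = (\<kappa> + \<kappa>') * (1 + 2 * S) * norm (z x)" by (simp add: algebra_simps)
    also have "\<dots> < \<mu> * norm (z x)" using \<kappa>(2) zp by simp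
    finally have 1: "norm (dbar c d f' x - rop m (z x)) < norm (rop m (z x))" using \<mu>[of "z x"] by linarith
    \<comment> \<open>The estimate without cutoff shows that the original map has no complex point
      here either, so the two sets of complex points agree.\<close>
    have "\<kappa> * 1 \<le> (\<kappa> + \<kappa>') * (1 + 2 * S)" using \<kappa>(1) \<kappa>'0 S0 by (intro mult_mono) auto
    then have "\<kappa> < \<mu>" using \<kappa>(2) by simp
    then have "\<kappa> * norm (z x) < \<mu> * norm (z x)" using zp by simp
    then have 2: "norm (g x - rop m (z x)) < norm (rop m (z x))" using g1 \<mu>[of "z x"] by linarith
    show ?thesis using 1 2 by auto
  qed
  have cpt_db: "cpt h (cinv c x) \<longleftrightarrow> dbar c d h x = 0"
    if "smf h" "x \<in> ball x0 r" "h (cinv c x) \<in> fst d" "graphical (frechet_derivative (local_rep c d h) (at x))" for h x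
  proof -
    have x: "cinv c x \<in> fst c" "snd c (cinv c x) = x" using chart_cinv(2,3)[OF gp.ic] that(2) gp.ballc(1) by blast+
    show ?thesis using cpt_iff[OF that(1) cd(1,2) x(1) that(3)] graphical_complex_iff[of "drep c d h (cinv c x)"] that(4) x(2) by simp
  qed
  have zinj: "x = x0" if "x \<in> ball x0 r" "z x = 0" for x
  proof -
    have "m0 * norm (x - x0) \<le> 0" using low[OF that(1)] that(2) by simp
    then show ?thesis using m0 by (simp add: mult_le_0_iff)
  qed
  have ex: "\<exists>\<rho>>0. \<forall>x\<in>ball x0 \<rho>. x \<in> ball x0 r \<and> (norm (z x))\<^sup>2 \<le> \<epsilon>\<^sup>2"
  proof -
    have "open (ball x0 r \<inter> z -` ball 0 \<epsilon>)" by (rule continuous_open_preimage[OF CinfD(3)[OF zC]]) auto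
    moreover have "x0 \<in> ball x0 r \<inter> z -` ball 0 \<epsilon>" using x0r z0 \<epsilon>(1) by simp
    ultimately obtain e where e: "e > 0" "ball x0 e \<subseteq> ball x0 r \<inter> z -` ball 0 \<epsilon>" using openE by blast
    have "(norm (z x))\<^sup>2 \<le> \<epsilon>\<^sup>2" if "x \<in> ball x0 e" for x
      using e(2) that by (intro power_mono) auto
    then show ?thesis using e by blast
  qed
  have exact: "wc c d f' x = qform m' (z x)" if "x \<in> ball x0 r" "(norm (z x))\<^sup>2 \<le> \<epsilon>\<^sup>2" for x
    using rep'(1)[OF that(1)] a1[of x] that(2) smooth_step_1[of "a x"] by (simp add: \<eta>_def)
  have gc': "graph_chart f' y c d"
    using cd rep'[OF x0r] gr'[OF x0r] z0 yx0 by (simp add: graph_chart_def flip: x0_def)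
  have na: "normal_at f' y m'"
  proof -
    obtain \<rho>1 where \<rho>1: "\<rho>1 > 0" "\<forall>x\<in>ball x0 \<rho>1. x \<in> ball x0 r \<and> (norm (z x))\<^sup>2 \<le> \<epsilon>\<^sup>2" using ex by blast
    have "wc c d f' x = qform m' (zc c d f' x)" if "x \<in> ball x0 \<rho>1" for x
    proof -
      have x: "x \<in> ball x0 r" "(norm (z x))\<^sup>2 \<le> \<epsilon>\<^sup>2" using \<rho>1(2) that by blast+
      have "zc c d f' x = z x" using rep'(1)[OF x(1)] by simp
      then show ?thesis using exact[OF x] by simp
    qed
    then show ?thesis unfolding normal_at_def using gc' \<rho>1(1) unfolding x0_def by blast
  qed
  have at0: "g x0 = 0" "dbar c d f' x0 = 0"
  proof -
    have "norm (g x0 - rop m (z x0)) \<le> \<kappa> * norm (z x0)" using \<rho>0 by simp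
    then show g0: "g x0 = 0" using z0 linear_0[OF linear_rop] by simp
    show "dbar c d f' x0 = 0" using db[OF x0r] z0 g0 linear_0[OF linear_rop, of m'] by simp
  qed
  define K where "K = cinv c ` cball x0 s"
  have K: "closedin Y K"
    unfolding K_def by (rule compactin_imp_closedin[OF Hausdorff_Y chart_compact_cinv_image[OF gp.ic compact_cball gp.ballc(3)]])
  have KW: "K \<subseteq> W" using rW gp.ballc(2) ball_subset_cball unfolding K_def by blast
  have outK: "f' y' = f y'" if "y' \<in> topspace Y - K" for y'
    unfolding f'_def by (rule gp.push_out[where \<eta>=\<eta>, OF \<eta>s]) (use that in \<open>auto simp: K_def\<close>)
  have cpteq: "cpt f' y' \<longleftrightarrow> cpt f y'" if y': "y' \<in> topspace Y" for y'
  proof (cases "y' \<in> K")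
    case False
    have o: "openin Y (topspace Y - K)" using K by (simp add: closedin_def)
    show ?thesis by (rule cpt_local[OF o _ outK sf' sf]) (use y' False in auto)
  next
    case True
    then obtain x where x: "y' = cinv c x" "x \<in> ball x0 r" using gp.ballc(2) by (auto simp: K_def)
    have 1: "cpt f' y' \<longleftrightarrow> dbar c d f' x = 0" unfolding x(1) by (rule cpt_db[OF sf' x(2) rep'(2)[OF x(2)] gr'[OF x(2)]])
    have "f (cinv c x) \<in> fst d" using pk(5) x(2) ball_subset_cball by blast
    then have 2: "cpt f y' \<longleftrightarrow> g x = 0" unfolding x(1) g_def by (rule cpt_db[OF sf x(2) _ gp.gr[OF x(2)]])
    show ?thesis
    proof (cases "2 * \<epsilon>\<^sup>2 \<le> (norm (z x))\<^sup>2")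
      case True
      then show ?thesis using 1 2 out[OF x(2) True] by simp
    next
      case False
      then show ?thesis using 1 2 inn[OF x(2)] zinj[OF x(2)] at0 by (cases "z x = 0") auto
    qed
  qed
  show ?thesis by (rule that[OF f' na K KW outK cpteq])
qed

end

section \<open>Components of the space of nondegenerate jets\<close>

text \<open>Eigenvectors for distinct eigenvalues are independent. These finitely many values have
  to be avoided when a singular block is perturbed by multiples of the identity.\<close>

lemma finite_eigenvalues:
  fixes T :: "'a::euclidean_space \<Rightarrow> 'a"
  assumes T: "linear T" shows "finite {e::real. \<exists>v. v \<noteq> 0 \<and> T v = e *\<^sub>R v}"
proof (rule ccontr)
  let ?E = "{e::real. \<exists>v. v \<noteq> 0 \<and> T v = e *\<^sub>R v}"
  assume "infinite ?E"
  then obtain E where E: "finite E" "card E = Suc DIM('a)" "E \<subseteq> ?E"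
    using infinite_arbitrarily_large by blast
  have "\<forall>e\<in>E. \<exists>v. v \<noteq> 0 \<and> T v = e *\<^sub>R v" using E(3) by blast
  from bchoice[OF this] obtain v where "\<forall>e\<in>E. v e \<noteq> 0 \<and> T (v e) = e *\<^sub>R v e" by blast
  then have v: "\<And>e. e \<in> E \<Longrightarrow> v e \<noteq> 0 \<and> T (v e) = e *\<^sub>R v e" by blast
  have zero: "\<forall>e\<in>F. c e = 0" if "finite F" "F \<subseteq> E" "(\<Sum>e\<in>F. c e *\<^sub>R v e) = 0" for F and c :: "real \<Rightarrow> real"
    using that
  proof (induction F arbitrary: c)
    case (insert e0 F)
    have "T (\<Sum>e\<in>insert e0 F. c e *\<^sub>R v e) - e0 *\<^sub>R (\<Sum>e\<in>insert e0 F. c e *\<^sub>R v e) = 0"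
      using insert.prems(2) linear_0[OF T] by simp
    then have "(\<Sum>e\<in>insert e0 F. c e *\<^sub>R T (v e)) - (\<Sum>e\<in>insert e0 F. e0 *\<^sub>R (c e *\<^sub>R v e)) = 0"
      by (simp only: linear_sum[OF T] linear_scale[OF T] scaleR_sum_right)
    then have "(\<Sum>e\<in>insert e0 F. c e *\<^sub>R T (v e) - e0 *\<^sub>R (c e *\<^sub>R v e)) = 0"
      by (simp only: sum_subtractf)
    moreover have "(\<Sum>e\<in>insert e0 F. c e *\<^sub>R T (v e) - e0 *\<^sub>R (c e *\<^sub>R v e)) = (\<Sum>e\<in>insert e0 F. (c e * (e - e0)) *\<^sub>R v e)"
      using v insert.prems(1) by (intro sum.cong) (auto simp: algebra_simps)
    ultimately have "(\<Sum>e\<in>F. (c e * (e - e0)) *\<^sub>R v e) = 0" using insert.hyps by simp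
    then have "\<forall>e\<in>F. c e * (e - e0) = 0" using insert.IH[of "\<lambda>e. c e * (e - e0)"] insert.prems(1) by simp
    then have F: "\<forall>e\<in>F. c e = 0" using insert.hyps(2) by auto
    then have "c e0 *\<^sub>R v e0 = 0" using insert.prems(2) insert.hyps by simp
    then show ?case using F v insert.prems(1) by auto
  qed simp
  have inj: "inj_on v E"
  proof (rule inj_onI)
    fix a b assume ab: "a \<in> E" "b \<in> E" "v a = v b"
    then have "a *\<^sub>R v a = b *\<^sub>R v a" using v by metis
    then show "a = b" using v ab(1) by simp
  qed
  have "independent (v ` E)"
  proof (rule independent_if_scalars_zero)
    fix f x assume "(\<Sum>x\<in>v ` E. f x *\<^sub>R x) = 0" "x \<in> v ` E"
    then show "f x = 0" using zero[OF E(1) order_refl, of "\<lambda>e. f (v e)"] by (auto simp: sum.reindex[OF inj])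
  qed (use E(1) in simp)
  then have "card (v ` E) \<le> DIM('a)" using independent_bound by blast
  then show False using E(2) card_image[OF inj] by simp
qed

lemma rop_nth: "rop m z $ p = (\<Sum>q\<in>UNIV. fst m $ p $ q * z $ q + snd m $ p $ q * cnj (z $ q))"
  by (simp add: rop_def matrix_vector_mult_def cnjv_def sum.distrib)

section \<open>Splitting off one coordinate line by a Schur complement\<close>

definition jets :: "'n::finite jet set" where "jets = {m. nondeg m}"

abbreviation conn :: "'n::finite jet \<Rightarrow> 'n jet \<Rightarrow> bool" where
  "conn \<equiv> connected_component jets"

text \<open>With \<open>a = 1\<close> and \<open>b = 0\<close> the associated map is injective iff
  the block of \<open>m\<close> off the coordinate \<open>j\<close> is. This expresses invertibility
  of a smaller block without changing the index type.\<close>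

definition decouple :: "'n::finite jet \<Rightarrow> 'n \<Rightarrow> complex \<Rightarrow> complex \<Rightarrow> 'n jet" where
  "decouple m j a b = (\<chi> p q. if p = j \<and> q = j then a else if p = j \<or> q = j then 0 else fst m $ p $ q,
                   \<chi> p q. if p = j \<and> q = j then b else if p = j \<or> q = j then 0 else snd m $ p $ q)"

definition decoupled :: "'n::finite jet \<Rightarrow> 'n \<Rightarrow> bool" where
  "decoupled m j \<longleftrightarrow> (\<forall>q. q \<noteq> j \<longrightarrow> fst m $ j $ q = 0 \<and> fst m $ q $ j = 0 \<and> snd m $ j $ q = 0 \<and> snd m $ q $ j = 0)"

lemma sym_iff: "transpose (M :: complex ^ 'n ^ 'n) = M \<longleftrightarrow> (\<forall>p q. M $ p $ q = M $ q $ p)"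
  by (auto simp: transpose_def vec_eq_iff)

lemma rop_axis_nth: "rop m (axis j a) $ p = fst m $ p $ j * a + snd m $ p $ j * cnj a"
  using rop_axis[of "fst m" "snd m"] by simp

lemma rop_decouple_same: "rop (decouple m j a b) z $ j = a * z $ j + b * cnj (z $ j)"
proof -
  have "rop (decouple m j a b) z $ j = (\<Sum>q\<in>UNIV. if q = j then a * z $ j + b * cnj (z $ j) else 0)"
    unfolding rop_nth by (intro sum.cong) (auto simp: decouple_def)
  then show ?thesis by simp
qed

lemma rop_decouple_other: "p \<noteq> j \<Longrightarrow> rop (decouple m j a b) z $ p = rop m (z - axis j (z $ j)) $ p"
  unfolding rop_nth by (intro sum.cong) (auto simp: decouple_def axis_def)

lemma inj_rop_iff: "inj (rop m) \<longleftrightarrow> (\<forall>z. rop m z = 0 \<longrightarrow> z = 0)"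
  by (rule linear_injective_0[OF linear_rop])

text \<open>The real determinant of \<open>z \<mapsto> a z + b cnj z\<close> is
  \<open>|a|^2 - |b|^2\<close>; equal moduli are the degenerate case.\<close>

lemma unequal_norm_zero: "cmod a \<noteq> cmod b \<Longrightarrow> a * z + b * cnj z = 0 \<Longrightarrow> z = 0"
proof -
  assume ab: "cmod a \<noteq> cmod b" and "a * z + b * cnj z = 0"
  then have "a * z = - (b * cnj z)" by (simp add: eq_neg_iff_add_eq_0)
  then have "cmod a * cmod z = cmod b * cmod z" by (metis complex_mod_cnj norm_minus_cancel norm_mult)
  then show "z = 0" using ab by simp
qed

lemma equal_norm_zero:
  assumes "cmod a = cmod b" obtains z where "z \<noteq> 0" "a * z + b * cnj z = 0"
proof (cases "a = 0")
  case True
  then show ?thesis using assms that[of 1] by simp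
next
  case False
  define c where "c = - b / a"
  have c: "cmod c = 1" using assms[symmetric] False by (simp add: c_def norm_divide)
  \<comment> \<open>For \<open>cmod z = 1\<close> the equation \<open>a * z + b * cnj z = 0\<close>
    reads \<open>z^2 = c\<close>.\<close>
  define z where "z = csqrt c"
  have z2: "z\<^sup>2 = c" by (simp add: z_def)
  then have zn: "cmod z = 1" using c by (metis norm_ge_zero norm_power power2_eq_1_iff le_minus_one_simps(3))
  then have "z * cnj z = 1" by (simp add: complex_norm_square[symmetric])
  then have "c * cnj z = z" using z2 by (metis mult.assoc mult.right_neutral power2_eq_square)
  then have "a * z = - b * cnj z" using False by (simp add: c_def field_simps)
  moreover have "z \<noteq> 0" using zn by auto
  ultimately show ?thesis using that[of z] by simp
qed

text \<open>Scaling the off-diagonal blocks \<open>b, c\<close> of \<open>(a b; c d)\<close> by \<open>s\<close> and correcting \<open>a\<close> to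
  \<open>a - (1 - s^2) b d\<^bsup>-1\<^esup> c\<close> keeps the Schur complement, hence invertibility. Since the upper left
  entry is a real linear map of the complex line, no symmetry constraint is violated.\<close>

lemma schur:
  fixes m :: "'n::finite jet"
  assumes sym: "transpose (snd m) = snd m" and D: "inj (rop (decouple m j 1 0))"
    and L: "\<And>\<zeta>. \<exists>y. y $ j = 0 \<and> (\<forall>p. p \<noteq> j \<longrightarrow> rop m y $ p = rop m (axis j \<zeta>) $ p) \<and>
      rop m y $ j = \<alpha> * \<zeta> + \<beta> * cnj \<zeta>"
    and ab: "cmod (fst m $ j $ j - \<alpha>) \<noteq> cmod (snd m $ j $ j - \<beta>)"
  shows "conn m (decouple m j (fst m $ j $ j - \<alpha>) (snd m $ j $ j - \<beta>))"
proof -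
  let ?a = "fst m $ j $ j - \<alpha>" and ?b = "snd m $ j $ j - \<beta>"
  define g where "g s = (\<chi> p q. if p = j \<and> q = j then ?a + of_real (s\<^sup>2) * \<alpha> else if p = j \<or> q = j then of_real s * fst m $ p $ q else fst m $ p $ q,
     \<chi> p q. if p = j \<and> q = j then ?b + of_real (s\<^sup>2) * \<beta> else if p = j \<or> q = j then of_real s * snd m $ p $ q else snd m $ p $ q)" for s :: real
  have Dz: "v = 0" if "v $ j = 0" "\<And>p. p \<noteq> j \<Longrightarrow> rop m v $ p = 0" for v
  proof -
    have v: "v - axis j (v $ j) = v" using that(1) by (simp add: axis_def vec_eq_iff)
    have "rop (decouple m j 1 0) v $ p = 0" for p
      using that rop_decouple_same[of m j 1 0 v] rop_decouple_other[of p j m 1 0 v, unfolded v] by (cases "p = j") simp_all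
    then show ?thesis using D unfolding inj_rop_iff by (simp add: vec_eq_iff)
  qed
  have gs: "rop (g s) z $ j = (?a + of_real (s\<^sup>2) * \<alpha>) * z $ j + (?b + of_real (s\<^sup>2) * \<beta>) * cnj (z $ j)
      + of_real s * rop m (z - axis j (z $ j)) $ j" for s z
  proof -
    define K where "K = (?a + of_real (s\<^sup>2) * \<alpha>) * z $ j + (?b + of_real (s\<^sup>2) * \<beta>) * cnj (z $ j)"
    define y where "y = z - axis j (z $ j)"
    define G where "G q = fst m $ j $ q * y $ q + snd m $ j $ q * cnj (y $ q)" for q
    have "fst (g s) $ j $ q * z $ q + snd (g s) $ j $ q * cnj (z $ q) = (if q = j then K else 0) + of_real s * G q" for q
      by (cases "q = j") (simp_all add: g_def axis_def K_def G_def y_def algebra_simps)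
    then have "rop (g s) z $ j = (\<Sum>q\<in>UNIV. (if q = j then K else 0) + of_real s * G q)"
      unfolding rop_nth by simp
    also have "\<dots> = (\<Sum>q\<in>UNIV. if q = j then K else 0) + (\<Sum>q\<in>UNIV. of_real s * G q)" by (rule sum.distrib)
    also have "\<dots> = K + of_real s * (\<Sum>q\<in>UNIV. G q)" by (simp add: sum_distrib_left)
    finally show ?thesis unfolding rop_nth G_def K_def y_def .
  qed
  have gp: "rop (g s) z $ p = of_real s * rop m (axis j (z $ j)) $ p + rop m (z - axis j (z $ j)) $ p" if p: "p \<noteq> j" for s z p
  proof -
    define x where "x = axis j (z $ j)"
    define y where "y = z - axis j (z $ j)"
    define G where "G v q = fst m $ p $ q * v $ q + snd m $ p $ q * cnj (v $ q)" for v q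
    have "fst (g s) $ p $ q * z $ q + snd (g s) $ p $ q * cnj (z $ q) = of_real s * G x q + G y q" for q
      using p by (cases "q = j") (simp_all add: g_def axis_def G_def x_def y_def algebra_simps)
    then have "rop (g s) z $ p = (\<Sum>q\<in>UNIV. of_real s * G x q + G y q)"
      unfolding rop_nth by simp
    also have "\<dots> = (\<Sum>q\<in>UNIV. of_real s * G x q) + (\<Sum>q\<in>UNIV. G y q)" by (rule sum.distrib)
    also have "\<dots> = of_real s * (\<Sum>q\<in>UNIV. G x q) + (\<Sum>q\<in>UNIV. G y q)" by (simp add: sum_distrib_left)
    finally show ?thesis unfolding rop_nth G_def x_def y_def .
  qed
  have inj: "inj (rop (g s))" for s
    unfolding inj_rop_iff
  proof (intro allI impI)
    fix z assume z: "rop (g s) z = 0"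
    define \<zeta> where "\<zeta> = z $ j"
    define z' where "z' = z - axis j \<zeta>"
    have z'j: "z' $ j = 0" by (simp add: z'_def \<zeta>_def axis_def)
    obtain y where y: "y $ j = 0" "\<And>p. p \<noteq> j \<Longrightarrow> rop m y $ p = rop m (axis j \<zeta>) $ p" "rop m y $ j = \<alpha> * \<zeta> + \<beta> * cnj \<zeta>"
      using L[of \<zeta>] by blast
    have lin: "rop m (z' + s *\<^sub>R y) = rop m z' + s *\<^sub>R rop m y"
      by (simp add: linear_add[OF linear_rop] linear_scale[OF linear_rop])
    \<comment> \<open>The rows off \<open>j\<close> put \<open>z' + s *\<^sub>R y\<close> into the
      kernel of the remaining block. Substituted into row \<open>j\<close>, its vanishing leaves the
      Schur complement, in which \<open>s\<close> no longer occurs.\<close>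
    have v: "z' + s *\<^sub>R y = 0"
    proof (rule Dz)
      show "rop m (z' + s *\<^sub>R y) $ p = 0" if "p \<noteq> j" for p
        using gp[OF that, of s z] z y(2)[OF that] unfolding lin by (simp add: z'_def \<zeta>_def scaleR_conv_of_real[where 'a=complex] add.commute)
    qed (use z'j y in simp)
    have "rop m z' $ j = - of_real s * (\<alpha> * \<zeta> + \<beta> * cnj \<zeta>)"
      using arg_cong[OF v, of "\<lambda>v. rop m v $ j"] unfolding lin
      by (simp add: linear_0[OF linear_rop] y(3) scaleR_conv_of_real[where 'a=complex] eq_neg_iff_add_eq_0)
    note r = this
    have "0 = (?a + of_real (s\<^sup>2) * \<alpha>) * \<zeta> + (?b + of_real (s\<^sup>2) * \<beta>) * cnj \<zeta> + of_real s * rop m z' $ j"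
      using gs[of s z] z by (simp add: \<zeta>_def[symmetric] z'_def[symmetric])
    also have "\<dots> = ?a * \<zeta> + ?b * cnj \<zeta>"
      unfolding r by (simp add: algebra_simps power2_eq_square)
    finally have "?a * \<zeta> + ?b * cnj \<zeta> = 0" by (rule HOL.sym)
    then have \<zeta>0: "\<zeta> = 0" by (rule unequal_norm_zero[OF ab])
    have "y = 0" by (rule Dz[OF y(1)]) (simp add: y(2) \<zeta>0 rop_axis_nth)
    then have "z' = 0" using v by simp
    then show "z = 0" using \<zeta>0 by (simp add: z'_def)
  qed
  have V: "g s \<in> jets" for s
  proof -
    have "transpose (snd (g s)) = snd (g s)" using sym unfolding sym_iff by (simp add: g_def)
    then show ?thesis using inj by (simp add: jets_def nondeg_def)
  qed
  have cont: "continuous_on {0..1} g"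
    unfolding g_def
  proof (intro continuous_on_Pair continuous_on_vec_lambda)
    fix p q
    show "continuous_on {0..1} (\<lambda>s. if p = j \<and> q = j then ?a + of_real (s\<^sup>2) * \<alpha>
        else if p = j \<or> q = j then of_real s * fst m $ p $ q else fst m $ p $ q)"
      "continuous_on {0..1} (\<lambda>s. if p = j \<and> q = j then ?b + of_real (s\<^sup>2) * \<beta>
        else if p = j \<or> q = j then of_real s * snd m $ p $ q else snd m $ p $ q)"
      by (cases "p = j"; cases "q = j"; simp; intro continuous_intros)+
  qed
  have "connected (g ` {0..1})" by (rule connected_continuous_image[OF cont]) simp
  moreover have "g 1 = m" "g 0 = decouple m j ?a ?b" by (simp_all add: g_def decouple_def prod_eq_iff vec_eq_iff)
  ultimately show ?thesis
    unfolding connected_component_def using V by (intro exI[of _ "g ` {0..1}"]) (auto intro!: image_eqI)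
qed

text \<open>The vector \<open>y \<zeta>\<close> solves the rows off \<open>j\<close>, so
  \<open>L\<close> is the correction term of the Schur complement. As a real linear map of one
  complex variable it has the form \<open>\<alpha> \<zeta> + \<beta> cnj \<zeta>\<close>. A
  degenerate complement would produce the kernel vector \<open>axis j \<zeta> - y \<zeta>\<close> of
  \<open>m\<close>.\<close>

lemma schur_exists:
  fixes m :: "'n::finite jet"
  assumes m: "nondeg m" and D: "inj (rop (decouple m j 1 0))"
  obtains a b where "conn m (decouple m j a b)"
proof -
  let ?D = "rop (decouple m j 1 0)"
  have b: "bij ?D" by (rule linear_inj_imp_bij[OF linear_rop D]) simp
  define c where "c \<zeta> = rop m (axis j \<zeta>) - axis j (rop m (axis j \<zeta>) $ j)" for \<zeta>
  define y where "y \<zeta> = inv ?D (c \<zeta>)" for \<zeta>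
  have Dy: "?D (y \<zeta>) = c \<zeta>" for \<zeta> unfolding y_def by (rule surj_f_inv_f[OF bij_is_surj[OF b]])
  have yj: "y \<zeta> $ j = 0" for \<zeta>
    using rop_decouple_same[of m j 1 0 "y \<zeta>"] Dy[of \<zeta>] by (simp add: c_def axis_def)
  have yp: "rop m (y \<zeta>) $ p = rop m (axis j \<zeta>) $ p" if "p \<noteq> j" for \<zeta> p
  proof -
    have "y \<zeta> - axis j (y \<zeta> $ j) = y \<zeta>" by (simp add: yj axis_def vec_eq_iff)
    then show ?thesis using rop_decouple_other[OF that, of m 1 0 "y \<zeta>"] Dy[of \<zeta>] that by (simp add: c_def axis_def)
  qed
  have ax: "axis j (u + v) = axis j u + axis j v" "axis j (r *\<^sub>R u) = r *\<^sub>R axis j u" for u v :: complex and r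
    by (auto simp: axis_def vec_eq_iff)
  have "linear c"
    by (rule linearI) (simp_all add: c_def ax linear_add[OF linear_rop] linear_scale[OF linear_rop] scaleR_diff_right)
  then have "linear y" using linear_compose[OF _ linear_inv_bij[OF linear_rop b]] by (simp add: y_def[abs_def] o_def)
  define L where "L \<zeta> = rop m (y \<zeta>) $ j" for \<zeta>
  have linL: "linear L"
    by (rule linearI) (simp_all add: L_def linear_add[OF \<open>linear y\<close>] linear_scale[OF \<open>linear y\<close>] linear_add[OF linear_rop] linear_scale[OF linear_rop])
  define \<alpha> where "\<alpha> = (L 1 - \<i> * L \<i>) / 2"
  define \<beta> where "\<beta> = (L 1 + \<i> * L \<i>) / 2"
  have Leq: "L \<zeta> = \<alpha> * \<zeta> + \<beta> * cnj \<zeta>" for \<zeta>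
  proof -
    have "\<zeta> = Re \<zeta> *\<^sub>R 1 + Im \<zeta> *\<^sub>R \<i>" by (simp add: complex_eq_iff)
    then have "L \<zeta> = Re \<zeta> *\<^sub>R L 1 + Im \<zeta> *\<^sub>R L \<i>" by (metis linear_add[OF linL] linear_scale[OF linL])
    moreover obtain u v where "\<zeta> = Complex u v" by (cases \<zeta>)
    ultimately show ?thesis by (simp add: \<alpha>_def \<beta>_def scaleR_conv_of_real Complex_eq field_simps)
  qed
  have ab: "cmod (fst m $ j $ j - \<alpha>) \<noteq> cmod (snd m $ j $ j - \<beta>)"
  proof
    assume "cmod (fst m $ j $ j - \<alpha>) = cmod (snd m $ j $ j - \<beta>)"
    then obtain \<zeta> where \<zeta>: "\<zeta> \<noteq> 0" "(fst m $ j $ j - \<alpha>) * \<zeta> + (snd m $ j $ j - \<beta>) * cnj \<zeta> = 0"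
      by (rule equal_norm_zero)
    have "rop m (axis j \<zeta> - y \<zeta>) $ p = 0" for p
    proof (cases "p = j")
      case True
      then show ?thesis using \<zeta>(2) Leq[of \<zeta>]
        by (simp add: linear_diff[OF linear_rop] rop_axis_nth L_def algebra_simps)
    next
      case False
      then show ?thesis using yp by (simp add: linear_diff[OF linear_rop])
    qed
    then have "rop m (axis j \<zeta> - y \<zeta>) = 0" by (simp add: vec_eq_iff)
    then have "axis j \<zeta> - y \<zeta> = 0" using m unfolding nondeg_def inj_rop_iff by blast
    then have "(axis j \<zeta> - y \<zeta>) $ j = 0" by simp
    then show False using \<zeta>(1) yj by (simp add: axis_def)
  qed
  have "\<exists>y. y $ j = 0 \<and> (\<forall>p. p \<noteq> j \<longrightarrow> rop m y $ p = rop m (axis j \<zeta>) $ p) \<and> rop m y $ j = \<alpha> * \<zeta> + \<beta> * cnj \<zeta>" for \<zeta>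
    using yj yp Leq by (intro exI[of _ "y \<zeta>"]) (simp add: L_def)
  then show ?thesis using that schur[OF _ D _ ab] m by (simp add: nondeg_def)
qed

lemma nondeg_open:
  assumes "nondeg (m :: 'n::finite jet)"
  obtains r where "r > 0" "\<And>m'. transpose (snd m') = snd m' \<Longrightarrow> norm (m' - m) < r \<Longrightarrow> nondeg m'"
proof -
  obtain \<mu> where \<mu>: "\<mu> > 0" "\<And>z. \<mu> * norm z \<le> norm (rop m z)"
    using linear_inj_bounded_below_pos[OF linear_rop, of m] assms unfolding nondeg_def by metis
  obtain C where C: "C > 0" "\<And>(m :: 'n jet) z. norm (rop m z) \<le> C * norm m * norm z"
    using jet_bounds by metis
  have "nondeg m'" if s: "transpose (snd m') = snd m'" and d: "norm (m' - m) < \<mu> / C" for m'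
  proof -
    have Cd: "C * norm (m' - m) < \<mu>" using d C(1) by (simp add: pos_less_divide_eq mult.commute)
    have "z = 0" if z: "rop m' z = 0" for z
    proof (rule ccontr)
      assume "z \<noteq> 0"
      then have "C * norm (m' - m) * norm z < \<mu> * norm z" using Cd by simp
      moreover have "rop m z = - rop (m' - m) z"
        using z bounded_bilinear.diff_left[OF bounded_bilinear_rop, of m' m z] by simp
      ultimately show False using \<mu>(2)[of z] C(2)[of "m' - m" z] by simp
    qed
    then show ?thesis using s by (simp add: nondeg_def inj_rop_iff)
  qed
  then show ?thesis using that[of "\<mu> / C"] \<mu>(1) C(1) by simp
qed

text \<open>The block off \<open>j\<close> may be singular. Adding \<open>e\<close> times the
  identity to the first matrix repairs this unless \<open>- e\<close> is an eigenvalue of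
  \<open>decouple m j 1 0\<close>. For small \<open>e\<close> the jet stays nondegenerate on the
  way, and a diagonal term does not couple the coordinates in \<open>S\<close> again.\<close>

lemma decouple_step:
  fixes m :: "'n::finite jet"
  assumes m: "nondeg m" and dS: "\<forall>j\<in>S. decoupled m j"
  shows "\<exists>m'. conn m m' \<and> (\<forall>i\<in>insert j S. decoupled m' i)"
proof -
  define P where "P e = m + (e::real) *\<^sub>R (mat 1 :: complex ^ 'n ^ 'n, 0)" for e
  obtain r where r: "r > 0" "\<And>m'. transpose (snd m') = snd m' \<Longrightarrow> norm (m' - m) < r \<Longrightarrow> nondeg m'"
    by (rule nondeg_open[OF m]) blast
  define M where "M = norm (mat 1 :: complex ^ 'n ^ 'n, 0 :: complex ^ 'n ^ 'n)"
  have symP: "transpose (snd (P e)) = snd (P e)" for e using m by (simp add: P_def nondeg_def)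
  let ?E = "{e::real. \<exists>v. v \<noteq> 0 \<and> rop (decouple m j 1 0) v = e *\<^sub>R v}"
  have "finite (uminus ` ?E)" using finite_eigenvalues[OF linear_rop] by blast
  moreover have "infinite {0<..<r / (M + 1)}" using r(1) by (simp add: M_def add_nonneg_pos)
  ultimately obtain e where e: "e \<in> {0<..<r / (M + 1)}" "e \<notin> uminus ` ?E"
    by (meson finite_subset subsetI)
  have Mp: "M + 1 > 0" by (simp add: M_def add_nonneg_pos)
  have small: "norm (P t - m) < r" if "t \<in> {0..e}" for t
  proof -
    have "norm (P t - m) = t * M" using that by (simp add: P_def M_def)
    also have "\<dots> \<le> e * M" using that by (intro mult_right_mono) (auto simp: M_def)
    also have "\<dots> < e * (M + 1)" using e(1) by simp
    also have "\<dots> < r" using e(1) Mp by (simp add: pos_less_divide_eq)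
    finally show ?thesis .
  qed
  have "P t \<in> jets" if "t \<in> {0..e}" for t using r(2)[OF symP small[OF that]] by (simp add: jets_def)
  moreover have "connected (P ` {0..e})"
    unfolding P_def by (intro connected_continuous_image continuous_intros) simp
  moreover have "P 0 = m" by (simp add: P_def zero_prod_def[symmetric])
  ultimately have c1: "conn m (P e)"
    unfolding connected_component_def using e(1) by (intro exI[of _ "P ` {0..e}"]) (auto intro!: image_eqI)
  have ropP: "rop (P e) v = rop m v + e *\<^sub>R v" for v
  proof -
    have "rop (mat 1 :: complex ^ 'n ^ 'n, 0) v = v" by (simp add: rop_def)
    then show ?thesis
      unfolding P_def bounded_bilinear.add_left[OF bounded_bilinear_rop] bounded_bilinear.scaleR_left[OF bounded_bilinear_rop]
      by simp
  qed
  have D: "inj (rop (decouple (P e) j 1 0))"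
    unfolding inj_rop_iff
  proof (intro allI impI, rule ccontr)
    fix v assume v: "rop (decouple (P e) j 1 0) v = 0" "v \<noteq> 0"
    have vj: "v $ j = 0" using rop_decouple_same[of "P e" j 1 0 v] v(1) by simp
    then have v': "v - axis j (v $ j) = v" by (simp add: axis_def vec_eq_iff)
    have "rop (decouple m j 1 0) v $ p = ((- e) *\<^sub>R v) $ p" for p
    proof (cases "p = j")
      case True
      then show ?thesis using rop_decouple_same[of m j 1 0 v] vj by simp
    next
      case False
      have "rop (P e) v $ p = 0" using rop_decouple_other[OF False, of "P e" 1 0 v] v(1) v' by simp
      then show ?thesis using rop_decouple_other[OF False, of m 1 0 v] v' ropP[of v] by (simp add: eq_neg_iff_add_eq_0)
    qed
    then have "rop (decouple m j 1 0) v = (- e) *\<^sub>R v" by (simp add: vec_eq_iff)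
    then have "- e \<in> ?E" using v(2) by blast
    then have "- (- e) \<in> uminus ` ?E" by (rule imageI)
    then show False using e(2) by simp
  qed
  have "P e \<in> jets" using connected_component_in[OF c1] by simp
  then have ne: "nondeg (P e)" by (simp add: jets_def)
  obtain a b where ab: "conn (P e) (decouple (P e) j a b)" by (rule schur_exists[OF ne D])
  have "decoupled (decouple (P e) j a b) i" if "i \<in> insert j S" for i
    using dS that by (auto simp: decoupled_def decouple_def P_def mat_def)
  then show ?thesis using connected_component_trans[OF c1 ab] by blast
qed

lemma decouple_all:
  fixes m :: "'n::finite jet"
  assumes "nondeg m" shows "\<exists>m'. conn m m' \<and> (\<forall>j. decoupled m' j)"
proof -
  have "\<exists>m'. conn m m' \<and> (\<forall>j\<in>S. decoupled m' j)" if "finite S" for S :: "'n set"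
    using that
  proof (induction S)
    case empty
    then show ?case using assms by (intro exI[of _ m]) (simp add: jets_def)
  next
    case (insert j S)
    then obtain m' where m': "conn m m'" "\<forall>j\<in>S. decoupled m' j" by blast
    have nd: "nondeg m'" using connected_component_in[OF m'(1)] by (simp add: jets_def)
    obtain m'' where m'': "conn m' m''" "\<forall>i\<in>insert j S. decoupled m'' i"
      using decouple_step[OF nd m'(2), of j] by blast
    show ?case using connected_component_trans[OF m'(1) m''(1)] m''(2) by (intro exI[of _ m'']) (rule conjI)
  qed
  from this[of UNIV] show ?thesis by simp
qed

section \<open>Normal forms on single lines, and the two standard jets\<close>

lemma connected_component_intro:
  "connected T \<Longrightarrow> T \<subseteq> S \<Longrightarrow> x \<in> T \<Longrightarrow> y \<in> T \<Longrightarrow> connected_component S x y"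
  unfolding connected_component_def by blast

text \<open>Shrink \<open>b\<close> to 0, then move \<open>a\<close> inside the punctured
  plane.\<close>

lemma dominant_connected:
  assumes "cmod b < cmod a" shows "connected_component {(a, b). cmod b < cmod a} (a, b) (1, 0)"
proof -
  let ?C = "{(a, b). cmod b < cmod a}"
  have "connected ((\<lambda>t. (a, of_real t * b)) ` {0..1})"
    by (intro connected_continuous_image continuous_intros) simp
  moreover have "(\<lambda>t. (a, of_real t * b)) ` {0..1} \<subseteq> ?C"
  proof clarsimp
    fix t :: real assume "0 \<le> t" "t \<le> 1"
    then have "\<bar>t\<bar> * cmod b \<le> 1 * cmod b" by (intro mult_right_mono) auto
    then show "cmod (of_real t * b) < cmod a" using assms by (simp add: norm_mult)
  qed
  moreover have "(a, b) \<in> (\<lambda>t. (a, of_real t * b)) ` {0..1}" by (rule image_eqI[of _ _ 1]) auto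
  moreover have "(a, 0) \<in> (\<lambda>t. (a, of_real t * b)) ` {0..1}" by (rule image_eqI[of _ _ 0]) auto
  ultimately have 1: "connected_component ?C (a, b) (a, 0)"
    by (rule connected_component_intro)
  have "connected ((\<lambda>a::complex. (a, 0::complex)) ` (- {0}))"
    by (intro connected_continuous_image continuous_intros connected_punctured_universe) simp
  then have 2: "connected_component ?C (a, 0) (1, 0)"
  proof (rule connected_component_intro)
    show "(\<lambda>a::complex. (a, 0::complex)) ` (- {0}) \<subseteq> ?C" by auto
    have "a \<noteq> 0" using assms by auto
    then show "(a, 0) \<in> (\<lambda>a::complex. (a, 0::complex)) ` (- {0})" by (intro image_eqI[of _ _ a]) simp_all
    show "(1, 0) \<in> (\<lambda>a::complex. (a, 0::complex)) ` (- {0})" by (intro image_eqI[of _ _ 1]) simp_all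
  qed
  show ?thesis using connected_component_trans[OF 1 2] .
qed

text \<open>A decoupled coordinate splits off as a direct summand, so its pair may wander through
  nondegenerate pairs while the rest stands still.\<close>

lemma decouple_conn:
  fixes m :: "'n::finite jet"
  assumes m: "nondeg m" "decoupled m j" and C: "connected_component {(a, b). cmod a \<noteq> cmod b} (fst m $ j $ j, snd m $ j $ j) (a, b)"
  shows "conn m (decouple m j a b)"
proof -
  obtain T where T: "connected T" "T \<subseteq> {(a, b). cmod a \<noteq> cmod b}" "(fst m $ j $ j, snd m $ j $ j) \<in> T" "(a, b) \<in> T"
    using C unfolding connected_component_def by blast
  let ?f = "\<lambda>q. decouple m j (fst q) (snd q)"
  have "continuous_on T ?f"
    unfolding decouple_def
  proof (intro continuous_on_Pair continuous_on_vec_lambda)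
    fix p q
    show "continuous_on T (\<lambda>x. if p = j \<and> q = j then fst x else if p = j \<or> q = j then 0 else fst m $ p $ q)"
      "continuous_on T (\<lambda>x. if p = j \<and> q = j then snd x else if p = j \<or> q = j then 0 else snd m $ p $ q)"
      by (cases "p = j"; cases "q = j"; simp add: continuous_on_fst continuous_on_snd continuous_on_id)+
  qed
  then have "connected (?f ` T)" using T(1) by (rule connected_continuous_image)
  moreover have "?f q \<in> jets" if q: "q \<in> T" for q
  proof -
    have ab: "cmod (fst q) \<noteq> cmod (snd q)" using T(2) q by (cases q) auto
    have "transpose (snd (?f q)) = snd (?f q)" using m(1) unfolding nondeg_def sym_iff by (simp add: decouple_def)
    moreover have "z = 0" if z: "rop (?f q) z = 0" for z
    proof -
      have "fst q * z $ j + snd q * cnj (z $ j) = 0" using rop_decouple_same[of m j "fst q" "snd q" z] z by simp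
      then have zj: "z $ j = 0" by (rule unequal_norm_zero[OF ab])
      then have z': "z - axis j (z $ j) = z" by (simp add: axis_def vec_eq_iff)
      have "rop m z $ p = 0" for p
      proof (cases "p = j")
        case True
        have "fst m $ j $ x * z $ x + snd m $ j $ x * cnj (z $ x) = 0" for x
          using m(2) zj by (cases "x = j") (simp_all add: decoupled_def)
        then show ?thesis unfolding rop_nth True by simp
      next
        case False
        then show ?thesis using rop_decouple_other[OF False, of m "fst q" "snd q" z] z z' by simp
      qed
      then show ?thesis using m(1) unfolding nondeg_def inj_rop_iff by (simp add: vec_eq_iff)
    qed
    ultimately show ?thesis by (simp add: jets_def nondeg_def inj_rop_iff)
  qed
  then have "?f ` T \<subseteq> jets" by blast
  moreover have "m = ?f (fst m $ j $ j, snd m $ j $ j)"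
    using m(2) by (auto simp: decouple_def decoupled_def prod_eq_iff vec_eq_iff)
  then have "m \<in> ?f ` T" using T(3) by (rule image_eqI)
  moreover have "decouple m j a b \<in> ?f ` T" using T(4) by (intro image_eqI[of _ _ "(a, b)"]) simp_all
  ultimately show ?thesis by (rule connected_component_intro)
qed

lemma connected_component_mono_set: "connected_component S x y \<Longrightarrow> S \<subseteq> T \<Longrightarrow> connected_component T x y"
  unfolding connected_component_def by blast

text \<open>On one line the nondegenerate pairs form two connected sets according to which modulus
  is larger; \<open>(1, 0)\<close> and \<open>(0, 2)\<close> are representatives that yield the
  terms of the normal forms.\<close>

lemma decouple_conn_std:
  fixes m :: "'n::finite jet"
  assumes m: "nondeg m" "decoupled m j"
  shows "cmod (snd m $ j $ j) < cmod (fst m $ j $ j) \<Longrightarrow> conn m (decouple m j 1 0)"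
    "cmod (fst m $ j $ j) < cmod (snd m $ j $ j) \<Longrightarrow> conn m (decouple m j 0 2)"
proof -
  assume a: "cmod (snd m $ j $ j) < cmod (fst m $ j $ j)"
  show "conn m (decouple m j 1 0)"
    by (rule decouple_conn[OF m connected_component_mono_set[OF dominant_connected[OF a]]]) auto
next
  assume a: "cmod (fst m $ j $ j) < cmod (snd m $ j $ j)"
  have sw: "connected_component {(a, b). cmod a < cmod b} (b, a) (0, 1)" if ba: "cmod b < cmod a" for a b
  proof -
    obtain T where T: "connected T" "T \<subseteq> {(a, b). cmod b < cmod a}" "(a, b) \<in> T" "(1, 0) \<in> T"
      using dominant_connected[OF ba] unfolding connected_component_def by (elim exE conjE) (rule that)
    have "connected (prod.swap ` T)" by (intro connected_continuous_image T(1) continuous_on_swap)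
    then show ?thesis unfolding connected_component_def using T by (intro exI[of _ "prod.swap ` T"]) force
  qed
  have "connected_component {(a, b). cmod a < cmod b} (fst m $ j $ j, snd m $ j $ j) (0, 1)" by (rule sw[OF a])
  moreover have "connected_component {(a, b). cmod a < cmod b} (0, 1) (0, 2)"
    by (rule connected_component_sym, rule sw) simp
  ultimately have "connected_component {(a, b). cmod a < cmod b} (fst m $ j $ j, snd m $ j $ j) (0, 2)"
    by (rule connected_component_trans)
  note c = this
  show "conn m (decouple m j 0 2)"
    by (rule decouple_conn[OF m connected_component_mono_set[OF c]]) auto
qed

text \<open>\<open>S\<close> lists the coordinates that enter through the square of
  \<open>cnj (z $ j)\<close>; the entry 2 makes up for the factor 1/2 in
  \<open>qform\<close>.\<close>

definition stdjet :: "'n::finite set \<Rightarrow> 'n jet" where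
  "stdjet S = (\<chi> p q. if p = q \<and> p \<notin> S then 1 else 0, \<chi> p q. if p = q \<and> p \<in> S then 2 else 0)"

lemma jet_eqI:
  "(\<And>p q. fst m $ p $ q = fst m' $ p $ q \<and> snd m $ p $ q = snd m' $ p $ q) \<Longrightarrow> m = (m' :: 'n::finite jet)"
  by (simp add: prod_eq_iff vec_eq_iff)

lemma stdjet_nth: "fst (stdjet S) $ p $ q = (if p = q \<and> p \<notin> S then 1 else 0)"
  "snd (stdjet S) $ p $ q = (if p = q \<and> p \<in> S then 2 else 0)"
  by (simp_all add: stdjet_def)

lemma decouple_nth: "fst (decouple m j a b) $ p $ q = (if p = j \<and> q = j then a else if p = j \<or> q = j then 0 else fst m $ p $ q)"
  "snd (decouple m j a b) $ p $ q = (if p = j \<and> q = j then b else if p = j \<or> q = j then 0 else snd m $ p $ q)"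
  by (simp_all add: decouple_def)

lemma rop_stdjet: "rop (stdjet S) z $ p = (if p \<in> S then 2 * cnj (z $ p) else z $ p)"
proof -
  have "rop (stdjet S) z $ p = (\<Sum>q\<in>UNIV. if q = p then (if p \<in> S then 2 * cnj (z $ p) else z $ p) else 0)"
    unfolding rop_nth by (intro sum.cong) (auto simp: stdjet_def)
  then show ?thesis by simp
qed

lemma inj_stdjet: "inj (rop (stdjet S))"
  unfolding inj_rop_iff by (auto simp: vec_eq_iff rop_stdjet split: if_splits)

lemma nondeg_stdjet: "nondeg (stdjet S)"
  unfolding nondeg_def sym_iff using inj_stdjet by (auto simp: stdjet_def)

text \<open>Once all coordinates are decoupled, each diagonal pair is nondegenerate by itself, as a
  degenerate one would put a multiple of a coordinate vector into the kernel; so each can be moved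
  to its representative.\<close>

lemma conn_stdjet:
  fixes m :: "'n::finite jet"
  assumes "nondeg m" shows "\<exists>S. conn m (stdjet S)"
proof -
  obtain m0 where m0: "conn m m0" "\<forall>j. decoupled m0 j" using decouple_all[OF assms] by blast
  have "\<exists>m'. conn m m' \<and> (\<forall>j. decoupled m' j) \<and>
      (\<forall>j\<in>S. (fst m' $ j $ j, snd m' $ j $ j) \<in> {(1, 0), (0, 2)})" if "finite S" for S :: "'n set"
    using that
  proof (induction S)
    case empty
    then show ?case using m0 by blast
  next
    case (insert j S)
    then obtain m' where m': "conn m m'" "\<forall>j. decoupled m' j" "\<forall>j\<in>S. (fst m' $ j $ j, snd m' $ j $ j) \<in> {(1, 0), (0, 2)}" by blast
    have nd: "nondeg m'" using connected_component_in[OF m'(1)] by (simp add: jets_def)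
    have ne: "cmod (fst m' $ j $ j) \<noteq> cmod (snd m' $ j $ j)"
    proof
      assume "cmod (fst m' $ j $ j) = cmod (snd m' $ j $ j)"
      then obtain \<zeta> where \<zeta>: "\<zeta> \<noteq> 0" "fst m' $ j $ j * \<zeta> + snd m' $ j $ j * cnj \<zeta> = 0" by (rule equal_norm_zero)
      have "rop m' (axis j \<zeta>) $ p = 0" for p
        using \<zeta>(2) m'(2) by (cases "p = j") (auto simp: rop_axis_nth decoupled_def)
      then have "axis j \<zeta> = 0" using nd unfolding nondeg_def inj_rop_iff by (simp add: vec_eq_iff)
      then show False using \<zeta>(1) by (simp add: axis_eq_0_iff)
    qed
    have "\<exists>a b. (a, b) \<in> {(1, 0), (0, 2)} \<and> conn m' (decouple m' j a b)"
      using decouple_conn_std[OF nd, of j] m'(2) ne by (cases "cmod (fst m' $ j $ j) < cmod (snd m' $ j $ j)") auto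
    then obtain a b where ab: "(a, b) \<in> {(1, 0), (0, 2)}" "conn m' (decouple m' j a b)" by blast
    have "\<forall>i. decoupled (decouple m' j a b) i" using m'(2) by (auto simp: decoupled_def decouple_def)
    moreover have "\<forall>i\<in>insert j S. (fst (decouple m' j a b) $ i $ i, snd (decouple m' j a b) $ i $ i) \<in> {(1, 0), (0, 2)}"
      using m'(3) ab(1) by (auto simp: decouple_def)
    ultimately show ?case using connected_component_trans[OF m'(1) ab(2)] by blast
  qed
  from this[of UNIV] obtain m' :: "'n jet" where m': "conn m m'" "\<forall>j. decoupled m' j"
    "\<forall>j. (fst m' $ j $ j, snd m' $ j $ j) \<in> {(1, 0), (0, 2)}" by auto
  have "m' = stdjet {j. snd m' $ j $ j = 2}"
  proof (rule jet_eqI)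
    fix p q
    show "fst m' $ p $ q = fst (stdjet {j. snd m' $ j $ j = 2}) $ p $ q \<and> snd m' $ p $ q = snd (stdjet {j. snd m' $ j $ j = 2}) $ p $ q"
    proof (cases "p = q")
      case True
      have "fst m' $ q $ q = 1 \<and> snd m' $ q $ q = 0 \<or> fst m' $ q $ q = 0 \<and> snd m' $ q $ q = 2"
        using m'(3)[rule_format, of q] by simp
      then show ?thesis unfolding True by (elim disjE conjE) (simp_all add: stdjet_nth)
    next
      case False
      then show ?thesis using m'(2)[rule_format, of p] by (simp add: decoupled_def stdjet_nth)
    qed
  qed
  then have "conn m (stdjet {j. snd m' $ j $ j = 2})" using m'(1) by simp
  then show ?thesis by (rule exI)
qed

text \<open>The jet \<open>M\<close> couples the lines \<open>j\<close> and \<open>k\<close> through real parts; its two Schur complements exhibit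
  it as a common neighbour of the two standard jets.\<close>

lemma flip:
  fixes S :: "'n::finite set"
  assumes j: "j \<in> S" "j \<noteq> k"
  shows "conn (stdjet S) (stdjet (if k \<in> S then S - {j, k} else insert k (S - {j})))"
proof -
  let ?S' = "if k \<in> S then S - {j, k} else insert k (S - {j})"
  define E where "E p q \<longleftrightarrow> (p = j \<and> q = k) \<or> (p = k \<and> q = j)" for p q
  define M :: "'n jet" where "M = (\<chi> p q. if E p q then 1 else fst (stdjet (S - {j})) $ p $ q,
     \<chi> p q. if E p q then 1 else snd (stdjet (S - {j})) $ p $ q)"
  have symM: "transpose (snd M) = snd M"
    unfolding sym_iff
  proof (intro allI)
    fix p q
    have "E p q = E q p" by (auto simp: E_def)
    moreover have "snd (stdjet (S - {j})) $ p $ q = snd (stdjet (S - {j})) $ q $ p"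
      by (cases "p = q") (simp_all add: stdjet_def)
    ultimately show "snd M $ p $ q = snd M $ q $ p" by (simp add: M_def)
  qed
  have M_nth: "fst M $ p $ q = (if E p q then 1 else if p = q \<and> p \<notin> S - {j} then 1 else 0)"
    "snd M $ p $ q = (if E p q then 1 else if p = q \<and> p \<in> S - {j} then 2 else 0)" for p q
    by (simp_all add: M_def stdjet_nth)
  have nE: "\<not> E p q" if "p \<noteq> j \<and> q \<noteq> j \<or> p \<noteq> k \<and> q \<noteq> k" for p q using that by (auto simp: E_def)
  have decouple_std: "decouple m i a b = stdjet T"
    if "\<And>p q. p \<noteq> i \<Longrightarrow> q \<noteq> i \<Longrightarrow> fst m $ p $ q = fst (stdjet T) $ p $ q \<and> snd m $ p $ q = snd (stdjet T) $ p $ q"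
      "i \<in> T \<Longrightarrow> a = 0 \<and> b = 2" "i \<notin> T \<Longrightarrow> a = 1 \<and> b = 0" for m i a b T
    by (rule jet_eqI, case_tac "p = i"; case_tac "q = i") (use that in \<open>simp_all add: decouple_nth stdjet_nth\<close>)
  have Mj: "decouple M j a b = stdjet T" if "T - {j} = S - {j}" "j \<in> T \<Longrightarrow> a = 0 \<and> b = 2" "j \<notin> T \<Longrightarrow> a = 1 \<and> b = 0" for a b T
    using that by (intro decouple_std) (auto simp: M_nth nE stdjet_nth)
  have Mk: "decouple M k a b = stdjet T" if "T - {k} = S - {j, k}" "k \<in> T \<Longrightarrow> a = 0 \<and> b = 2" "k \<notin> T \<Longrightarrow> a = 1 \<and> b = 0" for a b T
    using that by (intro decouple_std) (auto simp: M_nth nE stdjet_nth)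
  have decouple2: "decouple (decouple m i a b) i a' b' = decouple m i a' b'" for m i a b a' b'
    by (rule jet_eqI) (simp add: decouple_nth)
  have ropM: "rop M (axis q c) $ p = (if E p q then c + cnj c else if p \<noteq> q then 0 else if q \<in> S - {j} then 2 * cnj c else c)" for p q c
    by (cases "E p q"; cases "p = q") (simp_all add: rop_axis_nth M_nth)
  have jj: "fst M $ j $ j = 1" "snd M $ j $ j = 0" using j nE[of j j] by (simp_all add: M_nth)
  have kk: "fst M $ k $ k = (if k \<in> S then 0 else 1)" "snd M $ k $ k = (if k \<in> S then 2 else 0)"
    using j nE[of k k] by (simp_all add: M_nth)
  \<comment> \<open>Elimination of the line \<open>k\<close> for the real input
    \<open>t = \<zeta> + cnj \<zeta>\<close>: the equation on that line is
    \<open>2 * cnj y = t\<close> if \<open>k\<close> is in \<open>S\<close> and \<open>y = t\<close>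
    otherwise. The coupling returns \<open>y + cnj y\<close>, which is \<open>t\<close> or
    \<open>2 * t\<close>.\<close>
  define \<alpha> :: complex where "\<alpha> = (if k \<in> S then 1 else 2)"
  have "conn M (decouple M j (fst M $ j $ j - \<alpha>) (snd M $ j $ j - \<alpha>))"
  proof (rule schur[OF symM])
    show "inj (rop (decouple M j 1 0))" by (subst Mj[of "S - {j}"]) (auto simp: inj_stdjet)
    show "\<exists>y. y $ j = 0 \<and> (\<forall>p. p \<noteq> j \<longrightarrow> rop M y $ p = rop M (axis j \<zeta>) $ p) \<and> rop M y $ j = \<alpha> * \<zeta> + \<alpha> * cnj \<zeta>" for \<zeta>
    proof (intro exI conjI allI impI)
      let ?y = "axis k (\<alpha> / 2 * (\<zeta> + cnj \<zeta>))"
      show "?y $ j = 0" using j by (simp add: axis_def)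
      show "rop M ?y $ p = rop M (axis j \<zeta>) $ p" if "p \<noteq> j" for p
        unfolding ropM using that j by (auto simp: E_def \<alpha>_def)
      show "rop M ?y $ j = \<alpha> * \<zeta> + \<alpha> * cnj \<zeta>"
        unfolding ropM using j by (auto simp: E_def \<alpha>_def algebra_simps)
    qed
    show "cmod (fst M $ j $ j - \<alpha>) \<noteq> cmod (snd M $ j $ j - \<alpha>)" by (simp add: jj \<alpha>_def)
  qed
  note c1 = this
  let ?M1 = "decouple M j (fst M $ j $ j - \<alpha>) (snd M $ j $ j - \<alpha>)"
  have "?M1 \<in> jets" using connected_component_in[OF c1] by simp
  then have "conn ?M1 (decouple ?M1 j 0 2)"
    by (intro decouple_conn_std(2)) (simp_all add: jets_def decoupled_def decouple_nth jj \<alpha>_def)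
  moreover have "decouple ?M1 j 0 2 = stdjet S"
    unfolding decouple2 by (rule Mj) (use j in auto)
  ultimately have a: "conn M (stdjet S)" using connected_component_trans[OF c1] by simp
  \<comment> \<open>Elimination of the line \<open>j\<close>, on which \<open>M\<close> is the
    identity, returns \<open>2 * t\<close>. Subtracting this correction at \<open>k\<close>
    exchanges which of the two entries has the larger modulus.\<close>
  have "conn M (decouple M k (fst M $ k $ k - 2) (snd M $ k $ k - 2))"
  proof (rule schur[OF symM])
    show "inj (rop (decouple M k 1 0))" by (subst Mk[of "S - {j, k}"]) (auto simp: inj_stdjet)
    show "\<exists>y. y $ k = 0 \<and> (\<forall>p. p \<noteq> k \<longrightarrow> rop M y $ p = rop M (axis k \<zeta>) $ p) \<and> rop M y $ k = 2 * \<zeta> + 2 * cnj \<zeta>" for \<zeta>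
    proof (intro exI conjI allI impI)
      let ?y = "axis j (\<zeta> + cnj \<zeta>)"
      show "?y $ k = 0" using j by (simp add: axis_def)
      show "rop M ?y $ p = rop M (axis k \<zeta>) $ p" if "p \<noteq> k" for p
        unfolding ropM using that j by (auto simp: E_def)
      show "rop M ?y $ k = 2 * \<zeta> + 2 * cnj \<zeta>"
        unfolding ropM using j by (auto simp: E_def algebra_simps)
    qed
    show "cmod (fst M $ k $ k - 2) \<noteq> cmod (snd M $ k $ k - 2)" by (simp add: kk)
  qed
  note c2 = this
  let ?M2 = "decouple M k (fst M $ k $ k - 2) (snd M $ k $ k - 2)"
  have M2: "?M2 \<in> jets" using connected_component_in[OF c2] by simp
  have dM2: "decoupled ?M2 k" by (simp add: decoupled_def decouple_nth)
  have "conn ?M2 (stdjet ?S')"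
  proof (cases "k \<in> S")
    case True
    have "conn ?M2 (decouple ?M2 k 1 0)"
      by (rule decouple_conn_std(1)) (use M2 dM2 True in \<open>simp_all add: jets_def decouple_nth kk\<close>)
    moreover have "decouple ?M2 k 1 0 = stdjet ?S'"
      unfolding decouple2 by (rule Mk) (use j True in auto)
    ultimately show ?thesis by simp
  next
    case False
    have "conn ?M2 (decouple ?M2 k 0 2)"
      by (rule decouple_conn_std(2)) (use M2 dM2 False in \<open>simp_all add: jets_def decouple_nth kk\<close>)
    moreover have "decouple ?M2 k 0 2 = stdjet ?S'"
      unfolding decouple2 by (rule Mk) (use j False in auto)
    ultimately show ?thesis by simp
  qed
  then have "conn M (stdjet ?S')" by (rule connected_component_trans[OF c2])
  then show ?thesis by (rule connected_component_trans[OF connected_component_sym[OF a]])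
qed

text \<open>Each \<open>flip\<close> toggles both \<open>j\<close> and \<open>k\<close> in
  \<open>S\<close>, so elements other than \<open>k\<close> can be removed one at a time. The parity
  of \<open>card S\<close>, which is the sign of the real determinant, is preserved.\<close>

lemma jet_classification:
  fixes m :: "'n::finite jet"
  assumes "nondeg m" shows "conn m (stdjet {}) \<or> conn m (stdjet {k})"
proof -
  have "conn (stdjet S) (stdjet {}) \<or> conn (stdjet S) (stdjet {k})" for S :: "'n set"
  proof (induction "card (S - {k})" arbitrary: S)
    case 0
    then have "S \<subseteq> {k}" by simp
    then have "S = {} \<or> S = {k}" by blast
    moreover have "conn (stdjet S) (stdjet S)" by (simp add: jets_def nondeg_stdjet)
    ultimately show ?case by blast
  next
    case (Suc n)
    then have "S - {k} \<noteq> {}" by (metis card.empty nat.distinct(1))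
    then obtain j where j: "j \<in> S" "j \<noteq> k" by blast
    let ?S' = "if k \<in> S then S - {j, k} else insert k (S - {j})"
    have "?S' - {k} = S - {k} - {j}" by auto
    then have "n = card (?S' - {k})" using Suc.hyps(2) j by simp
    from Suc.hyps(1)[OF this] show ?case
      using connected_component_trans[OF flip[OF j]] by (elim disjE) simp_all
  qed
  note * = this
  obtain S where S: "conn m (stdjet S)" using conn_stdjet[OF assms] by blast
  from *[of S] show ?thesis
    using connected_component_trans[OF S] by (elim disjE) simp_all
qed

lemma qform_stdjet:
  "qform (stdjet {}) z = (\<Sum>j\<in>UNIV. complex_of_real ((cmod (z $ j))\<^sup>2))"
  "qform (stdjet {k}) z = (cnj (z $ k))\<^sup>2 + (\<Sum>j\<in>UNIV - {k}. complex_of_real ((cmod (z $ j))\<^sup>2))"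
proof -
  have h: "rop (fst (stdjet S), (1/2) *\<^sub>R snd (stdjet S)) z $ p = (if p \<in> S then cnj (z $ p) else z $ p)" for S :: "'a set" and p
  proof -
    have "rop (fst (stdjet S), (1/2) *\<^sub>R snd (stdjet S)) z $ p = (\<Sum>q\<in>UNIV. if q = p then (if p \<in> S then cnj (z $ p) else z $ p) else 0)"
      unfolding rop_nth by (intro sum.cong) (auto simp: stdjet_def)
    then show ?thesis by simp
  qed
  have n: "cnj w * w = complex_of_real ((cmod w)\<^sup>2)" for w
    unfolding complex_norm_square by (rule mult.commute)
  show "qform (stdjet {}) z = (\<Sum>j\<in>UNIV. complex_of_real ((cmod (z $ j))\<^sup>2))"
    unfolding qform_def cdot_def h by (simp add: cnjv_def n)
  have "qform (stdjet {k}) z = cnj (z $ k) * cnj (z $ k) + (\<Sum>j\<in>UNIV - {k}. cnj (z $ j) * z $ j)"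
    unfolding qform_def cdot_def h
    by (subst sum.remove[of UNIV k]) (auto simp: cnjv_def intro!: sum.cong)
  then show "qform (stdjet {k}) z = (cnj (z $ k))\<^sup>2 + (\<Sum>j\<in>UNIV - {k}. complex_of_real ((cmod (z $ j))\<^sup>2))"
    by (simp add: n power2_eq_square)
qed

section \<open>Normal forms at all complex points\<close>

lemma rop_diff: "rop (m' - m) z = rop m' z - rop m z"
  by (rule bounded_bilinear.diff_left[OF bounded_bilinear_rop])

lemma qform_diff: "qform (m' - m) z = qform m' z - qform m z"
  unfolding qform_def cdot_add(4)[symmetric] rop_diff[symmetric] by (simp add: scaleR_diff_right)

lemma frechet_derivative_cong_open:
  assumes "open U" "x \<in> U" "\<And>x. x \<in> U \<Longrightarrow> f x = g x"
  shows "frechet_derivative f (at x) = frechet_derivative g (at x)"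
proof -
  have "(f has_derivative D) (at x) \<longleftrightarrow> (g has_derivative D) (at x)" for D
    using has_derivative_transform_within_open[OF _ assms(1,2), of f D UNIV g]
      has_derivative_transform_within_open[OF _ assms(1,2), of g D UNIV f] assms(3) by auto
  then show ?thesis by (simp add: frechet_derivative_def)
qed

section \<open>Deformations along connected sets of jets\<close>

context cr_setting
begin

text \<open>Quantified over all embeddings, neighbourhoods and points, so that it is a relation
  between jets alone and can be composed. The set \<open>K\<close> confines the change to a
  prescribed neighbourhood of the point.\<close>

definition deformable :: "'n jet \<Rightarrow> 'n jet \<Rightarrow> bool" where
  "deformable m m' \<longleftrightarrow> (\<forall>f N y W. embd f \<longrightarrow> openin (C0_topology Y X) N \<longrightarrow> f \<in> N \<longrightarrow> oscul f y m \<longrightarrow>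
     openin Y W \<longrightarrow> y \<in> W \<longrightarrow> (\<exists>g K. embd g \<and> g \<in> N \<and> reach N f g \<and> normal_at g y m' \<and>
       closedin Y K \<and> K \<subseteq> W \<and> (\<forall>y'\<in>topspace Y - K. g y' = f y') \<and> (\<forall>y'\<in>topspace Y. cpt g y' \<longleftrightarrow> cpt f y')))"

lemma deformableD:
  assumes "deformable m m'" "embd f" "openin (C0_topology Y X) N" "f \<in> N" "oscul f y m" "openin Y W" "y \<in> W"
  shows "\<exists>g K. embd g \<and> g \<in> N \<and> reach N f g \<and> normal_at g y m' \<and>
       closedin Y K \<and> K \<subseteq> W \<and> (\<forall>y'\<in>topspace Y - K. g y' = f y') \<and> (\<forall>y'\<in>topspace Y. cpt g y' \<longleftrightarrow> cpt f y')"
  using assms unfolding deformable_def by simp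

lemma deformable_trans:
  assumes 1: "deformable m m'" and 2: "deformable m' m''" and s: "transpose (snd m') = snd m'"
  shows "deformable m m''"
  unfolding deformable_def
proof (intro allI impI)
  fix f N y W
  assume a: "embd f" "openin (C0_topology Y X) N" "f \<in> N" "oscul f y m" "openin Y W" "y \<in> W"
  obtain g K where g: "embd g" "g \<in> N" "reach N f g" "normal_at g y m'" "closedin Y K" "K \<subseteq> W"
    "\<forall>y'\<in>topspace Y - K. g y' = f y'" "\<forall>y'\<in>topspace Y. cpt g y' \<longleftrightarrow> cpt f y'"
    using deformableD[OF 1 a] by (elim exE conjE)
  obtain h L where h: "embd h" "h \<in> N" "reach N g h" "normal_at h y m''" "closedin Y L" "L \<subseteq> W"
    "\<forall>y'\<in>topspace Y - L. h y' = g y'" "\<forall>y'\<in>topspace Y. cpt h y' \<longleftrightarrow> cpt g y'"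
    using deformableD[OF 2 g(1) a(2) g(2) normal_at_imp_oscul[OF g(1) g(4) s] a(5,6)] by (elim exE conjE)
  show "\<exists>g K. embd g \<and> g \<in> N \<and> reach N f g \<and> normal_at g y m'' \<and>
       closedin Y K \<and> K \<subseteq> W \<and> (\<forall>y'\<in>topspace Y - K. g y' = f y') \<and> (\<forall>y'\<in>topspace Y. cpt g y' \<longleftrightarrow> cpt f y')"
  proof (intro exI[of _ h] exI[of _ "K \<union> L"] conjI)
    show "reach N f h" by (rule reach_trans[OF g(3) h(3)])
    show "closedin Y (K \<union> L)" using g(5) h(5) by (rule closedin_Un)
    show "K \<union> L \<subseteq> W" using g(6) h(6) by (rule Un_least)
    show "\<forall>y'\<in>topspace Y - (K \<union> L). h y' = f y'" using g(7) h(7) by simp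
    show "\<forall>y'\<in>topspace Y. cpt h y' \<longleftrightarrow> cpt f y'" using g(8) h(8) by simp
  qed (rule h)+
qed

lemma deformable_near:
  assumes m: "nondeg m"
  shows "\<exists>r>0. \<forall>m'. transpose (snd m') = snd m' \<and> norm (m' - m) < r \<longrightarrow> deformable m m' \<and> deformable m' m"
proof -
  obtain \<mu> where \<mu>: "\<mu> > 0" "\<And>z. \<mu> * norm z \<le> norm (rop m z)"
    using linear_inj_bounded_below_pos[OF linear_rop, of m] m unfolding nondeg_def by metis
  obtain C where C: "C > 0" "\<And>(m :: 'n jet) z. norm (rop m z) \<le> C * norm m * norm z"
    "\<And>(m :: 'n jet) z. cmod (qform m z) \<le> C * norm m * (norm z)\<^sup>2"
    by (rule jet_bounds) (rule that)
  obtain s' S where S: "\<And>x. (smooth_step has_field_derivative s' x) (at x)"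
    "\<And>x. \<bar>s' x\<bar> \<le> S" "S \<ge> 0" "\<And>x. x \<le> 0 \<Longrightarrow> s' x = 0" by (rule smooth_step_deriv) (rule that)
  \<comment> \<open>\<open>2 + 2 * S\<close> rather than \<open>1 + 2 * S\<close>: at the nearby jet
    only the lower bound \<open>\<mu> - \<kappa>\<close> is available, and the way back has to
    satisfy its estimate with that.\<close>
  define r where "r = \<mu> / (C * (2 + 2 * S))"
  have r: "r > 0" using \<mu>(1) C(1) S(3) by (simp add: r_def)
  have main: "deformable a b" if ab: "transpose (snd a) = snd a" "transpose (snd b) = snd b"
      and \<nu>: "\<And>z. \<nu> * norm z \<le> norm (rop a z)" and cl: "C * norm (b - a) * (1 + 2 * S) < \<nu>" for a b \<nu>
    unfolding deformable_def
  proof (intro allI impI)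
    fix f N y W
    assume f: "embd f" "openin (C0_topology Y X) N" "f \<in> N" "oscul f y a" "openin Y W" "y \<in> W"
    have k: "norm (rop b z - rop a z) \<le> C * norm (b - a) * norm z"
      "cmod (qform b z - qform a z) \<le> C * norm (b - a) * (norm z)\<^sup>2" for z
      using C(2,3)[of "b - a" z] by (simp_all add: rop_diff qform_diff)
    have k0: "0 \<le> C * norm (b - a)" using C(1) by simp
    show "\<exists>g K. embd g \<and> g \<in> N \<and> reach N f g \<and> normal_at g y b \<and>
       closedin Y K \<and> K \<subseteq> W \<and> (\<forall>y'\<in>topspace Y - K. g y' = f y') \<and> (\<forall>y'\<in>topspace Y. cpt g y' \<longleftrightarrow> cpt f y')"
    proof (rule modify_jet[OF f ab \<nu> k S(1,2) _ cl k0 S(3)])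
      show "s' x = 0" if "x \<le> 0" for x using that by (rule S(4))
      show ?thesis
        if g: "embd g" "g \<in> N" "reach N f g" "normal_at g y b" "closedin Y K" "K \<subseteq> W"
          "\<And>y'. y' \<in> topspace Y - K \<Longrightarrow> g y' = f y'" "\<And>y'. y' \<in> topspace Y \<Longrightarrow> cpt g y' \<longleftrightarrow> cpt f y'" for g K
        by (intro exI[of _ g] exI[of _ K] conjI ballI g)
    qed
  qed
  have "deformable m m' \<and> deformable m' m" if m': "transpose (snd m') = snd m'" "norm (m' - m) < r" for m'
  proof -
    have sm: "transpose (snd m) = snd m" using m by (simp add: nondeg_def)
    define \<kappa> where "\<kappa> = C * norm (m' - m)"
    have "0 < C * (2 + 2 * S)" using C(1) S(3) by simp
    then have \<kappa>: "\<kappa> * (2 + 2 * S) < \<mu>" "0 \<le> \<kappa>"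
      using m'(2) C(1) by (simp_all add: r_def \<kappa>_def pos_less_divide_eq mult_ac)
    have "\<kappa> * (1 + 2 * S) \<le> \<kappa> * (2 + 2 * S)" using \<kappa>(2) by (intro mult_left_mono) simp_all
    then have k1: "\<kappa> * (1 + 2 * S) < \<mu>" using \<kappa>(1) by linarith
    have k2: "\<kappa> * (1 + 2 * S) < \<mu> - \<kappa>" using \<kappa>(1) by (simp add: algebra_simps)
    have "(\<mu> - \<kappa>) * norm z \<le> norm (rop m' z)" for z
    proof -
      have "norm (rop m z) \<le> norm (rop m' z) + norm (rop (m' - m) z)"
        using norm_triangle_sub[of "rop m z" "rop m' z"] by (simp add: rop_diff norm_minus_commute)
      then show ?thesis using \<mu>(2)[of z] C(2)[of "m' - m" z] by (simp add: \<kappa>_def left_diff_distrib)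
    qed
    then have "deformable m' m"
      by (rule main[OF m'(1) sm]) (use k2 in \<open>simp add: \<kappa>_def norm_minus_commute\<close>)
    moreover have "deformable m m'"
      by (rule main[OF sm m'(1) \<mu>(2)]) (use k1 in \<open>simp add: \<kappa>_def\<close>)
    ultimately show ?thesis by simp
  qed
  then show ?thesis using r by (intro exI[of _ r]) simp
qed

text \<open>Deformability in both directions is symmetric, transitive on the jets at hand and holds
  between neighbouring jets, hence it holds throughout a connected set of jets.\<close>

lemma deformable_conn:
  assumes "conn m m'" shows "deformable m m'"
proof -
  obtain T where T: "connected T" "T \<subseteq> jets" "m \<in> T" "m' \<in> T"
    using assms unfolding connected_component_def by (elim exE conjE) (rule that)
  have sT: "transpose (snd a) = snd a" "nondeg a" if "a \<in> T" for a
    using subsetD[OF T(2) that] by (simp_all add: jets_def nondeg_def)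
  have "deformable m m' \<and> deformable m' m"
  proof (rule connected_equivalence_relation[OF T(1,3,4), of "\<lambda>a b. deformable a b \<and> deformable b a"])
    show "deformable a c \<and> deformable c a"
      if "deformable a b \<and> deformable b a" "deformable b c \<and> deformable c b" "a \<in> T" "b \<in> T" "c \<in> T" for a b c
      using that deformable_trans sT(1) by meson
    show "\<exists>U. openin (top_of_set T) U \<and> a \<in> U \<and> (\<forall>x\<in>U. deformable a x \<and> deformable x a)" if a: "a \<in> T" for a
    proof -
      obtain r where r: "r > 0" "\<forall>m'. transpose (snd m') = snd m' \<and> norm (m' - a) < r \<longrightarrow> deformable a m' \<and> deformable m' a"
        using deformable_near[OF sT(2)[OF a]] by (elim exE conjE)
      show ?thesis
      proof (intro exI[of _ "T \<inter> ball a r"] conjI ballI)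
        show "openin (top_of_set T) (T \<inter> ball a r)" by (rule openin_open_Int[OF open_ball])
        show "a \<in> T \<inter> ball a r" using a r(1) by simp
        fix x assume "x \<in> T \<inter> ball a r"
        then have "deformable a x \<and> deformable x a" using r(2)[rule_format, of x] sT(1) by (simp add: dist_norm norm_minus_commute)
        then show "deformable a x" "deformable x a" by simp_all
      qed
    qed
  qed simp
  then show ?thesis by simp
qed

lemma normalize_point:
  assumes f: "embd f" and N: "openin (C0_topology Y X) N" "f \<in> N" and r: "regular f y" "cpt f y"
    and W: "openin Y W" "y \<in> W"
  shows "\<exists>g K S. embd g \<and> g \<in> N \<and> reach N f g \<and> S \<in> {{}, {k}} \<and> normal_at g y (stdjet S) \<and>
    closedin Y K \<and> K \<subseteq> W \<and> (\<forall>y'\<in>topspace Y - K. g y' = f y') \<and> (\<forall>y'\<in>topspace Y. cpt g y' \<longleftrightarrow> cpt f y')"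
proof -
  obtain m where m: "nondeg m" "oscul f y m" by (rule regular_complex_oscul[OF f r])
  obtain S where S: "S \<in> {{}, {k}}" "conn m (stdjet S)" using jet_classification[OF m(1), of k] by blast
  from deformableD[OF deformable_conn[OF S(2)] f N m(2) W] show ?thesis using S(1) by blast
qed

section \<open>Locality of the notions, and isolation of complex points\<close>

lemma rep_eq_open:
  assumes f: "smf f" and cd: "c \<in> B" "y \<in> fst c" and W: "openin Y W" "y \<in> W" "\<And>y. y \<in> W \<Longrightarrow> f y = g y"
  shows "\<exists>U. open U \<and> snd c y \<in> U \<and> U \<subseteq> snd c ` fst c \<and> (\<forall>x\<in>U. local_rep c d f x = local_rep c d g x)"
proof (intro exI conjI ballI)
  note ic = B_chart[OF cd(1)]
  show "open (snd c ` (fst c \<inter> W))" by (rule chart_open_image[OF ic]) (use W(1) is_chartD(1)[OF ic] in auto)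
  show "snd c y \<in> snd c ` (fst c \<inter> W)" using cd(2) W(2) by simp
  show "snd c ` (fst c \<inter> W) \<subseteq> snd c ` fst c" by auto
  fix x assume "x \<in> snd c ` (fst c \<inter> W)"
  then have "cinv c x \<in> W" using chart_cinv(1)[OF ic] by auto
  then show "local_rep c d f x = local_rep c d g x" by (simp add: local_rep_def W(3))
qed

lemma regular_local:
  assumes f: "smf f" and r: "regular f y" and W: "openin Y W" "y \<in> W" "\<And>y. y \<in> W \<Longrightarrow> f y = g y"
  shows "regular g y"
proof -
  obtain c d where cd: "c \<in> B" "hc d" "y \<in> fst c" "f y \<in> fst d" "graphical (drep c d f y)"
    "dbar c d f (snd c y) = 0 \<longrightarrow> inj (frechet_derivative (dbar c d f) (at (snd c y)))"
    using r unfolding regular_def by blast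
  obtain U where U: "open U" "snd c y \<in> U" "\<forall>x\<in>U. local_rep c d f x = local_rep c d g x"
    using rep_eq_open[OF f cd(1,3) W] by blast
  have fd: "frechet_derivative (local_rep c d f) (at x) = frechet_derivative (local_rep c d g) (at x)" if "x \<in> U" for x
    by (rule frechet_derivative_cong_open[OF U(1) that]) (use U(3) in simp)
  have db: "dbar c d f x = dbar c d g x" if "x \<in> U" for x using fd[OF that] by simp
  have "frechet_derivative (dbar c d f) (at (snd c y)) = frechet_derivative (dbar c d g) (at (snd c y))"
    by (rule frechet_derivative_cong_open[OF U(1,2) db])
  then have "dbar c d g (snd c y) = 0 \<longrightarrow> inj (frechet_derivative (dbar c d g) (at (snd c y)))"
    using cd(6) db[OF U(2)] by simp
  moreover have "g y \<in> fst d" using cd(4) W(2,3) by simp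
  moreover have "graphical (drep c d g y)" using cd(5) fd[OF U(2)] by simp
  ultimately show ?thesis unfolding regular_def using cd(1-3) by (intro bexI[OF _ cd(1)] exI[of _ d] conjI)
qed

lemma normal_at_local:
  assumes f: "smf f" and r: "normal_at f y m" and W: "openin Y W" "y \<in> W" "\<And>y. y \<in> W \<Longrightarrow> f y = g y"
  shows "normal_at g y m"
proof -
  obtain c d \<rho> where g: "graph_chart f y c d" and \<rho>: "\<rho> > 0" "\<forall>x\<in>ball (snd c y) \<rho>. wc c d f x = qform m (zc c d f x)"
    using r unfolding normal_at_def by (elim exE conjE)
  have cd: "c \<in> B" "hc d" "y \<in> fst c" "f y \<in> fst d" "graphical (drep c d f y)" "zc c d f (snd c y) = 0"
    using g by (simp_all add: graph_chart_def)
  obtain U where U: "open U" "snd c y \<in> U" "\<forall>x\<in>U. local_rep c d f x = local_rep c d g x"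
    using rep_eq_open[OF f cd(1,3) W] by blast
  have "drep c d f y = drep c d g y"
    by (rule frechet_derivative_cong_open[OF U(1,2)]) (use U(3) in simp)
  then have "graph_chart g y c d" unfolding graph_chart_def using cd U(2,3) W(2) W(3)[OF W(2)] by simp
  moreover obtain \<rho>' where \<rho>': "\<rho>' > 0" "ball (snd c y) \<rho>' \<subseteq> U" using U(1,2) open_contains_ball by blast
  have "\<forall>x\<in>ball (snd c y) (min \<rho> \<rho>'). wc c d g x = qform m (zc c d g x)"
  proof
    fix x assume x: "x \<in> ball (snd c y) (min \<rho> \<rho>')"
    then have "x \<in> U" using \<rho>'(2) by auto
    then have e: "local_rep c d f x = local_rep c d g x" using U(3) by simp
    have "wc c d f x = qform m (zc c d f x)" using \<rho>(2) x by simp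
    then show "wc c d g x = qform m (zc c d g x)" unfolding e .
  qed
  moreover have "min \<rho> \<rho>' > 0" using \<rho>(1) \<rho>'(1) by simp
  ultimately show ?thesis unfolding normal_at_def by (intro exI[of _ c] exI[of _ d] conjI exI[of _ "min \<rho> \<rho>'"])
qed

text \<open>At a nondegenerate zero the gradient grows at least linearly with the distance; where it
  is nonzero it stays so nearby by continuity.\<close>

lemma complex_points_isolated:
  assumes f: "embd f" and y: "y \<in> topspace Y" and r: "regular f y"
  shows "\<exists>W. openin Y W \<and> y \<in> W \<and> (\<forall>y'\<in>W. cpt f y' \<longrightarrow> y' = y)"
proof -
  have sf: "smf f" using f by (simp add: embd_def)
  obtain c d where cd: "c \<in> B" "hc d" "y \<in> fst c" "f y \<in> fst d" "graphical (drep c d f y)"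
    and ii: "dbar c d f (snd c y) = 0 \<longrightarrow> inj (frechet_derivative (dbar c d f) (at (snd c y)))"
    using r unfolding regular_def by blast
  note ic = B_chart[OF cd(1)]
  define x0 where "x0 = snd c y"
  obtain r Z m where p: "patch_ok f (c, d, x0, r, Z, m)"
    using patch_exists[OF sf cd zero_less_one] unfolding x0_def by blast
  note pk = patch_okD[OF sf p]
  interpret gp: graph_patch Y B X A f c d x0 r "r / 2"
    by (rule patch_ok_graph_patch[OF f p]) (use pk(3) in simp_all)
  have G: "Cinf (dbar c d f) (ball x0 r)"
    by (rule Cinf_dz_part(2)[OF Cinf_deriv[OF gp.u_Cinf] gp.gr open_ball])
  have x0r: "x0 \<in> ball x0 r" using pk(3) by simp
  let ?D = "frechet_derivative (dbar c d f) (at x0)"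
  have D: "(dbar c d f has_derivative ?D) (at x0)" by (rule Cinf_has_derivative[OF G x0r])
  have "\<exists>e>0. \<forall>x\<in>ball x0 e. dbar c d f x = 0 \<longrightarrow> x = x0"
  proof (cases "dbar c d f x0 = 0")
    case True
    then have "inj ?D" using ii by (simp add: x0_def)
    then obtain \<mu> where \<mu>: "\<mu> > 0" "\<And>v. \<mu> * norm v \<le> norm (?D v)"
      using linear_inj_bounded_below_pos[OF has_derivative_linear[OF D]] by metis
    obtain e where e: "e > 0" "\<And>x. norm (x - x0) < e \<Longrightarrow> norm (dbar c d f x - dbar c d f x0 - ?D (x - x0)) \<le> (\<mu> / 2) * norm (x - x0)"
      using D \<mu>(1) unfolding has_derivative_at_alt by (meson half_gt_zero)
    have "x = x0" if x: "x \<in> ball x0 e" "dbar c d f x = 0" for x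
    proof (rule ccontr)
      assume "x \<noteq> x0"
      then have "\<mu> * norm (x - x0) > 0" using \<mu>(1) by simp
      moreover have "norm (?D (x - x0)) \<le> (\<mu> / 2) * norm (x - x0)"
        using e(2)[of x] x True by (simp add: dist_norm norm_minus_commute)
      ultimately show False using \<mu>(2)[of "x - x0"] by linarith
    qed
    then show ?thesis using e(1) by blast
  next
    case False
    have "isCont (dbar c d f) x0" by (rule has_derivative_continuous[OF D])
    then have "\<forall>\<^sub>F x in at x0. dbar c d f x \<noteq> 0"
      using False unfolding isCont_def by (rule tendsto_imp_eventually_ne)
    then obtain e where e: "e > 0" "\<forall>x. x \<noteq> x0 \<and> dist x x0 < e \<longrightarrow> dbar c d f x \<noteq> 0"
      unfolding eventually_at by auto
    then show ?thesis by (intro exI[of _ e]) (use e in \<open>auto simp: dist_commute\<close>)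
  qed
  then obtain e where e: "e > 0" "\<And>x. x \<in> ball x0 e \<Longrightarrow> dbar c d f x = 0 \<Longrightarrow> x = x0" by blast
  let ?W = "cinv c ` ball x0 (min e r)"
  have sub: "ball x0 (min e r) \<subseteq> ball x0 r" by (rule subset_ball) simp
  have "openin Y ?W" by (rule chart_open_cinv_image[OF ic open_ball]) (use gp.ballc(1) sub in blast)
  moreover have "y = cinv c x0" using chart_cinv(1)[OF ic cd(3)] by (simp add: x0_def)
  then have "y \<in> ?W" using e(1) pk(3) by (intro image_eqI[of _ _ x0]) simp_all
  moreover have "y' = y" if y': "y' \<in> ?W" "cpt f y'" for y'
  proof -
    obtain x where x: "x \<in> ball x0 (min e r)" "y' = cinv c x" using y'(1) by (rule imageE) simp
    have xr: "x \<in> ball x0 r" "x \<in> cball x0 r" "x \<in> ball x0 e" using x(1) by simp_all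
    have xc: "x \<in> snd c ` fst c" using pk(4) xr(2) by blast
    have yc: "y' \<in> fst c" "snd c y' = x" unfolding x(2) by (rule chart_cinv(2,3)[OF ic xc])+
    have "f y' \<in> fst d" using pk(5)[OF xr(2)] x(2) by simp
    from cpt_iff[OF sf cd(1,2) yc(1) this] have "cpt f y' \<longleftrightarrow> dbar c d f x = 0"
      unfolding yc(2) graphical_complex_iff[OF pk(6)[OF xr(2)]] .
    then have "dbar c d f x = 0" using y'(2) by simp
    then have "x = x0" by (rule e(2)[OF xr(3)])
    then show ?thesis using x(2) \<open>y = cinv c x0\<close> by simp
  qed
  ultimately show ?thesis by (intro exI[of _ ?W]) simp
qed

lemma finite_complex_points:
  assumes f: "embd f" and r: "\<And>y. y \<in> topspace Y \<Longrightarrow> regular f y"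
  shows "finite {y \<in> topspace Y. cpt f y}"
proof -
  have "\<forall>y\<in>topspace Y. \<exists>W. openin Y W \<and> y \<in> W \<and> (\<forall>y'\<in>W. cpt f y' \<longrightarrow> y' = y)"
    using complex_points_isolated[OF f _ r] by simp
  then obtain W where W: "\<And>y. y \<in> topspace Y \<Longrightarrow> openin Y (W y)" "\<And>y. y \<in> topspace Y \<Longrightarrow> y \<in> W y"
    "\<And>y y'. y \<in> topspace Y \<Longrightarrow> y' \<in> W y \<Longrightarrow> cpt f y' \<Longrightarrow> y' = y"
    unfolding bchoice_iff by blast
  have "\<exists>F. finite F \<and> F \<subseteq> W ` topspace Y \<and> topspace Y \<subseteq> \<Union>F"
    using compact_Y W(1,2) unfolding compact_space_alt by (elim allE[of _ "W ` topspace Y"]) blast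
  then obtain T where T: "finite T" "T \<subseteq> topspace Y" "topspace Y \<subseteq> \<Union>(W ` T)"
    by (metis finite_subset_image)
  have "{y \<in> topspace Y. cpt f y} \<subseteq> T" using T(2,3) W(3) by blast
  then show ?thesis using T(1) finite_subset by blast
qed

text \<open>The finitely many complex points are treated one by one. The neighbourhood used for
  \<open>y\<close> omits the other complex points, so the normal forms already reached and the
  regularity still to be exploited survive as properties of germs.\<close>

lemma normal_embedding:
  assumes f: "embd f" and N: "openin (C0_topology Y X) N" "f \<in> N"
  shows "\<exists>g. embd g \<and> reach N f g \<and>
    (\<forall>y\<in>topspace Y. cpt g y \<longrightarrow> normal_at g y (stdjet {}) \<or> normal_at g y (stdjet {k}))"
proof -
  obtain g0 where g0: "embd g0" "g0 \<in> N" "reach N f g0" "\<And>y. y \<in> topspace Y \<Longrightarrow> regular g0 y"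
    by (rule generic_embedding[OF f N]) (rule that)
  define C where "C = {y \<in> topspace Y. cpt g0 y}"
  have finC: "finite C" unfolding C_def by (rule finite_complex_points[OF g0(1,4)])
  have "\<exists>g. embd g \<and> g \<in> N \<and> reach N f g \<and> (\<forall>y\<in>topspace Y. cpt g y \<longleftrightarrow> cpt g0 y) \<and>
      (\<forall>y\<in>D. normal_at g y (stdjet {}) \<or> normal_at g y (stdjet {k})) \<and> (\<forall>y\<in>C - D. regular g y)"
    if "finite D" "D \<subseteq> C" for D
    using that
  proof (induction D)
    case empty
    show ?case using g0 by (intro exI[of _ g0] conjI ballI) (simp_all add: C_def)
  next
    case (insert y D)
    have DC: "D \<subseteq> C" "y \<in> C" "y \<notin> D" using insert by simp_all
    obtain g where g: "embd g" "g \<in> N" "reach N f g" "\<forall>y\<in>topspace Y. cpt g y \<longleftrightarrow> cpt g0 y"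
      "\<forall>y\<in>D. normal_at g y (stdjet {}) \<or> normal_at g y (stdjet {k})" "\<forall>y\<in>C - D. regular g y"
      using insert.IH[OF DC(1)] by (elim exE conjE)
    have sg: "smf g" using g(1) by (simp add: embd_def)
    have yC: "y \<in> topspace Y" "cpt g y" "regular g y" using g(4,6) DC by (simp_all add: C_def)
    let ?W = "topspace Y - (C - {y})"
    have "closedin Y (C - {y})"
      using Hausdorff_imp_t1_space[OF Hausdorff_Y] finC unfolding t1_space_closedin_finite by (simp add: C_def subset_iff)
    then have W: "openin Y ?W" by (rule openin_diff[OF openin_topspace])
    have yW: "y \<in> ?W" using yC(1) by simp
    obtain h K S where h: "embd h" "h \<in> N" "reach N g h" "S \<in> {{}, {k}}" "normal_at h y (stdjet S)" "closedin Y K" "K \<subseteq> ?W"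
      "\<forall>y'\<in>topspace Y - K. h y' = g y'" "\<forall>y'\<in>topspace Y. cpt h y' \<longleftrightarrow> cpt g y'"
      using normalize_point[where k=k, OF g(1) N(1) g(2) yC(3,2) W yW] by (elim exE conjE)
    have oK: "openin Y (topspace Y - K)" by (rule openin_diff[OF openin_topspace h(6)])
    have eq: "g y' = h y'" if "y' \<in> topspace Y - K" for y' using h(8) that by simp
    have inK: "y' \<in> topspace Y - K" if "y' \<in> C" "y' \<noteq> y" for y' using that h(7) by (auto simp: C_def)
    show ?case
    proof (intro exI[of _ h] conjI ballI)
      show "embd h" "h \<in> N" by (rule h)+
      show "reach N f h" by (rule reach_trans[OF g(3) h(3)])
      show "cpt h y' \<longleftrightarrow> cpt g0 y'" if "y' \<in> topspace Y" for y' using g(4) h(9) that by simp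
      show "normal_at h y' (stdjet {}) \<or> normal_at h y' (stdjet {k})" if y': "y' \<in> insert y D" for y'
      proof (cases "y' = y")
        case True
        then show ?thesis using h(4,5) by auto
      next
        case False
        then have "y' \<in> D" using y' by simp
        then have "y' \<in> topspace Y - K" using inK False DC(1) by (simp add: subset_iff)
        from normal_at_local[OF sg _ oK this eq] show ?thesis using g(5) \<open>y' \<in> D\<close> by metis
      qed
      show "regular h y'" if y': "y' \<in> C - insert y D" for y'
        using regular_local[OF sg _ oK inK eq, of y'] g(6) y' by simp
    qed
  qed
  from this[OF finC subset_refl] show ?thesis by (auto simp: C_def)
qed

end

section \<open>The isotopy\<close>

lemma type_eq_qform:
  "type_i_eq = (\<lambda>z w. w = qform (stdjet {}) z)" "type_ii_eq k = (\<lambda>z w. w = qform (stdjet {k}) z)"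
  by (rule ext, rule ext, simp add: type_i_eq_def type_ii_eq_def qform_stdjet)+

section \<open>From the normal form to the local equation and the smooth isotopy\<close>

context cr_setting
begin

lemma hc_restrict:
  assumes d: "hc d" and V: "openin X V" "V \<subseteq> fst d" shows "hc (V, snd d)"
proof -
  note id = hc_chart[OF d]
  have "homeomorphic_map (subtopology (subtopology X (fst d)) V) (subtopology (top_of_set (snd d ` fst d)) (snd d ` V)) (snd d)"
    by (rule homeomorphic_map_subtopologies[OF is_chart_homeo[OF id]])
      (use V(2) is_chart_topspace[OF id] in \<open>auto simp: Int_absorb1\<close>)
  then have "homeomorphic_map (subtopology X V) (top_of_set (snd d ` V)) (snd d)"
    using V(2) by (simp add: subtopology_subtopology Int_absorb1 image_mono)
  then have "is_chart X (V, snd d)"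
    unfolding is_chart_def using V(1) chart_open_image[OF id V] by simp
  moreover have "compatible holomorphic_map_on (V, snd d) e" if e: "e \<in> A" for e
  proof -
    note ie = A_chart[OF e]
    have cmp: "compatible holomorphic_map_on d e" using d e unfolding holomorphic_chart_def by simp
    have inv: "inv_into V (snd d) x = cinv d x" if x: "x \<in> snd d ` V" for x
    proof -
      obtain q where q: "q \<in> V" "x = snd d q" using x by blast
      then show ?thesis
        using inv_into_f_f[OF inj_on_subset[OF is_chartD(3)[OF id] V(2)], of q] chart_cinv(1)[OF id, of q] V(2) by auto
    qed
    have o: "open (snd d ` (V \<inter> fst e))" "open (snd e ` (V \<inter> fst e))"
      using V is_chartD(1)[OF ie] by (intro chart_open_image[OF id] chart_open_image[OF ie] openin_Int; auto)+
    have "holomorphic_map_on (snd d ` (V \<inter> fst e)) (snd e \<circ> cinv d)"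
      by (rule holomorphic_map_on_subset) (use cmp V(2) in \<open>auto simp: compatible_iff\<close>)
    then have "holomorphic_map_on (snd d ` (V \<inter> fst e)) (snd e \<circ> inv_into V (snd d))"
      by (rule holomorphic_map_on_eqI[OF _ o(1)]) (simp add: inv[OF subsetD[OF image_mono[OF Int_lower1]]])
    moreover have "holomorphic_map_on (snd e ` (V \<inter> fst e)) (snd d \<circ> cinv e)"
      by (rule holomorphic_map_on_subset) (use cmp V(2) in \<open>auto simp: compatible_iff\<close>)
    ultimately show ?thesis unfolding compatible_iff by simp
  qed
  ultimately show ?thesis unfolding holomorphic_chart_def by simp
qed

text \<open>The equation must describe the whole image near the point, so other sheets are cut away
  by removing the compact image of the rest of \<open>Y\<close>. The domain is also restricted to
  \<open>z\<close> in the image of a small ball, which is open by invariance of domain, so that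
  every solution of the equation comes from a point of the ball.\<close>

lemma normal_at_imp_locally_given_by:
  assumes f: "embd f" and n: "normal_at f y m"
  shows "locally_given_by X A (f ` topspace Y) (f y) (\<lambda>z w. w = qform m z)"
proof -
  obtain c d \<rho> where g: "graph_chart f y c d" and \<rho>: "\<rho> > 0" "\<forall>x\<in>ball (snd c y) \<rho>. wc c d f x = qform m (zc c d f x)"
    using n unfolding normal_at_def by (elim exE conjE)
  have cd: "c \<in> B" "hc d" "y \<in> fst c" "f y \<in> fst d" "zc c d f (snd c y) = 0"
    using g by (simp_all add: graph_chart_def)
  have sf: "smf f" and inj: "inj_on f (topspace Y)" using f by (simp_all add: embd_def)
  note ic = B_chart[OF cd(1)] and id = hc_chart[OF cd(2)]
  have cY: "fst c \<subseteq> topspace Y" by (rule openin_subset[OF is_chartD(1)[OF ic]])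
  have yY: "y \<in> topspace Y" using cY cd(3) by blast
  define x0 where "x0 = snd c y"
  obtain r Z M where p: "patch_ok f (c, d, x0, r, Z, M)"
    unfolding x0_def using small_patch[OF sf g openin_topspace yY] by metis
  note pk = patch_okD[OF sf p]
  interpret gp: graph_patch Y B X A f c d x0 r "r / 2"
    by (rule patch_ok_graph_patch[OF f p]) (use pk(3) in simp_all)
  define b where "b = ball x0 (min \<rho> r)"
  have b: "b \<subseteq> ball x0 r" "b \<subseteq> cball x0 r" "b \<subseteq> ball x0 \<rho>" "x0 \<in> b" "open b" "b \<subseteq> snd c ` fst c"
    using \<rho>(1) pk(3,4) by (auto simp: b_def)
  let ?z = "\<lambda>x. fst (local_rep c d f x)"
  have rep: "local_rep c d f x = snd d (f (cinv c x))" for x by (simp add: local_rep_def)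
  have yx0: "cinv c x0 = y" using chart_cinv(1)[OF ic cd(3)] by (simp add: x0_def)
  have "open (?z ` b)"
  proof (rule invariance_of_domain_gen[OF b(5)])
    show "continuous_on b ?z"
      by (intro continuous_on_fst continuous_on_subset[OF gp.u_cont b(2)])
    show "inj_on ?z b" by (rule inj_on_subset[OF pk(8) b(2)])
    show "DIM(complex ^ 'n) \<le> DIM('e)" using dim by simp
  qed
  then have oz: "open (fst -` (?z ` b) :: 'n cmodel set)" by (rule open_vimage_fst)
  define K where "K = f ` (topspace Y - cinv c ` b)"
  have "closedin Y (topspace Y - cinv c ` b)"
    by (intro closedin_diff closedin_topspace chart_open_cinv_image[OF ic b(5,6)])
  then have "compactin Y (topspace Y - cinv c ` b)" by (rule closedin_compact_space[OF compact_Y])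
  then have "compactin X K" unfolding K_def using smfD(1)[OF sf] by (rule image_compactin)
  then have Kc: "closedin X K" by (rule compactin_imp_closedin[OF Hausdorff_X])
  define V where "V = {q \<in> fst d. snd d q \<in> fst -` (?z ` b)} - K"
  have oV: "openin X V" unfolding V_def by (rule openin_diff[OF chart_open_preimage[OF id oz] Kc])
  have "hc (V, snd d)" by (rule hc_restrict[OF cd(2) oV]) (auto simp: V_def)
  moreover have "f y \<in> V"
  proof -
    have "f y \<notin> K"
    proof
      assume "f y \<in> K"
      then obtain y' where y': "y' \<in> topspace Y" "y' \<notin> cinv c ` b" "f y = f y'" by (auto simp: K_def)
      then have "y = y'" using inj_onD[OF inj y'(3) yY y'(1)] by simp
      moreover have "y \<in> cinv c ` b" using yx0 b(4) by blast
      ultimately show False using y'(2) by simp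
    qed
    moreover have "fst (snd d (f y)) = ?z x0" by (simp add: rep yx0)
    ultimately show ?thesis unfolding V_def using cd(4) b(4) by blast
  qed
  moreover have "snd d (f y) = 0"
  proof -
    have "wc c d f x0 = qform m (zc c d f x0)" using \<rho>(2) b(3,4) by (auto simp: x0_def)
    moreover have "qform m 0 = 0" by (simp add: qform_def cnjv_def cdot_def)
    ultimately have "local_rep c d f x0 = 0" using cd(5) by (simp add: x0_def prod_eq_iff)
    then show ?thesis by (simp add: rep yx0)
  qed
  moreover have "q \<in> f ` topspace Y \<longleftrightarrow> snd (snd d q) = qform m (fst (snd d q))" if q: "q \<in> V" for q
  proof
    have qd: "q \<in> fst d" "fst (snd d q) \<in> ?z ` b" "q \<notin> K" using q by (auto simp: V_def)
    show "snd (snd d q) = qform m (fst (snd d q))" if "q \<in> f ` topspace Y"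
    proof -
      obtain y' where y': "y' \<in> topspace Y" "q = f y'" using \<open>q \<in> f ` topspace Y\<close> by blast
      then have "y' \<in> cinv c ` b" using qd(3) by (auto simp: K_def)
      then obtain x where x: "x \<in> b" "y' = cinv c x" by blast
      have "wc c d f x = qform m (zc c d f x)" using \<rho>(2) b(3) x(1) by (auto simp: x0_def)
      then show ?thesis by (simp add: rep x(2)[symmetric] y'(2)[symmetric])
    qed
    show "q \<in> f ` topspace Y" if e: "snd (snd d q) = qform m (fst (snd d q))"
    proof -
      obtain x where x: "x \<in> b" "fst (snd d q) = ?z x" using qd(2) by blast
      have "wc c d f x = qform m (zc c d f x)" using \<rho>(2) b(3) x(1) by (auto simp: x0_def)
      then have "snd d q = snd d (f (cinv c x))" unfolding rep[symmetric] using e x(2) by (simp add: prod_eq_iff)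
      moreover have "f (cinv c x) \<in> fst d" using pk(5) b(2) x(1) by blast
      ultimately have "q = f (cinv c x)" using inj_onD[OF is_chartD(3)[OF id]] qd(1) by simp
      moreover have "cinv c x \<in> topspace Y" using chart_cinv(2)[OF ic] b(6) x(1) cY by blast
      ultimately show ?thesis by blast
    qed
  qed
  ultimately show ?thesis unfolding locally_given_by_def by (intro exI[of _ V] exI[of _ "snd d"]) simp
qed

text \<open>The time interval from 0 to \<open>T\<close> is rescaled; smoothness up to the endpoints
  is inherited from the family over the whole line.\<close>

lemma reach_imp_isotopy:
  assumes "reach N f g"
  shows "\<exists>F. smooth_isotopy Y B X A F \<and> (\<forall>t\<in>{0..1}. F t \<in> N) \<and>
    (\<forall>y\<in>topspace Y. F 0 y = f y) \<and> (\<forall>y\<in>topspace Y. F 1 y = g y)"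
proof -
  obtain G T where G: "0 < T" "fam (UNIV :: real set) G" "\<forall>t. embd (G t) \<and> G t \<in> N"
    "\<forall>t\<le>0. \<forall>y\<in>topspace Y. G t y = f y" "\<forall>t\<ge>T. \<forall>y\<in>topspace Y. G t y = g y"
    using assms unfolding reach_def by (elim exE conjE)
  define F where "F t = G (T * t + 0)" for t
  have F: "fam (UNIV :: real set) F" unfolding F_def by (rule fam_reparam[OF G(2)])
  have "smooth_isotopy Y B X A F"
    unfolding smooth_isotopy_def
  proof (intro conjI ballI)
    have "prod_topology (top_of_set {0..1::real}) Y = subtopology (prod_topology (top_of_set UNIV) Y) ({0..1} \<times> topspace Y)"
      by (simp add: prod_topology_subtopology)
    then show "continuous_map (prod_topology (top_of_set {0..1}) Y) X (\<lambda>(t, y). F t y)"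
      using continuous_map_from_subtopology[OF famD(2)[OF F]] by simp
    show "smooth_embedding Y B X A (F t)" for t
      using G(3) by (simp add: smooth_embedding_iff_embd F_def)
    fix c d assume c: "c \<in> B" and d: "d \<in> A"
    let ?U = "{(t, snd c y) |t y. t \<in> UNIV \<and> y \<in> fst c \<and> F t y \<in> fst d}"
    have C: "Cinf (\<lambda>(t, x). local_rep c d (F t) x) ?U"
      using F[unfolded fam_def, THEN conjunct2, THEN conjunct2, rule_format, OF c A_hc[OF d]] .
    show "smooth_on {(t, snd c y) |t y. t \<in> {0..1} \<and> y \<in> fst c \<and> F t y \<in> fst d} (\<lambda>(t, x). local_rep c d (F t) x)"
      unfolding smooth_on_def
    proof (intro ballI exI conjI)
      show "open ?U" "\<forall>k. Ck_on k (\<lambda>(t, x). local_rep c d (F t) x) ?U" 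
        by (rule conjunct1[OF C[unfolded Cinf_def]], rule conjunct2[OF C[unfolded Cinf_def]])
      fix q assume "q \<in> {(t, snd c y) |t y. t \<in> {0..1} \<and> y \<in> fst c \<and> F t y \<in> fst d}"
      then show "q \<in> ?U" by blast
    qed simp
  qed
  moreover have "F t \<in> N" for t using G(3) by (simp add: F_def)
  moreover have "F 0 y = f y" "F 1 y = g y" if "y \<in> topspace Y" for y
    using G(4,5) that by (simp_all add: F_def)
  ultimately show ?thesis by (intro exI[of _ F]) simp
qed

end

theorem theorem1:
  fixes Y :: "'y topology" and B :: "('y, 'e::euclidean_space) chart set"
    and X :: "'x topology" and A :: "('x, 'n::finite cmodel) chart set"
    and i :: "'y \<Rightarrow> 'x" and k :: 'n
  assumes "smooth_manifold Y B" and "compact_space Y" and "DIM('e) = 2 * CARD('n)"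
    and "complex_manifold X A"
    and "smooth_embedding Y B X A i"
  shows "\<forall>N. openin (C0_topology Y X) N \<and> i \<in> N \<longrightarrow>
    (\<exists>F :: real \<Rightarrow> 'y \<Rightarrow> 'x.
       smooth_isotopy Y B X A F \<and>
       (\<forall>y\<in>topspace Y. F 0 y = i y) \<and>
       (\<forall>t\<in>{0..1}. F t \<in> N) \<and>
       (\<forall>p\<in>F 1 ` topspace Y. complex_point B A (F 1) p \<longrightarrow>
          locally_given_by X A (F 1 ` topspace Y) p type_i_eq \<or>
          locally_given_by X A (F 1 ` topspace Y) p (type_ii_eq k)))"
proof (intro allI impI)
  fix N assume N: "openin (C0_topology Y X) N \<and> i \<in> N"
  interpret cr_setting Y B X A by unfold_locales (rule assms)+
  have "embd i" using assms(5) by (simp add: smooth_embedding_iff_embd)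
  note e = this
  obtain g where g: "embd g" "reach N i g"
    "\<forall>y\<in>topspace Y. cpt g y \<longrightarrow> normal_at g y (stdjet {}) \<or> normal_at g y (stdjet {k})"
    using normal_embedding[OF e conjunct1[OF N] conjunct2[OF N], of k] by (elim exE conjE)
  obtain F where F: "smooth_isotopy Y B X A F" "\<forall>t\<in>{0..1}. F t \<in> N"
    "\<forall>y\<in>topspace Y. F 0 y = i y" "\<forall>y\<in>topspace Y. F 1 y = g y"
    using reach_imp_isotopy[OF g(2)] by (elim exE conjE)
  have F1: "embd (F 1)" using F(1) by (simp add: smooth_isotopy_def smooth_embedding_iff_embd)
  have im: "F 1 ` topspace Y = g ` topspace Y" using F(4) by (intro image_cong) simp_all
  have "locally_given_by X A (F 1 ` topspace Y) p type_i_eq \<or>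
      locally_given_by X A (F 1 ` topspace Y) p (type_ii_eq k)" if p: "complex_point B A (F 1) p" for p
  proof -
    obtain y where y: "y \<in> topspace Y" "F 1 y = p" "cpt (F 1) y" using p complex_point_iff[OF F1] by blast
    have "cpt g y"
      using cpt_local[OF openin_topspace y(1), of "F 1" g] F(4) F1 g(1) y(3) by (simp add: embd_def)
    then have n: "normal_at g y (stdjet {}) \<or> normal_at g y (stdjet {k})" using g(3) y(1) by simp
    have gy: "g y = p" using F(4) y by simp
    show ?thesis
      using n normal_at_imp_locally_given_by[OF g(1), of y] unfolding gy im type_eq_qform by blast
  qed
  then show "\<exists>F. smooth_isotopy Y B X A F \<and> (\<forall>y\<in>topspace Y. F 0 y = i y) \<and> (\<forall>t\<in>{0..1}. F t \<in> N) \<and>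
       (\<forall>p\<in>F 1 ` topspace Y. complex_point B A (F 1) p \<longrightarrow>
          locally_given_by X A (F 1 ` topspace Y) p type_i_eq \<or>
          locally_given_by X A (F 1 ` topspace Y) p (type_ii_eq k))"
    using F by (intro exI[of _ F]) simp
qed

end
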